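(* Let $1<\alpha\le1+\frac1{1000}$, $\alpha-1<\theta<1$, put $\delta=\theta-(\alpha-1)$, and let $(\varphi_s)$ be a sequence which is uniformly in $C_c^\infty(\frac12,2)$, with associated truncated discrete Hilbert transforms $\mathbb H_M$. There is $\gamma_0>0$ depending only on $\delta$ such that, with $\|\cdot\|_{A_M}$ defined using this $\gamma_0$, the following holds. Assume that for some fixed $\lambda\in\mathbb C$ and constants $C_I,M_0$ all operators $\lambda\,\mathrm{Id}+\mathbb H_M$, $M\ge M_0$, are invertible on $\ell^2(\mathbb Z)$ and $$\|(\lambda\,\mathrm{Id}+\mathbb H_M)^{-1}\|_{\ell^2\to\ell^2}\le C_I\qquad (M\ge M_0).$$ Then there exist a constant $C(C_I,\lambda)$ and $M_1\ge M_0$ such that for all $M\ge M_1$ $$\|(\lambda\,\mathrm{Id}+\mathbb H_M)^{-1}\|_{A_M}\le C(C_I,\lambda).$$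
   Context: Convolution operators on $\mathbb Z$ are identified with their kernels; $\mathrm{Id}$ has kernel $\delta_0$. $[t]$ denotes the integer part. The parameter $s$ is dyadic, $s=2^k$, $k\in\{0,1,2,\dots\}$. "$(\varphi_s)$ is uniformly in $C_c^\infty(\frac12,2)$" means that each $\varphi_s$ is a (complex-valued) smooth function with compact support in $(\frac12,2)$ and $\sup_s\|\varphi_s^{(k)}\|_\infty<\infty$ for every $k\ge0$. Define $$\mathbb H_Mf(x)=\sum_{\substack{M^\theta\le s\le M\\ s\text{ dyadic}}}\ \sum_{m>0}\varphi_s\Big(\frac{m^\alpha}{s}\Big)\frac{f(x-[m^\alpha])-f(x+[m^\alpha])}{m},\qquad x\in\mathbb Z .$$ The space $A_M$ consists of the convolution operators $T$ on $\mathbb Z$ with kernels of the form $$T=\lambda\,\mathrm{Id}+\beta\,\mathbb H_M+\sum_{\substack{M^\theta\le s<\infty\\ s\text{ dyadic}}}K_s,\qquad \lambda,\beta\in\mathbb C,\qquad( * )$$ where for each $s$ the kernel $K_s$ satisfies, with some constant $D_s\ge 0$ and with the fixed small exponent $\gamma_0>0$: (i) $\sum_xK_s(x)=0$; (ii) $\mathrm{supp}\,K_s\subset[-s,s]$; (iii) $\sum_x|K_s(x)|^2\le D_s^2/s$; (iv) $\sum_x|K_s(x+h)-K_s(x)|^2\le \frac{D_s^2}{s}\big(\frac{|h|}{s}\big)^{\gamma_0}$ for all $h\in\mathbb Z$; and $\|\{K_s\}\|_{A_M}:=\sup_{s\ge M^\theta}D_s<\infty$ (with $D_s$ the least admissible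 constant). The norm is $$\|T\|_{A_M}=\inf\{|\lambda|+|\beta|+\|\{K_s\}\|_{A_M}\},$$ the infimum being over all representations of $T$ in the form $( * )$. The data $\alpha,\theta,(\varphi_s)$ are fixed and constants may depend on them. *)

theory Defs
  imports "HOL-Analysis.Analysis"
begin

section \<open>Operators on square summable sequences over the integers\<close>

definition ell2 :: "(int \<Rightarrow> complex) set" where
  "ell2 = {f. (\<lambda>x. (cmod (f x))\<^sup>2) summable_on UNIV}"

definition ell2_norm :: "(int \<Rightarrow> complex) \<Rightarrow> real" where
  "ell2_norm f = sqrt (\<Sum>\<^sub>\<infinity>x. (cmod (f x))\<^sup>2)"

type_synonym seq_op = "(int \<Rightarrow> complex) \<Rightarrow> (int \<Rightarrow> complex)"

text \<open>An operator on \<open>\<ell>\<^sup>2\<close> is a total function on sequences of which only the restriction to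
  \<^const>\<open>ell2\<close> matters.\<close>

definition ell2_bounded :: "seq_op \<Rightarrow> bool" where
  "ell2_bounded T \<longleftrightarrow>
     (\<forall>f\<in>ell2. T f \<in> ell2) \<and>
     (\<forall>f\<in>ell2. \<forall>g\<in>ell2. \<forall>c d. T (\<lambda>x. c * f x + d * g x) = (\<lambda>x. c * T f x + d * T g x)) \<and>
     (\<exists>B. \<forall>f\<in>ell2. ell2_norm (T f) \<le> B * ell2_norm f)"

text \<open>A real-valued supremum: meaningful for operators satisfying \<^const>\<open>ell2_bounded\<close>.\<close>

definition ell2_opnorm :: "seq_op \<Rightarrow> real" where
  "ell2_opnorm T = (SUP f\<in>{f \<in> ell2. ell2_norm f \<le> 1}. ell2_norm (T f))"

definition ell2_invertible :: "seq_op \<Rightarrow> bool" where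
  "ell2_invertible T \<longleftrightarrow>
     ell2_bounded T \<and> (\<exists>S. ell2_bounded S \<and> (\<forall>f\<in>ell2. S (T f) = f \<and> T (S f) = f))"

definition ell2_inverse :: "seq_op \<Rightarrow> seq_op" where
  "ell2_inverse T = inv_into ell2 T"

definition delta0 :: "int \<Rightarrow> complex" where
  "delta0 x = (if x = 0 then 1 else 0)"

definition convolve :: "(int \<Rightarrow> complex) \<Rightarrow> seq_op" where
  "convolve k f x = (\<Sum>\<^sub>\<infinity>y. k y * f (x - y))"

section \<open>Truncated discrete Hilbert transforms\<close>

definition dyadic :: "nat set" where
  "dyadic = range (\<lambda>k. 2 ^ k)"

definition nderiv :: "nat \<Rightarrow> (real \<Rightarrow> complex) \<Rightarrow> real \<Rightarrow> complex" where
  "nderiv k = (\<lambda>g x. vector_derivative g (at x)) ^^ k"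

text \<open>The inclusion of the closed support in the bounded interval makes the support compact.
  Only the members of the sequence with a dyadic index matter.\<close>

definition uniformly_Cc_smooth :: "(nat \<Rightarrow> real \<Rightarrow> complex) \<Rightarrow> bool" where
  "uniformly_Cc_smooth \<phi> \<longleftrightarrow>
     (\<forall>s\<in>dyadic. (\<forall>k x. nderiv k (\<phi> s) differentiable (at x)) \<and>
                  closure {x. \<phi> s x \<noteq> 0} \<subseteq> {1/2<..<2}) \<and>
     (\<forall>k. \<exists>B. \<forall>s\<in>dyadic. \<forall>x. cmod (nderiv k (\<phi> s) x) \<le> B)"

text \<open>For fixed \<open>s\<close> only finitely many \<open>m\<close> give a nonzero summand, because of the support
  of \<open>\<phi> s\<close>.\<close>

definition hilbert_trunc ::
  "real \<Rightarrow> real \<Rightarrow> (nat \<Rightarrow> real \<Rightarrow> complex) \<Rightarrow> real \<Rightarrow> seq_op" where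
  "hilbert_trunc \<alpha> \<theta> \<phi> M f x =
     (\<Sum>s\<in>{s \<in> dyadic. M powr \<theta> \<le> real s \<and> real s \<le> M}.
        \<Sum>\<^sub>\<infinity>m\<in>{m::nat. m > 0}.
          \<phi> s (real m powr \<alpha> / real s) *
            ((f (x - \<lfloor>real m powr \<alpha>\<rfloor>) - f (x + \<lfloor>real m powr \<alpha>\<rfloor>)) / of_nat m))"

definition shifted_hilbert ::
  "real \<Rightarrow> real \<Rightarrow> (nat \<Rightarrow> real \<Rightarrow> complex) \<Rightarrow> complex \<Rightarrow> real \<Rightarrow> seq_op" where
  "shifted_hilbert \<alpha> \<theta> \<phi> lam M f x = lam * f x + hilbert_trunc \<alpha> \<theta> \<phi> M f x"

section \<open>The spaces \<open>A\<^sub>M\<close>\<close>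

definition admissible_const :: "real \<Rightarrow> nat \<Rightarrow> (int \<Rightarrow> complex) \<Rightarrow> real \<Rightarrow> bool" where
  "admissible_const \<gamma>0 s k D \<longleftrightarrow>
     0 \<le> D \<and>
     (\<Sum>\<^sub>\<infinity>x. (cmod (k x))\<^sup>2) \<le> D\<^sup>2 / real s \<and>
     (\<forall>h::int. (\<Sum>\<^sub>\<infinity>x. (cmod (k (x + h) - k x))\<^sup>2)
                  \<le> D\<^sup>2 / real s * (real_of_int \<bar>h\<bar> / real s) powr \<gamma>0)"

definition least_const :: "real \<Rightarrow> nat \<Rightarrow> (int \<Rightarrow> complex) \<Rightarrow> real" where
  "least_const \<gamma>0 s k = Inf {D. admissible_const \<gamma>0 s k D}"

definition A_scales :: "real \<Rightarrow> real \<Rightarrow> nat set" where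
  "A_scales \<theta> M = {s \<in> dyadic. M powr \<theta> \<le> real s}"

definition A_family :: "real \<Rightarrow> real \<Rightarrow> real \<Rightarrow> (nat \<Rightarrow> int \<Rightarrow> complex) \<Rightarrow> bool" where
  "A_family \<gamma>0 \<theta> M K \<longleftrightarrow>
     (\<forall>s\<in>A_scales \<theta> M.
        (\<Sum>\<^sub>\<infinity>x. K s x) = 0 \<and>
        {x. K s x \<noteq> 0} \<subseteq> {- int s..int s} \<and>
        (\<exists>D. admissible_const \<gamma>0 s (K s) D)) \<and>
     bdd_above ((\<lambda>s. least_const \<gamma>0 s (K s)) ` A_scales \<theta> M)"

definition A_family_norm :: "real \<Rightarrow> real \<Rightarrow> real \<Rightarrow> (nat \<Rightarrow> int \<Rightarrow> complex) \<Rightarrow> real" where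
  "A_family_norm \<gamma>0 \<theta> M K = (SUP s\<in>A_scales \<theta> M. least_const \<gamma>0 s (K s))"

text \<open>The kernel of a convolution operator is its value at \<^const>\<open>delta0\<close>. The series over \<open>s\<close>
  converges absolutely, since \<open>cmod (K s x)\<close> is at most a constant times \<open>1 / sqrt s\<close>.\<close>

definition A_kernel ::
  "real \<Rightarrow> real \<Rightarrow> (nat \<Rightarrow> real \<Rightarrow> complex) \<Rightarrow> real \<Rightarrow>
   complex \<Rightarrow> complex \<Rightarrow> (nat \<Rightarrow> int \<Rightarrow> complex) \<Rightarrow> int \<Rightarrow> complex" where
  "A_kernel \<alpha> \<theta> \<phi> M lam beta K x =
     lam * delta0 x + beta * hilbert_trunc \<alpha> \<theta> \<phi> M delta0 x + (\<Sum>\<^sub>\<infinity>s\<in>A_scales \<theta> M. K s x)"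

definition A_represents ::
  "real \<Rightarrow> real \<Rightarrow> real \<Rightarrow> (nat \<Rightarrow> real \<Rightarrow> complex) \<Rightarrow> real \<Rightarrow> seq_op \<Rightarrow>
   complex \<Rightarrow> complex \<Rightarrow> (nat \<Rightarrow> int \<Rightarrow> complex) \<Rightarrow> bool" where
  "A_represents \<gamma>0 \<alpha> \<theta> \<phi> M T lam beta K \<longleftrightarrow>
     A_family \<gamma>0 \<theta> M K \<and> (\<forall>f\<in>ell2. T f = convolve (A_kernel \<alpha> \<theta> \<phi> M lam beta K) f)"

definition A_space ::
  "real \<Rightarrow> real \<Rightarrow> real \<Rightarrow> (nat \<Rightarrow> real \<Rightarrow> complex) \<Rightarrow> real \<Rightarrow> seq_op set" where
  "A_space \<gamma>0 \<alpha> \<theta> \<phi> M = {T. \<exists>lam beta K. A_represents \<gamma>0 \<alpha> \<theta> \<phi> M T lam beta K}"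

text \<open>A real-valued infimum: meaningful for members of \<^const>\<open>A_space\<close>.\<close>

definition A_norm ::
  "real \<Rightarrow> real \<Rightarrow> real \<Rightarrow> (nat \<Rightarrow> real \<Rightarrow> complex) \<Rightarrow> real \<Rightarrow> seq_op \<Rightarrow> real" where
  "A_norm \<gamma>0 \<alpha> \<theta> \<phi> M T =
     Inf {cmod lam + cmod beta + A_family_norm \<gamma>0 \<theta> M K | lam beta K.
            A_represents \<gamma>0 \<alpha> \<theta> \<phi> M T lam beta K}"

end

theory Submission
  imports Defs
begin

text \<open>
  Let \<open>X\<close> be the kernel of the inverse of \<open>\<lambda> Id + H\<close>. Since \<open>H\<close> has integral zero and nearly
  annihilates long intervals, invertibility forces \<open>\<lambda> \<noteq> 0\<close>, and
  \<open>Y = X - \<delta>\<^sub>0 / \<lambda> + H / \<lambda>\<^sup>2 = \<lambda>\<^sup>-\<^sup>2 H * H * X\<close> has to be written as a sum of the \<open>K\<^sub>s\<close>.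

  The function \<open>cis (\<eta> x) X x\<close> is the kernel of the inverse of the modulated operator. Taking
  \<open>\<eta> = 1 / s\<close>, the resolvent identity expresses \<open>(cis (x / s) - 1) Y x\<close> through \<open>X\<close> and the bilinear
  expressions \<open>H * (g H)\<close> with \<open>g x = cis (\<plusminus> x / s) - 1\<close>, so the bound on the inverse reduces everything
  to the estimate \<open>\<parallel>H * (g H)\<parallel>\<^sub>2 = O(s powr (- 1/2))\<close> and to the corresponding Hoelder bound for
  increments. On the shell \<open>\<bar>x\<bar> \<approx> s\<close> the factor \<open>cis (x / s) - 1\<close> is bounded below, so \<open>Y\<close>
  satisfies there the bounds required of \<open>K\<^sub>s\<close>. Cutting \<open>Y\<close> into shells and moving the masses of the
  pieces from scale to scale with tent functions gives the \<open>K\<^sub>s\<close>; the masses are bounded because a tent is an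
  autocorrelation of an interval.

  For the bilinear estimate, \<open>H\<close> is the sum of a smooth odd kernel \<open>h\<close> and of an error \<open>e\<close> that contains
  the deviation of the indicator of \<open>{\<lfloor>m powr \<alpha>\<rfloor>}\<close> from its density. The products with \<open>h\<close> are
  elementary. In \<open>e * (g e)\<close> the diagonal is controlled by counting pairs of integer parts with a given
  difference, and the deviation by exponential sums (van der Corput, Kusmin--Landau); this gains a power
  of \<open>M\<close> as soon as \<open>s \<ge> M powr \<theta>\<close> with \<open>\<theta> > \<alpha> - 1\<close>.
\<close>

section \<open>Square summable sequences\<close>

text \<open>Sparsity dictates how far the inverse is expanded. With b = 1 / \<alpha>, a piece of the
  transform at scale t has height t powr (- b) on about t powr b points, so its squared norm t powr
  (- b) exceeds the 1 / t allowed to a K_s. The transform must therefore remain a separate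
  generator, and only products with two factors H are spread out enough. In such a product the
  diagonal of the autocorrelations still loses M powr (1 - b), while the smaller scale wins back M
  powr (- \<theta> * b); as 1 - b = b * (\<alpha> - 1), the net exponent is - b * \<delta>. No
  smoothness is proved for the products that involve e. They are smaller than required by M powr (-
  \<delta> / 200), and because increments a are integers this gain is at most (a / s) powr (\<delta>
  / 200) for s <= M; beyond M a sharper size bound takes over. Squaring gives \<gamma>0 = \<delta> /
  100. The number 200 is bookkeeping: the exponential sums save t powr (- 1 / 60), a pair of error
  kernels keeps M powr (- \<delta> / 160), and counting the pairs of scales costs M powr (\<delta> /
  800).\<close>

lemma L2_set_le_ell2_norm:
 assumes "f \<in> ell2"
 shows "L2_set (%x. cmod (f x)) F <= ell2_norm f"
proof (cases "finite F")
 case True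
 have "(\<Sum>x\<in>F. (cmod (f x))\<^sup>2) <= (\<Sum>\<^sub>\<infinity>x. (cmod (f x))\<^sup>2)"
  using assms True by (intro finite_sum_le_infsum) (auto simp: ell2_def)
 then show ?thesis by (simp add: L2_set_def ell2_norm_def)
qed (simp add: ell2_norm_def infsum_nonneg)

lemma ell2_norm_nonneg [simp]: "0 <= ell2_norm f" by (simp add: ell2_norm_def infsum_nonneg)

lemma ell2_norm_sq: "(ell2_norm f)\<^sup>2 = (\<Sum>\<^sub>\<infinity>x. (cmod (f x))\<^sup>2)"
 by (simp add: ell2_norm_def infsum_nonneg)

text \<open>Membership and norm are tested on finite sets. This imports Minkowski's inequality from
  \<open>L2_set\<close>, so no triangle inequality for infinite sums has to be proved.\<close>

lemma ell2I:
 assumes "!!F. finite F ==> L2_set (%x. cmod (f x)) F <= B"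
 shows "f \<in> ell2 & ell2_norm f <= B"
proof -
 have B: "0 <= B" using assms[of "{}"] by simp
 have sq: "(\<Sum>x\<in>F. (cmod (f x))\<^sup>2) <= B\<^sup>2" if "finite F" for F
  using assms[OF that] B by (simp add: L2_set_def real_le_lsqrt sqrt_le_D)
 have "(%x. (cmod (f x))\<^sup>2) summable_on UNIV"
  by (rule nonneg_bdd_above_summable_on) (use sq in \<open>auto simp: bdd_above_def\<close>)
 moreover have "(\<Sum>\<^sub>\<infinity>x. (cmod (f x))\<^sup>2) <= B\<^sup>2"
  by (rule infsum_le_finite_sums) (use sq calculation in auto)
 ultimately show ?thesis using B by (simp add: ell2_def ell2_norm_def real_le_lsqrt)
qed

lemma ell2_mono:
 assumes "g \<in> ell2" "!!x. cmod (f x) <= c * cmod (g x)" "0 <= c"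
 shows "f \<in> ell2 & ell2_norm f <= c * ell2_norm g"
proof (rule ell2I)
 fix F :: "int set" assume "finite F"
 have "L2_set (%x. cmod (f x)) F <= L2_set (%x. c * cmod (g x)) F" by (rule L2_set_mono) (use assms in auto)
 also have "... = c * L2_set (%x. cmod (g x)) F" by (rule L2_set_right_distrib[symmetric]) fact
 also have "... <= c * ell2_norm g" using assms by (intro mult_left_mono L2_set_le_ell2_norm) auto
 finally show "L2_set (%x. cmod (f x)) F <= c * ell2_norm g" .
qed

lemma ell2_add:
 assumes "f \<in> ell2" "g \<in> ell2"
 shows "(%x. f x + g x) \<in> ell2 & ell2_norm (%x. f x + g x) <= ell2_norm f + ell2_norm g"
proof (rule ell2I)
 fix F :: "int set" assume "finite F"
 have "L2_set (%x. cmod (f x + g x)) F <= L2_set (%x. cmod (f x) + cmod (g x)) F"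
  by (rule L2_set_mono) (auto intro: norm_triangle_ineq)
 also have "... <= L2_set (%x. cmod (f x)) F + L2_set (%x. cmod (g x)) F" by (rule L2_set_triangle_ineq)
 also have "... <= ell2_norm f + ell2_norm g" using assms by (intro add_mono L2_set_le_ell2_norm)
 finally show "L2_set (%x. cmod (f x + g x)) F <= ell2_norm f + ell2_norm g" .
qed

lemma ell2_cmult:
 assumes "f \<in> ell2"
 shows "(%x. c * f x) \<in> ell2 & ell2_norm (%x. c * f x) <= cmod c * ell2_norm f"
 using assms by (intro ell2_mono) (auto simp: norm_mult)

lemma ell2_cong_norm:
 assumes "f \<in> ell2" "!!x. cmod (g x) = cmod (f x)"
 shows "g \<in> ell2 & ell2_norm g = ell2_norm f" using assms by (simp add: ell2_def ell2_norm_def)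

lemma ell2_diff:
 assumes "f \<in> ell2" "g \<in> ell2"
 shows "(%x. f x - g x) \<in> ell2 & ell2_norm (%x. f x - g x) <= ell2_norm f + ell2_norm g"
proof -
 have "(%x. - g x) \<in> ell2 & ell2_norm (%x. - g x) = ell2_norm g" using assms(2) by (intro ell2_cong_norm) auto
 then show ?thesis using ell2_add[OF assms(1), of "%x. - g x"] by simp
qed

lemma ell2_zero: "(%x. 0) \<in> ell2" "ell2_norm (%x. 0) = 0" by (auto simp: ell2_def ell2_norm_def)

lemma ell2_sum:
 assumes "finite A" "!!i. i \<in> A ==> f i \<in> ell2"
 shows "(%x. \<Sum>i\<in>A. f i x) \<in> ell2 & ell2_norm (%x. \<Sum>i\<in>A. f i x) <= (\<Sum>i\<in>A. ell2_norm (f i))"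
 using assms
proof (induction A rule: finite_induct)
 case empty
 then show ?case by (simp add: ell2_zero)
next
 case (insert i A)
 have IH: "(%x. \<Sum>i\<in>A. f i x) \<in> ell2 & ell2_norm (%x. \<Sum>i\<in>A. f i x) <= (\<Sum>i\<in>A. ell2_norm (f i))"
  using insert by auto
 have "(%x. \<Sum>i\<in>insert i A. f i x) = (%x. f i x + (\<Sum>i\<in>A. f i x))" using insert by auto
 then show ?case using IH insert ell2_add[of "f i" "%x. \<Sum>i\<in>A. f i x"] by auto
qed

lemma ell2_sum_bound:
 assumes "finite A" "!!i. i \<in> A ==> f i \<in> ell2 & ell2_norm (f i) <= b i"
 shows "(%x. \<Sum>i\<in>A. f i x) \<in> ell2 & ell2_norm (%x. \<Sum>i\<in>A. f i x) <= (\<Sum>i\<in>A. b i)"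
proof -
 have "(\<Sum>i\<in>A. ell2_norm (f i)) <= (\<Sum>i\<in>A. b i)" using assms by (intro sum_mono) auto
 then show ?thesis using ell2_sum[of A f] assms by fastforce
qed

lemma ell2_bij:
 assumes "f \<in> ell2" "bij p"
 shows "(%x. f (p x)) \<in> ell2 & ell2_norm (%x. f (p x)) = ell2_norm f"
proof -
 have "((%x. (cmod (f (p x)))\<^sup>2) summable_on UNIV) = ((%x. (cmod (f x))\<^sup>2) summable_on UNIV)"
  using summable_on_reindex_bij_betw[OF assms(2), of "%x. (cmod (f x))\<^sup>2"] by simp
 moreover have "(\<Sum>\<^sub>\<infinity>x. (cmod (f (p x)))\<^sup>2) = (\<Sum>\<^sub>\<infinity>x. (cmod (f x))\<^sup>2)"
  using infsum_reindex_bij_betw[OF assms(2), of "%x. (cmod (f x))\<^sup>2"] by simp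
 ultimately show ?thesis using assms(1) by (simp add: ell2_def ell2_norm_def)
qed

lemma bij_int_plus: "bij (%x::int. x + a)" by (rule bij_betw_byWitness[where f' = "%x. x - a"]) auto

lemma bij_int_minus: "bij (%x::int. a - x)" by (rule bij_betw_byWitness[where f' = "%x. a - x"]) auto

lemma ell2_shift:
 "f \<in> ell2 ==> (%x. f (x + a)) \<in> ell2 & ell2_norm (%x. f (x + a)) = ell2_norm f"
 by (rule ell2_bij[OF _ bij_int_plus])

lemma ell2_shift_diff:
 "f \<in> ell2 ==> (%x. f (x - a)) \<in> ell2 & ell2_norm (%x. f (x - a)) = ell2_norm f"
 using ell2_shift[of f "- a"] by simp

lemma ell2_reflect:
 "f \<in> ell2 ==> (%x. f (- x)) \<in> ell2 & ell2_norm (%x. f (- x)) = ell2_norm f"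
 using ell2_bij[OF _ bij_int_minus, of f 0] by simp

lemma ell2_difference:
 assumes "f \<in> ell2"
 shows "(%x. f (x + a) - f x) \<in> ell2 & ell2_norm (%x. f (x + a) - f x) <= 2 * ell2_norm f"
 using ell2_diff[of "%x. f (x + a)" f] ell2_shift[OF assms, of a] assms by simp

text \<open>A shift by \<open>a\<close> turns one difference into the negative of the other.
  Increments are therefore estimated for \<open>a >= 1\<close> only.\<close>

lemma ell2_difference_minus:
 assumes "f \<in> ell2"
 shows "ell2_norm (%x. f (x - a) - f x) = ell2_norm (%x. f (x + a) - f x)"
proof -
 have "ell2_norm (%x. f (x + a) - f x) = ell2_norm (%x. f (x - a + a) - f (x - a))"
  using ell2_shift_diff[of "%x. f (x + a) - f x" a] ell2_difference[OF assms, of a] by simp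
 also have "... = ell2_norm (%x. f (x - a) - f x)" by (simp add: ell2_norm_def norm_minus_commute)
 finally show ?thesis by simp
qed

lemma cmod_le_ell2_norm: "f \<in> ell2 ==> cmod (f x) <= ell2_norm f" using L2_set_le_ell2_norm[of f "{x}"] by simp

lemma ell2_inner:
 assumes "f \<in> ell2" "g \<in> ell2"
 shows "(%x. cmod (f x * g x)) summable_on UNIV"
  and "cmod (\<Sum>\<^sub>\<infinity>x. f x * g x) <= ell2_norm f * ell2_norm g"
proof -
 have *: "(\<Sum>x\<in>F. cmod (f x * g x)) <= ell2_norm f * ell2_norm g" for F
 proof -
  have "(\<Sum>x\<in>F. cmod (f x * g x)) = (\<Sum>x\<in>F. \<bar>cmod (f x)\<bar> * \<bar>cmod (g x)\<bar>)"
   by (simp add: norm_mult)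
  also have "... <= L2_set (%x. cmod (f x)) F * L2_set (%x. cmod (g x)) F" by (rule L2_set_mult_ineq)
  also have "... <= ell2_norm f * ell2_norm g" using assms by (intro mult_mono L2_set_le_ell2_norm) auto
  finally show ?thesis .
 qed
 show s: "(%x. cmod (f x * g x)) summable_on UNIV"
  by (rule nonneg_bdd_above_summable_on) (use * in \<open>auto simp: bdd_above_def\<close>)
 have "cmod (\<Sum>\<^sub>\<infinity>x. f x * g x) <= (\<Sum>\<^sub>\<infinity>x. cmod (f x * g x))"
  by (rule norm_infsum_bound[OF s])
 also have "... <= ell2_norm f * ell2_norm g" by (rule infsum_le_finite_sums[OF s]) (use * in auto)
 finally show "cmod (\<Sum>\<^sub>\<infinity>x. f x * g x) <= ell2_norm f * ell2_norm g" .
qed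

section \<open>Finitely supported kernels\<close>

definition supp :: "(int => complex) => int set" where "supp f = {x. f x ~= 0}"

text \<open>The sum runs over the support of the left factor, which is finite wherever it matters;
  the right factor may be any sequence, in particular an element of \<open>ell2\<close> or a
  character. The algebra of kernels thus stays within finite sums.\<close>

definition conv :: "(int => complex) => (int => complex) => int => complex" where
 "conv k f x = (\<Sum>y\<in>supp k. k y * f (x - y))"

definition ft :: "(int => complex) => real => complex" where
 "ft f \<xi> = (\<Sum>y\<in>supp f. f y * cis (\<xi> * of_int y))"

definition l1norm :: "(int => complex) => real" where
 "l1norm f = (\<Sum>y\<in>supp f. cmod (f y))"

lemma sum_supp:
 assumes "finite A" "supp k \<subseteq> A" "!!y. k y = 0 ==> F y = 0"
 shows "(\<Sum>y\<in>supp k. F y) = (\<Sum>y\<in>A. F y)"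
 using assms by (intro sum.mono_neutral_left) (auto simp: supp_def)

lemma conv_eq:
 assumes "finite A" "supp k \<subseteq> A"
 shows "conv k f x = (\<Sum>y\<in>A. k y * f (x - y))" unfolding conv_def using assms by (intro sum_supp) auto

lemma l1norm_nonneg [simp]: "0 <= l1norm f" by (auto simp: l1norm_def intro: sum_nonneg)

lemma ft_eq:
 assumes "finite A" "supp k \<subseteq> A"
 shows "ft k \<xi> = (\<Sum>y\<in>A. k y * cis (\<xi> * of_int y))"
 unfolding ft_def using assms by (intro sum_supp) auto

lemma l1norm_eq:
 assumes "finite A" "supp k \<subseteq> A"
 shows "l1norm k = (\<Sum>y\<in>A. cmod (k y))" unfolding l1norm_def using assms by (intro sum_supp) auto

lemma supp_subset_atLeastAtMost:
 assumes "finite (supp f)"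
 obtains L where "0 <= L" "supp f \<subseteq> {-L..L}"
proof
 show "supp f \<subseteq> {- (\<Sum>x\<in>supp f. \<bar>x\<bar>).. (\<Sum>x\<in>supp f. \<bar>x\<bar>)}"
 proof
  fix x assume "x \<in> supp f"
  then have "\<bar>x\<bar> <= (\<Sum>x\<in>supp f. \<bar>x\<bar>)" using assms by (intro member_le_sum) auto
  then show "x \<in> {- (\<Sum>x\<in>supp f. \<bar>x\<bar>).. (\<Sum>x\<in>supp f. \<bar>x\<bar>)}" by auto
 qed
qed (auto intro: sum_nonneg)

lemma finite_supp_ell2:
 assumes "finite A" "supp f \<subseteq> A"
 shows "f \<in> ell2" "(ell2_norm f)\<^sup>2 = (\<Sum>x\<in>A. (cmod (f x))\<^sup>2)"
proof -
 have "(%x. (cmod (f x))\<^sup>2) summable_on A \<longleftrightarrow> (%x. (cmod (f x))\<^sup>2) summable_on UNIV"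
  using assms by (intro summable_on_cong_neutral) (auto simp: supp_def)
 then show "f \<in> ell2" using assms by (simp add: ell2_def)
 have "(\<Sum>\<^sub>\<infinity>x. (cmod (f x))\<^sup>2) = (\<Sum>\<^sub>\<infinity>x\<in>A. (cmod (f x))\<^sup>2)"
  using assms by (intro infsum_cong_neutral) (auto simp: supp_def)
 then show "(ell2_norm f)\<^sup>2 = (\<Sum>x\<in>A. (cmod (f x))\<^sup>2)" using assms by (simp add: ell2_norm_sq)
qed

lemma supp_in_ell2: "finite (supp f) ==> f \<in> ell2" using finite_supp_ell2(1)[of "supp f" f] by auto

lemma ell2_norm_le_of_sum:
 assumes "finite A" "supp f \<subseteq> A" "(\<Sum>x\<in>A. (cmod (f x))\<^sup>2) <= B\<^sup>2" "0 <= B"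
 shows "ell2_norm f <= B" using finite_supp_ell2(2)[OF assms(1,2)] assms(3,4) by (metis power2_le_imp_le)

lemma finite_supp_delta0: "supp delta0 = {0}" by (auto simp: supp_def delta0_def)

lemma conv_delta0: "finite (supp k) ==> conv k delta0 = k"
proof
 fix x assume k: "finite (supp k)"
 have "conv k delta0 x = (\<Sum>y\<in>supp k. if y = x then k y else 0)"
  unfolding conv_def by (intro sum.cong) (auto simp: delta0_def)
 then show "conv k delta0 x = k x" using k by (auto simp: supp_def)
qed

lemma delta0_conv: "conv delta0 f = f" by (auto simp: conv_def finite_supp_delta0 delta0_def)

lemma supp_conv:
 assumes "finite (supp f)" "finite (supp g)"
 shows "supp (conv f g) \<subseteq> (%(x,y). x + y) ` (supp f \<times> supp g)"
proof
 fix x assume "x \<in> supp (conv f g)"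
 then have "(\<Sum>y\<in>supp f. f y * g (x - y)) ~= 0" by (simp add: supp_def conv_def)
 then obtain y where "y \<in> supp f" "f y * g (x - y) ~= 0" by (meson sum.neutral)
 then have "(y, x - y) \<in> supp f \<times> supp g" "x = y + (x - y)" by (auto simp: supp_def)
 then show "x \<in> (%(x,y). x + y) ` (supp f \<times> supp g)" by force
qed

lemma finite_supp_conv:
 "finite (supp f) ==> finite (supp g) ==> finite (supp (conv f g))" using finite_subset[OF supp_conv] by blast

lemma finite_supp_add: "finite (supp f) ==> finite (supp g) ==> finite (supp (%x. f x + g x))"
 by (rule finite_subset[of _ "supp f \<union> supp g"]) (auto simp: supp_def)

lemma finite_supp_diff: "finite (supp f) ==> finite (supp g) ==> finite (supp (%x. f x - g x))"
 by (rule finite_subset[of _ "supp f \<union> supp g"]) (auto simp: supp_def)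

lemma finite_supp_mult: "finite (supp f) ==> finite (supp (%x. g x * f x))"
 by (rule finite_subset[of _ "supp f"]) (auto simp: supp_def)

lemma finite_supp_shift: "finite (supp f) ==> finite (supp (%x. f (x + a)))"
proof -
 assume "finite (supp f)"
 moreover have "supp (%x. f (x + a)) \<subseteq> (%x. x - a) ` supp f"
 proof
  fix x assume "x \<in> supp (%x. f (x + a))"
  then show "x \<in> (%x. x - a) ` supp f" by (intro image_eqI[where x = "x + a"]) (auto simp: supp_def)
 qed
 ultimately show ?thesis using finite_surj by blast
qed

lemma finite_supp_reflect: "finite (supp f) ==> finite (supp (%x. f (- x)))"
proof -
 assume "finite (supp f)"
 moreover have "supp (%x. f (- x)) \<subseteq> uminus ` supp f"
 proof
  fix x assume "x \<in> supp (%x. f (- x))"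
  then show "x \<in> uminus ` supp f" by (intro image_eqI[where x = "- x"]) (auto simp: supp_def)
 qed
 ultimately show ?thesis using finite_surj by blast
qed

lemma finite_supp_sum:
 "finite A ==> (!!i. i \<in> A ==> finite (supp (f i))) ==> finite (supp (%x. \<Sum>i\<in>A. f i x))"
 by (rule finite_subset[of _ "\<Union>i\<in>A. supp (f i)"]) (auto simp: supp_def intro: sum.neutral)

lemma conv_add_right: "conv k (%x. f x + g x) = (%x. conv k f x + conv k g x)"
 by (auto simp: conv_def sum.distrib algebra_simps)

lemma conv_diff_right: "conv k (%x. f x - g x) = (%x. conv k f x - conv k g x)"
 by (auto simp: conv_def sum_subtractf algebra_simps)

lemma conv_cmult_right: "conv k (%x. c * f x) = (%x. c * conv k f x)"
 by (auto simp: conv_def sum_distrib_left algebra_simps)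

lemma conv_sum_right: "conv k (%x. \<Sum>i\<in>A. f i x) = (%x. \<Sum>i\<in>A. conv k (f i) x)"
proof
 fix x
 have "conv k (%x. \<Sum>i\<in>A. f i x) x = (\<Sum>y\<in>supp k. \<Sum>i\<in>A. k y * f i (x - y))"
  by (simp add: conv_def sum_distrib_left)
 then show "conv k (%x. \<Sum>i\<in>A. f i x) x = (\<Sum>i\<in>A. conv k (f i) x)"
  by (simp add: conv_def sum.swap[of _ A])
qed

lemma conv_add_left:
 assumes "finite (supp f)" "finite (supp g)"
 shows "conv (%x. f x + g x) k = (%x. conv f k x + conv g k x)"
proof
 fix x
 let ?A = "supp f \<union> supp g"
 have "conv (%x. f x + g x) k x = (\<Sum>y\<in>?A. (f y + g y) * k (x - y))"
  using assms by (intro conv_eq) (auto simp: supp_def)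
 also have "... = conv f k x + conv g k x" using assms by (simp add: conv_eq[of ?A] sum.distrib algebra_simps)
 finally show "conv (%x. f x + g x) k x = conv f k x + conv g k x" .
qed

lemma conv_diff_left:
 assumes "finite (supp f)" "finite (supp g)"
 shows "conv (%x. f x - g x) k = (%x. conv f k x - conv g k x)"
proof
 fix x
 let ?A = "supp f \<union> supp g"
 have "conv (%x. f x - g x) k x = (\<Sum>y\<in>?A. (f y - g y) * k (x - y))"
  using assms by (intro conv_eq) (auto simp: supp_def)
 also have "... = conv f k x - conv g k x" using assms by (simp add: conv_eq[of ?A] sum_subtractf algebra_simps)
 finally show "conv (%x. f x - g x) k x = conv f k x - conv g k x" .
qed

lemma conv_sum_left:
 assumes "finite A" "!!i. i \<in> A ==> finite (supp (f i))"
 shows "conv (%x. \<Sum>i\<in>A. f i x) k = (%x. \<Sum>i\<in>A. conv (f i) k x)"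
proof
 fix x
 let ?B = "\<Union>i\<in>A. supp (f i)"
 have fin: "finite ?B" using assms by auto
 have "conv (%x. \<Sum>i\<in>A. f i x) k x = (\<Sum>y\<in>?B. (\<Sum>i\<in>A. f i y) * k (x - y))"
  using fin by (intro conv_eq) (auto simp: supp_def intro: sum.neutral)
 also have "... = (\<Sum>i\<in>A. \<Sum>y\<in>?B. f i y * k (x - y))" by (subst sum.swap) (simp add: sum_distrib_right)
 also have "... = (\<Sum>i\<in>A. conv (f i) k x)" using fin by (intro sum.cong refl conv_eq[symmetric]) auto
 finally show "conv (%x. \<Sum>i\<in>A. f i x) k x = (\<Sum>i\<in>A. conv (f i) k x)" .
qed

lemma conv_commute:
 assumes "finite (supp f)" "finite (supp g)"
 shows "conv f g = conv g f"
proof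
 fix x
 have "conv f g x = (\<Sum>y\<in>supp f \<inter> (%z. x - z) ` supp g. f y * g (x - y))" unfolding conv_def
 proof (rule sum.mono_neutral_right)
  show "\<forall>i\<in>supp f - supp f \<inter> (%z. x - z) ` supp g. f i * g (x - i) = 0"
  proof
   fix i assume i: "i \<in> supp f - supp f \<inter> (%z. x - z) ` supp g"
   have "x - i \<notin> supp g"
   proof
    assume "x - i \<in> supp g"
    then have "x - (x - i) \<in> (%z. x - z) ` supp g" by blast
    then show False using i by simp
   qed
   then show "f i * g (x - i) = 0" by (simp add: supp_def)
  qed
 qed (use assms in auto)
 also have "... = (\<Sum>z\<in>supp g \<inter> (%z. x - z) ` supp f. g z * f (x - z))"
  by (rule sum.reindex_bij_witness[where i = "%z. x - z" and j = "%z. x - z"]) (auto simp: image_iff)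
 also have "... = conv g f x" unfolding conv_def
 proof (rule sum.mono_neutral_left)
  show "\<forall>i\<in>supp g - supp g \<inter> (%z. x - z) ` supp f. g i * f (x - i) = 0"
  proof
   fix i assume i: "i \<in> supp g - supp g \<inter> (%z. x - z) ` supp f"
   have "x - i \<notin> supp f"
   proof
    assume "x - i \<in> supp f"
    then have "x - (x - i) \<in> (%z. x - z) ` supp f" by blast
    then show False using i by simp
   qed
   then show "g i * f (x - i) = 0" by (simp add: supp_def)
  qed
 qed (use assms in auto)
 finally show "conv f g x = conv g f x" .
qed

text \<open>Interchange of two sums over supports. Unlike \<open>conv_commute\<close> this leaves
  the third factor arbitrary, so kernels acting on an element of \<open>ell2\<close> can be
  interchanged.\<close>

lemma conv_conv_commute: "conv f (conv g k) = conv g (conv f k)"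
proof
 fix x
 have "conv f (conv g k) x = (\<Sum>y\<in>supp f. \<Sum>z\<in>supp g. f y * g z * k (x - y - z))"
  by (simp add: conv_def sum_distrib_left algebra_simps)
 also have "... = (\<Sum>z\<in>supp g. \<Sum>y\<in>supp f. f y * g z * k (x - y - z))" by (rule sum.swap)
 also have "... = conv g (conv f k) x" by (simp add: conv_def sum_distrib_left algebra_simps)
 finally show "conv f (conv g k) x = conv g (conv f k) x" .
qed

lemma conv_assoc:
 assumes "finite (supp f)" "finite (supp g)"
 shows "conv (conv f g) k = conv f (conv g k)"
proof
 fix x
 let ?B = "(%(x,y). x + y) ` (supp f \<times> supp g)"
 have "conv (conv f g) k x = (\<Sum>y\<in>?B. conv f g y * k (x - y))" using assms supp_conv by (intro conv_eq) auto
 also have "... = (\<Sum>z\<in>supp f. \<Sum>y\<in>?B. f z * g (y - z) * k (x - y))"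
  by (subst sum.swap) (simp add: conv_def sum_distrib_right)
 also have "... = (\<Sum>z\<in>supp f. \<Sum>y\<in>supp g. f z * g y * k (x - z - y))"
 proof (rule sum.cong[OF refl])
  fix z assume z: "z \<in> supp f"
  have "(\<Sum>y\<in>?B. f z * g (y - z) * k (x - y)) = (\<Sum>y\<in>(%y. z + y) ` supp g. f z * g (y - z) * k (x - y))"
  proof (rule sum.mono_neutral_right)
   show "\<forall>i\<in>?B - (+) z ` supp g. f z * g (i - z) * k (x - i) = 0"
   proof
    fix i assume i: "i \<in> ?B - (+) z ` supp g"
    have "i - z \<notin> supp g"
    proof
     assume "i - z \<in> supp g"
     then have "z + (i - z) \<in> (+) z ` supp g" by blast
     then show False using i by simp
    qed
    then show "f z * g (i - z) * k (x - i) = 0" by (simp add: supp_def)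
   qed
  qed (use assms z in auto)
  also have "... = (\<Sum>y\<in>supp g. f z * g y * k (x - z - y))" by (subst sum.reindex) (auto simp: algebra_simps)
  finally show "(\<Sum>y\<in>?B. f z * g (y - z) * k (x - y)) = (\<Sum>y\<in>supp g. f z * g y * k (x - z - y))" .
 qed
 also have "... = conv f (conv g k) x" by (simp add: conv_def sum_distrib_left algebra_simps)
 finally show "conv (conv f g) k x = conv f (conv g k) x" .
qed

lemma conv_shift_right: "conv k (%x. f (x + a)) = (%x. conv k f (x + a))" by (auto simp: conv_def algebra_simps)

lemma conv_difference_right:
 "conv k (%x. f (x + a) - f x) = (%x. conv k f (x + a) - conv k f x)" by (simp add: conv_diff_right conv_shift_right)

lemma conv_reflect: "conv (%x. f (- x)) (%x. g (- x)) = (%x. conv f g (- x))"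
proof
 fix x
 show "conv (%x. f (- x)) (%x. g (- x)) x = conv f g (- x)" unfolding conv_def
  by (rule sum.reindex_bij_witness[where i = uminus and j = uminus]) (auto simp: supp_def algebra_simps)
qed

text \<open>Multiplication by a character is an automorphism of the convolution algebra. Hence the
  modulated inverse kernel inverts the modulated operator, with the same norm.\<close>

lemma conv_modulate:
 "conv (%x. cis (\<eta> * of_int x) * f x) (%x. cis (\<eta> * of_int x) * g x) = (%x. cis (\<eta> * of_int x) * conv f g x)"
proof
 fix x
 have s: "supp (%x. cis (\<eta> * of_int x) * f x) = supp f" by (auto simp: supp_def)
 have c: "cis (\<eta> * of_int y) * f y * (cis (\<eta> * of_int (x - y)) * g (x - y))
   = cis (\<eta> * of_int x) * (f y * g (x - y))" for y
 proof -
  have "cis (\<eta> * of_int x) = cis (\<eta> * of_int y) * cis (\<eta> * of_int (x - y))"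
   by (simp add: cis_mult algebra_simps)
  then show ?thesis by simp
 qed
 show "conv (%x. cis (\<eta> * of_int x) * f x) (%x. cis (\<eta> * of_int x) * g x) x
  = cis (\<eta> * of_int x) * conv f g x" unfolding conv_def s sum_distrib_left by (rule sum.cong[OF refl c])
qed

lemma conv_ell2:
 assumes "finite (supp k)" "f \<in> ell2"
 shows "conv k f \<in> ell2 & ell2_norm (conv k f) <= l1norm k * ell2_norm f"
proof -
 have "(%x. \<Sum>y\<in>supp k. k y * f (x - y)) \<in> ell2 &
   ell2_norm (%x. \<Sum>y\<in>supp k. k y * f (x - y)) <= (\<Sum>y\<in>supp k. cmod (k y) * ell2_norm f)"
 proof (rule ell2_sum_bound[OF assms(1)])
  fix y
  show "(%x. k y * f (x - y)) \<in> ell2 & ell2_norm (%x. k y * f (x - y)) <= cmod (k y) * ell2_norm f"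
   using ell2_cmult[of "%x. f (x - y)" "k y"] ell2_shift_diff[OF assms(2), of y] by simp
 qed
 then show ?thesis by (simp add: conv_def[abs_def] l1norm_def sum_distrib_right)
qed

lemma cmod_ft_le_l1norm: "cmod (ft f \<xi>) <= l1norm f"
 unfolding ft_def l1norm_def by (rule order_trans[OF norm_sum]) (simp add: norm_mult)


section \<open>Plancherel's identity for finitely supported kernels\<close>

lemma conv_cis: "conv f (%x. cis (- \<xi> * of_int x)) = (%x. ft f \<xi> * cis (- \<xi> * of_int x))"
proof
 fix x
 have "f y * cis (- \<xi> * of_int (x - y)) = f y * cis (\<xi> * of_int y) * cis (- \<xi> * of_int x)" for y
 proof -
  have "cis (- \<xi> * of_int (x - y)) = cis (\<xi> * of_int y) * cis (- \<xi> * of_int x)"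
   by (simp add: cis_mult algebra_simps)
  then show ?thesis by simp
 qed
 then show "conv f (%x. cis (- \<xi> * of_int x)) x = ft f \<xi> * cis (- \<xi> * of_int x)"
  unfolding conv_def ft_def sum_distrib_right by (rule sum.cong[OF refl])
qed

text \<open>Characters are eigenvectors of convolution (\<open>conv_cis\<close>), so
  multiplicativity is read off from associativity, evaluated at 0.\<close>

lemma ft_conv:
 assumes "finite (supp f)" "finite (supp g)"
 shows "ft (conv f g) \<xi> = ft f \<xi> * ft g \<xi>"
proof -
 have "conv (conv f g) (%x. cis (- \<xi> * of_int x)) = conv f (conv g (%x. cis (- \<xi> * of_int x)))"
  by (rule conv_assoc[OF assms])
 also have "... = (%x. ft g \<xi> * (ft f \<xi> * cis (- \<xi> * of_int x)))" by (simp only: conv_cis conv_cmult_right)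
 finally have "ft (conv f g) \<xi> * cis (- \<xi> * of_int 0) = ft g \<xi> * (ft f \<xi> * cis (- \<xi> * of_int 0))"
  by (simp only: conv_cis fun_eq_iff)
 then show ?thesis by simp
qed

lemma sum_cis_roots:
 fixes n :: int
 assumes "\<bar>n\<bar> < int Q"
 shows "(\<Sum>a<Q. cis (2 * pi * real a / real Q * of_int n)) = (if n = 0 then of_nat Q else 0)"
proof (cases "n = 0")
 case False
 have Q: "0 < Q" using assms by auto
 define z where "z = cis (2 * pi * of_int n / real Q)"
 have pow: "cis (2 * pi * real a / real Q * of_int n) = z ^ a" for a
 proof -
  have "2 * pi * real a / real Q * of_int n = real a * (2 * pi * of_int n / real Q)" by simp
  then show ?thesis unfolding z_def using Complex.DeMoivre by metis
 qed
 have "z ^ Q = cis (2 * pi * of_int n)" unfolding z_def Complex.DeMoivre using Q by simp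
 also have "... = 1" by (simp add: cis_multiple_2pi)
 finally have zQ: "z ^ Q = 1" .
 have "z ~= 1"
 proof
  assume "z = 1"
  then have "cis (2 * pi * of_int n / real Q) = cis 0" by (simp add: z_def)
  then have "cos (2 * pi * of_int n / real Q) = 1" by (simp add: complex_eq_iff)
  then obtain k :: int where "2 * pi * of_int n / real Q = of_int k * 2 * pi" using cos_one_2pi_int by auto
  then have "real_of_int n = of_int k * real Q" using Q by (simp add: field_simps)
  then have "real_of_int n = real_of_int (k * int Q)" by simp
  then have nk: "n = k * int Q" by (simp only: of_int_eq_iff)
  then have "\<bar>k\<bar> * int Q < int Q" using assms by (simp add: abs_mult)
  then have "\<bar>k\<bar> < 1" using Q by simp
  then show False using nk False by simp
 qed
 then have "(\<Sum>a<Q. z ^ a) = 0" using zQ by (simp add: sum_gp_strict)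
 then show ?thesis using False by (simp only: pow if_False)
qed simp

text \<open>The integral over the circle is replaced by a sum over Q equally spaced frequencies.
  This is exact because differences of points of the support are smaller than Q in modulus.\<close>

lemma parseval:
 assumes "supp f \<subseteq> {-L..L}" "2 * L < int Q"
 shows "(\<Sum>a<Q. (cmod (ft f (2 * pi * real a / real Q)))\<^sup>2) = real Q * (ell2_norm f)\<^sup>2"
proof -
 let ?A = "{-L..L}"
 let ?c = "%a n. cis (2 * pi * real a / real Q * of_int n)"
 have sq: "complex_of_real ((cmod (ft f (2 * pi * real a / real Q)))\<^sup>2)
   = (\<Sum>x\<in>?A. \<Sum>y\<in>?A. f x * cnj (f y) * ?c a (x - y))" for a
 proof -
  have "complex_of_real ((cmod (ft f (2 * pi * real a / real Q)))\<^sup>2)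
    = (\<Sum>x\<in>?A. f x * ?c a x) * cnj (\<Sum>y\<in>?A. f y * ?c a y)"
   using ft_eq[OF _ assms(1)] by (simp only: complex_norm_square[symmetric] finite_atLeastAtMost_int)
  also have "... = (\<Sum>x\<in>?A. \<Sum>y\<in>?A. (f x * ?c a x) * (cnj (f y) * ?c a (- y)))"
   by (simp add: sum_product cis_cnj)
  also have "... = (\<Sum>x\<in>?A. \<Sum>y\<in>?A. f x * cnj (f y) * ?c a (x - y))"
  proof (intro sum.cong refl)
   fix x y
   have "?c a (x - y) = ?c a x * ?c a (- y)" unfolding cis_mult distrib_left[symmetric] by simp
   then show "(f x * ?c a x) * (cnj (f y) * ?c a (- y)) = f x * cnj (f y) * ?c a (x - y)" by simp
  qed
  finally show ?thesis .
 qed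
 have "complex_of_real (\<Sum>a<Q. (cmod (ft f (2 * pi * real a / real Q)))\<^sup>2)
   = (\<Sum>a<Q. \<Sum>x\<in>?A. \<Sum>y\<in>?A. f x * cnj (f y) * ?c a (x - y))" by (simp only: of_real_sum sq)
 also have "... = (\<Sum>x\<in>?A. \<Sum>y\<in>?A. \<Sum>a<Q. f x * cnj (f y) * ?c a (x - y))"
  by (subst sum.swap, intro sum.cong refl, subst sum.swap, rule refl)
 also have "... = (\<Sum>x\<in>?A. \<Sum>y\<in>?A. if y = x then f x * cnj (f x) * of_nat Q else 0)"
 proof (intro sum.cong refl)
  fix x y assume "x \<in> ?A" "y \<in> ?A"
  then have "\<bar>x - y\<bar> < int Q" using assms(2) by auto
  from sum_cis_roots[OF this] show "(\<Sum>a<Q. f x * cnj (f y) * ?c a (x - y))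
    = (if y = x then f x * cnj (f x) * of_nat Q else 0)" by (simp add: sum_distrib_left[symmetric])
 qed
 also have "... = (\<Sum>x\<in>?A. of_nat Q * complex_of_real ((cmod (f x))\<^sup>2))"
  by (intro sum.cong refl) (simp add: sum.delta complex_norm_square[symmetric] mult.commute del: of_real_power)
 also have "... = complex_of_real (real Q * (ell2_norm f)\<^sup>2)"
  using finite_supp_ell2(2)[OF _ assms(1)] by (simp add: sum_distrib_left)
 finally show ?thesis by (simp only: of_real_eq_iff)
qed

text \<open>A bound for the Fourier transform is an operator bound. Q exceeds twice the radius of
  both supports, so that \<open>parseval\<close> applies to \<open>g\<close> and to the convolution
  alike.\<close>

theorem ell2_norm_conv_le_ft:
 assumes f: "finite (supp f)" and g: "finite (supp g)" and B: "!!\<xi>. cmod (ft f \<xi>) <= B"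
 shows "ell2_norm (conv f g) <= B * ell2_norm g"
proof -
 have B0: "0 <= B" by (rule order_trans[OF norm_ge_zero B])
 obtain L1 where L1: "0 <= L1" "supp g \<subseteq> {-L1..L1}" using supp_subset_atLeastAtMost[OF g] by blast
 obtain L2 where L2: "0 <= L2" "supp (conv f g) \<subseteq> {-L2..L2}"
  using supp_subset_atLeastAtMost[OF finite_supp_conv[OF f g]] by blast
 define L where "L = max L1 L2"
 define Q where "Q = nat (2 * L + 1)"
 have Q: "2 * L < int Q" "0 < Q" using L1 L2 by (auto simp: Q_def L_def)
 have s: "supp g \<subseteq> {-L..L}" "supp (conv f g) \<subseteq> {-L..L}"
 proof -
  have "{-L1..L1} \<subseteq> {-L..L}" "{-L2..L2} \<subseteq> {-L..L}" by (simp_all add: L_def)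
  then show "supp g \<subseteq> {-L..L}" "supp (conv f g) \<subseteq> {-L..L}" using L1(2) L2(2) by (meson order_trans)+
 qed
 have "real Q * (ell2_norm (conv f g))\<^sup>2 = (\<Sum>a<Q. (cmod (ft (conv f g) (2 * pi * real a / real Q)))\<^sup>2)"
  by (rule parseval[OF s(2) Q(1), symmetric])
 also have "... <= (\<Sum>a<Q. B\<^sup>2 * (cmod (ft g (2 * pi * real a / real Q)))\<^sup>2)"
 proof (rule sum_mono)
  fix a
  have "cmod (ft (conv f g) (2 * pi * real a / real Q)) <= B * cmod (ft g (2 * pi * real a / real Q))"
   using B by (simp add: ft_conv[OF f g] norm_mult mult_right_mono)
  then show "(cmod (ft (conv f g) (2 * pi * real a / real Q)))\<^sup>2
    <= B\<^sup>2 * (cmod (ft g (2 * pi * real a / real Q)))\<^sup>2"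
   using power_mono[OF _ norm_ge_zero, of "ft (conv f g) (2 * pi * real a / real Q)"
     "B * cmod (ft g (2 * pi * real a / real Q))" 2] by (simp add: power_mult_distrib)
 qed
 also have "... = real Q * (B\<^sup>2 * (ell2_norm g)\<^sup>2)"
  by (simp add: sum_distrib_left[symmetric] parseval[OF s(1) Q(1)])
 finally have "(ell2_norm (conv f g))\<^sup>2 <= (B * ell2_norm g)\<^sup>2" using Q(2) by (simp add: power_mult_distrib)
 then show ?thesis by (rule power2_le_imp_le) (simp add: B0)
qed

section \<open>Autocorrelations\<close>

definition acorr :: "(int => complex) => int => complex" where
 "acorr f x = (\<Sum>y\<in>supp f. cnj (f y) * f (y + x))"

lemma acorr_conv:
 assumes "finite (supp f)"
 shows "acorr f = conv (%x. cnj (f (- x))) f"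
proof
 fix x
 show "acorr f x = conv (%x. cnj (f (- x))) f x" unfolding conv_def acorr_def
  by (rule sum.reindex_bij_witness[where i = uminus and j = uminus]) (auto simp: supp_def algebra_simps)
qed

lemma ell2_norm_acorr:
 assumes f: "finite (supp f)" and B: "!!\<xi>. cmod (ft f \<xi>) <= B"
 shows "finite (supp (acorr f))" "ell2_norm (acorr f) <= B * ell2_norm f"
proof -
 have s: "supp (%x. cnj (f (- x))) = supp (%x. f (- x))" by (auto simp: supp_def)
 have f': "finite (supp (%x. cnj (f (- x))))" unfolding s by (rule finite_supp_reflect[OF f])
 show "finite (supp (acorr f))" unfolding acorr_conv[OF f] by (rule finite_supp_conv[OF f' f])
 have ft': "ft (%x. cnj (f (- x))) \<xi> = cnj (ft f \<xi>)" for \<xi>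
 proof -
  have "ft (%x. cnj (f (- x))) \<xi> = (\<Sum>y\<in>supp f. cnj (f y) * cis (- (\<xi> * of_int y)))" unfolding ft_def
   by (rule sum.reindex_bij_witness[where i = uminus and j = uminus]) (auto simp: supp_def algebra_simps)
  then show ?thesis by (simp add: ft_def cis_cnj)
 qed
 show "ell2_norm (acorr f) <= B * ell2_norm f"
  unfolding acorr_conv[OF f] by (rule ell2_norm_conv_le_ft[OF f' f]) (simp add: ft' B)
qed

lemma acorr_0: "finite (supp f) ==> acorr f 0 = complex_of_real ((ell2_norm f)\<^sup>2)"
 by (simp add: acorr_def finite_supp_ell2(2)[of "supp f"] complex_norm_square[symmetric] mult.commute
   del: of_real_power)

text \<open>The squared norm is the value at 0 of \<open>acorr (conv f g)\<close>, which factors as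
  \<open>conv (acorr f) (acorr g)\<close>. The point x = 0 and the remaining points can then be
  treated by different means: norms on the diagonal, counting and Fourier bounds off it.\<close>

lemma ell2_norm_conv_acorr:
 assumes f: "finite (supp f)" and g: "finite (supp g)" and A: "finite A" "supp (acorr f) \<subseteq> A"
 shows "(ell2_norm (conv f g))\<^sup>2 <= (\<Sum>x\<in>A. cmod (acorr f x) * cmod (acorr g x))"
proof -
 have fg: "finite (supp (conv f g))" by (rule finite_supp_conv[OF f g])
 have f': "finite (supp (%x. cnj (f (- x))))" and g': "finite (supp (%x. cnj (g (- x))))"
  using finite_supp_reflect[OF f] finite_supp_reflect[OF g] by (auto simp: supp_def)
 have c: "(%x. cnj (conv f g (- x))) = conv (%x. cnj (f (- x))) (%x. cnj (g (- x)))"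
 proof
  fix x
  have "cnj (conv f g (- x)) = cnj (conv (%x. f (- x)) (%x. g (- x)) x)" by (simp add: conv_reflect)
  also have "... = conv (%x. cnj (f (- x))) (%x. cnj (g (- x))) x" by (simp add: conv_def supp_def)
  finally show "cnj (conv f g (- x)) = conv (%x. cnj (f (- x))) (%x. cnj (g (- x))) x" .
 qed
 have "acorr (conv f g) = conv (conv (%x. cnj (f (- x))) (%x. cnj (g (- x)))) (conv f g)"
  by (simp add: acorr_conv[OF fg] c)
 also have "... = conv (%x. cnj (f (- x))) (conv f (conv (%x. cnj (g (- x))) g))"
  by (simp add: conv_assoc f' g' conv_conv_commute[of "%x. cnj (g (- x))"])
 also have "... = conv (acorr f) (acorr g)" by (simp add: acorr_conv f g conv_assoc f')
 finally have eq: "acorr (conv f g) = conv (acorr f) (acorr g)" .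
 have sym: "cmod (acorr g (- y)) = cmod (acorr g y)" for y
 proof -
  have *: "acorr g y = conv g (%x. cnj (g (- x))) y" by (simp add: acorr_conv[OF g] conv_commute[OF g' g])
  have "acorr g y = (\<Sum>z\<in>supp g. g z * cnj (g (z - y)))" by (simp add: * conv_def)
  moreover have "cnj (acorr g (- y)) = (\<Sum>z\<in>supp g. g z * cnj (g (z - y)))" by (simp add: acorr_def)
  ultimately have "cnj (acorr g (- y)) = acorr g y" by simp
  then show ?thesis by (metis complex_mod_cnj)
 qed
 have "complex_of_real ((ell2_norm (conv f g))\<^sup>2) = (\<Sum>x\<in>A. acorr f x * acorr g (0 - x))"
  unfolding acorr_0[OF fg, symmetric] eq by (rule conv_eq[OF A])
 then have "(ell2_norm (conv f g))\<^sup>2 = cmod (\<Sum>x\<in>A. acorr f x * acorr g (0 - x))"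
  by (metis norm_of_real abs_of_nonneg zero_le_power2)
 also have "... <= (\<Sum>x\<in>A. cmod (acorr f x * acorr g (0 - x)))" by (rule norm_sum)
 also have "... = (\<Sum>x\<in>A. cmod (acorr f x) * cmod (acorr g x))" by (simp add: norm_mult sym)
 finally show ?thesis .
qed

section \<open>Exponential sums\<close>

lemma sin_ge_half:
 fixes x :: real
 assumes "0 <= x" "x <= pi / 2"
 shows "x / 2 <= sin x"
proof (cases "x <= pi / 3")
 case True
 have "(sin 0 - 0 / 2) <= sin x - x / 2"
 proof (rule DERIV_nonneg_imp_nondecreasing[OF assms(1)])
  fix t :: real assume t: "0 <= t" "t <= x"
  have "cos (pi / 3) <= cos t" using t True by (intro cos_monotone_0_pi_le) auto
  then have "0 <= cos t - 1 / 2" by (simp add: cos_60)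
  moreover have "((%x. sin x - x / 2) has_real_derivative (cos t - 1 / 2)) (at t)"
   by (auto intro!: derivative_eq_intros)
  ultimately show "\<exists>y. ((%x. sin x - x / 2) has_real_derivative y) (at t) & 0 <= y" by blast
 qed
 then show ?thesis by simp
next
 \<comment> \<open>Beyond pi / 3 the sine is at least sqrt 3 / 2, which exceeds pi / 4.\<close>
 case False
 have "sin (pi / 3) <= sin x" using False assms by (intro sin_monotone_2pi_le) auto
 moreover have "(17 / 10) <= sqrt 3" by (rule real_le_rsqrt) (simp add: power2_eq_square)
 moreover have "pi < 3.2" using pi_approx by simp
 ultimately show ?thesis using assms by (simp add: sin_60)
qed

lemma cmod_cis_minus_1: "cmod (cis x - 1) = 2 * \<bar>sin (x / 2)\<bar>"
proof -
 have "cis x - 1 = 2 * \<i> * complex_of_real (sin (x / 2)) * cis (x / 2)"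
 proof -
  have "cos x = 1 - 2 * (sin (x / 2))\<^sup>2" using cos_double_sin[of "x / 2"] by simp
  moreover have "sin x = 2 * sin (x / 2) * cos (x / 2)" using sin_double[of "x / 2"] by simp
  ultimately show ?thesis by (simp add: complex_eq_iff power2_eq_square)
 qed
 then show ?thesis by (simp add: norm_mult)
qed

lemma cmod_cis_minus_1_le: "cmod (cis x - 1) <= \<bar>x\<bar>"
 using abs_sin_x_le_abs_x[of "x / 2"] by (simp add: cmod_cis_minus_1)

lemma cmod_cis_minus_1_le_2: "cmod (cis x - 1) <= 2" by (simp add: cmod_cis_minus_1)

lemma cmod_cis_minus_1_ge:
 assumes "\<bar>x\<bar> <= pi"
 shows "\<bar>x\<bar> / 2 <= cmod (cis x - 1)"
proof -
 have "\<bar>x\<bar> / 2 / 2 <= sin (\<bar>x\<bar> / 2)" using assms by (intro sin_ge_half) auto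
 moreover have "\<bar>sin (x / 2)\<bar> = \<bar>sin (\<bar>x\<bar> / 2)\<bar>" by (cases "x \<ge> 0") auto
 ultimately show ?thesis by (simp add: cmod_cis_minus_1)
qed

text \<open>The real part is constant, so differences of these inverses are purely imaginary and
  their total variation is that of a monotone cotangent.\<close>

lemma inverse_cis_minus_1:
 assumes "0 < v" "v <= pi"
 shows "inverse (cis v - 1) = Complex (- 1 / 2) (- cot (v / 2) / 2)"
proof -
 have s: "0 < sin (v / 2)" using assms by (intro sin_gt_zero) auto
 have c: "cos v = 1 - 2 * (sin (v / 2))\<^sup>2" using cos_double_sin[of "v / 2"] by simp
 have d: "sin v = 2 * sin (v / 2) * cos (v / 2)" using sin_double[of "v / 2"] by simp
 have "(cis v - 1) * Complex (- 1 / 2) (- cot (v / 2) / 2) = 1" using s sin_cos_squared_add[of "v / 2"]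
  by (simp add: complex_eq_iff c d cot_def power2_eq_square field_simps distrib_left[symmetric] del: distrib_left_numeral)
 then show ?thesis by (metis inverse_unique)
qed

lemma cot_antimono:
 assumes "0 < a" "a <= b" "b <= pi / 2"
 shows "cot b <= cot (a :: real)"
proof -
 have s: "0 < sin a" "0 < sin b" "0 <= sin (b - a)" using assms by (auto intro!: sin_gt_zero sin_ge_zero)
 have "cot a - cot b = sin (b - a) / (sin a * sin b)" using s by (simp add: cot_def sin_diff field_simps)
 then show ?thesis using s by (smt (verit) divide_nonneg_pos mult_pos_pos)
qed

lemma cot_half_bounds:
 assumes "0 < l" "l <= v" "v <= pi"
 shows "0 <= cot (v / 2)" "cot (v / 2) <= 4 / l"
proof -
 have s: "0 < sin (v / 2)" using assms by (intro sin_gt_zero) auto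
 have h: "v / 2 / 2 <= sin (v / 2)" using assms by (intro sin_ge_half) auto
 have "0 <= cos (v / 2)" using assms by (intro cos_ge_zero) auto
 then show "0 <= cot (v / 2)" using s by (simp add: cot_def)
 have "cot (v / 2) <= 1 / (v / 4)" unfolding cot_def
 proof (rule frac_le)
  show "v / 4 <= sin (v / 2)" using h by simp
 qed (use assms in auto)
 also have "... <= 4 / l" using assms by (simp add: frac_le)
 finally show "cot (v / 2) <= 4 / l" .
qed

text \<open>\<open>cis (g i)\<close> is the increment of
 \<open>cis \<circ> g\<close> divided by \<open>cis (\<Delta>g) - 1\<close>, whose inverse is essentially a monotone cotangent.\<close>

lemma kusmin_landau:
 fixes g :: "nat => real"
 assumes l: "0 < l"
  and D: "!!i. Suc i < n ==> l <= g (Suc i) - g i & g (Suc i) - g i <= pi"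
  and mono: "!!i. Suc (Suc i) < n ==> g (Suc (Suc i)) - g (Suc i) <= g (Suc i) - g i"
  and l2: "l <= 4"
 shows "cmod (\<Sum>i<n. cis (g i)) <= 20 / l"
proof -
 define q where "q = (%i. inverse (cis (g (Suc i) - g i) - 1))"
 define ct where "ct = (%i. cot ((g (Suc i) - g i) / 2))"
 have q: "q i = Complex (- 1 / 2) (- ct i / 2)" if "Suc i < n" for i
  using D[OF that] l unfolding q_def ct_def by (intro inverse_cis_minus_1) auto
 have ctb: "0 <= ct i" "ct i <= 4 / l" if "Suc i < n" for i
  using D[OF that] cot_half_bounds[OF l] unfolding ct_def by auto
 have ctm: "ct i <= ct (Suc i)" if "Suc (Suc i) < n" for i
  unfolding ct_def using D[of i] D[of "Suc i"] mono[OF that] that l by (intro cot_antimono) auto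
 have cq: "cmod (q i) <= 1 / 2 + ct i / 2" if "Suc i < n" for i using q[OF that] ctb[OF that] cmod_le[of "q i"] by simp
 have e: "cis (g i) = (cis (g (Suc i)) - cis (g i)) * q i" if "Suc i < n" for i
 proof -
  have "cis (g (Suc i) - g i) - 1 ~= 0"
  proof
   assume "cis (g (Suc i) - g i) - 1 = 0"
   then have "cmod (cis (g (Suc i) - g i) - 1) = 0" by simp
   moreover have "\<bar>g (Suc i) - g i\<bar> <= pi" using D[OF that] l by auto
   ultimately show False using cmod_cis_minus_1_ge[of "g (Suc i) - g i"] D[OF that] l by auto
  qed
  moreover have "cis (g (Suc i)) - cis (g i) = cis (g i) * (cis (g (Suc i) - g i) - 1)"
   by (simp add: algebra_simps cis_mult)
  ultimately show ?thesis by (simp add: q_def)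
 qed
 \<comment> \<open>Summation by parts. The variation of the cotangents telescopes, so the bound
   involves only the last value \<open>ct k\<close>.\<close>
 have main: "cmod ((\<Sum>i<Suc k. cis (g i)) - cis (g (Suc k)) * q k) <= 1 / 2 + ct k / 2" if "Suc k < n" for k
  using that
 proof (induction k)
  case 0
  have "(\<Sum>i<Suc 0. cis (g i)) - cis (g (Suc 0)) * q 0 = - cis (g 0) * q 0"
   using e[OF 0] by (simp add: algebra_simps)
  then show ?case using cq[OF 0] by (simp add: norm_mult)
 next
  case (Suc k)
  then have k: "Suc k < n" by simp
  have "(\<Sum>i<Suc (Suc k). cis (g i)) - cis (g (Suc (Suc k))) * q (Suc k)
    = ((\<Sum>i<Suc k. cis (g i)) - cis (g (Suc k)) * q k) + cis (g (Suc k)) * (q k - q (Suc k))"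
   using e[OF Suc.prems] by (simp add: algebra_simps)
  then have "cmod ((\<Sum>i<Suc (Suc k). cis (g i)) - cis (g (Suc (Suc k))) * q (Suc k))
    <= cmod ((\<Sum>i<Suc k. cis (g i)) - cis (g (Suc k)) * q k) + cmod (q k - q (Suc k))"
   using norm_triangle_ineq by (metis mult_1 norm_cis norm_mult)
  moreover have "cmod (q k - q (Suc k)) = (ct (Suc k) - ct k) / 2"
  proof -
   have "q k - q (Suc k) = Complex 0 ((ct (Suc k) - ct k) / 2)"
    using q[OF k] q[OF Suc.prems] by (simp add: complex_eq_iff)
   then show ?thesis using ctm[OF Suc.prems] by (simp add: cmod_def)
  qed
  ultimately show ?case using Suc.IH[OF k] by (simp add: field_simps)
 qed
 show ?thesis
 proof (cases "n <= 1")
  case True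
  then have "n = 0 \<or> n = 1" by auto
  then have "cmod (\<Sum>i<n. cis (g i)) <= 1" by auto
  also have "1 <= 20 / l" using l l2 by simp
  finally show ?thesis .
 next
  case False
  then obtain k where n: "n = Suc (Suc k)" by (metis One_nat_def not_less_eq_eq old.nat.exhaust zero_le)
  have k: "Suc k < n" by (simp add: n)
  have "(\<Sum>i<n. cis (g i)) = ((\<Sum>i<Suc k. cis (g i)) - cis (g (Suc k)) * q k)
    + (cis (g (Suc k)) * q k + cis (g (Suc k)))" by (simp add: n)
  also have "cmod ... <= cmod ((\<Sum>i<Suc k. cis (g i)) - cis (g (Suc k)) * q k)
    + cmod (cis (g (Suc k)) * q k + cis (g (Suc k)))" by (rule norm_triangle_ineq)
  also have "cmod (cis (g (Suc k)) * q k + cis (g (Suc k))) <= cmod (q k) + 1"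
   by (rule order_trans[OF norm_triangle_ineq]) (simp add: norm_mult)
  finally have "cmod (\<Sum>i<n. cis (g i)) <= 2 + ct k" using main[OF k] cq[OF k] by simp
  also have "... <= 8 / l + 4 / l" using ctb[OF k] l l2 by (intro add_mono) (auto simp: field_simps)
  also have "... <= 20 / l" using l by (simp add: field_simps)
  finally show ?thesis .
 qed
qed

section \<open>Van der Corput's differencing inequality\<close>

lemma cmod_acorr_minus:
 assumes g: "finite (supp g)"
 shows "cmod (acorr g (- y)) = cmod (acorr g y)"
proof -
 have g': "finite (supp (%x. cnj (g (- x))))" using finite_supp_reflect[OF g] by (auto simp: supp_def)
 have *: "acorr g y = conv g (%x. cnj (g (- x))) y" by (simp add: acorr_conv[OF g] conv_commute[OF g' g])
 have "acorr g y = (\<Sum>z\<in>supp g. g z * cnj (g (z - y)))" by (simp add: * conv_def)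
 moreover have "cnj (acorr g (- y)) = (\<Sum>z\<in>supp g. g z * cnj (g (z - y)))" by (simp add: acorr_def)
 ultimately have "cnj (acorr g (- y)) = acorr g y" by simp
 then show ?thesis by (metis complex_mod_cnj)
qed

text \<open>Convolve with the indicator of \<open>{0..<H}\<close>.\<close>

lemma van_der_corput:
 assumes z: "supp z \<subseteq> {A<..A + int n}" and H: "0 < H"
 shows "(cmod (ft z 0))\<^sup>2 <= (real n + real H) / real H * (\<Sum>h\<in>{- int H<..<int H}. cmod (acorr z h))"
proof -
 define b :: "int => complex" where "b = (%x. if 0 <= x & x < int H then 1 else 0)"
 have sb: "supp b = {0..<int H}" by (auto simp: supp_def b_def)
 have fz: "finite (supp z)" using z finite_subset by blast
 have fb: "finite (supp b)" by (simp add: sb)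
 have sc: "supp (conv b z) \<subseteq> {A<..<A + int n + int H}" using supp_conv[OF fb fz] z by (force simp: sb)
 have ftb: "ft b 0 = of_nat H" unfolding ft_def sb by (simp add: b_def)
 have "(\<Sum>x\<in>{A<..<A + int n + int H}. cmod (conv b z x))\<^sup>2 <=
   real (card {A<..<A + int n + int H}) * (\<Sum>x\<in>{A<..<A + int n + int H}. (cmod (conv b z x))\<^sup>2)"
  using Cauchy_Schwarz_ineq_sum[of "%_. 1" "%x. cmod (conv b z x)" "{A<..<A + int n + int H}"] by simp
 also have "... <= (real n + real H) * (\<Sum>x\<in>{A<..<A + int n + int H}. (cmod (conv b z x))\<^sup>2)"
  by (intro mult_right_mono sum_nonneg) auto
 also have "(\<Sum>x\<in>{A<..<A + int n + int H}. (cmod (conv b z x))\<^sup>2) = (ell2_norm (conv b z))\<^sup>2"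
  using finite_supp_ell2(2)[OF _ sc] by simp
 finally have 1: "(\<Sum>x\<in>{A<..<A + int n + int H}. cmod (conv b z x))\<^sup>2 <= (real n + real H) * (ell2_norm (conv b z))\<^sup>2" .
 have "real H * cmod (ft z 0) = cmod (ft (conv b z) 0)" by (simp add: ft_conv fb fz ftb norm_mult)
 also have "... <= (\<Sum>x\<in>{A<..<A + int n + int H}. cmod (conv b z x))"
  unfolding ft_eq[OF _ sc, OF finite_greaterThanLessThan_int] by (rule order_trans[OF norm_sum]) (simp add: norm_mult)
 finally have "(real H * cmod (ft z 0))\<^sup>2 <= (\<Sum>x\<in>{A<..<A + int n + int H}. cmod (conv b z x))\<^sup>2"
  by (intro power_mono) auto
 with 1 have 2: "(real H)\<^sup>2 * (cmod (ft z 0))\<^sup>2 <= (real n + real H) * (ell2_norm (conv b z))\<^sup>2"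
  by (simp add: power_mult_distrib)
 have sa: "supp (acorr b) \<subseteq> {- int H<..<int H}"
 proof
  fix x assume "x \<in> supp (acorr b)"
  then have "(\<Sum>y\<in>supp b. cnj (b y) * b (y + x)) ~= 0" by (simp add: supp_def acorr_def)
  then obtain y where "y \<in> supp b" "cnj (b y) * b (y + x) ~= 0" by (meson sum.neutral)
  then show "x \<in> {- int H<..<int H}" by (auto simp: b_def split: if_splits)
 qed
 have "(ell2_norm (conv b z))\<^sup>2 <= (\<Sum>x\<in>{- int H<..<int H}. cmod (acorr b x) * cmod (acorr z x))"
  by (rule ell2_norm_conv_acorr[OF fb fz _ sa]) simp
 also have "... <= (\<Sum>x\<in>{- int H<..<int H}. real H * cmod (acorr z x))"
 proof (intro sum_mono mult_right_mono)
  fix x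
  have "cmod (acorr b x) <= (\<Sum>y\<in>supp b. 1)"
   unfolding acorr_def by (rule order_trans[OF norm_sum], rule sum_mono) (auto simp: b_def)
  then show "cmod (acorr b x) <= real H" by (simp add: sb)
 qed auto
 finally have "(ell2_norm (conv b z))\<^sup>2 <= real H * (\<Sum>x\<in>{- int H<..<int H}. cmod (acorr z x))"
  by (simp add: sum_distrib_left)
 with 2 have "(real H)\<^sup>2 * (cmod (ft z 0))\<^sup>2
   <= (real n + real H) * (real H * (\<Sum>x\<in>{- int H<..<int H}. cmod (acorr z x)))"
  by (meson mult_left_mono add_nonneg_nonneg of_nat_0_le_iff order_trans)
 then have "real H * (real H * (cmod (ft z 0))\<^sup>2)
   <= real H * ((real n + real H) * (\<Sum>x\<in>{- int H<..<int H}. cmod (acorr z x)))"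
  by (simp only: power2_eq_square mult_ac)
 then have "real H * (cmod (ft z 0))\<^sup>2 <= (real n + real H) * (\<Sum>x\<in>{- int H<..<int H}. cmod (acorr z x))"
  using H by (simp only: mult_le_cancel_left_pos of_nat_0_less_iff)
 then show ?thesis using H by (simp add: pos_le_divide_eq mult.commute)
qed

text \<open>The shift 0 costs at most n, and the shifts h and - h contribute equally; what remains
  are correlations at positive shifts below H.\<close>

lemma van_der_corput_unimodular:
 assumes z: "supp z \<subseteq> {A<..A + int n}" and z1: "!!x. cmod (z x) <= 1" and H: "0 < H"
  and b: "!!h. 0 < h ==> h < H ==> cmod (acorr z (int h)) <= b h"
 shows "(cmod (ft z 0))\<^sup>2 <= (real n + real H) / real H * (real n + 2 * (\<Sum>h=1..<H. b h))"
proof -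
 have fz: "finite (supp z)" using z finite_subset by blast
 have z0: "cmod (acorr z 0) <= real n"
 proof -
  have "cmod (acorr z 0) <= (\<Sum>y\<in>supp z. 1)" unfolding acorr_def
  proof (rule order_trans[OF norm_sum], rule sum_mono)
   fix y
   show "cmod (cnj (z y) * z (y + 0)) <= 1" using mult_mono[OF z1[of y] z1[of y]] by (simp add: norm_mult)
  qed
  also have "... <= real (card {A<..A + int n})" using card_mono[OF _ z] by simp
  finally show ?thesis by simp
 qed
 have dec: "{- int H<..<int H} = {0} \<union> ((%h. int h) ` {1..<H} \<union> (%h. - int h) ` {1..<H})"
 proof (intro equalityI subsetI)
  fix x assume x: "x \<in> {- int H<..<int H}"
  consider "x = 0" | "x = int (nat x)" "nat x \<in> {1..<H}" | "x = - int (nat (- x))" "nat (- x) \<in> {1..<H}"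
   using x by (cases "x = 0"; cases "x > 0") (simp_all, linarith+)
  then show "x \<in> {0} \<union> ((%h. int h) ` {1..<H} \<union> (%h. - int h) ` {1..<H})" by cases blast+
 qed (use H in auto)
 have "(\<Sum>h\<in>{- int H<..<int H}. cmod (acorr z h)) =
   cmod (acorr z 0) + ((\<Sum>h\<in>(%h. int h) ` {1..<H}. cmod (acorr z h)) + (\<Sum>h\<in>(%h. - int h) ` {1..<H}. cmod (acorr z h)))"
 proof -
  have d: "(%h. int h) ` {1..<H} \<inter> (%h. - int h) ` {1..<H} = {}"
   "{0} \<inter> ((%h. int h) ` {1..<H} \<union> (%h. - int h) ` {1..<H}) = {}" by auto
  show ?thesis unfolding dec using d by (simp only: sum.union_disjoint finite_UnI finite_imageI finite_atLeastLessThan finite.intros) simp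
 qed
 also have "... = cmod (acorr z 0) + 2 * (\<Sum>h=1..<H. cmod (acorr z (int h)))"
  by (subst sum.reindex, simp add: inj_on_def, subst sum.reindex, simp add: inj_on_def)
    (simp add: cmod_acorr_minus[OF fz])
 also have "... <= real n + 2 * (\<Sum>h=1..<H. b h)" using z0 b by (intro add_mono mult_left_mono sum_mono) auto
 finally have "(\<Sum>h\<in>{- int H<..<int H}. cmod (acorr z h)) <= real n + 2 * (\<Sum>h=1..<H. b h)" .
 then show ?thesis
  using van_der_corput[OF z H] H by (meson mult_left_mono divide_nonneg_nonneg add_nonneg_nonneg of_nat_0_le_iff order_trans)
qed

text \<open>A power in place of the logarithm is good enough: H will be about Y powr (2/5), and only
  some fixed power has to be saved.\<close>

lemma sum_inverse_le_sqrt: "(\<Sum>h=1..<H. 1 / real h) <= 3 * sqrt (real H)"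
proof (induction H)
 case (Suc H)
 show ?case
 proof (cases "H = 0")
  case False
  have s: "1 / real H <= 3 * (sqrt (real (Suc H)) - sqrt (real H))"
  proof -
   have p: "0 < sqrt (real H)" "sqrt (real H) <= sqrt (real (Suc H))" using False by auto
   have "(sqrt (real (Suc H)) - sqrt (real H)) * (sqrt (real (Suc H)) + sqrt (real H)) = 1" by (simp add: algebra_simps)
   then have e: "sqrt (real (Suc H)) - sqrt (real H) = 1 / (sqrt (real (Suc H)) + sqrt (real H))"
    using p by (subst eq_divide_eq) auto
   have "sqrt (real (Suc H)) <= 3 / 2 * real H"
   proof (rule real_le_lsqrt)
    have "1 <= real H" using False by simp
    then have "1 * real H <= real H * real H" by (intro mult_right_mono) auto
    then have "9 * real H <= 9 * (real H * real H)" by simp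
    moreover have "4 * (1 + real H) <= 9 * real H" using \<open>1 <= real H\<close> by simp
    ultimately have "4 * (1 + real H) <= 9 * (real H * real H)" by (rule order_trans[rotated])
    then show "real (Suc H) <= (3 / 2 * real H)\<^sup>2" by (simp add: power2_eq_square field_simps)
   qed auto
   then have "sqrt (real (Suc H)) + sqrt (real H) <= 3 * real H" using p by linarith
   then have "1 / (3 * real H) <= sqrt (real (Suc H)) - sqrt (real H)"
    unfolding e using p by (intro divide_left_mono) (auto intro!: mult_pos_pos add_pos_pos simp: False)
   then show ?thesis using False by (simp add: field_simps)
  qed
  have "(\<Sum>h=1..<Suc H. 1 / real h) = (\<Sum>h=1..<H. 1 / real h) + 1 / real H"
   using False by (simp add: sum.atLeastLessThan_Suc)
  then show ?thesis using Suc s by simp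
 qed simp
qed simp

section \<open>Exponential sums with phase x powr b\<close>

lemma powr_difference_bounds:
 fixes b x h :: real
 assumes b: "0 < b" "b < 1" and x: "0 < x" and h: "0 < h"
 defines "q \<equiv> %x. (x + 1) powr b - x powr b"
 shows "h * (b * (1 - b) * (x + h + 1) powr (b - 2)) <= q x - q (x + h)"
  and "q x - q (x + h) <= h * (b * (1 - b) * x powr (b - 2))"
proof -
 have "\<exists>z>x. z < x + h & q (x + h) - q x = (x + h - x) * (b * ((z + 1) powr (b - 1) - z powr (b - 1)))"
 proof (rule MVT2)
  fix t assume "x <= t" "t <= x + h"
  then show "(q has_real_derivative (b * ((t + 1) powr (b - 1) - t powr (b - 1)))) (at t)"
   unfolding q_def using x by (auto intro!: derivative_eq_intros simp: algebra_simps)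
 qed (use h in auto)
 then obtain z where z: "x < z" "z < x + h"
  "q (x + h) - q x = h * (b * ((z + 1) powr (b - 1) - z powr (b - 1)))" by auto
 have "\<exists>w>z. w < z + 1 & (z + 1) powr (b - 1) - z powr (b - 1) = (z + 1 - z) * ((b - 1) * w powr (b - 2))"
 proof (rule MVT2)
  fix t assume "z <= t" "t <= z + 1"
  moreover have "b - 1 - 1 = b - 2" by simp
  ultimately show "((%t. t powr (b - 1)) has_real_derivative ((b - 1) * t powr (b - 2))) (at t)"
   using x z by (auto intro!: derivative_eq_intros)
 qed auto
 then obtain w where w: "z < w" "w < z + 1" "(z + 1) powr (b - 1) - z powr (b - 1) = (b - 1) * w powr (b - 2)" by auto
 have e: "q x - q (x + h) = h * (b * (1 - b) * w powr (b - 2))" using z(3)[unfolded w(3)] by (simp add: algebra_simps)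
 have "(x + h + 1) powr (b - 2) <= w powr (b - 2)" "w powr (b - 2) <= x powr (b - 2)"
  using w z x b by (auto intro!: powr_mono2')
 then show "h * (b * (1 - b) * (x + h + 1) powr (b - 2)) <= q x - q (x + h)"
  "q x - q (x + h) <= h * (b * (1 - b) * x powr (b - 2))" unfolding e using b h by (auto intro!: mult_left_mono)
qed

text \<open>The third differences of x powr b have a sign. Together with the size of the second
  differences in \<open>powr_difference_bounds\<close> this supplies the hypotheses of
  \<open>kusmin_landau\<close> for the differenced phase.\<close>

lemma powr_difference_mono:
 fixes b x h :: real
 assumes b: "0 < b" "b < 1" and x: "0 < x" and h: "0 < h"
 defines "q \<equiv> %x. (x + 1) powr b - x powr b"
 shows "q (x + 1) - q (x + 1 + h) <= q x - q (x + h)"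
proof -
 define r where "r = (%t::real. t powr (b - 1) - (t + 1) powr (b - 1))"
 have r: "r (t + h) <= r t" if "0 < t" for t
 proof (rule DERIV_nonpos_imp_nonincreasing[of t "t + h" r])
  fix u assume u: "t <= u" "u <= t + h"
  have "(r has_real_derivative ((b - 1) * (u powr (b - 2) - (u + 1) powr (b - 2)))) (at u)"
  proof -
   have "b - 1 - 1 = b - 2" by simp
   then show ?thesis unfolding r_def using that u by (auto intro!: derivative_eq_intros simp: algebra_simps)
  qed
  moreover have "(u + 1) powr (b - 2) <= u powr (b - 2)" using u that b by (intro powr_mono2') auto
  then have "(b - 1) * (u powr (b - 2) - (u + 1) powr (b - 2)) <= 0" using b by (intro mult_nonpos_nonneg) auto
  ultimately show "\<exists>y. (r has_real_derivative y) (at u) & y <= 0" by blast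
 qed (use h in auto)
 have "(%t. q t - q (t + h)) (x + 1) <= (%t. q t - q (t + h)) x"
 proof (rule DERIV_nonpos_imp_nonincreasing[of x "x + 1" "%t. q t - q (t + h)"])
  fix u assume u: "x <= u" "u <= x + 1"
  have "((%t. q t - q (t + h)) has_real_derivative (b * (r (u + h) - r u))) (at u)" unfolding q_def r_def using x u h
   by (auto intro!: derivative_eq_intros simp: algebra_simps)
  moreover have "b * (r (u + h) - r u) <= 0" using r[of u] x u b by (intro mult_nonneg_nonpos) auto
  ultimately show "\<exists>y. ((%t. q t - q (t + h)) has_real_derivative y) (at u) & y <= 0" by blast
 qed simp
 then show ?thesis by (simp add: algebra_simps)
qed

text \<open>Differencing turns the linear phase \<xi> * x into a constant, which makes the bound
  uniform in \<xi>. The differenced phase has monotone increments, bounded below by l through the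
  second differences and above by pi because c * H <= pi * A, so Kusmin--Landau applies at every
  shift; 120 = 2 * 20 * 3.\<close>

lemma exp_sum_powr_pos:
 fixes b c \<xi> :: real
 assumes b: "0 < b" "b < 1" and c: "0 < c" and A: "0 < A" and H: "0 < H" and cH: "c * real H <= pi * real A"
 shows "(cmod (\<Sum>x\<in>{int A<..int A + int n}. cis (c * of_int x powr b + \<xi> * of_int x)))\<^sup>2
   <= (real n + real H) / real H *
    (real n + 120 * (real (A + n) powr (2 - b) / (c * (b * (1 - b)))) * sqrt (real H))"
proof -
 define f where "f = (%x::int. c * of_int x powr b + \<xi> * of_int x)"
 define z where "z = (%x. if x \<in> {int A<..int A + int n} then cis (f x) else 0)"
 define K where "K = real (A + n) powr (2 - b) / (c * (b * (1 - b)))"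
 have sz: "supp z = {int A<..int A + int n}" by (auto simp: supp_def z_def)
 have ac: "cmod (acorr z (int h)) <= 20 * K / real h" if h: "0 < h" "h < H" for h
 proof -
  \<comment> \<open>The minus sign makes the increments positive, since x powr b is concave.\<close>
  define g where "g = (%i. - (f (int A + 1 + int i + int h) - f (int A + 1 + int i)))"
  define l where "l = c * (real h * (b * (1 - b) * real (A + n) powr (b - 2)))"
  have y: "0 < real (A + n)" using A by simp
  have l0: "0 < l" unfolding l_def using b c h y by (intro mult_pos_pos) auto
  have bb: "b * (1 - b) <= 1" using b mult_mono[of b 1 "1 - b" 1] by simp
  have up: "c * (real h * (b * (1 - b) * t powr (b - 2))) <= pi" if t: "real A <= t" for t
  proof -
   have t1: "1 <= t" using t A by linarith
   have "t powr (b - 2) <= t powr (- 1)" using t1 b by (intro powr_mono) auto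
   also have "... = 1 / t" using t1 by (simp add: powr_minus field_simps)
   also have "... <= 1 / real A" using t A by (intro divide_left_mono) auto
   finally have "t powr (b - 2) <= 1 / real A" .
   then have "b * (1 - b) * t powr (b - 2) <= 1 * (1 / real A)" using bb b by (intro mult_mono) auto
   then have "c * (real h * (b * (1 - b) * t powr (b - 2))) <= c * (real H * (1 / real A))"
    using h c b by (intro mult_left_mono mult_mono) auto
   also have "... <= pi" using cH A by (simp add: field_simps)
   finally show ?thesis .
  qed
  have l4: "l <= 4" using up[of "real (A + n)"] pi_approx unfolding l_def by simp
  have eq: "acorr z (int h) = (\<Sum>i<n - h. cis (- g i))"
  proof -
   have "acorr z (int h) = (\<Sum>x\<in>{int A<..int A + int n}. cnj (z x) * z (x + int h))" by (simp add: acorr_def sz)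
   also have "... = (\<Sum>x\<in>{int A<..int A + int n - int h}. cnj (z x) * z (x + int h))"
    by (rule sum.mono_neutral_right) (auto simp: z_def)
   also have "... = (\<Sum>i<n - h. cis (- g i))"
   proof (rule sum.reindex_bij_witness[where i = "%i. int A + 1 + int i" and j = "%x. nat (x - int A - 1)"])
    fix x assume x: "x \<in> {int A<..int A + int n - int h}"
    have e: "int A + 1 + int (nat (x - int A - 1)) = x" using x by auto
    show "int A + 1 + int (nat (x - int A - 1)) = x" by (rule e)
    show "nat (x - int A - 1) \<in> {..<n - h}" using x by auto
    have "z x = cis (f x)" "z (x + int h) = cis (f (x + int h))" using x by (auto simp: z_def)
    then show "cis (- g (nat (x - int A - 1))) = cnj (z x) * z (x + int h)"
     unfolding g_def e by (simp add: cis_cnj cis_mult)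
   qed auto
   finally show ?thesis .
  qed
  have gd: "g (Suc i) - g i = c * (((of_int (int A + 1 + int i) + 1) powr b - of_int (int A + 1 + int i) powr b)
    - ((of_int (int A + 1 + int i) + real h + 1) powr b - (of_int (int A + 1 + int i) + real h) powr b))" for i
   unfolding g_def f_def by (simp add: algebra_simps)
  have "cmod (\<Sum>i<n - h. cis (g i)) <= 20 / l"
  proof (rule kusmin_landau[OF l0 _ _ l4])
   fix i assume i: "Suc i < n - h"
   let ?x = "real_of_int (int A + 1 + int i)"
   have x: "0 < ?x" "real A <= ?x" "?x + real h + 1 <= real (A + n)" using i h by auto
   note P = powr_difference_bounds[OF b x(1), of "real h"]
   have "real (A + n) powr (b - 2) <= (?x + real h + 1) powr (b - 2)" using x b by (intro powr_mono2') auto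
   then have "l <= c * (real h * (b * (1 - b) * (?x + real h + 1) powr (b - 2)))"
    unfolding l_def using b c h by (intro mult_left_mono) auto
   also have "... <= g (Suc i) - g i" unfolding gd using P(1) h c by (intro mult_left_mono) auto
   finally have 1: "l <= g (Suc i) - g i" .
   have "g (Suc i) - g i <= c * (real h * (b * (1 - b) * ?x powr (b - 2)))"
    unfolding gd using P(2) h c by (intro mult_left_mono) auto
   also have "... <= pi" by (rule up[OF x(2)])
   finally show "l <= g (Suc i) - g i & g (Suc i) - g i <= pi" using 1 by simp
  next
   fix i assume i: "Suc (Suc i) < n - h"
   let ?x = "real_of_int (int A + 1 + int i)"
   have s: "real_of_int (int A + 1 + int (Suc i)) = ?x + 1" by simp
   show "g (Suc (Suc i)) - g (Suc i) <= g (Suc i) - g i" unfolding gd[of "Suc i"] gd[of i] s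
    using powr_difference_mono[OF b, of ?x "real h"] h A c by (intro mult_left_mono) (auto simp: add_ac)
  qed
  moreover have "cmod (\<Sum>i<n - h. cis (- g i)) = cmod (\<Sum>i<n - h. cis (g i))"
   by (subst complex_mod_cnj[symmetric]) (simp add: cis_cnj)
  moreover have "20 / l = 20 * K / real h"
  proof -
   have "real (A + n) powr (b - 2) = 1 / real (A + n) powr (2 - b)"
    using powr_minus_divide[of "real (A + n)" "2 - b"] by simp
   then show ?thesis unfolding l_def K_def using h c b by (simp add: field_simps)
  qed
  ultimately show ?thesis by (simp add: eq)
 qed
 have "(cmod (ft z 0))\<^sup>2 <= (real n + real H) / real H * (real n + 2 * (\<Sum>h=1..<H. 20 * K / real h))"
  by (rule van_der_corput_unimodular[OF sz[THEN equalityD1] _ H ac]) (auto simp: z_def)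
 also have "... <= (real n + real H) / real H * (real n + 120 * K * sqrt (real H))"
 proof (rule mult_left_mono)
  have K0: "0 <= K" unfolding K_def using b c by auto
  have "(\<Sum>h=1..<H. 20 * K / real h) = 20 * K * (\<Sum>h=1..<H. 1 / real h)" by (simp add: sum_distrib_left)
  also have "... <= 20 * K * (3 * sqrt (real H))" using K0 by (intro mult_left_mono sum_inverse_le_sqrt) auto
  finally show "real n + 2 * (\<Sum>h=1..<H. 20 * K / real h) <= real n + 120 * K * sqrt (real H)" by simp
 qed auto
 finally show ?thesis unfolding ft_def sz K_def by (simp add: z_def f_def)
qed

lemma exp_sum_powr:
 fixes b c \<xi> :: real
 assumes b: "0 < b" "b < 1" and c: "1 <= \<bar>c\<bar>" and A: "0 < A" and H: "0 < H" and cH: "\<bar>c\<bar> * real H <= pi * real A"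
 shows "(cmod (\<Sum>x\<in>{int A<..int A + int n}. cis (c * of_int x powr b + \<xi> * of_int x)))\<^sup>2
   <= (real n + real H) / real H *
    (real n + 120 * (real (A + n) powr (2 - b) / (b * (1 - b))) * sqrt (real H))"
proof -
 let ?S = "%c \<xi>. cmod (\<Sum>x\<in>{int A<..int A + int n}. cis (c * of_int x powr b + \<xi> * of_int x))"
 have "?S c \<xi> = ?S \<bar>c\<bar> (if c < 0 then - \<xi> else \<xi>)"
 proof (cases "c < 0")
  case True
  have "?S c \<xi> = cmod (cnj (\<Sum>x\<in>{int A<..int A + int n}. cis (c * of_int x powr b + \<xi> * of_int x)))"
   by (simp only: complex_mod_cnj)
  then show ?thesis using True by (simp add: cis_cnj)
 qed auto
 then have "(?S c \<xi>)\<^sup>2 <= (real n + real H) / real H *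
    (real n + 120 * (real (A + n) powr (2 - b) / (\<bar>c\<bar> * (b * (1 - b)))) * sqrt (real H))"
  using exp_sum_powr_pos[OF b _ A H cH] c by auto
 also have "... <= (real n + real H) / real H *
    (real n + 120 * (real (A + n) powr (2 - b) / (b * (1 - b))) * sqrt (real H))"
 proof -
  have "1 * (b * (1 - b)) <= \<bar>c\<bar> * (b * (1 - b))" using c b by (intro mult_right_mono) auto
  then have "real (A + n) powr (2 - b) / (\<bar>c\<bar> * (b * (1 - b))) <= real (A + n) powr (2 - b) / (b * (1 - b))"
   using b c by (intro divide_left_mono) (auto intro!: mult_pos_pos)
  then show ?thesis by (intro mult_left_mono add_left_mono mult_right_mono) auto
 qed
 finally show ?thesis .
qed

section \<open>Fejer kernels and the fractional part\<close>

definition fejer :: "nat => real => real" where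
 "fejer M w = (cmod (\<Sum>i<M. cis (2 * pi * real i * w)))\<^sup>2 / real M"

lemma fejer_nonneg: "0 <= fejer M w" by (simp add: fejer_def)

lemma fejer_expand:
 "complex_of_real (fejer M w) = (\<Sum>i<M. \<Sum>k<M. cis (2 * pi * of_int (int i - int k) * w)) / of_nat M"
proof -
 have "complex_of_real ((cmod (\<Sum>i<M. cis (2 * pi * real i * w)))\<^sup>2)
   = (\<Sum>i<M. cis (2 * pi * real i * w)) * cnj (\<Sum>i<M. cis (2 * pi * real i * w))"
  by (simp only: complex_norm_square)
 also have "... = (\<Sum>i<M. \<Sum>k<M. cis (2 * pi * real i * w) * cis (- (2 * pi * real k * w)))"
  by (simp add: sum_product cis_cnj)
 also have "... = (\<Sum>i<M. \<Sum>k<M. cis (2 * pi * of_int (int i - int k) * w))"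
  by (intro sum.cong refl) (simp add: cis_mult algebra_simps)
 finally show ?thesis unfolding fejer_def by simp
qed

lemma fejer_periodic: "fejer M (w + of_int k) = fejer M w"
proof -
 have "cis (2 * pi * real i * (w + of_int k)) = cis (2 * pi * real i * w)" for i
 proof -
  have "2 * pi * real i * (w + of_int k) = 2 * pi * real i * w + 2 * pi * of_int (int i * k)"
   by (simp add: algebra_simps)
  then show ?thesis by (simp add: cis_mult[symmetric] cis_multiple_2pi del: of_int_mult)
 qed
 then show ?thesis by (simp add: fejer_def)
qed

text \<open>A trigonometric polynomial of degree below M is integrated exactly by M equally spaced
  nodes, and the kernel has mean 1.\<close>

lemma fejer_average:
 assumes "0 < M"
 shows "(\<Sum>q<M. fejer M (v - real q / real M)) = real M"
proof -
 have "complex_of_real (\<Sum>q<M. fejer M (v - real q / real M))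
   = (\<Sum>q<M. (\<Sum>i<M. \<Sum>k<M. cis (2 * pi * of_int (int i - int k) * (v - real q / real M))) / of_nat M)"
  by (simp add: fejer_expand)
 also have "... = (\<Sum>i<M. \<Sum>k<M. \<Sum>q<M. cis (2 * pi * of_int (int i - int k) * (v - real q / real M))) / of_nat M"
  unfolding sum_divide_distrib[symmetric]
  by (rule arg_cong2[where f = "(/)"], rule trans[OF sum.swap], rule sum.cong[OF refl], rule sum.swap, rule refl)
 also have "... = (\<Sum>i<M. \<Sum>k<M. if k = i then of_nat M else 0) / of_nat M"
 proof -
  have "(\<Sum>q<M. cis (2 * pi * of_int (int i - int k) * (v - real q / real M))) = (if k = i then of_nat M else 0)"
   if "i < M" "k < M" for i k
  proof -
   have "cis (2 * pi * of_int (int i - int k) * (v - real q / real M))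
     = cis (2 * pi * of_int (int i - int k) * v) * cis (2 * pi * real q / real M * of_int (int k - int i))" for q
    unfolding cis_mult using assms by (intro arg_cong[where f = cis]) (simp add: field_simps)
   then have "(\<Sum>q<M. cis (2 * pi * of_int (int i - int k) * (v - real q / real M)))
     = cis (2 * pi * of_int (int i - int k) * v) * (\<Sum>q<M. cis (2 * pi * real q / real M * of_int (int k - int i)))"
    by (simp only: sum_distrib_left)
   also have "(\<Sum>q<M. cis (2 * pi * real q / real M * of_int (int k - int i))) = (if int k - int i = 0 then of_nat M else 0)"
    using that by (intro sum_cis_roots) auto
   finally show ?thesis by auto
  qed
  then show ?thesis by simp
 qed
 also have "... = complex_of_real (real M)" using assms by simp
 finally show ?thesis by (simp only: of_real_eq_iff)
qed

lemma fejer_upper: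
 assumes D: "0 < D" and M: "0 < M" and w: "1 / (6 * real D) <= \<bar>w\<bar>" "\<bar>w\<bar> <= 1 - 1 / (6 * real D)"
 shows "fejer M w <= 36 * (real D)\<^sup>2 / real M"
proof -
 let ?z = "cis (2 * pi * w)"
 have "pi * (1 / (6 * real D)) / 2 <= \<bar>sin (pi * w)\<bar>"
 proof (cases "\<bar>w\<bar> <= 1 / 2")
  case True
  have "pi * \<bar>w\<bar> / 2 <= sin (pi * \<bar>w\<bar>)" using True by (intro sin_ge_half) auto
  moreover have "\<bar>sin (pi * w)\<bar> = \<bar>sin (pi * \<bar>w\<bar>)\<bar>" by (cases "w \<ge> 0") auto
  moreover have "pi * (1 / (6 * real D)) / 2 <= pi * \<bar>w\<bar> / 2"
   using w by (intro divide_right_mono mult_left_mono) auto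
  ultimately show ?thesis using abs_ge_self[of "sin (pi * \<bar>w\<bar>)"] by (metis order_trans)
 next
  case False
  have h: "pi * (1 - \<bar>w\<bar>) / 2 <= sin (pi * (1 - \<bar>w\<bar>))"
  proof (rule sin_ge_half)
   have "1 / (6 * real D) \<ge> 0" by simp
   then have "0 <= 1 - \<bar>w\<bar>" using w(2) by linarith
   then show "0 <= pi * (1 - \<bar>w\<bar>)" by simp
   have "pi * (1 - \<bar>w\<bar>) <= pi * (1 / 2)" using False by (intro mult_left_mono) auto
   then show "pi * (1 - \<bar>w\<bar>) <= pi / 2" by simp
  qed
  have "sin (pi * (1 - \<bar>w\<bar>)) = sin (pi * \<bar>w\<bar>)"
   using sin_pi_minus[of "pi * \<bar>w\<bar>"] by (simp add: algebra_simps)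
  moreover have "\<bar>sin (pi * w)\<bar> = \<bar>sin (pi * \<bar>w\<bar>)\<bar>" by (cases "w \<ge> 0") auto
  moreover have "pi * (1 / (6 * real D)) / 2 <= pi * (1 - \<bar>w\<bar>) / 2"
   using w(2) by (intro divide_right_mono mult_left_mono) (linarith, simp_all)
  ultimately show ?thesis using h abs_ge_self[of "sin (pi * \<bar>w\<bar>)"] by (metis order_trans)
 qed
 moreover have "1 / (3 * real D) <= pi * (1 / (6 * real D))"
 proof -
  have "2 * (1 / (6 * real D)) <= pi * (1 / (6 * real D))" using pi_ge_two by (intro mult_right_mono) auto
  then show ?thesis by simp
 qed
 ultimately have zl: "1 / (3 * real D) <= cmod (?z - 1)" using cmod_cis_minus_1[of "2 * pi * w"] by (simp only:) simp
 then have z1: "?z ~= 1" using D by auto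
 have "(\<Sum>i<M. cis (2 * pi * real i * w)) = (\<Sum>i<M. ?z ^ i)"
  by (intro sum.cong refl) (simp add: Complex.DeMoivre algebra_simps)
 also have "... = (?z ^ M - 1) / (?z - 1)" by (rule geometric_sum[OF z1])
 finally have "cmod (\<Sum>i<M. cis (2 * pi * real i * w)) = cmod (?z ^ M - 1) / cmod (?z - 1)"
  by (simp add: norm_divide)
 also have "... <= 2 / (1 / (3 * real D))"
 proof (rule frac_le)
  show "cmod (?z ^ M - 1) <= 2" unfolding Complex.DeMoivre by (rule cmod_cis_minus_1_le_2)
 qed (use zl D in auto)
 finally have "(cmod (\<Sum>i<M. cis (2 * pi * real i * w)))\<^sup>2 <= (6 * real D)\<^sup>2" by (intro power_mono) auto
 then show ?thesis unfolding fejer_def using M by (intro divide_right_mono) (auto simp: power2_eq_square)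
qed

text \<open>In this range all phases 2 * pi * i * w with i < D stay within pi / 3, where the cosine
  is at least 1/2. This is the origin of the threshold 1 / (6 * D).\<close>

lemma fejer_lower:
 assumes D: "0 < D" and w: "\<bar>w\<bar> <= 1 / (6 * real D)"
 shows "real D / 4 <= fejer D w"
proof -
 have c: "1 / 2 <= cos (2 * pi * real i * w)" if "i < D" for i
 proof -
  have "\<bar>2 * pi * real i * w\<bar> = 2 * pi * (real i * \<bar>w\<bar>)" by (simp add: abs_mult)
  also have "... <= 2 * pi * (real D * (1 / (6 * real D)))" using w that by (intro mult_left_mono mult_mono) auto
  also have "... = pi / 3" using D by simp
  finally have "cos (pi / 3) <= cos \<bar>2 * pi * real i * w\<bar>" by (intro cos_monotone_0_pi_le) auto
  then show ?thesis by (simp add: cos_60)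
 qed
 have "(\<Sum>i<D. 1 / 2) <= (\<Sum>i<D. cos (2 * pi * real i * w))" using c by (intro sum_mono) auto
 also have "... = Re (\<Sum>i<D. cis (2 * pi * real i * w))" by simp
 also have "... <= cmod (\<Sum>i<D. cis (2 * pi * real i * w))" by (rule complex_Re_le_cmod)
 finally have "(real D / 2)\<^sup>2 <= (cmod (\<Sum>i<D. cis (2 * pi * real i * w)))\<^sup>2" by (intro power_mono) auto
 then have "(real D / 2)\<^sup>2 / real D <= fejer D w" unfolding fejer_def by (intro divide_right_mono) auto
 then show ?thesis using D by (simp add: power2_eq_square)
qed

text \<open>The fractional part is compared with its average against a Fejer kernel over J nodes.
  Away from the jump, each node farther than 1 / (6 * D) carries weight at most 36 * D^2 / J; after
  division by J the J nodes contribute 36 * D^2 / J, which is 36 / D for J = D^3. Within 1 / (6 * D)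
  of an integer the trivial error 1 is at most 4 / D * \<open>fejer D v\<close> by
  \<open>fejer_lower\<close>; this majorant is again a trigonometric polynomial of mean 1 up to the
  factor 4 / D, hence cheap to sum.\<close>

lemma frac_fejer_approx:
 assumes D: "0 < D"
 defines "J \<equiv> D ^ 3"
 shows "\<bar>frac v - (\<Sum>q<J. real q / real J * fejer J (v - real q / real J)) / real J\<bar>
   <= 37 / real D + 4 / real D * fejer D v"
proof -
 have J: "0 < J" unfolding J_def using D by simp
 have avg: "(\<Sum>q<J. fejer J (v - real q / real J)) = real J" by (rule fejer_average[OF J])
 have per: "fejer K (v - p) = fejer K (frac v - p)" for K p
  using fejer_periodic[of K "frac v - p" "\<lfloor>v\<rfloor>"] by (simp add: frac_def)
 have "frac v - (\<Sum>q<J. real q / real J * fejer J (v - real q / real J)) / real J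
   = (\<Sum>q<J. (frac v - real q / real J) * fejer J (v - real q / real J)) / real J"
 proof -
  have "(\<Sum>q<J. (frac v - real q / real J) * fejer J (v - real q / real J))
   = frac v * (\<Sum>q<J. fejer J (v - real q / real J)) - (\<Sum>q<J. real q / real J * fejer J (v - real q / real J))"
   by (simp add: left_diff_distrib sum_subtractf sum_distrib_left)
  then show ?thesis using J by (simp add: avg diff_divide_distrib)
 qed
 then have e: "\<bar>frac v - (\<Sum>q<J. real q / real J * fejer J (v - real q / real J)) / real J\<bar>
   <= (\<Sum>q<J. \<bar>frac v - real q / real J\<bar> * fejer J (v - real q / real J)) / real J"
  using sum_abs[of "%q. (frac v - real q / real J) * fejer J (v - real q / real J)" "{..<J}"]
  by (simp add: abs_mult fejer_nonneg divide_right_mono)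
 have d1: "\<bar>frac v - real q / real J\<bar> <= 1" if "q < J" for q
 proof -
  have "real q / real J <= 1" using that by simp
  moreover have "0 <= real q / real J" by simp
  ultimately show ?thesis using frac_ge_0[of v] frac_lt_1[of v] by linarith
 qed
 show ?thesis
 proof (cases "1 / (6 * real D) <= frac v & frac v <= 1 - 1 / (6 * real D)")
  case True
  have "(\<Sum>q<J. \<bar>frac v - real q / real J\<bar> * fejer J (v - real q / real J))
    <= (\<Sum>q<J. 1 / (6 * real D) * fejer J (v - real q / real J) + 36 * (real D)\<^sup>2 / real J)"
  proof (rule sum_mono)
   fix q assume q: "q \<in> {..<J}"
   let ?w = "frac v - real q / real J"
   show "\<bar>?w\<bar> * fejer J (v - real q / real J) <= 1 / (6 * real D) * fejer J (v - real q / real J) + 36 * (real D)\<^sup>2 / real J"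
   proof (cases "\<bar>?w\<bar> <= 1 / (6 * real D)")
    case True
    then have "\<bar>?w\<bar> * fejer J (v - real q / real J) <= 1 / (6 * real D) * fejer J (v - real q / real J)"
     by (intro mult_right_mono fejer_nonneg)
    moreover have "0 <= 36 * (real D)\<^sup>2 / real J" by simp
    ultimately show ?thesis by linarith
   next
    case False
    have "0 <= real q / real J" "real q / real J < 1" using q by auto
    then have "\<bar>?w\<bar> <= 1 - 1 / (6 * real D)" using True by linarith
    then have "fejer J ?w <= 36 * (real D)\<^sup>2 / real J" using False by (intro fejer_upper[OF D J]) auto
    then have "\<bar>?w\<bar> * fejer J (v - real q / real J) <= 1 * (36 * (real D)\<^sup>2 / real J)"
     unfolding per using d1 q by (intro mult_mono fejer_nonneg) auto
    moreover have "0 <= 1 / (6 * real D) * fejer J (v - real q / real J)" by (simp add: fejer_nonneg)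
    ultimately show ?thesis by linarith
   qed
  qed
  also have "... = 1 / (6 * real D) * real J + 36 * (real D)\<^sup>2"
   using J by (simp only: sum.distrib sum_distrib_left[symmetric] avg) simp
  also have "... <= 37 / real D * real J"
  proof -
   have "36 * (real D)\<^sup>2 = 36 / real D * real J" using D by (simp add: J_def power3_eq_cube power2_eq_square)
   moreover have "1 / (6 * real D) * real J <= 1 / real D * real J"
    using D by (intro mult_right_mono divide_left_mono) auto
   moreover have "37 / real D * real J = 1 / real D * real J + 36 / real D * real J"
    by (simp add: add_divide_distrib[symmetric] distrib_right[symmetric])
   ultimately show ?thesis by linarith
  qed
  finally have "(\<Sum>q<J. \<bar>frac v - real q / real J\<bar> * fejer J (v - real q / real J)) / real J <= 37 / real D"
   using J by (simp add: divide_le_eq)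
  moreover have "0 <= 4 / real D * fejer D v" by (simp add: fejer_nonneg)
  ultimately show ?thesis using e by linarith
 next
  case False
  have "(\<Sum>q<J. \<bar>frac v - real q / real J\<bar> * fejer J (v - real q / real J)) <= (\<Sum>q<J. 1 * fejer J (v - real q / real J))"
   using d1 by (intro sum_mono mult_right_mono fejer_nonneg) auto
  then have "(\<Sum>q<J. \<bar>frac v - real q / real J\<bar> * fejer J (v - real q / real J)) / real J <= 1"
   using J by (simp add: avg)
  moreover have "real D / 4 <= fejer D v"
  proof (cases "frac v < 1 / (6 * real D)")
   case True
   then have "real D / 4 <= fejer D (frac v)" using frac_ge_0[of v] by (intro fejer_lower[OF D]) auto
   then show ?thesis using per[of D 0] by simp
  next
   case F2: False
   then have "real D / 4 <= fejer D (frac v - 1)"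
    using False frac_lt_1[of v] by (intro fejer_lower[OF D]) (auto simp: abs_le_iff)
   then show ?thesis using fejer_periodic[of D v "-1"] per[of D 1] by simp
  qed
  then have "1 <= 4 / real D * fejer D v" using D by (simp add: field_simps)
  moreover have "0 <= 37 / real D" by simp
  ultimately show ?thesis using e by linarith
 qed
qed

text \<open>After expansion the diagonal i = k yields the unweighted sum; fewer than M^2 further
  terms remain, and the kernel divides them by M.\<close>

lemma sum_fejer:
 fixes v :: "'a => real" and a :: "'a => complex"
 assumes M: "0 < M"
  and B: "!!j::int. j ~= 0 ==> \<bar>j\<bar> < int M ==> cmod (\<Sum>x\<in>X. a x * cis (2 * pi * of_int j * v x)) <= B"
  and B0: "0 <= B"
 shows "cmod ((\<Sum>x\<in>X. a x * of_real (fejer M (v x - p))) - (\<Sum>x\<in>X. a x)) <= real M * B"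
proof -
 let ?T = "%i k. \<Sum>x\<in>X. a x * cis (2 * pi * of_int (int i - int k) * (v x - p))"
 have "(\<Sum>x\<in>X. a x * of_real (fejer M (v x - p))) = (\<Sum>i<M. \<Sum>k<M. ?T i k) / of_nat M"
 proof -
  have "(\<Sum>x\<in>X. a x * of_real (fejer M (v x - p)))
    = (\<Sum>x\<in>X. \<Sum>i<M. \<Sum>k<M. a x * cis (2 * pi * of_int (int i - int k) * (v x - p)) / of_nat M)"
   by (simp add: fejer_expand sum_divide_distrib sum_distrib_left)
  also have "... = (\<Sum>i<M. \<Sum>k<M. \<Sum>x\<in>X. a x * cis (2 * pi * of_int (int i - int k) * (v x - p)) / of_nat M)"
   by (subst sum.swap, intro sum.cong refl, subst sum.swap, rule refl)
  finally show ?thesis by (simp only: sum_divide_distrib)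
 qed
 also have "... = ((\<Sum>x\<in>X. a x) * of_nat M + (\<Sum>i<M. \<Sum>k\<in>{..<M}-{i}. ?T i k)) / of_nat M"
 proof -
  have "(\<Sum>k<M. ?T i k) = (\<Sum>x\<in>X. a x) + (\<Sum>k\<in>{..<M}-{i}. ?T i k)" if "i < M" for i
   using that by (subst sum.remove[of _ i]) auto
  then show ?thesis by (simp add: sum.distrib mult.commute)
 qed
 finally have "(\<Sum>x\<in>X. a x * of_real (fejer M (v x - p))) - (\<Sum>x\<in>X. a x) = (\<Sum>i<M. \<Sum>k\<in>{..<M}-{i}. ?T i k) / of_nat M"
  using M by (simp add: field_simps)
 then have "cmod ((\<Sum>x\<in>X. a x * of_real (fejer M (v x - p))) - (\<Sum>x\<in>X. a x))
   = cmod (\<Sum>i<M. \<Sum>k\<in>{..<M}-{i}. ?T i k) / real M" by (simp add: norm_divide)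
 also have "... <= (\<Sum>i<M. \<Sum>k\<in>{..<M}-{i}. B) / real M"
 proof (intro divide_right_mono)
  show "cmod (\<Sum>i<M. \<Sum>k\<in>{..<M}-{i}. ?T i k) <= (\<Sum>i<M. \<Sum>k\<in>{..<M}-{i}. B)"
  proof (rule order_trans[OF norm_sum], rule sum_mono, rule order_trans[OF norm_sum], rule sum_mono)
   fix i k assume ik: "i \<in> {..<M}" "k \<in> {..<M}-{i}"
   have "?T i k = cis (- (2 * pi * of_int (int i - int k) * p)) * (\<Sum>x\<in>X. a x * cis (2 * pi * of_int (int i - int k) * v x))"
   proof -
    have "cis (2 * pi * of_int (int i - int k) * (v x - p))
     = cis (- (2 * pi * of_int (int i - int k) * p)) * cis (2 * pi * of_int (int i - int k) * v x)" for x
     unfolding cis_mult by (rule arg_cong[where f = cis]) (simp add: algebra_simps)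
    then show ?thesis by (simp only: sum_distrib_left mult_ac)
   qed
   then have "cmod (?T i k) = cmod (\<Sum>x\<in>X. a x * cis (2 * pi * of_int (int i - int k) * v x))"
    by (simp only: norm_mult norm_cis mult_1)
   also have "... <= B" using ik by (intro B) auto
   finally show "cmod (?T i k) <= B" .
  qed
 qed simp
 also have "... <= (\<Sum>i<M. \<Sum>k<M. B) / real M" using B0 by (intro divide_right_mono sum_mono sum_mono2) auto
 also have "... = real M * B" using M by simp
 finally show ?thesis .
qed

text \<open>Two trigonometric polynomials enter. The approximation of the fractional part is summed
  with the weights \<open>a\<close>, its error is dominated by \<open>fejer D\<close> and summed
  without weights; hence the two families of exponential sums. The frequencies below D of the second
  lie among those below D^3.\<close>

lemma sum_frac_bound:
 fixes v :: "'a => real" and a :: "'a => complex"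
 assumes D: "0 < D" and a: "!!x. cmod (a x) <= 1" and B0: "0 <= B"
  and B: "!!j::int. j ~= 0 ==> \<bar>j\<bar> < int (D ^ 3) ==> cmod (\<Sum>x\<in>X. a x * cis (2 * pi * of_int j * v x)) <= B"
  and B1: "!!j::int. j ~= 0 ==> \<bar>j\<bar> < int (D ^ 3) ==> cmod (\<Sum>x\<in>X. cis (2 * pi * of_int j * v x)) <= B"
 shows "cmod (\<Sum>x\<in>X. a x * of_real (frac (v x))) <= cmod (\<Sum>x\<in>X. a x) + (real D ^ 3 + 4) * B + 41 * real (card X) / real D"
proof -
 define J where "J = D ^ 3"
 have J: "0 < J" unfolding J_def using D by simp
 define \<sigma> where "\<sigma> = (%w. (\<Sum>q<J. real q / real J * fejer J (w - real q / real J)) / real J)"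
 have DJ: "int D <= int (D ^ 3)" using D by (simp add: self_le_power)
 have s1: "(\<Sum>x\<in>X. fejer D (v x)) <= real (card X) + real D * B"
 proof -
  have "cmod ((\<Sum>x\<in>X. 1 * of_real (fejer D (v x - 0))) - (\<Sum>x\<in>X. 1)) <= real D * B"
  proof (rule sum_fejer[OF D _ B0])
   fix j :: int assume "j ~= 0" "\<bar>j\<bar> < int D"
   then show "cmod (\<Sum>x\<in>X. 1 * cis (2 * pi * of_int j * v x)) <= B"
    using B1[of j] DJ by (simp del: of_nat_power)
  qed
  then have "\<bar>Re ((\<Sum>x\<in>X. 1 * of_real (fejer D (v x - 0))) - (\<Sum>x\<in>X. 1))\<bar> <= real D * B"
   using abs_Re_le_cmod order_trans by blast
  then show ?thesis by simp
 qed
 have s2: "cmod (\<Sum>x\<in>X. a x * of_real (\<sigma> (v x))) <= cmod (\<Sum>x\<in>X. a x) + real J * B"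
 proof -
  have "(\<Sum>x\<in>X. a x * of_real (\<sigma> (v x)))
   = (\<Sum>x\<in>X. \<Sum>q<J. of_real (real q / real J / real J) * (a x * of_real (fejer J (v x - real q / real J))))"
   unfolding \<sigma>_def by (simp add: sum_divide_distrib sum_distrib_left algebra_simps)
  also have "... = (\<Sum>q<J. of_real (real q / real J / real J) * (\<Sum>x\<in>X. a x * of_real (fejer J (v x - real q / real J))))"
   unfolding sum_distrib_left by (rule sum.swap)
  also have "cmod ... <= (\<Sum>q<J. 1 / real J * (cmod (\<Sum>x\<in>X. a x) + real J * B))"
  proof (intro order_trans[OF norm_sum] sum_mono)
   fix q assume q: "q \<in> {..<J}"
   have "cmod ((\<Sum>x\<in>X. a x * of_real (fejer J (v x - real q / real J))) - (\<Sum>x\<in>X. a x)) <= real J * B"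
    using B unfolding J_def[symmetric] by (intro sum_fejer[OF J _ B0]) auto
   then have 1: "cmod (\<Sum>x\<in>X. a x * of_real (fejer J (v x - real q / real J))) <= cmod (\<Sum>x\<in>X. a x) + real J * B"
    using norm_triangle_ineq2 by (smt (verit))
   have "cmod (of_real (real q / real J / real J)) <= 1 / real J"
    using q J divide_right_mono[of "real q / real J" 1 "real J"] by (simp only: norm_of_real) (simp del: divide_divide_eq_left)
   then show "cmod (of_real (real q / real J / real J) * (\<Sum>x\<in>X. a x * of_real (fejer J (v x - real q / real J))))
     <= 1 / real J * (cmod (\<Sum>x\<in>X. a x) + real J * B)" unfolding norm_mult using 1 by (intro mult_mono) auto
  qed
  also have "... = cmod (\<Sum>x\<in>X. a x) + real J * B" using J by simp
  finally show ?thesis .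
 qed
 have "(\<Sum>x\<in>X. a x * of_real (frac (v x))) = (\<Sum>x\<in>X. a x * of_real (\<sigma> (v x))) + (\<Sum>x\<in>X. a x * of_real (frac (v x) - \<sigma> (v x)))"
  by (simp add: sum.distrib[symmetric] algebra_simps)
 then have "cmod (\<Sum>x\<in>X. a x * of_real (frac (v x))) <=
   cmod (\<Sum>x\<in>X. a x * of_real (\<sigma> (v x))) + cmod (\<Sum>x\<in>X. a x * of_real (frac (v x) - \<sigma> (v x)))"
  using norm_triangle_ineq by metis
 also have "cmod (\<Sum>x\<in>X. a x * of_real (frac (v x) - \<sigma> (v x))) <= (\<Sum>x\<in>X. 37 / real D + 4 / real D * fejer D (v x))"
 proof (intro order_trans[OF norm_sum] sum_mono)
  fix x
  have "\<bar>frac (v x) - \<sigma> (v x)\<bar> <= 37 / real D + 4 / real D * fejer D (v x)"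
   unfolding \<sigma>_def J_def by (rule frac_fejer_approx[OF D])
  then have "cmod (a x) * \<bar>frac (v x) - \<sigma> (v x)\<bar> <= 1 * (37 / real D + 4 / real D * fejer D (v x))"
   using a by (intro mult_mono) auto
  then show "cmod (a x * of_real (frac (v x) - \<sigma> (v x))) <= 37 / real D + 4 / real D * fejer D (v x)"
   by (simp add: norm_mult del: of_real_diff)
 qed
 also have "(\<Sum>x\<in>X. 37 / real D + 4 / real D * fejer D (v x)) = real (card X) * (37 / real D) + 4 / real D * (\<Sum>x\<in>X. fejer D (v x))"
  by (simp add: sum.distrib sum_distrib_left)
 also have "... <= real (card X) * (37 / real D) + 4 / real D * (real (card X) + real D * B)"
  using s1 by (intro add_left_mono mult_left_mono) auto
 also have "... = 41 * real (card X) / real D + 4 * B" using D by (simp add: field_simps)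
 finally show ?thesis using s2 by (simp add: J_def algebra_simps)
qed

section \<open>The sawtooth of x powr b\<close>

definition usaw :: "real => int => real" where
 "usaw b x = frac (- (of_int x powr b))"

lemma usaw_bounds: "0 <= usaw b x" "usaw b x < 1" by (auto simp: usaw_def frac_lt_1)

text \<open>The omitted initial segment has length A = 2 * D^3 * H, so that c * H <= pi * A holds
  for every frequency c = 2 * pi * j with j below D^3. With H about Y powr (2/5), differencing
  bounds the square by Y powr (3/5) times Y powr (1001/1000 + 1/5), where 1001/1000 dominates 2 - b;
  the root is Y powr (9005/10000).\<close>

lemma usaw_exp_sum_tail:
 fixes b \<xi> :: real
 assumes b: "999 / 1000 <= b" "b < 1" and D: "0 < D" and H: "0 < H"
  and Y: "2 * D ^ 3 * H + n = Y" and HY: "real Y powr (2/5) <= real H" "real H <= 2 * real Y powr (2/5)"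
 defines "A \<equiv> 2 * D ^ 3 * H"
 shows "cmod (\<Sum>x\<in>{int A<..int Y}. cis (\<xi> * of_int x) * of_real (usaw b x))
   <= cmod (\<Sum>x\<in>{int A<..int Y}. cis (\<xi> * of_int x))
    + (real D ^ 3 + 4) * (sqrt (241 / (b * (1 - b))) * real Y powr (9005/10000)) + 41 * real n / real D"
proof -
 define C0 where "C0 = 1 / (b * (1 - b))"
 have b01: "0 < b" using b by simp
 have bb: "0 < b * (1 - b)" "b * (1 - b) <= 1" using b b01 mult_mono[of b 1 "1 - b" 1] by auto
 then have C0: "1 <= C0" by (simp add: C0_def)
 have A0: "0 < A" unfolding A_def using D H by simp
 have HA: "H <= A" unfolding A_def using D by simp
 have YA: "A + n = Y" using Y by (simp add: A_def)
 have y1: "1 <= real Y" using YA A0 by simp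
 have bound: "cmod (\<Sum>x\<in>{int A<..int Y}. cis (- (2 * pi * of_int j) * of_int x powr b + \<xi>' * of_int x))
   <= sqrt (241 * C0) * real Y powr (9005/10000)" if j: "j ~= 0" "\<bar>j\<bar> < int (D ^ 3)" for j :: int and \<xi>'
 proof -
  have "1 * 1 <= 2 * pi * \<bar>real_of_int j\<bar>" using j pi_ge_two by (intro mult_mono) auto
  moreover have "2 * pi * \<bar>real_of_int j\<bar> * real H <= pi * real A"
  proof -
   have "\<bar>j\<bar> <= int (D ^ 3)" using j by simp
   then have "\<bar>real_of_int j\<bar> <= real (D ^ 3)" by linarith
   then have "2 * pi * \<bar>real_of_int j\<bar> * real H <= 2 * pi * real (D ^ 3) * real H"
    by (intro mult_right_mono mult_left_mono) auto
   then show ?thesis by (simp add: A_def)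
  qed
  ultimately have "(cmod (\<Sum>x\<in>{int A<..int A + int n}. cis (- (2 * pi * of_int j) * of_int x powr b + \<xi>' * of_int x)))\<^sup>2
    <= (real n + real H) / real H *
    (real n + 120 * (real (A + n) powr (2 - b) / (b * (1 - b))) * sqrt (real H))"
   using b by (intro exp_sum_powr A0 H) (auto simp: abs_mult)
  also have "... <= real Y powr (3/5) * (241 * C0 * real Y powr (1201/1000))"
  proof (intro mult_mono)
   have "(real n + real H) / real H <= real Y / real Y powr (2/5)" using HY(1) HA YA y1 H by (intro frac_le) auto
   also have "... = real Y powr (1 - 2/5)" using y1 by (subst powr_diff) auto
   finally show "(real n + real H) / real H <= real Y powr (3/5)" by simp
   have "real n <= real Y powr 1" using YA y1 by simp
   also have "... <= real Y powr (1201/1000)" using y1 by (intro powr_mono) auto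
   also have "... <= C0 * real Y powr (1201/1000)" using mult_right_mono[OF C0, of "real Y powr (1201/1000)"] by simp
   finally have 1: "real n <= C0 * real Y powr (1201/1000)" .
   have "sqrt (real H) <= sqrt (2 * real Y powr (2/5))" using HY(2) by simp
   also have "... <= 2 * real Y powr (1/5)"
   proof (rule real_le_lsqrt)
    have "(real Y powr (1/5))\<^sup>2 = real Y powr (2/5)" using y1 by (simp add: power2_eq_square powr_add[symmetric])
    then show "2 * real Y powr (2/5) <= (2 * real Y powr (1/5))\<^sup>2" by (simp add: power_mult_distrib)
   qed auto
   finally have s: "sqrt (real H) <= 2 * real Y powr (1/5)" .
   have "real (A + n) powr (2 - b) <= real Y powr (1001/1000)" unfolding YA using y1 b by (intro powr_mono) auto
   then have "real (A + n) powr (2 - b) / (b * (1 - b)) <= real Y powr (1001/1000) / (b * (1 - b))"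
    using bb by (intro divide_right_mono) auto
   also have "... = C0 * real Y powr (1001/1000)" by (simp add: C0_def)
   finally have "120 * (real (A + n) powr (2 - b) / (b * (1 - b))) * sqrt (real H)
     <= 120 * (C0 * real Y powr (1001/1000)) * (2 * real Y powr (1/5))"
    using s C0 by (intro mult_mono mult_left_mono) auto
   also have "... = 240 * C0 * (real Y powr (1001/1000) * real Y powr (1/5))" by simp
   also have "... = 240 * C0 * real Y powr (1201/1000)" by (simp add: powr_add[symmetric])
   finally show "real n + 120 * (real (A + n) powr (2 - b) / (b * (1 - b))) * sqrt (real H)
     <= 241 * C0 * real Y powr (1201/1000)" using 1 by simp
  qed (use bb in auto)
  also have "... = 241 * C0 * (real Y powr (3/5) * real Y powr (1201/1000))" by simp
  also have "... = 241 * C0 * real Y powr (1801/1000)" by (simp add: powr_add[symmetric])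
  also have "... = (sqrt (241 * C0) * real Y powr (9005/10000))\<^sup>2"
  proof -
   have "(real Y powr (9005/10000))\<^sup>2 = real Y powr (1801/1000)"
    using y1 by (simp add: power2_eq_square powr_add[symmetric])
   then show ?thesis using C0 by (simp add: power_mult_distrib)
  qed
  finally show ?thesis unfolding YA[symmetric] of_nat_add by (rule power2_le_imp_le) (use C0 in auto)
 qed
 have eq: "cis (\<xi>' * of_int x) * cis (2 * pi * of_int j * (- (of_int x powr b)))
   = cis (- (2 * pi * of_int j) * of_int x powr b + \<xi>' * of_int x)" for x j :: int and \<xi>'
  unfolding cis_mult by (rule arg_cong[where f = cis]) simp
 have "cmod (\<Sum>x\<in>{int A<..int Y}. cis (\<xi> * of_int x) * of_real (frac (- (of_int x powr b))))
   <= cmod (\<Sum>x\<in>{int A<..int Y}. cis (\<xi> * of_int x))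
    + (real D ^ 3 + 4) * (sqrt (241 * C0) * real Y powr (9005/10000)) + 41 * real (card {int A<..int Y}) / real D"
 proof (rule sum_frac_bound[OF D])
  fix j :: int assume j: "j ~= 0" "\<bar>j\<bar> < int (D ^ 3)"
  show "cmod (\<Sum>x\<in>{int A<..int Y}. cis (\<xi> * of_int x) * cis (2 * pi * of_int j * - (of_int x powr b)))
    <= sqrt (241 * C0) * real Y powr (9005/10000)" unfolding eq by (rule bound[OF j])
  show "cmod (\<Sum>x\<in>{int A<..int Y}. cis (2 * pi * of_int j * - (of_int x powr b)))
    <= sqrt (241 * C0) * real Y powr (9005/10000)" using bound[OF j, of 0] by simp
 qed (use C0 in auto)
 moreover have "card {int A<..int Y} = n" using YA by simp
 ultimately show ?thesis by (simp add: usaw_def C0_def)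
qed

text \<open>Shifting the sum by one turns the increment of the sawtooth into the factor cis (-
  \<xi>) - 1. This factor matters because \<open>frac\<close> has mean 1/2: for \<xi> near 0 the
  sawtooth itself sums to the order of Y, but the factor cancels the resulting geometric sum. With D
  about Y powr (1/50) the error 41 * n / D becomes Y powr (49/50), and D^3 * Y powr (9005/10000) is
  smaller. The first A terms are bounded trivially.\<close>

theorem indicator_exp_sum:
 fixes b :: real
 assumes b: "999 / 1000 <= b" "b < 1"
 shows "\<exists>C>0. \<forall>Y::nat. \<forall>\<xi>::real.
  cmod (\<Sum>x\<in>{1..int Y}. of_real (usaw b (x + 1) - usaw b x) * cis (\<xi> * of_int x)) <= C * real Y powr (49/50)"
proof -
 define C1 where "C1 = sqrt (241 / (b * (1 - b)))"
 have C1: "0 <= C1" unfolding C1_def using b by auto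
 have main: "cmod (\<Sum>x\<in>{1..int Y}. of_real (usaw b (x + 1) - usaw b x) * cis (\<xi> * of_int x))
   <= (180 + 10 * C1) * real Y powr (49/50)" if Y: "0 < Y" for Y :: nat and \<xi> :: real
 proof -
  define y where "y = real Y"
  have y1: "1 <= y" using Y by (simp add: y_def)
  define H where "H = nat \<lceil>y powr (2/5)\<rceil>"
  define D where "D = nat \<lfloor>y powr (1/50)\<rfloor>"
  define A where "A = 2 * D ^ 3 * H"
  define e where "e = (%x::int. cis (\<xi> * of_int x))"
  define S where "S = (\<Sum>x\<in>{1..int Y}. e x * of_real (usaw b x))"
  have p1: "1 <= y powr t" if "0 <= t" for t using y1 that by (rule ge_one_powr_ge_zero)
  have H: "y powr (2/5) <= real H" "real H <= 2 * y powr (2/5)" "0 < H"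
   using p1[of "2/5"] by (auto simp: H_def) linarith+
  have D: "real D <= y powr (1/50)" "y powr (1/50) / 2 <= real D" "0 < D"
  proof -
   have f: "1 <= \<lfloor>y powr (1/50)\<rfloor>" using p1[of "1/50"] by simp
   then have "real D = of_int \<lfloor>y powr (1/50)\<rfloor>" by (simp add: D_def)
   then show "real D <= y powr (1/50)" "y powr (1/50) / 2 <= real D" using f by linarith+
   show "0 < D" using f by (simp add: D_def)
  qed
  have D3: "real D ^ 3 <= y powr (6/100)"
  proof -
   have "real D ^ 3 <= (y powr (1/50)) ^ 3" using D by (intro power_mono) auto
   also have "... = y powr (6/100)" using y1 by (simp add: power3_eq_cube powr_add[symmetric])
   finally show ?thesis .
  qed
  have A: "real A <= 4 * y powr (49/50)"
  proof -
   have "real A = 2 * (real D ^ 3 * real H)" by (simp add: A_def)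
   also have "... <= 2 * (y powr (6/100) * (2 * y powr (2/5)))" using D3 H by (intro mult_left_mono mult_mono) auto
   also have "... = 4 * y powr (46/100)" by (simp add: powr_add[symmetric])
   also have "... <= 4 * y powr (49/50)" using y1 by (intro mult_left_mono powr_mono) auto
   finally show ?thesis .
  qed
  have u1: "cmod (complex_of_real (usaw b x)) <= 1" for x using usaw_bounds[of b x] by simp
  have "(\<Sum>x\<in>{1..int Y}. of_real (usaw b (x + 1) - usaw b x) * e x)
    = (\<Sum>x\<in>{1..int Y}. of_real (usaw b (x + 1)) * e x) - S" by (simp add: S_def sum_subtractf algebra_simps)
  also have "(\<Sum>x\<in>{1..int Y}. of_real (usaw b (x + 1)) * e x) = (\<Sum>x\<in>{2..int Y + 1}. of_real (usaw b x) * e (x - 1))"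
   by (rule sum.reindex_bij_witness[where i = "%x. x - 1" and j = "%x. x + 1"]) auto
  also have "... = (\<Sum>x\<in>{2..int Y + 1}. cis (- \<xi>) * (e x * of_real (usaw b x)))"
  proof (rule sum.cong[OF refl])
   fix x
   have "e (x - 1) = cis (- \<xi>) * e x" unfolding e_def cis_mult by (rule arg_cong[where f = cis]) (simp add: algebra_simps)
   then show "of_real (usaw b x) * e (x - 1) = cis (- \<xi>) * (e x * of_real (usaw b x))" by simp
  qed
  also have "... = cis (- \<xi>) * (\<Sum>x\<in>{2..int Y + 1}. e x * of_real (usaw b x))" by (rule sum_distrib_left[symmetric])
  also have "(\<Sum>x\<in>{2..int Y + 1}. e x * of_real (usaw b x)) = S + e (int Y + 1) * of_real (usaw b (int Y + 1)) - e 1 * of_real (usaw b 1)"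
  proof -
   have "insert 1 {2..int Y + 1} = insert (int Y + 1) {1..int Y}" using Y by auto
   then have "(\<Sum>x\<in>insert 1 {2..int Y + 1}. e x * of_real (usaw b x)) = (\<Sum>x\<in>insert (int Y + 1) {1..int Y}. e x * of_real (usaw b x))" by simp
   then show ?thesis unfolding S_def by (simp add: algebra_simps)
  qed
  finally have "(\<Sum>x\<in>{1..int Y}. of_real (usaw b (x + 1) - usaw b x) * e x)
   = (cis (- \<xi>) - 1) * S + cis (- \<xi>) * (e (int Y + 1) * of_real (usaw b (int Y + 1))) - cis (- \<xi>) * (e 1 * of_real (usaw b 1))"
   by (simp add: algebra_simps)
  also have "cmod ... <= cmod ((cis (- \<xi>) - 1) * S) + cmod (cis (- \<xi>) * (e (int Y + 1) * of_real (usaw b (int Y + 1))))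
    + cmod (cis (- \<xi>) * (e 1 * of_real (usaw b 1)))"
   by (intro order_trans[OF norm_triangle_ineq4] add_right_mono norm_triangle_ineq)
  also have "... <= cmod ((cis (- \<xi>) - 1) * S) + 1 + 1" using u1 by (intro add_mono) (auto simp: norm_mult e_def)
  finally have 1: "cmod (\<Sum>x\<in>{1..int Y}. of_real (usaw b (x + 1) - usaw b x) * e x) <= cmod (cis (- \<xi>) - 1) * cmod S + 2"
   by (simp add: norm_mult)
  have triv: "cmod (\<Sum>x\<in>X. e x * of_real (usaw b x)) <= real (card X)" for X
  proof -
   have "cmod (\<Sum>x\<in>X. e x * of_real (usaw b x)) <= (\<Sum>x\<in>X. 1)"
    using u1 by (intro order_trans[OF norm_sum] sum_mono) (auto simp: norm_mult e_def)
   then show ?thesis by simp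
  qed
  have S: "cmod (cis (- \<xi>) - 1) * cmod S <= (178 + 10 * C1) * y powr (49/50)"
  proof (cases "Y <= A")
   case True
   have "cmod S <= real Y" unfolding S_def using triv[of "{1..int Y}"] by simp
   also have "... <= 4 * y powr (49/50)" using True A by simp
   finally have "cmod (cis (- \<xi>) - 1) * cmod S <= 2 * (4 * y powr (49/50))"
    by (intro mult_mono cmod_cis_minus_1_le_2) auto
   also have "... <= (178 + 10 * C1) * y powr (49/50)"
    using C1 mult_right_mono[of 8 "178 + 10 * C1" "y powr (49/50)"] by simp
   finally show ?thesis .
  next
   case False
   define n where "n = Y - A"
   have n: "2 * D ^ 3 * H + n = Y" using False by (simp add: n_def A_def)
   let ?X = "{int A<..int Y}"
   have spl: "S = (\<Sum>x\<in>{1..int A}. e x * of_real (usaw b x)) + (\<Sum>x\<in>?X. e x * of_real (usaw b x))"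
   proof -
    have "{1..int Y} = {1..int A} \<union> ?X" using False by auto
    moreover have "{1..int A} \<inter> ?X = {}" by auto
    ultimately show ?thesis unfolding S_def by (simp add: sum.union_disjoint)
   qed
   have geo: "cmod (cis (- \<xi>) - 1) * cmod (\<Sum>x\<in>?X. e x) <= 2"
   proof -
    have "(cis (- \<xi>) - 1) * (\<Sum>x\<in>{int A<..int A + int k}. e x) = e (int A) - e (int A + int k)" for k
    proof (induction k)
     case (Suc k)
     have "{int A<..int A + int (Suc k)} = insert (int A + int (Suc k)) {int A<..int A + int k}" by auto
     then have "(\<Sum>x\<in>{int A<..int A + int (Suc k)}. e x) = e (int A + int (Suc k)) + (\<Sum>x\<in>{int A<..int A + int k}. e x)"
      by simp
     moreover have "cis (- \<xi>) * e (int A + int (Suc k)) = e (int A + int k)"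
      unfolding e_def cis_mult by (rule arg_cong[where f = cis]) (simp add: algebra_simps)
     ultimately show ?case using Suc by (simp add: algebra_simps)
    qed (simp add: e_def)
    from this[of n] have "(cis (- \<xi>) - 1) * (\<Sum>x\<in>?X. e x) = e (int A) - e (int Y)"
     using n by (simp only: A_def[symmetric] of_nat_add[symmetric])
    then have "cmod (cis (- \<xi>) - 1) * cmod (\<Sum>x\<in>?X. e x) = cmod (e (int A) - e (int Y))"
     by (metis norm_mult)
    also have "... <= 1 + 1" by (rule order_trans[OF norm_triangle_ineq4]) (simp add: e_def)
    finally show ?thesis by simp
   qed
   have tail: "cmod (\<Sum>x\<in>?X. e x * of_real (usaw b x)) <= cmod (\<Sum>x\<in>?X. e x)
     + (real D ^ 3 + 4) * (C1 * y powr (9005/10000)) + 41 * real n / real D" unfolding e_def C1_def y_def A_def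
    using usaw_exp_sum_tail[OF b D(3) H(3) n] H unfolding y_def by blast
   have t1: "(real D ^ 3 + 4) * (C1 * y powr (9005/10000)) <= 5 * C1 * y powr (49/50)"
   proof -
    have "real D ^ 3 + 4 <= 5 * y powr (6/100)" using D3 p1[of "6/100"] by simp
    then have "(real D ^ 3 + 4) * (C1 * y powr (9005/10000)) <= (5 * y powr (6/100)) * (C1 * y powr (9005/10000))"
     using C1 by (intro mult_right_mono) auto
    also have "... = 5 * C1 * (y powr (6/100) * y powr (9005/10000))" by simp
    also have "... = 5 * C1 * y powr (9605/10000)" by (simp add: powr_add[symmetric])
    also have "... <= 5 * C1 * y powr (49/50)" using y1 C1 by (intro mult_left_mono powr_mono) auto
    finally show ?thesis .
   qed
   have t2: "41 * real n / real D <= 82 * y powr (49/50)"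
   proof -
    have "41 * real n / real D <= 41 * y / (y powr (1/50) / 2)" using D y1 n by (intro frac_le) (auto simp: y_def)
    also have "... = 82 * (y powr 1 / y powr (1/50))" using y1 by simp
    also have "... = 82 * y powr (49/50)" by (simp only: powr_diff[symmetric]) simp
    finally show ?thesis .
   qed
   let ?c = "cmod (cis (- \<xi>) - 1)"
   have c2: "?c <= 2" by (rule cmod_cis_minus_1_le_2)
   have "cmod S <= real A + (cmod (\<Sum>x\<in>?X. e x) + (5 * C1 * y powr (49/50) + 82 * y powr (49/50)))"
    unfolding spl using triv[of "{1..int A}"] tail t1 t2 by (intro order_trans[OF norm_triangle_ineq] add_mono) auto
   then have "?c * cmod S <= ?c * (real A + (cmod (\<Sum>x\<in>?X. e x) + (5 * C1 * y powr (49/50) + 82 * y powr (49/50))))"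
    by (intro mult_left_mono) auto
   also have "... = ?c * real A + (?c * cmod (\<Sum>x\<in>?X. e x) + ?c * (5 * C1 * y powr (49/50) + 82 * y powr (49/50)))"
    by (simp add: algebra_simps)
   also have "... <= 2 * (4 * y powr (49/50)) + (2 + 2 * (5 * C1 * y powr (49/50) + 82 * y powr (49/50)))"
    using A c2 geo C1 by (intro add_mono mult_mono) auto
   also have "... <= (178 + 10 * C1) * y powr (49/50)" using p1[of "49/50"] by (simp add: algebra_simps)
   finally show ?thesis .
  qed
  have "cmod (\<Sum>x\<in>{1..int Y}. of_real (usaw b (x + 1) - usaw b x) * e x) <= (178 + 10 * C1) * y powr (49/50) + 2 * y powr (49/50)"
   using 1 S p1[of "49/50"] by simp
  then show ?thesis unfolding e_def y_def by (simp add: algebra_simps)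
 qed
 show ?thesis
 proof (intro exI[of _ "180 + 10 * C1"] conjI allI)
  fix Y :: nat and \<xi> :: real
  show "cmod (\<Sum>x\<in>{1..int Y}. of_real (usaw b (x + 1) - usaw b x) * cis (\<xi> * of_int x)) <= (180 + 10 * C1) * real Y powr (49/50)"
   using main[of Y \<xi>] by (cases "Y = 0") auto
 qed (use C1 in simp)
qed

section \<open>The sequence of integer parts of powers\<close>

locale power_sequence =
 fixes \<alpha> :: real
 assumes alpha: "1 < \<alpha>" "\<alpha> <= 1 + 1/1000"
begin

definition b :: real where "b = 1 / \<alpha>"

text \<open>For x >= 1 this is the least m with m powr \<alpha> >= x. So \<open>mu x - 1\<close>
  counts the members of the sequence below x, and at a member \<open>mu\<close> returns its index m
  (\<open>mu_floor\<close>).\<close>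

definition mu :: "int => int" where "mu x = \<lceil>of_int x powr b\<rceil>"

text \<open>For \<open>x \<ge> 1\<close> this is the indicator function of the set of all \<open>\<lfloor>m powr \<alpha>\<rfloor>\<close>.\<close>

definition ind :: "int => int" where "ind x = mu (x + 1) - mu x"

definition dens :: "int => real" where "dens x = of_int (x + 1) powr b - of_int x powr b"

lemma b_bounds: "999/1000 <= b" "b < 1" "0 < b" "\<alpha> * b = 1" "b * \<alpha> = 1"
 using alpha by (auto simp: b_def field_simps)

text \<open>Since frac (- y) is the ceiling of y minus y, the deviation of the indicator from its
  density is an increment of the bounded sequence \<open>usaw b\<close>. Both the exponential sums
  and the summation by parts rest on this.\<close>

lemma ind_dens: "of_int (ind x) - dens x = usaw b (x + 1) - usaw b x"
 by (simp add: ind_def dens_def mu_def usaw_def frac_def ceiling_def)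

lemma dens_bounds:
 assumes "1 <= x"
 shows "0 <= dens x" "dens x <= of_int x powr (b - 1)"
  and "!!a::int. 0 <= a ==> 0 <= dens x - dens (x + a) & dens x - dens (x + a) <= of_int a * of_int x powr (b - 2)"
proof -
 let ?x = "real_of_int x"
 have x: "1 <= ?x" using assms by simp
 have "\<exists>z>?x. z < ?x + 1 & (?x + 1) powr b - ?x powr b = (?x + 1 - ?x) * (b * z powr (b - 1))"
 proof (rule MVT2)
  fix t assume "?x <= t" "t <= ?x + 1"
  then show "((%t. t powr b) has_real_derivative (b * t powr (b - 1))) (at t)"
   using x by (auto intro!: derivative_eq_intros)
 qed simp
 then obtain z where z: "?x < z" "dens x = b * z powr (b - 1)" by (auto simp: dens_def add.commute)
 show "0 <= dens x" using z b_bounds by simp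
 have "z powr (b - 1) <= ?x powr (b - 1)" using z x b_bounds by (intro powr_mono2') auto
 then have "b * z powr (b - 1) <= 1 * ?x powr (b - 1)" using b_bounds by (intro mult_mono) auto
 then show "dens x <= ?x powr (b - 1)" using z by simp
 fix a :: int assume a: "0 <= a"
 show "0 <= dens x - dens (x + a) & dens x - dens (x + a) <= of_int a * ?x powr (b - 2)"
 proof (cases "a = 0")
  case False
  then have a: "0 < real_of_int a" using a by simp
  have xp: "0 < ?x" using x by simp
  note P = powr_difference_bounds[OF b_bounds(3,2) xp a]
  have e: "dens x - dens (x + a) = (?x + 1) powr b - ?x powr b - ((?x + of_int a + 1) powr b - (?x + of_int a) powr b)"
   by (simp add: dens_def add_ac)
  have "0 <= of_int a * (b * (1 - b) * (?x + of_int a + 1) powr (b - 2))" using a b_bounds by simp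
  moreover have "b * (1 - b) <= 1" using b_bounds mult_mono[of b 1 "1 - b" 1] by simp
  then have "of_int a * (b * (1 - b) * ?x powr (b - 2)) <= of_int a * (1 * ?x powr (b - 2))"
   using a by (intro mult_left_mono mult_right_mono) auto
  ultimately show ?thesis unfolding e using P by auto
 qed simp
qed

lemma dens_le_1: "1 <= x ==> dens x < 1"
proof -
 assume x: "1 <= x"
 have "\<exists>z>real_of_int x. z < of_int x + 1 & (of_int x + 1) powr b - of_int x powr b = (of_int x + 1 - of_int x) * (b * z powr (b - 1))"
 proof (rule MVT2)
  fix t :: real assume "of_int x <= t" "t <= of_int x + 1"
  then show "((%t. t powr b) has_real_derivative (b * t powr (b - 1))) (at t)"
   using x by (auto intro!: derivative_eq_intros)
 qed simp
 then obtain z where z: "of_int x < z" "dens x = b * z powr (b - 1)" by (auto simp: dens_def add.commute)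
 have "z powr (b - 1) <= 1 powr (b - 1)" using z x b_bounds by (intro powr_mono2') auto
 then have "b * z powr (b - 1) <= b * 1" using b_bounds by (intro mult_left_mono) auto
 also have "... < 1" using b_bounds by simp
 finally show ?thesis using z by simp
qed

text \<open>An increment of x powr b lies in [0, 1), so the ceiling moves by at most one.\<close>

lemma ind_cases:
 assumes "1 <= x"
 shows "ind x = 0 \<or> ind x = 1"
proof -
 have "0 <= dens x" "dens x < 1" using dens_bounds(1)[OF assms] dens_le_1[OF assms] by auto
 then have "of_int x powr b <= of_int (x + 1) powr b" "of_int (x + 1) powr b < of_int x powr b + 1"
  by (auto simp: dens_def)
 then have "mu x <= mu (x + 1)" "mu (x + 1) <= mu x + 1" unfolding mu_def by (auto intro: ceiling_mono) linarith
 then show ?thesis by (auto simp: ind_def)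
qed

lemma mu_pos: "1 <= x ==> 1 <= mu x"
proof -
 assume "1 <= x"
 then have "1 powr b <= of_int x powr b" using b_bounds by (intro powr_mono2) auto
 moreover assume "1 <= x"
 ultimately show ?thesis by (simp add: mu_def)
qed

lemma powr_alpha_b: "0 <= x ==> (x powr \<alpha>) powr b = x" "0 <= x ==> (x powr b) powr \<alpha> = x"
 by (auto simp: powr_powr b_bounds)

lemma ind_iff_powr:
 assumes "1 <= x"
 shows "ind x = 1 \<longleftrightarrow> of_int x <= of_int (mu x) powr \<alpha> & of_int (mu x) powr \<alpha> < of_int x + 1"
proof -
 have m: "1 <= mu x" by (rule mu_pos[OF assms])
 have 1: "of_int x <= of_int (mu x) powr \<alpha>"
 proof -
  have "of_int x powr b <= of_int (mu x)" by (simp add: mu_def)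
  then have "(of_int x powr b) powr \<alpha> <= of_int (mu x) powr \<alpha>" using alpha by (intro powr_mono2) auto
  then show ?thesis using assms by (simp add: powr_alpha_b)
 qed
 have "ind x = 1 \<longleftrightarrow> of_int (mu x) < real_of_int (x + 1) powr b"
  using ind_cases[OF assms] unfolding ind_def mu_def[of "x + 1"] by (auto simp: less_ceiling_iff) linarith+
 also have "... \<longleftrightarrow> of_int (mu x) powr \<alpha> < real_of_int (x + 1)"
 proof
  assume "of_int (mu x) < real_of_int (x + 1) powr b"
  then have "of_int (mu x) powr \<alpha> < (real_of_int (x + 1) powr b) powr \<alpha>"
   using m alpha by (intro powr_less_mono2) auto
  then show "of_int (mu x) powr \<alpha> < real_of_int (x + 1)" using assms powr_alpha_b(2)[of "real_of_int (x + 1)"] by simp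
 next
  assume "of_int (mu x) powr \<alpha> < real_of_int (x + 1)"
  then have "(of_int (mu x) powr \<alpha>) powr b < real_of_int (x + 1) powr b"
   using m b_bounds by (intro powr_less_mono2) auto
  then show "of_int (mu x) < real_of_int (x + 1) powr b" using m powr_alpha_b(1)[of "of_int (mu x)"] by simp
 qed
 finally show ?thesis using 1 by auto
qed

lemma mu_floor:
 assumes "1 <= m"
 shows "1 <= \<lfloor>of_int m powr \<alpha>\<rfloor>" "mu \<lfloor>of_int m powr \<alpha>\<rfloor> = m" "ind \<lfloor>of_int m powr \<alpha>\<rfloor> = 1"
proof -
 let ?y = "of_int m powr \<alpha>"
 have y: "1 <= ?y" using assms alpha by (intro ge_one_powr_ge_zero) auto
 then show x: "1 <= \<lfloor>?y\<rfloor>" by simp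
 have up: "of_int \<lfloor>?y\<rfloor> powr b <= of_int m"
 proof -
  have "of_int \<lfloor>?y\<rfloor> powr b <= ?y powr b" using x b_bounds by (intro powr_mono2) auto
  then show ?thesis using assms by (simp add: powr_alpha_b)
 qed
 have lo: "of_int m < of_int (\<lfloor>?y\<rfloor> + 1) powr b"
 proof -
  have "?y powr b < of_int (\<lfloor>?y\<rfloor> + 1) powr b" using y b_bounds by (intro powr_less_mono2) auto
  then show ?thesis using assms by (simp add: powr_alpha_b)
 qed
 have "mu \<lfloor>?y\<rfloor> <= m" using up by (simp add: mu_def ceiling_le_iff)
 moreover have "m < mu (\<lfloor>?y\<rfloor> + 1)" using lo by (simp add: mu_def less_ceiling_iff)
 ultimately show "mu \<lfloor>?y\<rfloor> = m" "ind \<lfloor>?y\<rfloor> = 1" using ind_cases[OF x] by (auto simp: ind_def)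
qed

lemma ind_1_floor:
 assumes "1 <= x" "ind x = 1"
 shows "x = \<lfloor>of_int (mu x) powr \<alpha>\<rfloor>"
 using assms ind_iff_powr[OF assms(1)] by (intro floor_unique[symmetric]) auto

lemma sum_ind: "0 <= N ==> (\<Sum>x\<in>{1..N}. ind x) = mu (N + 1) - 1"
proof (induction N rule: int_ge_induct)
 case base
 show ?case by (simp add: mu_def)
next
 case (step N)
 have "{1..N + 1} = insert (N + 1) {1..N}" using step by auto
 then show ?case using step by (simp add: ind_def)
qed

lemma sum_ind_le:
 assumes "1 <= t" "of_int N <= 2 * t"
 shows "(\<Sum>x\<in>{1..N}. real_of_int (ind x)) <= 3 * t powr b"
proof (cases "0 <= N")
 case True
 have "(\<Sum>x\<in>{1..N}. real_of_int (ind x)) = of_int (mu (N + 1)) - 1"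
  using sum_ind[OF True] by (simp add: of_int_sum[symmetric] del: of_int_sum)
 also have "... <= of_int (N + 1) powr b" by (simp add: mu_def)
 also have "... <= (3 * t) powr b" using assms True b_bounds by (intro powr_mono2) auto
 also have "... = 3 powr b * t powr b" using assms by (simp add: powr_mult)
 also have "... <= 3 powr 1 * t powr b" using b_bounds by (intro mult_right_mono powr_mono) auto
 finally show ?thesis by simp
qed simp

lemma powr_shift_bounds:
 fixes c t :: real
 assumes c: "1 <= c" and t: "0 < t"
 shows "(t / c) powr (b - 1) <= c * t powr (b - 1)" "(t / c) powr (- b) <= c * t powr (- b)"
  and "(c * t) powr b <= c * t powr b" "t powr b / c <= (t / c) powr b"
proof -
 have 1: "c powr e <= c" if "e <= 1" for e using powr_mono[OF that c] c by simp
 have "(t / c) powr e = c powr (- e) * t powr e" for e using c t by (simp add: powr_divide powr_minus_divide)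
 then show "(t / c) powr (b - 1) <= c * t powr (b - 1)" "(t / c) powr (- b) <= c * t powr (- b)"
  using 1[of "1 - b"] 1[of b] b_bounds by (auto intro!: mult_right_mono)
 show "(c * t) powr b <= c * t powr b" using c t 1[of b] b_bounds by (simp add: powr_mult mult_right_mono)
 have "t powr b / c <= t powr b / c powr b" using 1[of b] b_bounds c by (intro divide_left_mono) auto
 then show "t powr b / c <= (t / c) powr b" using c t by (simp add: powr_divide)
qed

section \<open>Counting pairs with a given difference\<close>

lemma power_difference_deriv:
 fixes m l :: real
 assumes "0 < m" "0 < l"
 shows "\<exists>z>m. z < m + l & (m + l) powr \<alpha> - m powr \<alpha> = l * (\<alpha> * z powr (\<alpha> - 1))"
proof -
 have "\<exists>z>m. z < m + l & (m + l) powr \<alpha> - m powr \<alpha> = (m + l - m) * (\<alpha> * z powr (\<alpha> - 1))"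
 proof (rule MVT2)
  fix t assume "m <= t" "t <= m + l"
  then show "((%t. t powr \<alpha>) has_real_derivative (\<alpha> * t powr (\<alpha> - 1))) (at t)"
   using assms by (auto intro!: derivative_eq_intros)
 qed (use assms in auto)
 then show ?thesis by auto
qed

text \<open>A lower bound for the mixed second difference of the convex power. For a fixed index gap
  l it keeps the values (m + l) powr \<alpha> - m powr \<alpha> apart, as \<open>card_spaced\<close>
  requires.\<close>

lemma power_difference_increasing:
 fixes m n l :: real
 assumes m: "0 < m" and n: "m < n" and l: "0 < l" and R: "n + l <= R"
 shows "(n - m) * (\<alpha> * (\<alpha> - 1) * l * R powr (\<alpha> - 2)) <= ((n + l) powr \<alpha> - n powr \<alpha>) - ((m + l) powr \<alpha> - m powr \<alpha>)"
proof -
 have "\<exists>z>m. z < n & ((n + l) powr \<alpha> - n powr \<alpha>) - ((m + l) powr \<alpha> - m powr \<alpha>)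
   = (n - m) * (\<alpha> * ((z + l) powr (\<alpha> - 1) - z powr (\<alpha> - 1)))"
 proof (rule MVT2[OF n])
  fix t assume "m <= t" "t <= n"
  then show "((%t. (t + l) powr \<alpha> - t powr \<alpha>) has_real_derivative (\<alpha> * ((t + l) powr (\<alpha> - 1) - t powr (\<alpha> - 1)))) (at t)"
   using m l by (auto intro!: derivative_eq_intros simp: algebra_simps)
 qed
 then obtain z where z: "m < z" "z < n" "((n + l) powr \<alpha> - n powr \<alpha>) - ((m + l) powr \<alpha> - m powr \<alpha>)
   = (n - m) * (\<alpha> * ((z + l) powr (\<alpha> - 1) - z powr (\<alpha> - 1)))" by auto
 have "\<exists>w>z. w < z + l & (z + l) powr (\<alpha> - 1) - z powr (\<alpha> - 1) = (z + l - z) * ((\<alpha> - 1) * w powr (\<alpha> - 2))"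
 proof (rule MVT2)
  fix t assume "z <= t" "t <= z + l"
  moreover have "\<alpha> - 1 - 1 = \<alpha> - 2" by simp
  ultimately show "((%t. t powr (\<alpha> - 1)) has_real_derivative ((\<alpha> - 1) * t powr (\<alpha> - 2))) (at t)"
   using z m by (auto intro!: derivative_eq_intros)
 qed (use l in auto)
 then obtain w where w: "z < w" "w < z + l" "(z + l) powr (\<alpha> - 1) - z powr (\<alpha> - 1) = l * ((\<alpha> - 1) * w powr (\<alpha> - 2))"
  by auto
 have "R powr (\<alpha> - 2) <= w powr (\<alpha> - 2)" using w z m R alpha by (intro powr_mono2') auto
 then have "(n - m) * (\<alpha> * (l * ((\<alpha> - 1) * R powr (\<alpha> - 2)))) <= (n - m) * (\<alpha> * (l * ((\<alpha> - 1) * w powr (\<alpha> - 2))))"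
  using n l alpha by (intro mult_left_mono) auto
 then show ?thesis unfolding z(3) w(3) by (simp add: mult_ac)
qed

text \<open>The values at the two extreme points of S differ by less than 2, and they grow at rate g
  at least.\<close>

lemma card_spaced:
 fixes S :: "int set" and F :: "int => real"
 assumes S: "finite S" and g: "0 < g"
  and F: "!!m n. m \<in> S ==> n \<in> S ==> m < n ==> of_int (n - m) * g <= F n - F m"
  and x: "!!m. m \<in> S ==> \<bar>F m - x\<bar> < 1"
 shows "real (card S) <= 1 + 2 / g"
proof (cases "S = {}")
 case False
 have d: "of_int (Max S - Min S) <= 2 / g"
 proof (cases "Min S < Max S")
  case True
  have "of_int (Max S - Min S) * g <= F (Max S) - F (Min S)" using S False True by (intro F) auto
  also have "... <= 2"
  proof -
   have "\<bar>F (Max S) - x\<bar> < 1" "\<bar>F (Min S) - x\<bar> < 1" using x S \<open>S ~= {}\<close> by auto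
   then show ?thesis by linarith
  qed
  finally show ?thesis using g by (simp add: pos_le_divide_eq)
 next
  case False
  then have "real_of_int (Max S - Min S) <= 0" by simp
  then show ?thesis using g by (smt (verit) divide_nonneg_pos)
 qed
 have "card S <= card {Min S..Max S}" using S by (intro card_mono) auto
 moreover have "Min S <= Max S" using S False by simp
 ultimately have "real (card S) <= 1 + of_int (Max S - Min S)" by simp
 then show ?thesis using d by simp
qed (use g in simp)

definition pair_set :: "real => int => int set" where
 "pair_set t x = {y. t / 8 <= of_int y & of_int y <= 2 * t & of_int (y + x) <= 2 * t & ind y = 1 & ind (y + x) = 1}"

lemma finite_pair_set: "finite (pair_set t x)"
 by (rule finite_subset[of _ "{\<lceil>t / 8\<rceil>..\<lfloor>2 * t\<rfloor>}"]) (auto simp: pair_set_def ceiling_le_iff le_floor_iff)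

text \<open>The bound is the number expected from the density, t * (t powr (b - 1))^2. A pair is
  coded by the gap l of its indices and the smaller index m. Then (m + l) powr \<alpha> - m powr
  \<alpha> is within 1 of x, which forces l to be of order x * t powr (b - 1). For each l the values
  are spaced by a multiple of l * t powr (1 - 2 * b), leaving 1 + O(t powr (2 * b - 1) / l) choices
  of m; the number of gaps is acceptable because x <= t powr b.\<close>

lemma card_pair_set:
 "\<exists>C>0. \<forall>t x. 1 <= t --> 1 <= x --> of_int x <= t powr b --> real (card (pair_set t x)) <= C * t powr (2 * b - 1)"
proof -
 define c1 where "c1 = \<alpha> * (\<alpha> - 1) / 3"
 have c1: "0 < c1" using alpha by (simp add: c1_def)
 have main: "real (card (pair_set t x)) <= (16 + 256 / c1) * t powr (2 * b - 1)"
  if t: "1 <= t" and x: "1 <= x" "of_int x <= t powr b" for t x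
 proof -
  define F where "F = (%l m::int. (of_int m + of_int l) powr \<alpha> - of_int m powr \<alpha>)"
  define S where "S = (%l. {m::int. t powr b / 8 <= of_int m & of_int (m + l) <= 3 * t powr b & \<bar>F l m - of_int x\<bar> < 1})"
  define L where "L = 16 * of_int x * t powr (b - 1)"
  have tb: "0 < t powr b" using t by simp
  have finS: "finite (S l)" for l
   by (rule finite_subset[of _ "{\<lceil>t powr b / 8\<rceil>..\<lfloor>3 * t powr b - of_int l\<rfloor>}"])
     (auto simp: S_def ceiling_le_iff le_floor_iff simp del: floor_diff_of_int)
  have mpos: "0 < real_of_int m" if "m \<in> S l" for m l
  proof -
   have "0 < t powr b / 8" using tb by simp
   also have "... <= of_int m" using that by (simp add: S_def)
   finally show ?thesis .
  qed
  have Fb: "of_int l * t powr (1 - b) / 8 <= F l m & F l m <= 4 * of_int l * t powr (1 - b)"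
   if m: "m \<in> S l" and l: "1 <= l" for l m
  proof -
   obtain z where z: "of_int m < z" "z < of_int m + of_int l" "F l m = of_int l * (\<alpha> * z powr (\<alpha> - 1))"
    using power_difference_deriv[OF mpos[OF m], of "of_int l"] l by (auto simp: F_def)
   have zb: "t powr b / 8 <= z" "z <= 3 * t powr b" using z m by (auto simp: S_def)
   have e: "(t powr b) powr (\<alpha> - 1) = t powr (1 - b)" using b_bounds by (simp add: powr_powr algebra_simps)
   have "t powr (1 - b) / 8 <= z powr (\<alpha> - 1)"
   proof -
    have "(8::real) powr (\<alpha> - 1) <= 8 powr 1" using alpha by (intro powr_mono) auto
    then have "t powr (1 - b) / 8 <= t powr (1 - b) / 8 powr (\<alpha> - 1)" by (intro divide_left_mono) auto
    also have "... = (t powr b / 8) powr (\<alpha> - 1)" using e tb by (simp add: powr_divide)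
    also have "... <= z powr (\<alpha> - 1)" using zb alpha tb by (intro powr_mono2) auto
    finally show ?thesis .
   qed
   then have "1 * (t powr (1 - b) / 8) <= \<alpha> * z powr (\<alpha> - 1)" using alpha by (intro mult_mono) auto
   then have lo: "of_int l * (1 * (t powr (1 - b) / 8)) <= F l m" unfolding z(3) using l by (intro mult_left_mono) auto
   have "z powr (\<alpha> - 1) <= (3 * t powr b) powr (\<alpha> - 1)" using zb alpha tb z mpos[OF m] by (intro powr_mono2) auto
   also have "... = 3 powr (\<alpha> - 1) * t powr (1 - b)" using e tb by (simp add: powr_mult)
   also have "... <= 3 powr 1 * t powr (1 - b)" using alpha by (intro mult_right_mono powr_mono) auto
   finally have "\<alpha> * z powr (\<alpha> - 1) <= (4/3) * (3 * t powr (1 - b))" using alpha by (intro mult_mono) auto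
   then have "F l m <= of_int l * ((4/3) * (3 * t powr (1 - b)))" unfolding z(3) using l by (intro mult_left_mono) auto
   then show ?thesis using lo by simp
  qed
  have lr: "of_int l <= L & (2 <= x --> L / 128 <= of_int l)" if l: "1 <= l" and ne: "S l ~= {}" for l
  proof -
   obtain m where m: "m \<in> S l" using ne by auto
   have a: "\<bar>F l m - of_int x\<bar> < 1" using m by (simp add: S_def)
   have x1: "1 <= real_of_int x" using x by simp
   have tt: "t powr (1 - b) * t powr (b - 1) = 1" using t by (simp add: powr_add[symmetric])
   have "of_int l * t powr (1 - b) / 8 <= 2 * of_int x" using Fb[OF m l] a x1 by linarith
   then have "of_int l * t powr (1 - b) / 8 * t powr (b - 1) <= 2 * of_int x * t powr (b - 1)"
    by (intro mult_right_mono) auto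
   then have "of_int l * (t powr (1 - b) * t powr (b - 1)) <= L" by (simp add: L_def)
   then have 1: "of_int l <= L" by (simp add: tt)
   have "L / 128 <= of_int l" if "2 <= x"
   proof -
    have "2 <= real_of_int x" using that by simp
    then have "of_int x / 2 <= 4 * of_int l * t powr (1 - b)" using Fb[OF m l] a by linarith
    then have "of_int x / 2 * t powr (b - 1) <= 4 * of_int l * t powr (1 - b) * t powr (b - 1)"
     by (intro mult_right_mono) auto
    then have "of_int x / 2 * t powr (b - 1) <= 4 * of_int l * (t powr (1 - b) * t powr (b - 1))" by simp
    then show ?thesis by (simp add: tt L_def)
   qed
   then show ?thesis using 1 by simp
  qed
  define Ls where "Ls = {l. 1 <= l & S l ~= {}}"
  have Lsub: "Ls \<subseteq> {1..\<lfloor>L\<rfloor>}"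
  proof
   fix l assume "l \<in> Ls"
   then have "1 <= l" "S l ~= {}" by (auto simp: Ls_def)
   then show "l \<in> {1..\<lfloor>L\<rfloor>}" using lr[of l] by (simp add: le_floor_iff)
  qed
  then have finL: "finite Ls" using finite_subset by blast
  have L0: "0 <= L" using x by (simp add: L_def)
  have cardL: "real (card Ls) <= L"
  proof -
   have "card Ls <= card {1..\<lfloor>L\<rfloor>}" using Lsub by (intro card_mono) auto
   also have "real (card {1..\<lfloor>L\<rfloor>}) <= L" using L0 by simp
   finally show ?thesis by simp
  qed
  have sumL: "(\<Sum>l\<in>Ls. 1 / real_of_int l) <= 128"
  proof (cases "2 <= x")
   case True
   have Lp: "0 < L" using x t by (simp add: L_def)
   have "(\<Sum>l\<in>Ls. 1 / real_of_int l) <= (\<Sum>l\<in>Ls. 1 / (L / 128))"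
    using lr True Lp by (intro sum_mono divide_left_mono) (auto simp: Ls_def)
   also have "... = real (card Ls) * (128 / L)" by simp
   also have "... <= L * (128 / L)" using cardL Lp by (intro mult_right_mono) auto
   finally show ?thesis using Lp by simp
  next
   case False
   have "t powr (b - 1) <= t powr 0" using t b_bounds by (intro powr_mono) auto
   moreover have "x = 1" using False x by simp
   ultimately have "L <= 16" using t by (simp add: L_def)
   have "(\<Sum>l\<in>Ls. 1 / real_of_int l) <= (\<Sum>l\<in>Ls. 1)" by (intro sum_mono) (auto simp: Ls_def)
   then show ?thesis using cardL \<open>L <= 16\<close> by simp
  qed
  have cardS: "real (card (S l)) <= 1 + 2 / (c1 * t powr (1 - 2 * b)) * (1 / of_int l)" if l: "l \<in> Ls" for l
  proof -
   have l1: "1 <= l" using l by (simp add: Ls_def)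
   define R where "R = 3 * t powr b"
   have Rp: "c1 * t powr (1 - 2 * b) <= \<alpha> * (\<alpha> - 1) * R powr (\<alpha> - 2)"
   proof -
    have "(t powr b) powr (\<alpha> - 2) = t powr (1 - 2 * b)" using b_bounds by (simp add: powr_powr algebra_simps)
    then have "R powr (\<alpha> - 2) = 3 powr (\<alpha> - 2) * t powr (1 - 2 * b)" using tb by (simp add: R_def powr_mult)
    moreover have "(3::real) powr (- 1) <= 3 powr (\<alpha> - 2)" using alpha by (intro powr_mono) auto
    then have "1 / 3 * t powr (1 - 2 * b) <= 3 powr (\<alpha> - 2) * t powr (1 - 2 * b)"
     by (intro mult_right_mono) (auto simp: powr_minus_divide)
    ultimately have "1 / 3 * t powr (1 - 2 * b) <= R powr (\<alpha> - 2)" by simp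
    then have "\<alpha> * (\<alpha> - 1) * (1 / 3 * t powr (1 - 2 * b)) <= \<alpha> * (\<alpha> - 1) * R powr (\<alpha> - 2)"
     using alpha by (intro mult_left_mono) auto
    then show ?thesis by (simp add: c1_def)
   qed
   have g0: "0 < c1 * t powr (1 - 2 * b) * of_int l" using c1 t l1 by simp
   have "real (card (S l)) <= 1 + 2 / (c1 * t powr (1 - 2 * b) * of_int l)"
   proof (rule card_spaced[OF finS g0, where F = "F l" and x = "of_int x"])
    fix m n assume mn: "m \<in> S l" "n \<in> S l" "m < n"
    have "of_int (n - m) * (c1 * t powr (1 - 2 * b) * of_int l) <= of_int (n - m) * (\<alpha> * (\<alpha> - 1) * of_int l * R powr (\<alpha> - 2))"
    proof (rule mult_left_mono)
     have "c1 * t powr (1 - 2 * b) * of_int l <= \<alpha> * (\<alpha> - 1) * R powr (\<alpha> - 2) * of_int l"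
      using Rp l1 by (intro mult_right_mono) auto
     then show "c1 * t powr (1 - 2 * b) * of_int l <= \<alpha> * (\<alpha> - 1) * of_int l * R powr (\<alpha> - 2)" by (simp add: mult_ac)
    qed (use mn in simp)
    also have "... <= F l n - F l m"
     using power_difference_increasing[OF mpos[OF mn(1)], of "of_int n" "of_int l" R] mn l1
     by (simp add: F_def S_def R_def)
    finally show "of_int (n - m) * (c1 * t powr (1 - 2 * b) * of_int l) <= F l n - F l m" .
   qed (auto simp: S_def)
   then show ?thesis by simp
  qed
  have "real (card (pair_set t x)) <= real (card (Sigma Ls S))"
  proof -
   \<comment> \<open>A member is determined by its index (\<open>ind_1_floor\<close>), so y is
     recovered from the second coordinate.\<close>
   let ?j = "%y. (mu (y + x) - mu y, mu y)"
   have y1: "1 <= y" if "y \<in> pair_set t x" for y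
   proof -
    have "0 < real_of_int y" using that t by (auto simp: pair_set_def)
    then show ?thesis by simp
   qed
   have inj: "inj_on ?j (pair_set t x)"
   proof (rule inj_onI)
    fix y y' assume y: "y \<in> pair_set t x" "y' \<in> pair_set t x" "?j y = ?j y'"
    then have "mu y = mu y'" by simp
    then show "y = y'" using ind_1_floor[OF y1[OF y(1)]] ind_1_floor[OF y1[OF y(2)]] y by (auto simp: pair_set_def)
   qed
   have sub: "?j ` pair_set t x \<subseteq> Sigma Ls S"
   proof
    fix p assume "p \<in> ?j ` pair_set t x"
    then obtain y where y: "y \<in> pair_set t x" "p = ?j y" by auto
    have yx1: "1 <= y + x" using y1[OF y(1)] x by simp
    have i: "ind y = 1" "ind (y + x) = 1" "t / 8 <= of_int y" "of_int (y + x) <= 2 * t"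
     using y(1) by (auto simp: pair_set_def)
    have p1: "of_int y <= of_int (mu y) powr \<alpha>" "of_int (mu y) powr \<alpha> < of_int y + 1"
     using ind_iff_powr[OF y1[OF y(1)]] i by auto
    have p2: "of_int (y + x) <= of_int (mu (y + x)) powr \<alpha>" "of_int (mu (y + x)) powr \<alpha> < of_int (y + x) + 1"
     using ind_iff_powr[OF yx1] i by auto
    have mm: "1 <= mu y" "1 <= mu (y + x)" using mu_pos y1[OF y(1)] yx1 by auto
    have "of_int (mu y) powr \<alpha> < of_int (mu (y + x)) powr \<alpha>"
    proof -
     have "real_of_int y + 1 <= of_int (y + x)" using x by simp
     then show ?thesis using p1 p2 by linarith
    qed
    then have l: "mu y < mu (y + x)"
     using mm alpha powr_mono2[of \<alpha> "of_int (mu (y + x))" "of_int (mu y)"] by (force simp: not_less)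
    have s1: "t powr b / 8 <= of_int (mu y)"
    proof -
     have "t powr b / 8 <= (t / 8) powr b" using powr_shift_bounds(4)[of 8 t] t by simp
     also have "... <= of_int y powr b" using i t b_bounds by (intro powr_mono2) auto
     also have "... <= of_int (mu y)" by (simp add: mu_def)
     finally show ?thesis .
    qed
    have s2: "of_int (mu (y + x)) <= 3 * t powr b"
    proof -
     have "of_int (mu (y + x)) = (of_int (mu (y + x)) powr \<alpha>) powr b" using mm by (simp add: powr_alpha_b)
     also have "... <= (3 * t) powr b" using p2 i t b_bounds by (intro powr_mono2) auto
     also have "... <= 3 * t powr b" using powr_shift_bounds(3)[of 3 t] t by simp
     finally show ?thesis .
    qed
    have s3: "\<bar>F (mu (y + x) - mu y) (mu y) - of_int x\<bar> < 1" using p1 p2 by (simp add: F_def abs_less_iff)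
    have "mu y \<in> S (mu (y + x) - mu y)" using s1 s2 s3 by (simp add: S_def)
    then show "p \<in> Sigma Ls S" using y(2) l by (auto simp: Ls_def)
   qed
   have "finite (Sigma Ls S)" using finL finS by auto
   then have "card (pair_set t x) <= card (Sigma Ls S)" using card_inj_on_le[OF inj sub] by simp
   then show ?thesis by simp
  qed
  also have "... = (\<Sum>l\<in>Ls. real (card (S l)))" using finL finS by simp
  also have "... <= (\<Sum>l\<in>Ls. 1 + 2 / (c1 * t powr (1 - 2 * b)) * (1 / of_int l))"
   by (rule sum_mono) (rule cardS)
  also have "... = real (card Ls) + 2 / (c1 * t powr (1 - 2 * b)) * (\<Sum>l\<in>Ls. 1 / of_int l)"
   by (simp add: sum.distrib sum_distrib_left)
  also have "... <= L + 2 / (c1 * t powr (1 - 2 * b)) * 128" using cardL sumL c1 by (intro add_mono mult_left_mono) auto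
  also have "2 / (c1 * t powr (1 - 2 * b)) * 128 = 256 / c1 * t powr (2 * b - 1)"
   using powr_minus_divide[of t "1 - 2 * b"] c1 by simp
  also have "L <= 16 * t powr b * t powr (b - 1)" using x unfolding L_def by (intro mult_right_mono) auto
  also have "16 * t powr b * t powr (b - 1) = 16 * (t powr b * t powr (b - 1))" by simp
  also have "... = 16 * t powr (2 * b - 1)" by (simp add: powr_add[symmetric])
  finally show ?thesis by (simp add: algebra_simps)
 qed
 show ?thesis by (rule exI[of _ "16 + 256 / c1"]) (use main c1 in \<open>auto intro: add_pos_pos\<close>)
qed

end

section \<open>Convolutions of arithmetic error kernels\<close>

context power_sequence begin

text \<open>The constants 1/8 and 2 accommodate the supports of all kernels at scale t; they come
  from \<open>wt_supp\<close>.\<close>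

definition shell :: "real => int set" where
 "shell t = {x. t / 8 <= \<bar>of_int x\<bar> & \<bar>of_int x\<bar> <= 2 * t}"

lemma finite_shell: "finite (shell t)"
proof (rule finite_subset)
 show "shell t \<subseteq> {- \<lfloor>2 * t\<rfloor>..\<lfloor>2 * t\<rfloor>}"
 proof
  fix x assume "x \<in> shell t"
  then have "\<bar>real_of_int x\<bar> <= 2 * t" by (simp add: shell_def)
  then have "\<bar>x\<bar> <= \<lfloor>2 * t\<rfloor>" by (simp add: le_floor_iff)
  then show "x \<in> {- \<lfloor>2 * t\<rfloor>..\<lfloor>2 * t\<rfloor>}" by auto
 qed
qed simp

lemma card_shell:
 assumes "1 <= t"
 shows "real (card (shell t)) <= 5 * t"
proof -
 have sub: "shell t \<subseteq> {- \<lfloor>2 * t\<rfloor>..\<lfloor>2 * t\<rfloor>}"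
 proof
  fix x assume "x \<in> shell t"
  then have "\<bar>real_of_int x\<bar> <= 2 * t" by (simp add: shell_def)
  then have "\<bar>x\<bar> <= \<lfloor>2 * t\<rfloor>" by (simp add: le_floor_iff)
  then show "x \<in> {- \<lfloor>2 * t\<rfloor>..\<lfloor>2 * t\<rfloor>}" by auto
 qed
 have "card (shell t) <= card {- \<lfloor>2 * t\<rfloor>..\<lfloor>2 * t\<rfloor>}" using sub by (intro card_mono) auto
 also have "real (card {- \<lfloor>2 * t\<rfloor>..\<lfloor>2 * t\<rfloor>}) <= 4 * t + 1" using assms by simp
 finally show ?thesis using assms by simp
qed

lemma shell_abs_ge_1: "1 <= t ==> x \<in> shell t ==> 1 <= \<bar>x\<bar>" by (cases "x = 0") (auto simp: shell_def)

lemma sum_ind_shell: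
 assumes t: "1 <= t"
 shows "(\<Sum>x\<in>shell t. real_of_int (ind \<bar>x\<bar>)) <= 6 * t powr b"
proof -
 let ?N = "\<lfloor>2 * t\<rfloor>"
 have i0: "0 <= real_of_int (ind x)" if "1 <= x" for x using ind_cases[OF that] by auto
 have sub: "shell t \<subseteq> {1..?N} \<union> uminus ` {1..?N}"
 proof
  fix x assume x: "x \<in> shell t"
  then have "\<bar>x\<bar> <= ?N" by (simp add: le_floor_iff shell_def)
  moreover have "1 <= \<bar>x\<bar>" by (rule shell_abs_ge_1[OF t x])
  ultimately show "x \<in> {1..?N} \<union> uminus ` {1..?N}"
   by (cases "0 < x") (auto intro!: image_eqI[where x = "- x"])
 qed
 have "(\<Sum>x\<in>shell t. real_of_int (ind \<bar>x\<bar>)) <= (\<Sum>x\<in>{1..?N} \<union> uminus ` {1..?N}. real_of_int (ind \<bar>x\<bar>))"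
  using i0 by (intro sum_mono2 sub) auto
 also have "... = (\<Sum>x\<in>{1..?N}. real_of_int (ind \<bar>x\<bar>)) + (\<Sum>x\<in>uminus ` {1..?N}. real_of_int (ind \<bar>x\<bar>))"
  by (rule sum.union_disjoint) auto
 also have "... = 2 * (\<Sum>x\<in>{1..?N}. real_of_int (ind x))" by (subst sum.reindex) (auto simp: inj_on_def)
 also have "... <= 2 * (3 * t powr b)" using t by (intro mult_left_mono sum_ind_le) auto
 finally show ?thesis by simp
qed

text \<open>What the bilinear estimate uses of an error kernel: height t powr (- b) on the members,
  plus the smooth density, and a power gain for the Fourier transform. These conditions survive
  modulation and linear combination, so multipliers can be absorbed. The exponent comes from the
  exponential sums: 49/50 - b <= - 1/60.\<close>

definition err_kernel :: "real => real => (int => complex) => bool" where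
 "err_kernel t A f \<longleftrightarrow> 0 <= A & supp f \<subseteq> shell t
   & (\<forall>x\<in>shell t. cmod (f x) <= A * t powr (- b) * (of_int (ind \<bar>x\<bar>) + t powr (b - 1)))
   & (\<forall>\<xi>. cmod (ft f \<xi>) <= A * t powr (- 1 / 60))"

lemma err_kernel_finite: "err_kernel t A f ==> finite (supp f)"
 using finite_shell finite_subset unfolding err_kernel_def by blast

text \<open>About t powr b points of height t powr (- b). Compared with the ideal 1 / t this loses t
  powr (1 - b), and the loss reappears in the diagonal term of
  \<open>err_kernel_conv\<close>.\<close>

lemma err_kernel_norm:
 assumes f: "err_kernel t A f" and t: "1 <= t"
 shows "(ell2_norm f)\<^sup>2 <= 22 * A\<^sup>2 * t powr (- b)"
proof -
 have s: "supp f \<subseteq> shell t" using f by (simp add: err_kernel_def)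
 have "(ell2_norm f)\<^sup>2 = (\<Sum>x\<in>shell t. (cmod (f x))\<^sup>2)"
  by (rule finite_supp_ell2(2)[OF finite_shell s])
 also have "... <= (\<Sum>x\<in>shell t. A\<^sup>2 * t powr (- 2 * b) * (2 * of_int (ind \<bar>x\<bar>) + 2 * t powr (2 * b - 2)))"
 proof (rule sum_mono)
  fix x assume x: "x \<in> shell t"
  let ?i = "real_of_int (ind \<bar>x\<bar>)" and ?r = "t powr (b - 1)"
  have i: "?i = 0 \<or> ?i = 1" using ind_cases[OF shell_abs_ge_1[OF t x]] by auto
  have "(cmod (f x))\<^sup>2 <= (A * t powr (- b) * (?i + ?r))\<^sup>2"
   using f x by (intro power_mono) (auto simp: err_kernel_def)
  also have "... = A\<^sup>2 * (t powr (- b))\<^sup>2 * (?i + ?r)\<^sup>2" by (simp add: power_mult_distrib)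
  also have "(t powr (- b))\<^sup>2 = t powr (- 2 * b)" using t by (simp add: power2_eq_square powr_add[symmetric])
  also have "A\<^sup>2 * t powr (- 2 * b) * (?i + ?r)\<^sup>2 <= A\<^sup>2 * t powr (- 2 * b) * (2 * ?i + 2 * t powr (2 * b - 2))"
  proof (rule mult_left_mono)
   have "(?i + ?r)\<^sup>2 <= 2 * ?i\<^sup>2 + 2 * ?r\<^sup>2"
    using sum_squares_bound[of ?i ?r] by (simp add: power2_sum)
   moreover have "?i\<^sup>2 = ?i" using i by auto
   moreover have "?r\<^sup>2 = t powr (2 * b - 2)" using t by (simp add: power2_eq_square powr_add[symmetric])
   ultimately show "(?i + ?r)\<^sup>2 <= 2 * ?i + 2 * t powr (2 * b - 2)" by simp
  qed simp
  finally show "(cmod (f x))\<^sup>2 <= A\<^sup>2 * t powr (- 2 * b) * (2 * ?i + 2 * t powr (2 * b - 2))" .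
 qed
 also have "... = A\<^sup>2 * t powr (- 2 * b) * (2 * (\<Sum>x\<in>shell t. of_int (ind \<bar>x\<bar>)) + real (card (shell t)) * (2 * t powr (2 * b - 2)))"
  by (simp add: sum_distrib_left[symmetric] sum.distrib)
 also have "... <= A\<^sup>2 * t powr (- 2 * b) * (2 * (6 * t powr b) + 5 * t * (2 * t powr (2 * b - 2)))"
  using sum_ind_shell[OF t] card_shell[OF t] by (intro mult_left_mono add_mono mult_right_mono) auto
 also have "... <= A\<^sup>2 * t powr (- 2 * b) * (22 * t powr b)"
 proof (rule mult_left_mono)
  have "t * t powr (2 * b - 2) = t powr 1 * t powr (2 * b - 2)" using t by simp
  also have "... = t powr (2 * b - 1)" by (simp only: powr_add[symmetric]) simp
  also have "... <= t powr b" using t b_bounds by (intro powr_mono) auto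
  finally show "2 * (6 * t powr b) + 5 * t * (2 * t powr (2 * b - 2)) <= 22 * t powr b" by simp
 qed simp
 also have "... = 22 * A\<^sup>2 * (t powr (- 2 * b) * t powr b)" by simp
 also have "... = 22 * A\<^sup>2 * t powr (- b)" by (simp add: powr_add[symmetric])
 finally show ?thesis .
qed

text \<open>Off the diagonal nothing is lost: about t powr (2 * b - 1) pairs of members with
  difference x, each of weight t powr (- 2 * b), give 1 / t, as for a smooth kernel of height 1 / t.
  The range of x lies within that of the pair count and is too short for y and y + x to have
  opposite signs.\<close>

lemma err_kernel_acorr:
 "\<exists>C>0. \<forall>t A f x. err_kernel t A f --> 1 <= t --> x ~= 0 --> \<bar>of_int x\<bar> <= t powr b / 16 -->
   cmod (acorr f x) <= C * A\<^sup>2 / t"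
proof -
 obtain C0 where C0: "0 < C0" "!!t x. 1 <= t ==> 1 <= x ==> of_int x <= t powr b
   ==> real (card (pair_set t x)) <= C0 * t powr (2 * b - 1)" using card_pair_set by blast
 have main: "cmod (acorr f x) <= (4 * C0 + 17) * A\<^sup>2 / t"
  if f: "err_kernel t A f" and t: "1 <= t" and x: "x ~= 0" "\<bar>of_int x\<bar> <= t powr b / 16" for t A f x
 proof -
  let ?r = "t powr (b - 1)"
  define i where "i = (%y::int. real_of_int (ind \<bar>y\<bar>))"
  define B where "B = {y. y \<in> shell t & y + x \<in> shell t}"
  have finB: "finite B" unfolding B_def using finite_shell by simp
  have s: "supp f \<subseteq> shell t" using f by (simp add: err_kernel_def)
  have i01: "i y = 0 \<or> i y = 1" if "y \<in> shell t" for y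
   using ind_cases[OF shell_abs_ge_1[OF t that]] by (auto simp: i_def)
  have fb: "cmod (f y) <= A * t powr (- b) * (i y + ?r)" if "y \<in> shell t" for y
   using f that by (auto simp: err_kernel_def i_def)
  have A0: "0 <= A" using f by (simp add: err_kernel_def)
  have "acorr f x = (\<Sum>y\<in>B. cnj (f y) * f (y + x))" unfolding acorr_def
  proof (rule sum.mono_neutral_cong)
   show "!!y. y \<in> B - supp f ==> cnj (f y) * f (y + x) = 0" by (auto simp: supp_def)
   show "!!y. y \<in> supp f - B ==> cnj (f y) * f (y + x) = 0" using s by (auto simp: supp_def B_def)
  qed (use finB err_kernel_finite[OF f] in auto)
  then have "cmod (acorr f x) <= (\<Sum>y\<in>B. cmod (f y) * cmod (f (y + x)))"
   using norm_sum[of "%y. cnj (f y) * f (y + x)" B] by (simp add: norm_mult)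
  also have "... <= (\<Sum>y\<in>B. (A * t powr (- b) * (i y + ?r)) * (A * t powr (- b) * (i (y + x) + ?r)))"
  proof (rule sum_mono)
   fix y assume "y \<in> B"
   then have y: "y \<in> shell t" "y + x \<in> shell t" by (auto simp: B_def)
   have "0 <= i y" using i01[OF y(1)] by auto
   then show "cmod (f y) * cmod (f (y + x)) <= (A * t powr (- b) * (i y + ?r)) * (A * t powr (- b) * (i (y + x) + ?r))"
    using fb[OF y(1)] fb[OF y(2)] A0 by (intro mult_mono) auto
  qed
  also have "... = (A * t powr (- b))\<^sup>2 * ((\<Sum>y\<in>B. i y * i (y + x)) + ?r * ((\<Sum>y\<in>B. i y) + (\<Sum>y\<in>B. i (y + x))) + real (card B) * ?r\<^sup>2)"
  proof -
   have "(A * t powr (- b) * (i y + ?r)) * (A * t powr (- b) * (i (y + x) + ?r))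
    = (A * t powr (- b))\<^sup>2 * (i y * i (y + x) + ?r * (i y + i (y + x)) + ?r\<^sup>2)" for y
    by (simp add: power2_eq_square algebra_simps)
   then show ?thesis by (simp add: sum_distrib_left[symmetric] sum.distrib)
  qed
  also have "... <= (A * t powr (- b))\<^sup>2 * (4 * (C0 * t powr (2 * b - 1)) + ?r * (6 * t powr b + 6 * t powr b) + 5 * t * ?r\<^sup>2)"
  proof (intro mult_left_mono add_mono mult_right_mono)
   define p where "p = \<bar>x\<bar>"
   define PS where "PS = pair_set t p"
   \<comment> \<open>One image of the positive pairs for each combination of the signs of y and
     x.\<close>
   define T where "T = PS \<union> (%u. u + p) ` PS \<union> uminus ` PS \<union> (%u. - u - p) ` PS"
   have p1: "1 <= p" using x by (simp add: p_def)
   have pt: "of_int p <= t powr b / 16" using x by (simp add: p_def)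
   have tb: "t powr b <= t" using powr_mono[of b 1 t] t b_bounds by simp
   have finPS: "finite PS" unfolding PS_def by (rule finite_pair_set)
   have "card T <= card PS + card PS + card PS + card PS"
    unfolding T_def by (intro order_trans[OF card_Un_le] add_mono card_image_le finPS order_refl)
   moreover have "real (card PS) <= C0 * t powr (2 * b - 1)" unfolding PS_def using pt p1 by (intro C0 t) auto
   ultimately have cT: "real (card T) <= 4 * (C0 * t powr (2 * b - 1))" by linarith
   have sub: "{y\<in>B. i y * i (y + x) ~= 0} \<subseteq> T"
   proof
    fix y assume "y \<in> {y\<in>B. i y * i (y + x) ~= 0}"
    then have y: "y \<in> shell t" "y + x \<in> shell t" "ind \<bar>y\<bar> = 1" "ind \<bar>y + x\<bar> = 1"
     using i01[of y] i01[of "y + x"] by (auto simp: B_def i_def)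
    have y8: "t / 8 <= \<bar>real_of_int y\<bar>" "t / 8 <= \<bar>real_of_int (y + x)\<bar>"
     "\<bar>real_of_int y\<bar> <= 2 * t" "\<bar>real_of_int (y + x)\<bar> <= 2 * t" using y by (auto simp: shell_def)
    have px: "real_of_int p < \<bar>real_of_int y\<bar>" using pt tb y8 t by linarith
    then have pyi: "p < \<bar>y\<bar>" by linarith
    consider "0 < y" "0 < x" | "y < 0" "0 < x" | "0 < y" "x < 0" | "y < 0" "x < 0"
     using x pyi by (cases "0 < y"; cases "0 < x") (auto simp: p_def)
    then show "y \<in> T"
    proof cases
     case 1
     then have "y \<in> PS" using y y8 by (auto simp: PS_def pair_set_def p_def)
     then show ?thesis by (simp add: T_def)
    next
     case 2
     have "- y - p \<in> PS"
     proof -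
      have "\<bar>y + x\<bar> = - y - p" "\<bar>y\<bar> = - y - p + p" using 2 pyi by (auto simp: p_def)
      then show ?thesis using y y8 2 by (auto simp: PS_def pair_set_def p_def)
     qed
     then have "- (- y - p) - p \<in> (%u. - u - p) ` PS" by (rule imageI)
     then show ?thesis by (simp add: T_def)
    next
     case 3
     have "y - p \<in> PS"
     proof -
      have "\<bar>y + x\<bar> = y - p" "\<bar>y\<bar> = y - p + p" using 3 pyi by (auto simp: p_def)
      then show ?thesis using y y8 3 by (auto simp: PS_def pair_set_def p_def)
     qed
     then have "(y - p) + p \<in> (%u. u + p) ` PS" by (rule imageI)
     then show ?thesis by (simp add: T_def)
    next
     case 4
     have "- y \<in> PS"
     proof -
      have "\<bar>y + x\<bar> = - y + p" "\<bar>y\<bar> = - y" using 4 by (auto simp: p_def)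
      then show ?thesis using y y8 4 by (auto simp: PS_def pair_set_def p_def)
     qed
     then have "- (- y) \<in> uminus ` PS" by (rule imageI)
     then show ?thesis by (simp add: T_def)
    qed
   qed
   have "(\<Sum>y\<in>B. i y * i (y + x)) = (\<Sum>y\<in>{y\<in>B. i y * i (y + x) ~= 0}. i y * i (y + x))"
    by (rule sum.mono_neutral_right[OF finB]) auto
   also have "... <= (\<Sum>y\<in>{y\<in>B. i y * i (y + x) ~= 0}. 1)"
    proof (rule sum_mono)
    fix y assume "y \<in> {y\<in>B. i y * i (y + x) ~= 0}"
    then show "i y * i (y + x) <= 1" using i01[of y] i01[of "y + x"] by (auto simp: B_def)
   qed
   also have "... <= real (card T)" using sub finPS by (simp add: T_def card_mono)
   finally show "(\<Sum>y\<in>B. i y * i (y + x)) <= 4 * (C0 * t powr (2 * b - 1))" using cT by simp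
   have i0: "0 <= i y" if "y \<in> shell t" for y using i01[OF that] by auto
   have S: "(\<Sum>y\<in>shell t. i y) <= 6 * t powr b" unfolding i_def by (rule sum_ind_shell[OF t])
   have "(\<Sum>y\<in>B. i y) <= (\<Sum>y\<in>shell t. i y)"
    using i0 by (intro sum_mono2 finite_shell) (auto simp: B_def)
   then show "(\<Sum>y\<in>B. i y) <= 6 * t powr b" using S by simp
   have "(\<Sum>y\<in>B. i (y + x)) = (\<Sum>y\<in>(%y. y + x) ` B. i y)" by (subst sum.reindex) (auto simp: inj_on_def)
   also have "... <= (\<Sum>y\<in>shell t. i y)" using i0 by (intro sum_mono2 finite_shell) (auto simp: B_def)
   finally show "(\<Sum>y\<in>B. i (y + x)) <= 6 * t powr b" using S by simp
   have "card B <= card (shell t)" by (rule card_mono[OF finite_shell]) (auto simp: B_def)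
   then show "real (card B) <= 5 * t" using card_shell[OF t] by linarith
  qed auto
  also have "... = A\<^sup>2 * (t powr (- 2 * b) * ((4 * C0 + 17) * t powr (2 * b - 1)))"
  proof -
   have 1: "(t powr (- b))\<^sup>2 = t powr (- 2 * b)" using t by (simp add: power2_eq_square powr_add[symmetric])
   have 2: "?r * t powr b = t powr (2 * b - 1)" by (simp add: powr_add[symmetric])
   have "t * ?r\<^sup>2 = t powr 1 * (t powr (b - 1) * t powr (b - 1))" using t by (simp add: power2_eq_square)
   also have "... = t powr (2 * b - 1)" by (simp only: powr_add[symmetric]) simp
   finally have 3: "t * ?r\<^sup>2 = t powr (2 * b - 1)" .
   have "4 * (C0 * t powr (2 * b - 1)) + ?r * (6 * t powr b + 6 * t powr b) + 5 * t * ?r\<^sup>2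
    = 4 * (C0 * t powr (2 * b - 1)) + 12 * (?r * t powr b) + 5 * (t * ?r\<^sup>2)" by (simp add: algebra_simps)
   also have "... = (4 * C0 + 17) * t powr (2 * b - 1)" unfolding 2 3 by (simp add: algebra_simps)
   finally show ?thesis by (simp add: power_mult_distrib 1)
  qed
  also have "... = A\<^sup>2 * ((4 * C0 + 17) * (t powr (- 2 * b) * t powr (2 * b - 1)))" by simp
  also have "t powr (- 2 * b) * t powr (2 * b - 1) = t powr (- 1)" by (simp only: powr_add[symmetric]) simp
  also have "t powr (- 1) = 1 / t" using t by (simp add: powr_minus_divide)
  finally show ?thesis by (simp add: mult_ac)
 qed
 show ?thesis by (rule exI[of _ "4 * C0 + 17"]) (use main C0 in auto)
qed

text \<open>If t2 powr b < 64 * t1, the Fourier bound for f1 gains t1 powr (- 1 / 60), and the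
  excess in the norm of f2 is only of order t1 powr (1 / 2000). Otherwise \<open>acorr f1\<close>
  lives where the off-diagonal bound for f2 holds. The off-diagonal part is then at most a constant
  / t2 times the l1 norm of \<open>acorr f1\<close>, which is small by Cauchy--Schwarz and the
  Fourier bound; on the diagonal, the excess t2 powr (1 - b) <= M powr (1 - b) is beaten by t1 powr
  (- b) <= M powr (- \<theta> * b).\<close>

lemma err_kernel_conv:
 "\<exists>C>0. \<forall>t1 t2 A1 A2 f1 f2 M \<theta> \<delta>.
   err_kernel t1 A1 f1 --> err_kernel t2 A2 f2 --> 1 <= M --> 0 < \<delta> --> \<theta> = \<delta> + (\<alpha> - 1) --> \<theta> < 1 -->
   M powr \<theta> <= t1 --> t1 <= t2 --> t2 <= M -->
   ell2_norm (conv f1 f2) <= C * A1 * A2 * M powr (- \<delta> / 160) * t2 powr (- 1 / 2)"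
proof -
 obtain C0 where C0: "0 < C0" "!!t A f x. err_kernel t A f ==> 1 <= t ==> x ~= 0
   ==> \<bar>of_int x\<bar> <= t powr b / 16 ==> cmod (acorr f x) <= C0 * A\<^sup>2 / t" using err_kernel_acorr by blast
 define C where "C = 320 + sqrt (484 + 15 * C0)"
 have main: "ell2_norm (conv f1 f2) <= C * A1 * A2 * M powr (- \<delta> / 160) * t2 powr (- 1 / 2)"
  if f1: "err_kernel t1 A1 f1" and f2: "err_kernel t2 A2 f2" and M: "1 <= M" and d: "0 < \<delta>"
   and th: "\<theta> = \<delta> + (\<alpha> - 1)" "\<theta> < 1" and t: "M powr \<theta> <= t1" "t1 <= t2" "t2 <= M"
  for t1 t2 A1 A2 f1 f2 M \<theta> \<delta>
 proof -
  have th0: "\<delta> <= \<theta>" "0 < \<theta>" using th d alpha by auto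
  have M1: "1 <= M powr \<theta>" using M th0 by (intro ge_one_powr_ge_zero) auto
  have t1: "1 <= t1" and t2: "1 <= t2" using M1 t by linarith+
  have A: "0 <= A1" "0 <= A2" using f1 f2 by (auto simp: err_kernel_def)
  have fin: "finite (supp f1)" "finite (supp f2)" using f1 f2 err_kernel_finite by auto
  have gain: "t1 powr (- e) <= M powr (- \<delta> * e)" if e: "0 <= e" for e
  proof -
   have "t1 powr (- e) <= (M powr \<theta>) powr (- e)" using t M1 e by (intro powr_mono2') auto
   also have "... = M powr (- \<theta> * e)" by (simp add: powr_powr)
   also have "... <= M powr (- \<delta> * e)" using M th0 e by (intro powr_mono) (auto intro: mult_right_mono)
   finally show ?thesis .
  qed
  have n1: "(ell2_norm f1)\<^sup>2 <= 22 * A1\<^sup>2 * t1 powr (- b)" by (rule err_kernel_norm[OF f1 t1])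
  have n2: "(ell2_norm f2)\<^sup>2 <= 22 * A2\<^sup>2 * t2 powr (- b)" by (rule err_kernel_norm[OF f2 t2])
  have sqn: "ell2_norm f <= 5 * A * t powr (- b / 2)" if "(ell2_norm f)\<^sup>2 <= 22 * A\<^sup>2 * t powr (- b)" "0 <= A" "1 <= t" for f A t
  proof (rule power2_le_imp_le)
   have "(t powr (- b / 2))\<^sup>2 = t powr (- b)" using that by (simp add: power2_eq_square powr_add[symmetric])
   then have "(5 * A * t powr (- b / 2))\<^sup>2 = 25 * A\<^sup>2 * t powr (- b)" by (simp add: power_mult_distrib)
   moreover have "22 * (A\<^sup>2 * t powr (- b)) <= 25 * (A\<^sup>2 * t powr (- b))" by (intro mult_right_mono) auto
   ultimately show "(ell2_norm f)\<^sup>2 <= (5 * A * t powr (- b / 2))\<^sup>2" using that(1) by linarith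
  qed (use that in auto)
  show ?thesis
  proof (cases "64 * t1 > t2 powr b")
   case True
   have "ell2_norm (conv f1 f2) <= A1 * t1 powr (- 1 / 60) * ell2_norm f2"
    using f1 by (intro ell2_norm_conv_le_ft fin) (auto simp: err_kernel_def)
   also have "... <= A1 * t1 powr (- 1 / 60) * (5 * A2 * t2 powr (- b / 2))"
    using sqn[OF n2 A(2) t2] A by (intro mult_left_mono) auto
   also have "t2 powr (- b / 2) = t2 powr ((1 - b) / 2) * t2 powr (- 1 / 2)"
    by (simp add: powr_add[symmetric] field_simps)
   also have "A1 * t1 powr (- 1 / 60) * (5 * A2 * (t2 powr ((1 - b) / 2) * t2 powr (- 1 / 2)))
     <= A1 * t1 powr (- 1 / 60) * (5 * A2 * ((64 * t1 powr (1 / 2000)) * t2 powr (- 1 / 2)))"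
   proof (intro mult_left_mono mult_right_mono)
    \<comment> \<open>t2 is at most (64 * t1) powr \<alpha>, and \<alpha> * (1 - b) = \<alpha> - 1
      <= 1/1000.\<close>
    have "t2 = (t2 powr b) powr \<alpha>" using t2 by (simp add: powr_alpha_b)
    also have "... <= (64 * t1) powr \<alpha>" using True alpha by (intro powr_mono2) auto
    finally have "t2 powr ((1 - b) / 2) <= ((64 * t1) powr \<alpha>) powr ((1 - b) / 2)"
     using t2 b_bounds by (intro powr_mono2) auto
    also have "... = (64 * t1) powr ((\<alpha> - 1) / 2)" using b_bounds by (simp add: powr_powr algebra_simps)
    also have "... <= (64 * t1) powr (1 / 2000)" using t1 alpha by (intro powr_mono) auto
    also have "... = 64 powr (1 / 2000) * t1 powr (1 / 2000)" using t1 by (simp add: powr_mult)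
    also have "... <= 64 powr 1 * t1 powr (1 / 2000)" by (intro mult_right_mono powr_mono) auto
    finally show "t2 powr ((1 - b) / 2) <= 64 * t1 powr (1 / 2000)" by simp
   qed (use A in auto)
   also have "... = 320 * A1 * A2 * (t1 powr (- 1 / 60) * t1 powr (1 / 2000)) * t2 powr (- 1 / 2)" by simp
   also have "t1 powr (- 1 / 60) * t1 powr (1 / 2000) = t1 powr (- 1 / 60 + 1 / 2000)" by (simp only: powr_add)
   also have "320 * A1 * A2 * t1 powr (- 1 / 60 + 1 / 2000) * t2 powr (- 1 / 2)
     <= C * A1 * A2 * M powr (- \<delta> / 160) * t2 powr (- 1 / 2)"
   proof (intro mult_mono)
    have "t1 powr (- 1 / 60 + 1 / 2000) <= t1 powr (- (1 / 160))" using t1 by (intro powr_mono) auto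
    also have "... <= M powr (- \<delta> / 160)" using gain[of "1/160"] by simp
    finally show "t1 powr (- 1 / 60 + 1 / 2000) <= M powr (- \<delta> / 160)" .
    show "320 <= C" unfolding C_def using C0 by simp
   qed (use A C0 in \<open>auto simp: C_def\<close>)
   finally show ?thesis .
  next
   case False
   define N where "N = \<lfloor>4 * t1\<rfloor>"
   have N: "of_int N <= 4 * t1" "1 <= N" using t1 by (auto simp: N_def le_floor_iff)
   have sA: "supp (acorr f1) \<subseteq> {-N..N}"
   proof
    fix x assume "x \<in> supp (acorr f1)"
    then have "(\<Sum>y\<in>supp f1. cnj (f1 y) * f1 (y + x)) ~= 0" by (simp add: supp_def acorr_def)
    then obtain y where y: "y \<in> supp f1" "cnj (f1 y) * f1 (y + x) ~= 0" by (meson sum.neutral)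
    then have "y \<in> shell t1" "y + x \<in> shell t1" using f1 by (auto simp: err_kernel_def supp_def)
    then have "\<bar>real_of_int x\<bar> <= 4 * t1" by (auto simp: shell_def)
    then have "\<bar>x\<bar> <= N" by (simp add: N_def le_floor_iff)
    then show "x \<in> {-N..N}" by auto
   qed
   have "(ell2_norm (conv f1 f2))\<^sup>2 <= (\<Sum>x\<in>{-N..N}. cmod (acorr f1 x) * cmod (acorr f2 x))"
    by (rule ell2_norm_conv_acorr[OF fin _ sA]) simp
   also have "... = cmod (acorr f1 0) * cmod (acorr f2 0) + (\<Sum>x\<in>{-N..N}-{0}. cmod (acorr f1 x) * cmod (acorr f2 x))"
    using N by (subst sum.remove[of _ 0]) auto
   also have "... <= (22 * A1\<^sup>2 * t1 powr (- b)) * (22 * A2\<^sup>2 * t2 powr (- b)) + C0 * A2\<^sup>2 / t2 * (15 * A1\<^sup>2 * t1 powr (- 1 / 80))"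
   proof (rule add_mono)
    show "cmod (acorr f1 0) * cmod (acorr f2 0) <= (22 * A1\<^sup>2 * t1 powr (- b)) * (22 * A2\<^sup>2 * t2 powr (- b))"
     using n1 n2 fin by (intro mult_mono) (auto simp: acorr_0 norm_of_real simp del: of_real_power)
    have "(\<Sum>x\<in>{-N..N}-{0}. cmod (acorr f1 x) * cmod (acorr f2 x)) <= (\<Sum>x\<in>{-N..N}-{0}. cmod (acorr f1 x) * (C0 * A2\<^sup>2 / t2))"
    proof (intro sum_mono mult_left_mono)
     fix x assume x: "x \<in> {-N..N} - {0}"
     have "\<bar>x\<bar> <= N" using x by auto
     then have "\<bar>real_of_int x\<bar> <= of_int N" by linarith
     then have "\<bar>real_of_int x\<bar> <= t2 powr b / 16" using N False by linarith
     then show "cmod (acorr f2 x) <= C0 * A2\<^sup>2 / t2" using x by (intro C0(2) f2 t2) auto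
    qed auto
    also have "... = C0 * A2\<^sup>2 / t2 * (\<Sum>x\<in>{-N..N}-{0}. cmod (acorr f1 x))"
     by (simp add: sum_distrib_left mult.commute)
    also have "... <= C0 * A2\<^sup>2 / t2 * (15 * A1\<^sup>2 * t1 powr (- 1 / 80))"
    proof (rule mult_left_mono)
     have "(\<Sum>x\<in>{-N..N}-{0}. cmod (acorr f1 x)) <= (\<Sum>x\<in>{-N..N}. 1 * cmod (acorr f1 x))"
      unfolding mult_1 by (intro sum_mono2) auto
     also have "... <= L2_set (%x. 1) {-N..N} * L2_set (%x. cmod (acorr f1 x)) {-N..N}"
      using L2_set_mult_ineq[of "%x. 1" "%x. cmod (acorr f1 x)" "{-N..N}"] by simp
     also have "... <= (3 * t1 powr (1 / 2)) * (A1 * t1 powr (- 1 / 60) * (5 * A1 * t1 powr (- b / 2)))"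
     proof (rule mult_mono)
      have "L2_set (%x. 1) {-N..N} = sqrt (real (card {-N..N}))" by (simp add: L2_set_def)
      also have "... <= sqrt (9 * t1)" using N t1 by (intro real_sqrt_le_mono) simp
      also have "... = 3 * t1 powr (1 / 2)" using t1 by (simp add: real_sqrt_mult powr_half_sqrt)
      finally show "L2_set (%x. 1) {-N..N} <= 3 * t1 powr (1 / 2)" .
      have ft1: "!!\<xi>. cmod (ft f1 \<xi>) <= A1 * t1 powr (- 1 / 60)" using f1 by (simp add: err_kernel_def)
      have "L2_set (%x. cmod (acorr f1 x)) {-N..N} <= ell2_norm (acorr f1)"
       by (intro L2_set_le_ell2_norm supp_in_ell2 ell2_norm_acorr(1)[OF fin(1) ft1])
      also have "... <= A1 * t1 powr (- 1 / 60) * ell2_norm f1" by (rule ell2_norm_acorr(2)[OF fin(1) ft1])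
      also have "... <= A1 * t1 powr (- 1 / 60) * (5 * A1 * t1 powr (- b / 2))"
       using sqn[OF n1 A(1) t1] A by (intro mult_left_mono) auto
      finally show "L2_set (%x. cmod (acorr f1 x)) {-N..N} <= A1 * t1 powr (- 1 / 60) * (5 * A1 * t1 powr (- b / 2))" .
     qed auto
     also have "... = 15 * A1\<^sup>2 * (t1 powr (1 / 2) * (t1 powr (- 1 / 60) * t1 powr (- b / 2)))"
      by (simp add: power2_eq_square)
     also have "t1 powr (1 / 2) * (t1 powr (- 1 / 60) * t1 powr (- b / 2)) = t1 powr (1 / 2 + (- 1 / 60 + - b / 2))"
      by (simp only: powr_add)
     also have "15 * A1\<^sup>2 * t1 powr (1 / 2 + (- 1 / 60 + - b / 2)) <= 15 * A1\<^sup>2 * t1 powr (- 1 / 80)"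
      using t1 b_bounds by (intro mult_left_mono powr_mono) auto
     finally show "(\<Sum>x\<in>{-N..N}-{0}. cmod (acorr f1 x)) <= 15 * A1\<^sup>2 * t1 powr (- 1 / 80)" .
    qed (use C0 t2 in auto)
    finally show "(\<Sum>x\<in>{-N..N}-{0}. cmod (acorr f1 x) * cmod (acorr f2 x)) <= C0 * A2\<^sup>2 / t2 * (15 * A1\<^sup>2 * t1 powr (- 1 / 80))" .
   qed
   also have "... = A1\<^sup>2 * A2\<^sup>2 * (484 * (t1 powr (- b) * t2 powr (- b)) + 15 * C0 * (t1 powr (- 1 / 80) / t2))"
    by (simp add: algebra_simps)
   also have "... <= A1\<^sup>2 * A2\<^sup>2 * (484 * (M powr (- \<delta> / 80) / t2) + 15 * C0 * (M powr (- \<delta> / 80) / t2))"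
   proof (intro mult_left_mono add_mono divide_right_mono)
    have e1: "1 - b = b * (\<alpha> - 1)" using b_bounds by (simp add: algebra_simps)
    have "t2 powr (- b) = t2 powr (1 - b) * t2 powr (- 1)" by (simp only: powr_add[symmetric]) simp
    also have "... <= M powr (1 - b) * t2 powr (- 1)" using t t2 b_bounds by (intro mult_right_mono powr_mono2) auto
    finally have a: "t2 powr (- b) <= M powr (1 - b) / t2" using t2 by (simp add: powr_minus_divide)
    have c: "t1 powr (- b) <= M powr (- \<theta> * b)"
    proof -
     have "t1 powr (- b) <= (M powr \<theta>) powr (- b)" using t M1 b_bounds by (intro powr_mono2') auto
     then show ?thesis by (simp add: powr_powr)
    qed
    have "t1 powr (- b) * t2 powr (- b) <= M powr (- \<theta> * b) * (M powr (1 - b) / t2)"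
     using a c by (intro mult_mono) auto
    also have "... = M powr (- \<theta> * b + (1 - b)) / t2" by (simp only: powr_add times_divide_eq_right)
    also have "... <= M powr (- \<delta> / 80) / t2"
    proof (intro divide_right_mono powr_mono)
     \<comment> \<open>The diagonal is harmless precisely because \<theta> exceeds \<alpha> -
       1.\<close>
     have "- \<theta> * b + (1 - b) = - (b * \<delta>)" unfolding e1 th by (simp add: algebra_simps)
     also have "... <= - ((1 / 80) * \<delta>)" using b_bounds d mult_right_mono[of "1/80" b \<delta>] by simp
     finally show "- \<theta> * b + (1 - b) <= - \<delta> / 80" by simp
    qed (use M t2 in auto)
    finally show "t1 powr (- b) * t2 powr (- b) <= M powr (- \<delta> / 80) / t2" .
    show "t1 powr (- 1 / 80) <= M powr (- \<delta> / 80)" using gain[of "1/80"] by simp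
   qed (use C0 t2 in auto)
   also have "... = (sqrt (484 + 15 * C0) * A1 * A2 * M powr (- \<delta> / 160) * t2 powr (- 1 / 2))\<^sup>2"
   proof -
    have "(M powr (- \<delta> / 160))\<^sup>2 = M powr (- \<delta> / 80)" using M by (simp add: power2_eq_square powr_add[symmetric])
    moreover have "(t2 powr (- 1 / 2))\<^sup>2 = 1 / t2"
     using t2 by (simp add: power2_eq_square powr_add[symmetric] powr_minus_divide)
    ultimately show ?thesis using C0 by (simp add: power_mult_distrib add_divide_distrib algebra_simps)
   qed
   finally have "ell2_norm (conv f1 f2) <= sqrt (484 + 15 * C0) * A1 * A2 * M powr (- \<delta> / 160) * t2 powr (- 1 / 2)"
    by (rule power2_le_imp_le) (use A C0 in auto)
   also have "... <= C * A1 * A2 * M powr (- \<delta> / 160) * t2 powr (- 1 / 2)"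
    using A C0 by (intro mult_right_mono) (auto simp: C_def)
   finally show ?thesis .
  qed
 qed
 have "0 < C" unfolding C_def using C0 by (intro add_pos_nonneg) auto
 then show ?thesis using main by blast
qed

end

section \<open>The kernels at a single scale\<close>

lemma sum_abel:
 fixes v c :: "int => complex"
 shows "(\<Sum>x\<in>{1..int N}. v x * c x) = v (int N + 1) * (\<Sum>x\<in>{1..int N}. c x)
  - (\<Sum>x\<in>{1..int N}. (\<Sum>y\<in>{1..x}. c y) * (v (x + 1) - v x))"
proof (induction N)
 case (Suc N)
 define a where "a = int N + 1"
 have a: "int (Suc N) = a" "int N = a - 1" by (simp_all add: a_def)
 have "{1..a} = insert a {1..a - 1}" by (auto simp: a_def)
 then have e: "(\<Sum>x\<in>{1..a}. F x) = F a + (\<Sum>x\<in>{1..a - 1}. F x)" for F :: "int => complex" by simp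
 define V where "V = (\<Sum>x\<in>{1..a - 1}. (\<Sum>y\<in>{1..x}. c y) * (v (x + 1) - v x))"
 define U where "U = (\<Sum>x\<in>{1..a - 1}. c x)"
 have IH: "(\<Sum>x\<in>{1..a - 1}. v x * c x) = v a * U - V"
  using Suc unfolding a U_def[symmetric] V_def[symmetric] by simp
 show ?case unfolding a e[of "%x. v x * c x"] e[of "%x. (\<Sum>y\<in>{1..x}. c y) * (v (x + 1) - v x)"] IH e[of c]
   U_def[symmetric] V_def[symmetric] by (simp only: algebra_simps)
qed simp

lemma sum_abel_bound:
 fixes v c :: "int => complex"
 assumes "v (int N + 1) = 0" and "!!y. y \<in> {1..int N} ==> cmod (\<Sum>x\<in>{1..y}. c x) <= B"
  and V: "(\<Sum>x\<in>{1..int N}. cmod (v (x + 1) - v x)) <= V" and B: "0 <= B"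
 shows "cmod (\<Sum>x\<in>{1..int N}. v x * c x) <= B * V"
proof -
 have "cmod (\<Sum>x\<in>{1..int N}. v x * c x) = cmod (\<Sum>x\<in>{1..int N}. (\<Sum>y\<in>{1..x}. c y) * (v (x + 1) - v x))"
  using sum_abel[of v c N] assms(1) by simp
 also have "... <= (\<Sum>x\<in>{1..int N}. B * cmod (v (x + 1) - v x))"
  by (intro order_trans[OF norm_sum] sum_mono) (auto simp: norm_mult intro!: mult_right_mono assms)
 also have "... = B * (\<Sum>x\<in>{1..int N}. cmod (v (x + 1) - v x))" by (simp add: sum_distrib_left)
 also have "... <= B * V" using V B by (rule mult_left_mono)
 finally show ?thesis .
qed

text \<open>Applied to sequences on the positive integers, where it is the odd extension: the kernel
  form of f (x - y) - f (x + y), see \<open>conv_antisym_part\<close>.\<close>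

definition antisym_part :: "(int => complex) => int => complex" where
 "antisym_part f x = f x - f (- x)"

locale rough_kernels = power_sequence +
 fixes \<phi> :: "nat => real => complex"
 assumes phi: "uniformly_Cc_smooth \<phi>"
begin

lemma phi_support:
 assumes t: "t \<in> dyadic" and u: "\<phi> t u ~= 0"
 shows "1/2 < u & u < 2"
proof -
 have "closure {x. \<phi> t x ~= 0} \<subseteq> {1/2<..<2}" using phi t unfolding uniformly_Cc_smooth_def by simp
 moreover have "u \<in> closure {x. \<phi> t x ~= 0}" using u closure_subset[of "{x. \<phi> t x ~= 0}"] by auto
 ultimately show ?thesis by auto
qed

lemma phi_props:
 "\<exists>B\<ge>1. \<forall>t\<in>dyadic. (\<forall>u. cmod (\<phi> t u) <= B) & (\<forall>u v. cmod (\<phi> t u - \<phi> t v) <= B * \<bar>u - v\<bar>)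
   & (\<forall>u. \<phi> t u ~= 0 --> 1/2 < u & u < 2)"
proof -
 have n0: "nderiv 0 g = g" for g by (simp add: nderiv_def)
 have n1: "nderiv 1 g = (%x. vector_derivative g (at x))" for g by (simp add: nderiv_def)
 have ex: "\<exists>B. \<forall>s\<in>dyadic. \<forall>x. cmod (nderiv k (\<phi> s) x) <= B" for k
  using phi by (simp add: uniformly_Cc_smooth_def)
 obtain B0 where B0': "\<forall>t\<in>dyadic. \<forall>u. cmod (\<phi> t u) <= B0"
  using ex[of 0] unfolding n0 by (elim exE)
 obtain B1 where B1': "\<forall>t\<in>dyadic. \<forall>u. cmod (vector_derivative (\<phi> t) (at u)) <= B1"
  using ex[of 1] unfolding n1 by (elim exE)
 note B0 = B0'[rule_format] and B1 = B1'[rule_format]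
 define B where "B = max 1 (max B0 B1)"
 show ?thesis
 proof (intro exI[of _ B] conjI ballI allI)
  show "1 <= B" by (simp add: B_def)
  fix t assume t: "t \<in> dyadic"
  show "cmod (\<phi> t u) <= B" for u using B0[OF t, of u] by (simp add: B_def)
  show "cmod (\<phi> t u - \<phi> t v) <= B * \<bar>u - v\<bar>" for u v
  proof -
   have "norm (\<phi> t u - \<phi> t v) <= B * norm (u - v)"
   proof (rule differentiable_bound[of UNIV "\<phi> t" "%x h. h *\<^sub>R vector_derivative (\<phi> t) (at x)"])
    fix x :: real
    have "nderiv 0 (\<phi> t) differentiable (at x)" using phi t unfolding uniformly_Cc_smooth_def by simp
    then show "(\<phi> t has_derivative (%h. h *\<^sub>R vector_derivative (\<phi> t) (at x))) (at x)"
     unfolding n0 by (simp add: vector_derivative_works has_vector_derivative_def)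
    show "onorm (%h. h *\<^sub>R vector_derivative (\<phi> t) (at x)) <= B"
    proof (rule onorm_le)
     fix h :: real
     have "cmod (vector_derivative (\<phi> t) (at x)) <= B" using B1[OF t, of x] by (simp add: B_def)
     then show "norm (h *\<^sub>R vector_derivative (\<phi> t) (at x)) <= B * norm h"
      by (simp add: mult.commute[of "\<bar>h\<bar>"] mult_right_mono)
    qed
   qed auto
   then show ?thesis by simp
  qed
  fix u
  show "\<phi> t u ~= 0 --> 1/2 < u & u < 2" using phi_support[OF t] by simp
 qed
qed

section \<open>Weights, density and error at one scale\<close>

definition weight :: "nat => int => complex" where
 "weight t m = \<phi> t (of_int m powr \<alpha> / real t) / of_int m"

text \<open>The weight of the index m, extended to all x >= 1 as a step function by means of
  \<open>mu\<close>. Multiplied by \<open>ind\<close> it gives the transform, by \<open>dens\<close>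
  the smooth kernel, and by their difference the error.\<close>

definition wt :: "nat => int => complex" where
 "wt t x = (if 1 <= x then weight t (mu x) else 0)"

lemma dyadic_ge_1: "t \<in> dyadic ==> 1 <= real t" by (auto simp: dyadic_def)

text \<open>Upper end: x <= (mu x) powr \<alpha>. Lower end: mu x <= 2 * x powr b costs 2 powr
  \<alpha> <= 4 on top of the 1/2 from the support of \<phi>, hence 1/8.\<close>

lemma wt_supp:
 assumes t: "t \<in> dyadic" and x: "wt t x ~= 0"
 shows "1 <= x" "real t / 8 <= of_int x" "of_int x <= 2 * real t"
proof -
 show x1: "1 <= x" using x by (auto simp: wt_def split: if_splits)
 let ?m = "mu x"
 have m: "1 <= ?m" by (rule mu_pos[OF x1])
 have nz: "\<phi> t (of_int ?m powr \<alpha> / real t) ~= 0" using x x1 by (auto simp: wt_def weight_def)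
 have u: "1/2 < of_int ?m powr \<alpha> / real t & of_int ?m powr \<alpha> / real t < 2" by (rule phi_support[OF t nz])
 have t1: "1 <= real t" by (rule dyadic_ge_1[OF t])
 have u': "real t / 2 < of_int ?m powr \<alpha>" "of_int ?m powr \<alpha> < 2 * real t"
  using u t1 by (auto simp: field_simps)
 have xb: "1 <= of_int x powr b" using x1 b_bounds by (intro ge_one_powr_ge_zero) auto
 have "of_int x = (of_int x powr b) powr \<alpha>" using x1 by (simp add: powr_alpha_b)
 also have "... <= of_int ?m powr \<alpha>" using alpha by (intro powr_mono2) (auto simp: mu_def)
 finally show "of_int x <= 2 * real t" using u' by simp
 have "of_int ?m < of_int x powr b + 1" unfolding mu_def by linarith
 then have "of_int ?m <= 2 * of_int x powr b" using xb by linarith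
 then have "of_int ?m powr \<alpha> <= (2 * of_int x powr b) powr \<alpha>" using m alpha by (intro powr_mono2) auto
 also have "... = 2 powr \<alpha> * of_int x" using x1 by (simp add: powr_mult powr_alpha_b)
 also have "... <= 2 powr 2 * of_int x" using x1 alpha by (intro mult_right_mono powr_mono) auto
 finally show "real t / 8 <= of_int x" using u' by simp
qed

text \<open>The weight changes only when the index does, by O(t powr (- 2 * b)) per step: it has
  size t powr (- b) and varies on the scale t powr b of the indices.\<close>

lemma wt_props:
 "\<exists>K\<ge>1. \<forall>t\<in>dyadic. (\<forall>x. cmod (wt t x) <= K * real t powr (- b))
   & (\<forall>x a. 1 <= x --> 0 <= a --> cmod (wt t (x + a) - wt t x) <= K * real t powr (- 2 * b) * of_int (mu (x + a) - mu x))"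
proof -
 obtain B where B: "1 <= B" "!!t u. t \<in> dyadic ==> cmod (\<phi> t u) <= B"
  "!!t u v. t \<in> dyadic ==> cmod (\<phi> t u - \<phi> t v) <= B * \<bar>u - v\<bar>" using phi_props by auto
 note B = B phi_support
 have wb: "cmod (weight t m) <= 2 * B * real t powr (- b)" if t: "t \<in> dyadic" and m: "1 <= m" for t m
 proof (cases "weight t m = 0")
  case False
  have t1: "1 <= real t" by (rule dyadic_ge_1[OF t])
  have "\<phi> t (of_int m powr \<alpha> / real t) ~= 0" using False by (simp add: weight_def)
  then have "1/2 < of_int m powr \<alpha> / real t" using B(4)[OF t] by blast
  then have "real t / 2 <= of_int m powr \<alpha>" using t1 by (simp add: field_simps)
  then have "(real t / 2) powr b <= (of_int m powr \<alpha>) powr b" using t1 b_bounds by (intro powr_mono2) auto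
  then have mb: "real t powr b / 2 <= of_int m"
   using powr_shift_bounds(4)[of 2 "real t"] t1 m by (simp add: powr_alpha_b)
  have "cmod (weight t m) = cmod (\<phi> t (of_int m powr \<alpha> / real t)) / of_int m"
   using m by (simp add: weight_def norm_divide)
  also have "... <= B / (real t powr b / 2)" using B(1) B(2)[OF t] mb t1 by (intro frac_le) auto
  also have "... = 2 * B * real t powr (- b)" by (simp add: powr_minus_divide)
  finally show ?thesis .
 qed (use B in simp)
 have wl: "cmod (weight t (m + 1) - weight t m) <= 72 * B * real t powr (- 2 * b)" if t: "t \<in> dyadic" and m: "1 <= m" for t m
 proof (cases "weight t (m + 1) = 0 & weight t m = 0")
  case False
  have t1: "1 <= real t" by (rule dyadic_ge_1[OF t])
  let ?m = "real_of_int m" and ?n = "real_of_int (m + 1)"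
  let ?u = "?m powr \<alpha> / real t" and ?v = "?n powr \<alpha> / real t"
  have m1: "1 <= ?m" using m by simp
  have le: "?m powr \<alpha> <= ?n powr \<alpha>" using m1 alpha by (intro powr_mono2) auto
  have "1/2 < ?v & ?n powr \<alpha> <= 8 * real t"
  proof (cases "weight t m = 0")
   case True
   then have "\<phi> t ?v ~= 0" using False by (auto simp: weight_def)
   then have "1/2 < ?v" "?v < 2" using B(4)[OF t] by blast+
   then show ?thesis using t1 by (auto simp: field_simps)
  next
   case False
   then have "\<phi> t ?u ~= 0" by (auto simp: weight_def)
   then have u: "1/2 < ?u" "?u < 2" using B(4)[OF t] by blast+
   moreover have "?u <= ?v" using le t1 by (intro divide_right_mono) auto
   moreover have "?n powr \<alpha> <= (2 * ?m) powr \<alpha>" using m1 alpha by (intro powr_mono2) auto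
   moreover have "(2 * ?m) powr \<alpha> <= 4 * ?m powr \<alpha>"
   proof -
    have "(2::real) powr \<alpha> <= 2 powr 2" using alpha by (intro powr_mono) auto
    then have "(2::real) powr \<alpha> <= 4" by simp
    then show ?thesis using m1 by (subst powr_mult) (auto intro!: mult_right_mono)
   qed
   moreover have "?m powr \<alpha> < 2 * real t" using u(2) t1 by (simp add: field_simps)
   ultimately show ?thesis by linarith
  qed
  then have v: "1/2 < ?v" "?n powr \<alpha> <= 8 * real t" by auto
  have nb: "real t powr b / 2 <= ?n"
  proof -
   have "real t / 2 <= ?n powr \<alpha>" using v(1) t1 by (simp add: field_simps)
   then have "(real t / 2) powr b <= (?n powr \<alpha>) powr b" using t1 b_bounds by (intro powr_mono2) auto
   then show ?thesis using powr_shift_bounds(4)[of 2 "real t"] t1 m powr_alpha_b(1)[of ?n] by simp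
  qed
  have n0: "0 < ?n" using m by simp
  have d: "\<bar>?v - ?u\<bar> <= 16 / ?n"
  proof -
   obtain z where z: "?m < z" "z < ?m + 1" "(?m + 1) powr \<alpha> - ?m powr \<alpha> = 1 * (\<alpha> * z powr (\<alpha> - 1))"
    using power_difference_deriv[of ?m 1] m1 by auto
   have "z powr (\<alpha> - 1) <= ?n powr (\<alpha> - 1)" using z m1 alpha by (intro powr_mono2) auto
   also have "... = ?n powr \<alpha> / ?n" using n0 by (simp add: powr_diff)
   also have "... <= 8 * real t / ?n" using v(2) n0 by (intro divide_right_mono) auto
   finally have "\<alpha> * z powr (\<alpha> - 1) <= 2 * (8 * real t / ?n)" using alpha by (intro mult_mono) auto
   then have "?n powr \<alpha> - ?m powr \<alpha> <= 16 * real t / ?n" using z by (simp add: add.commute)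
   then have "(?n powr \<alpha> - ?m powr \<alpha>) / real t <= 16 * real t / ?n / real t" using t1 by (intro divide_right_mono) auto
   then have "?v - ?u <= 16 / ?n" using t1 by (simp add: diff_divide_distrib)
   moreover have "0 <= ?v - ?u" using le t1 by (simp add: divide_right_mono)
   ultimately show ?thesis by simp
  qed
  have e: "weight t (m + 1) - weight t m = (\<phi> t ?v - \<phi> t ?u) / of_int (m + 1) - \<phi> t ?u * of_real (1 / (?m * ?n))"
  proof -
   have nz: "complex_of_int m ~= 0" "complex_of_int (m + 1) ~= 0" using m by (simp_all only: of_int_eq_0_iff)
   have alg: "q / N - p / M = (q - p) / N - p * (1 / (M * N))" if "M ~= 0" "N ~= 0" "N = M + 1" for p q M N :: complex
   proof -
    have "1 / M = (M + 1) / (M * N)" using that by simp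
    also have "... = 1 / N + 1 / (M * N)" using that by (simp add: add_divide_distrib)
    finally have "p * (1 / M) = p * (1 / N) + p * (1 / (M * N))" by (simp only: distrib_left)
    then show ?thesis by (simp add: diff_divide_distrib)
   qed
   have "complex_of_real (1 / (?m * ?n)) = 1 / (of_int m * of_int (m + 1))" by simp
   then show ?thesis unfolding weight_def using alg[OF nz] by simp
  qed
  have "cmod (weight t (m + 1) - weight t m) <= cmod (\<phi> t ?v - \<phi> t ?u) / ?n + cmod (\<phi> t ?u) * (1 / (?m * ?n))"
  proof -
   have c: "cmod (of_int (m + 1)) = ?n" "cmod (of_real (1 / (?m * ?n))) = 1 / (?m * ?n)"
    using n0 m1 by (simp_all only: norm_of_int norm_of_real) auto
   have "cmod (weight t (m + 1) - weight t m) <= cmod ((\<phi> t ?v - \<phi> t ?u) / of_int (m + 1)) + cmod (\<phi> t ?u * of_real (1 / (?m * ?n)))"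
    unfolding e by (rule norm_triangle_ineq4)
   then show ?thesis unfolding norm_divide norm_mult c .
  qed
  also have "... <= B * (16 / ?n) / ?n + B * (2 / (?n * ?n))"
  proof (rule add_mono)
   have "cmod (\<phi> t ?v - \<phi> t ?u) <= B * (16 / ?n)"
    using B(1) by (intro order_trans[OF B(3)[OF t] mult_left_mono[OF d]]) simp
   then show "cmod (\<phi> t ?v - \<phi> t ?u) / ?n <= B * (16 / ?n) / ?n" using n0 by (intro divide_right_mono) auto
   have "?n <= 2 * ?m" using m by simp
   then have "?n * ?n <= 2 * ?m * ?n" using n0 by (intro mult_right_mono) auto
   then have "1 / (?m * ?n) <= 2 / (?n * ?n)" using n0 m1 by (simp add: field_simps)
   then show "cmod (\<phi> t ?u) * (1 / (?m * ?n)) <= B * (2 / (?n * ?n))"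
    using B(1) B(2)[OF t] m1 n0 by (intro mult_mono) auto
  qed
  also have "... = 18 * B / (?n * ?n)" by (simp add: add_divide_distrib[symmetric])
  also have "... <= 18 * B / (real t powr b / 2 * (real t powr b / 2))"
   using nb n0 t1 B(1) by (intro divide_left_mono mult_mono mult_pos_pos) auto
  also have "... = 72 * B * (real t powr (- b) * real t powr (- b))" by (simp add: powr_minus_divide)
  also have "... = 72 * B * real t powr (- 2 * b)" by (simp add: powr_add[symmetric])
  finally show ?thesis .
 qed (use B in simp)
 have wla: "cmod (weight t (m + int k) - weight t m) <= 72 * B * real t powr (- 2 * b) * real k" if t: "t \<in> dyadic" and m: "1 <= m" for t m k
 proof (induction k)
  case (Suc k)
  have "cmod (weight t (m + int k + 1) - weight t (m + int k)) <= 72 * B * real t powr (- 2 * b)"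
   using m by (intro wl t) simp
  moreover have "weight t (m + int (Suc k)) - weight t m = (weight t (m + int k + 1) - weight t (m + int k)) + (weight t (m + int k) - weight t m)"
   by (simp add: add_ac)
  ultimately have "cmod (weight t (m + int (Suc k)) - weight t m) <= 72 * B * real t powr (- 2 * b) + 72 * B * real t powr (- 2 * b) * real k"
   using Suc by (simp only:) (rule order_trans[OF norm_triangle_ineq add_mono])
  also have "... = 72 * B * real t powr (- 2 * b) * real (Suc k)" by (simp add: distrib_left)
  finally show ?case .
 qed simp
 show ?thesis
 proof (intro exI[of _ "72 * B"] conjI ballI allI impI)
  show "1 <= 72 * B" using B by simp
  fix t assume t: "t \<in> dyadic"
  show "cmod (wt t x) <= 72 * B * real t powr (- b)" for x
  proof (cases "1 <= x")
   case True
   have "cmod (weight t (mu x)) <= 2 * B * real t powr (- b)" by (rule wb[OF t mu_pos[OF True]])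
   also have "... <= 72 * B * real t powr (- b)" using B by (intro mult_right_mono) auto
   finally show ?thesis using True by (simp add: wt_def)
  qed (use B in \<open>simp add: wt_def\<close>)
  fix x a :: int assume xa: "1 <= x" "0 <= a"
  have mono: "mu x <= mu (x + a)" unfolding mu_def using xa b_bounds by (intro ceiling_mono powr_mono2) auto
  then have "mu x + int (nat (mu (x + a) - mu x)) = mu (x + a)" by simp
  then show "cmod (wt t (x + a) - wt t x) <= 72 * B * real t powr (- 2 * b) * of_int (mu (x + a) - mu x)"
   using wla[OF t mu_pos[OF xa(1)], of "nat (mu (x + a) - mu x)"] mono xa by (simp add: wt_def)
 qed
qed

text \<open>Chosen in a context without \<theta>, \<delta> and M. \<open>CI\<close> and
  \<open>CB\<close> are obtained in the same way; this is what makes the final constant uniform in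
  M.\<close>

definition KW :: real where
 "KW = (SOME K. 1 <= K & (\<forall>t\<in>dyadic. (\<forall>x. cmod (wt t x) <= K * real t powr (- b))
   & (\<forall>x a. 1 <= x --> 0 <= a --> cmod (wt t (x + a) - wt t x) <= K * real t powr (- 2 * b) * of_int (mu (x + a) - mu x))))"

lemma KW:
 "1 <= KW" "t \<in> dyadic ==> cmod (wt t x) <= KW * real t powr (- b)"
 "t \<in> dyadic ==> 1 <= x ==> 0 <= a ==>
   cmod (wt t (x + a) - wt t x) <= KW * real t powr (- 2 * b) * of_int (mu (x + a) - mu x)"
 using someI_ex[OF wt_props, folded KW_def] by simp_all

lemma wt_diff_1: "t \<in> dyadic ==> 1 <= x ==> cmod (wt t (x + 1) - wt t x) <= KW * real t powr (- 2 * b) * of_int (ind x)"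
 using KW(3)[of t x 1] by (simp add: ind_def)

definition hpos :: "nat => int => complex" where "hpos t x = wt t x * of_real (dens x)"

definition hker :: "nat => int => complex" where "hker t = antisym_part (hpos t)"

definition epos :: "nat => int => complex" where "epos t x = wt t x * of_real (of_int (ind x) - dens x)"

definition eker :: "nat => int => complex" where "eker t = antisym_part (epos t)"

definition Hker :: "nat => int => complex" where "Hker t = antisym_part (%x. wt t x * of_int (ind x))"

lemma Hker_split: "Hker t x = hker t x + eker t x"
 by (simp add: Hker_def hker_def eker_def antisym_part_def hpos_def epos_def algebra_simps)

lemma wt_supp_shell: "t \<in> dyadic ==> wt t x ~= 0 ==> 1 <= x & x \<in> shell (real t) & x <= \<lfloor>2 * real t\<rfloor>"
 using wt_supp[of t x] by (auto simp: shell_def le_floor_iff)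

lemma supp_kers:
 assumes t: "t \<in> dyadic"
 shows "supp (hker t) \<subseteq> shell (real t)" "supp (eker t) \<subseteq> shell (real t)" "supp (Hker t) \<subseteq> shell (real t)"
proof -
 have s: "supp (antisym_part (%x. wt t x * g x)) \<subseteq> shell (real t)" for g
 proof
  fix x assume "x \<in> supp (antisym_part (%x. wt t x * g x))"
  then have "wt t x ~= 0 \<or> wt t (- x) ~= 0" by (auto simp: supp_def antisym_part_def)
  then have "x \<in> shell (real t) \<or> - x \<in> shell (real t)" using wt_supp_shell[OF t] by blast
  moreover have "- x \<in> shell (real t) \<longleftrightarrow> x \<in> shell (real t)" by (simp add: shell_def)
  ultimately show "x \<in> shell (real t)" by blast
 qed
 show "supp (hker t) \<subseteq> shell (real t)" "supp (eker t) \<subseteq> shell (real t)" "supp (Hker t) \<subseteq> shell (real t)"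
  unfolding hker_def eker_def Hker_def hpos_def[abs_def] epos_def[abs_def] by (rule s)+
qed

lemma finite_supp_kers:
 "t \<in> dyadic ==> finite (supp (hker t))" "t \<in> dyadic ==> finite (supp (eker t))" "t \<in> dyadic ==> finite (supp (Hker t))"
 by (rule finite_subset[OF supp_kers(1) finite_shell], assumption)
   (rule finite_subset[OF supp_kers(2) finite_shell], assumption,
   rule finite_subset[OF supp_kers(3) finite_shell], assumption)

lemma dens_shell:
 assumes t: "1 <= t" and x: "1 <= x" "t / 8 <= of_int x"
 shows "dens x <= 8 * t powr (b - 1)"
proof -
 have "dens x <= of_int x powr (b - 1)" by (rule dens_bounds(2)[OF x(1)])
 also have "... <= (t / 8) powr (b - 1)" using x t b_bounds by (intro powr_mono2') auto
 also have "... <= 8 * t powr (b - 1)" using powr_shift_bounds(1)[of 8 t] t by simp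
 finally show ?thesis .
qed

lemma hpos_bound:
 assumes t: "t \<in> dyadic"
 shows "cmod (hpos t x) <= 8 * KW / real t"
proof (cases "wt t x = 0")
 case False
 have t1: "1 <= real t" by (rule dyadic_ge_1[OF t])
 have "cmod (hpos t x) = cmod (wt t x) * dens x"
  using dens_bounds(1)[OF wt_supp(1)[OF t False]] by (simp add: hpos_def norm_mult)
 also have "... <= (KW * real t powr (- b)) * (8 * real t powr (b - 1))"
  using KW(1) KW(2)[OF t] dens_bounds(1)[OF wt_supp(1)[OF t False]] dens_shell[OF t1 wt_supp(1,2)[OF t False]]
  by (intro mult_mono) auto
 also have "... = 8 * KW * (real t powr (- b) * real t powr (b - 1))" by simp
 also have "real t powr (- b) * real t powr (b - 1) = real t powr (- 1)" by (simp only: powr_add[symmetric]) simp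
 also have "8 * KW * real t powr (- 1) = 8 * KW / real t" using t1 by (simp add: powr_minus_divide)
 finally show ?thesis .
qed (use KW(1) in \<open>simp add: hpos_def\<close>)

lemma hpos_diff_bound:
 assumes t: "t \<in> dyadic" and x: "1 <= x" and a: "0 <= a" and nz: "wt t x ~= 0 \<or> wt t (x + a) ~= 0"
 shows "cmod (hpos t (x + a) - hpos t x) <=
   KW * real t powr (- 2 * b) * of_int (mu (x + a) - mu x) * dens (x + a)
    + cmod (wt t x) * (of_int a * of_int x powr (b - 2))"
proof -
 have "hpos t (x + a) - hpos t x = (wt t (x + a) - wt t x) * of_real (dens (x + a)) - wt t x * of_real (dens x - dens (x + a))"
  by (simp add: hpos_def algebra_simps)
 then have "cmod (hpos t (x + a) - hpos t x) <= cmod (wt t (x + a) - wt t x) * \<bar>dens (x + a)\<bar> + cmod (wt t x) * \<bar>dens x - dens (x + a)\<bar>"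
  using norm_triangle_ineq4[of "(wt t (x + a) - wt t x) * of_real (dens (x + a))" "wt t x * of_real (dens x - dens (x + a))"]
  by (simp only: norm_mult norm_of_real)
 also have "... <= KW * real t powr (- 2 * b) * of_int (mu (x + a) - mu x) * dens (x + a) + cmod (wt t x) * (of_int a * of_int x powr (b - 2))"
 proof (intro add_mono)
  have "0 <= dens (x + a)" using dens_bounds(1)[of "x + a"] x a by simp
  then show "cmod (wt t (x + a) - wt t x) * \<bar>dens (x + a)\<bar> <= KW * real t powr (- 2 * b) * of_int (mu (x + a) - mu x) * dens (x + a)"
   using KW(3)[OF t x a] by (simp add: mult_right_mono)
  show "cmod (wt t x) * \<bar>dens x - dens (x + a)\<bar> <= cmod (wt t x) * (of_int a * of_int x powr (b - 2))"
   using dens_bounds(3)[OF x a] by (intro mult_left_mono) auto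
 qed
 finally show ?thesis .
qed

text \<open>The variation is of the order of the height 1 / t: O(t powr b) jumps of the weight, each
  of size t powr (- 2 * b), times the density t powr (b - 1), plus the slow variation of the
  density. The sum starts at 0 to include the jump from 0 to 1.\<close>

lemma hpos_variation:
 assumes t: "t \<in> dyadic"
 shows "(\<Sum>x\<in>{0..\<lfloor>2 * real t\<rfloor>}. cmod (hpos t (x + 1) - hpos t x)) <= 160 * KW / real t"
proof -
 have t1: "1 <= real t" by (rule dyadic_ge_1[OF t])
 let ?N = "\<lfloor>2 * real t\<rfloor>"
 have K0: "0 <= KW" using KW(1) by simp
 have each: "cmod (hpos t (x + 1) - hpos t x) <= 8 * KW * real t powr (- b - 1) * of_int (ind x) + 64 * KW / (real t)\<^sup>2" if x: "1 <= x" for x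
 proof (cases "wt t x = 0 & wt t (x + 1) = 0")
  case True
  have "0 <= real_of_int (ind x)" using ind_cases[OF x] by auto
  then show ?thesis using True K0 by (simp add: hpos_def)
 next
  case False
  have x8: "real t / 8 <= of_int (x + 1)" using False wt_supp(2)[OF t, of x] wt_supp(2)[OF t, of "x + 1"] by fastforce
  have i0: "0 <= real_of_int (ind x)" using ind_cases[OF x] by auto
  have "cmod (hpos t (x + 1) - hpos t x) <=
    KW * real t powr (- 2 * b) * of_int (ind x) * dens (x + 1) + cmod (wt t x) * (1 * of_int x powr (b - 2))"
   using hpos_diff_bound[OF t x, of 1] False by (auto simp: ind_def)
  also have "... <= KW * real t powr (- 2 * b) * of_int (ind x) * (8 * real t powr (b - 1)) + 64 * KW / (real t)\<^sup>2"
  proof (rule add_mono)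
   show "KW * real t powr (- 2 * b) * of_int (ind x) * dens (x + 1) <= KW * real t powr (- 2 * b) * of_int (ind x) * (8 * real t powr (b - 1))"
    using x x8 K0 i0 t1 by (intro mult_left_mono dens_shell) auto
   show "cmod (wt t x) * (1 * of_int x powr (b - 2)) <= 64 * KW / (real t)\<^sup>2"
   proof (cases "wt t x = 0")
    case False
    have "of_int x powr (b - 2) <= (real t / 8) powr (b - 2)"
     using wt_supp[OF t False] t1 b_bounds by (intro powr_mono2') auto
    also have "... = 8 powr (2 - b) * real t powr (b - 2)"
     using t1 powr_minus_divide[of 8 "2 - b"] by (simp add: powr_divide)
    also have "... <= 8 powr 2 * real t powr (b - 2)" using b_bounds by (intro mult_right_mono powr_mono) auto
    finally have "of_int x powr (b - 2) <= 64 * real t powr (b - 2)" by simp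
    then have "cmod (wt t x) * (1 * of_int x powr (b - 2)) <= (KW * real t powr (- b)) * (1 * (64 * real t powr (b - 2)))"
     using KW(2)[OF t] K0 by (intro mult_mono) auto
    also have "... = 64 * KW * (real t powr (- b) * real t powr (b - 2))" by simp
    also have "real t powr (- b) * real t powr (b - 2) = real t powr (- 2)" by (simp only: powr_add[symmetric]) simp
    also have "real t powr (- 2) = 1 / (real t)\<^sup>2" using t1 by (simp add: powr_minus_divide)
    finally show ?thesis by simp
   qed (use K0 in simp)
  qed
  also have "KW * real t powr (- 2 * b) * of_int (ind x) * (8 * real t powr (b - 1))
    = 8 * KW * (real t powr (- 2 * b) * real t powr (b - 1)) * of_int (ind x)" by simp
  also have "real t powr (- 2 * b) * real t powr (b - 1) = real t powr (- b - 1)" by (simp only: powr_add[symmetric]) simp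
  finally show ?thesis .
 qed
 have "{0..?N} = insert 0 {1..?N}" using t1 by auto
 then have "(\<Sum>x\<in>{0..?N}. cmod (hpos t (x + 1) - hpos t x)) = cmod (hpos t 1 - hpos t 0) + (\<Sum>x\<in>{1..?N}. cmod (hpos t (x + 1) - hpos t x))"
  by simp
 also have "... <= 8 * KW / real t + (\<Sum>x\<in>{1..?N}. 8 * KW * real t powr (- b - 1) * of_int (ind x) + 64 * KW / (real t)\<^sup>2)"
  using hpos_bound[OF t, of 1] each by (intro add_mono sum_mono) (auto simp: hpos_def wt_def)
 also have "... = 8 * KW / real t + 8 * KW * real t powr (- b - 1) * (\<Sum>x\<in>{1..?N}. of_int (ind x)) + of_int ?N * (64 * KW / (real t)\<^sup>2)"
  using t1 by (simp add: sum.distrib sum_distrib_left)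
 also have "... <= 8 * KW / real t + 8 * KW * real t powr (- b - 1) * (3 * real t powr b) + 2 * real t * (64 * KW / (real t)\<^sup>2)"
  using K0 t1 by (intro add_mono mult_left_mono mult_right_mono sum_ind_le) auto
 also have "8 * KW * real t powr (- b - 1) * (3 * real t powr b) = 24 * KW * (real t powr (- b - 1) * real t powr b)" by simp
 also have "real t powr (- b - 1) * real t powr b = real t powr (- 1)" by (simp only: powr_add[symmetric]) simp
 also have "real t powr (- 1) = 1 / real t" using t1 by (simp add: powr_minus_divide)
 also have "2 * real t * (64 * KW / (real t)\<^sup>2) = 128 * KW / real t" using t1 by (simp add: power2_eq_square)
 also have "8 * KW / real t + 24 * KW * (1 / real t) + 128 * KW / real t = 160 * KW / real t"
  using t1 by (simp add: field_simps)
 finally show ?thesis .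
qed

lemma hker_variation:
 assumes t: "t \<in> dyadic"
 shows "l1norm (%x. hker t (x + 1) - hker t x) <= 320 * KW / real t"
proof -
 let ?N = "\<lfloor>2 * real t\<rfloor>"
 have t_ge: "0 <= ?N" by simp
 have z: "hpos t x = 0" if "x <= 0 \<or> ?N < x" for x
  using that wt_supp_shell[OF t, of x] by (fastforce simp: hpos_def)
 have hz: "hker t x = 0" if "x < - ?N \<or> ?N < x" for x
 proof -
  have "0 <= ?N" by simp
  then have "x <= 0 \<or> ?N < x" "- x <= 0 \<or> ?N < - x" using that by linarith+
  then show ?thesis using z by (simp add: hker_def antisym_part_def)
 qed
 have s: "supp (%x. hker t (x + 1) - hker t x) \<subseteq> {- ?N - 1..?N}"
 proof
  fix x assume "x \<in> supp (%x. hker t (x + 1) - hker t x)"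
  then have "hker t (x + 1) ~= 0 \<or> hker t x ~= 0" by (auto simp: supp_def)
  then show "x \<in> {- ?N - 1..?N}" using hz[of x] hz[of "x + 1"] by force
 qed
 have "l1norm (%x. hker t (x + 1) - hker t x) = (\<Sum>x\<in>{- ?N - 1..?N}. cmod (hker t (x + 1) - hker t x))"
  by (rule l1norm_eq[OF _ s]) simp
 also have "... <= (\<Sum>x\<in>{- ?N - 1..?N}. cmod (hpos t (x + 1) - hpos t x) + cmod (hpos t (- x - 1 + 1) - hpos t (- x - 1)))"
 proof (rule sum_mono)
  fix x
  have "hker t (x + 1) - hker t x = (hpos t (x + 1) - hpos t x) + (hpos t (- x - 1 + 1) - hpos t (- x - 1))"
   by (simp add: hker_def antisym_part_def)
  then show "cmod (hker t (x + 1) - hker t x) <= cmod (hpos t (x + 1) - hpos t x) + cmod (hpos t (- x - 1 + 1) - hpos t (- x - 1))"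
   by (simp only: norm_triangle_ineq)
 qed
 also have "... = (\<Sum>x\<in>{- ?N - 1..?N}. cmod (hpos t (x + 1) - hpos t x)) + (\<Sum>x\<in>{- ?N - 1..?N}. cmod (hpos t (- x - 1 + 1) - hpos t (- x - 1)))"
  by (rule sum.distrib)
 also have "(\<Sum>x\<in>{- ?N - 1..?N}. cmod (hpos t (- x - 1 + 1) - hpos t (- x - 1))) = (\<Sum>x\<in>{- ?N - 1..?N}. cmod (hpos t (x + 1) - hpos t x))"
  by (rule sum.reindex_bij_witness[where i = "%x. - x - 1" and j = "%x. - x - 1"]) auto
 also have "(\<Sum>x\<in>{- ?N - 1..?N}. cmod (hpos t (x + 1) - hpos t x)) = (\<Sum>x\<in>{0..?N}. cmod (hpos t (x + 1) - hpos t x))"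
 proof (rule sum.mono_neutral_right)
  have "- 1 <= ?N" using t_ge by linarith
  then show "{0..?N} \<subseteq> {- ?N - 1..?N}" by auto
 qed (auto simp: z)
 finally show ?thesis using hpos_variation[OF t] by simp
qed

section \<open>Fourier transforms of the smooth kernels\<close>

lemma ft_shift:
 assumes "finite (supp f)"
 shows "ft (%x. f (x + a)) \<xi> = cis (- \<xi> * of_int a) * ft f \<xi>"
proof -
 have "ft (%x. f (x + a)) \<xi> = (\<Sum>y\<in>supp f. f y * cis (\<xi> * of_int (y - a)))" unfolding ft_def
  by (rule sum.reindex_bij_witness[where i = "%y. y - a" and j = "%y. y + a"]) (auto simp: supp_def)
 also have "... = (\<Sum>y\<in>supp f. cis (- \<xi> * of_int a) * (f y * cis (\<xi> * of_int y)))"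
 proof (rule sum.cong[OF refl])
  fix y
  have "cis (\<xi> * of_int (y - a)) = cis (- \<xi> * of_int a) * cis (\<xi> * of_int y)"
   unfolding cis_mult by (rule arg_cong[where f = cis]) (simp add: algebra_simps)
  then show "f y * cis (\<xi> * of_int (y - a)) = cis (- \<xi> * of_int a) * (f y * cis (\<xi> * of_int y))" by simp
 qed
 finally show ?thesis by (simp add: ft_def sum_distrib_left)
qed

lemma ft_diff:
 assumes "finite (supp f)" "finite (supp g)"
 shows "ft (%x. f x - g x) \<xi> = ft f \<xi> - ft g \<xi>"
proof -
 have "ft (%x. f x - g x) \<xi> = (\<Sum>y\<in>supp f \<union> supp g. (f y - g y) * cis (\<xi> * of_int y))"
  using assms by (intro ft_eq) (auto simp: supp_def)
 then show ?thesis using assms by (simp add: ft_eq[of "supp f \<union> supp g"] sum_subtractf algebra_simps)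
qed

lemma ft_add:
 assumes "finite (supp f)" "finite (supp g)"
 shows "ft (%x. f x + g x) \<xi> = ft f \<xi> + ft g \<xi>"
proof -
 have "ft (%x. f x + g x) \<xi> = (\<Sum>y\<in>supp f \<union> supp g. (f y + g y) * cis (\<xi> * of_int y))"
  using assms by (intro ft_eq) (auto simp: supp_def)
 then show ?thesis using assms by (simp add: ft_eq[of "supp f \<union> supp g"] sum.distrib algebra_simps)
qed

lemma cmod_cis_int_minus_1: "cmod (cis (of_int n * \<xi>) - 1) <= \<bar>of_int n\<bar> * cmod (cis \<xi> - 1)"
proof -
 have nat: "cmod (cis (real k * \<xi>) - 1) <= real k * cmod (cis \<xi> - 1)" for k \<xi>
 proof (induction k)
  case (Suc k)
  have "cis (real (Suc k) * \<xi>) - 1 = cis \<xi> * (cis (real k * \<xi>) - 1) + (cis \<xi> - 1)"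
   by (simp add: algebra_simps cis_mult)
  then have "cmod (cis (real (Suc k) * \<xi>) - 1) <= cmod (cis \<xi> * (cis (real k * \<xi>) - 1)) + cmod (cis \<xi> - 1)"
   by (simp only: norm_triangle_ineq)
  then have "cmod (cis (real (Suc k) * \<xi>) - 1) <= cmod (cis (real k * \<xi>) - 1) + cmod (cis \<xi> - 1)"
   by (simp only: norm_mult norm_cis mult_1)
  then show ?case using Suc by (simp add: algebra_simps)
 qed simp
 show ?thesis
 proof (cases "0 <= n")
  case True
  then show ?thesis using nat[of "nat n" \<xi>] by simp
 next
  case False
  have "cmod (cis (- \<xi>) - 1) = cmod (cis \<xi> - 1)" by (simp add: cmod_cis_minus_1)
  moreover have "real (nat (- n)) * - \<xi> = of_int n * \<xi>" using False by simp
  ultimately show ?thesis using nat[of "nat (- n)" "- \<xi>"] False by simp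
 qed
qed

text \<open>Low frequencies use the oddness of the kernel, high frequencies its total variation; z
  \<xi> replaces the modulus of \<xi> and keeps the bounds periodic. They balance at t * z \<xi> =
  1, so their sum over dyadic t converges geometrically on both sides.\<close>

lemma ft_hker_bounds:
 assumes t: "t \<in> dyadic"
 defines "z \<equiv> %\<xi>. cmod (cis \<xi> - 1)"
 shows "cmod (ft (hker t) \<xi>) <= 64 * KW * (real t * z \<xi>)"
  and "z \<xi> * cmod (ft (hker t) \<xi>) <= 320 * KW / real t"
proof -
 have t1: "1 <= real t" by (rule dyadic_ge_1[OF t])
 let ?N = "\<lfloor>2 * real t\<rfloor>"
 have f: "finite (supp (hker t))" by (rule finite_supp_kers[OF t])
 have "z \<xi> * cmod (ft (hker t) \<xi>) = cmod (ft (%x. hker t (x + 1) - hker t x) \<xi>)"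
 proof -
  have "ft (%x. hker t (x + 1) - hker t x) \<xi> = (cis (- \<xi>) - 1) * ft (hker t) \<xi>"
   using ft_shift[OF f, of 1 \<xi>] by (simp add: ft_diff finite_supp_shift f algebra_simps)
  moreover have "cmod (cis (- \<xi>) - 1) = z \<xi>" by (simp add: z_def cmod_cis_minus_1)
  ultimately show ?thesis by (simp add: norm_mult)
 qed
 also have "... <= l1norm (%x. hker t (x + 1) - hker t x)" by (rule cmod_ft_le_l1norm)
 also have "... <= 320 * KW / real t" by (rule hker_variation[OF t])
 finally show "z \<xi> * cmod (ft (hker t) \<xi>) <= 320 * KW / real t" .
 have zp: "hpos t x = 0" if "x \<notin> {1..?N}" for x
  using that wt_supp_shell[OF t, of x] by (fastforce simp: hpos_def)
 have sp: "supp (hpos t) \<subseteq> {1..?N}"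
 proof
  fix x assume "x \<in> supp (hpos t)"
  then show "x \<in> {1..?N}" using zp[of x] by (cases "x \<in> {1..?N}") (simp_all add: supp_def)
 qed
 have sm: "supp (%x. hpos t (- x)) \<subseteq> {- ?N..- 1}"
 proof
  fix x assume "x \<in> supp (%x. hpos t (- x))"
  then have "- x \<in> {1..?N}" using zp[of "- x"] by (cases "- x \<in> {1..?N}") (simp_all add: supp_def)
  then show "x \<in> {- ?N..- 1}" by auto
 qed
 have "ft (hker t) \<xi> = ft (hpos t) \<xi> - ft (%x. hpos t (- x)) \<xi>"
  unfolding hker_def antisym_part_def[abs_def] using sp sm by (intro ft_diff) (auto intro: finite_subset)
 also have "ft (%x. hpos t (- x)) \<xi> = (\<Sum>y\<in>{- ?N..- 1}. hpos t (- y) * cis (\<xi> * of_int y))"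
  by (rule ft_eq[OF _ sm]) simp
 also have "... = (\<Sum>y\<in>{1..?N}. hpos t y * cis (- \<xi> * of_int y))"
  by (rule sum.reindex_bij_witness[where i = uminus and j = uminus]) auto
 also have "ft (hpos t) \<xi> - ... = (\<Sum>y\<in>{1..?N}. hpos t y * (cis (\<xi> * of_int y) - cis (- \<xi> * of_int y)))"
  using ft_eq[OF _ sp] by (simp add: sum_subtractf algebra_simps)
 finally have "cmod (ft (hker t) \<xi>) <= (\<Sum>y\<in>{1..?N}. cmod (hpos t y) * cmod (cis (\<xi> * of_int y) - cis (- \<xi> * of_int y)))"
  using norm_sum[of "%y. hpos t y * (cis (\<xi> * of_int y) - cis (- \<xi> * of_int y))"] by (simp add: norm_mult)
 also have "... <= (\<Sum>y\<in>{1..?N}. 8 * KW / real t * (4 * real t * z \<xi>))"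
 proof (intro sum_mono mult_mono)
  fix y assume y: "y \<in> {1..?N}"
  show "cmod (hpos t y) <= 8 * KW / real t" by (rule hpos_bound[OF t])
  have "cis (\<xi> * of_int y) - cis (- \<xi> * of_int y) = cis (- \<xi> * of_int y) * (cis (of_int (2 * y) * \<xi>) - 1)"
   unfolding right_diff_distrib cis_mult by (simp add: algebra_simps)
  then have "cmod (cis (\<xi> * of_int y) - cis (- \<xi> * of_int y)) = cmod (cis (of_int (2 * y) * \<xi>) - 1)"
   by (simp only: norm_mult norm_cis mult_1)
  also have "... <= \<bar>of_int (2 * y)\<bar> * z \<xi>" unfolding z_def by (rule cmod_cis_int_minus_1)
  also have "... <= 4 * real t * z \<xi>" using y unfolding z_def by (intro mult_right_mono) (auto simp: le_floor_iff)
  finally show "cmod (cis (\<xi> * of_int y) - cis (- \<xi> * of_int y)) <= 4 * real t * z \<xi>" .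
 qed (use KW(1) in auto)
 also have "... = of_int ?N * (32 * KW * z \<xi>)" using t1 by (simp add: field_simps)
 also have "... <= 2 * real t * (32 * KW * z \<xi>)" using KW(1) by (intro mult_right_mono) (auto simp: z_def)
 finally show "cmod (ft (hker t) \<xi>) <= 64 * KW * (real t * z \<xi>)" by (simp add: mult_ac)
qed

text \<open>Prepares the summation by parts against the exponential sums. \<open>g\<close> is
  controlled only where the weight may live; at the neighbour just outside the support its Lipschitz
  bound still gives 2 * G.\<close>

lemma wt_mult_variation:
 assumes t: "t \<in> dyadic" and G: "0 <= G"
  and g: "!!x. 1 <= x ==> real t / 8 <= of_int x ==> of_int x <= 2 * real t ==> cmod (g x) <= G"
  and dg: "!!x. cmod (g (x + 1) - g x) <= G / real t"
 shows "(\<Sum>x\<in>{1..\<lfloor>2 * real t\<rfloor>}. cmod (g (x + 1) * wt t (x + 1) - g x * wt t x)) <= 8 * G * KW * real t powr (- b)"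
proof -
 have t1: "1 <= real t" by (rule dyadic_ge_1[OF t])
 have K0: "0 <= KW" using KW(1) by simp
 let ?N = "\<lfloor>2 * real t\<rfloor>"
 have "(\<Sum>x\<in>{1..?N}. cmod (g (x + 1) * wt t (x + 1) - g x * wt t x))
   <= (\<Sum>x\<in>{1..?N}. 2 * G * (KW * real t powr (- 2 * b) * of_int (ind x)) + KW * real t powr (- b) * (G / real t))"
 proof (rule sum_mono)
  fix x assume x: "x \<in> {1..?N}"
  then have x1: "1 <= x" by simp
  have b1: "cmod (g x * (wt t (x + 1) - wt t x)) <= 2 * G * (KW * real t powr (- 2 * b) * of_int (ind x))"
  proof (cases "wt t (x + 1) = 0 & wt t x = 0")
   case True
   have "0 <= real_of_int (ind x)" using ind_cases[OF x1] by auto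
   then show ?thesis using True G K0 by simp
  next
   case False
   have gx: "cmod (g x) <= 2 * G"
   proof (cases "wt t x = 0")
    case True
    then have "wt t (x + 1) ~= 0" using False by simp
    then have "cmod (g (x + 1)) <= G" using wt_supp[OF t, of "x + 1"] by (intro g) auto
    moreover have "G / real t <= G / 1" using G t1 by (intro divide_left_mono) auto
    then have "cmod (g (x + 1) - g x) <= G" using dg[of x] by simp
    ultimately show ?thesis using norm_triangle_ineq2[of "g x" "g (x + 1)"] by (simp add: norm_minus_commute)
   next
    case False
    have "cmod (g x) <= G" by (rule g) (use wt_supp[OF t False] in auto)
    then show ?thesis using G by simp
   qed
   show ?thesis unfolding norm_mult using gx wt_diff_1[OF t x1] G by (intro mult_mono) auto
  qed
  have b2: "cmod (wt t (x + 1) * (g (x + 1) - g x)) <= KW * real t powr (- b) * (G / real t)"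
   unfolding norm_mult using KW(2)[OF t] dg K0 by (intro mult_mono) auto
  have "g (x + 1) * wt t (x + 1) - g x * wt t x = g x * (wt t (x + 1) - wt t x) + wt t (x + 1) * (g (x + 1) - g x)"
   by (simp add: algebra_simps)
  then show "cmod (g (x + 1) * wt t (x + 1) - g x * wt t x)
    <= 2 * G * (KW * real t powr (- 2 * b) * of_int (ind x)) + KW * real t powr (- b) * (G / real t)"
   using b1 b2 by (simp only:) (rule order_trans[OF norm_triangle_ineq add_mono])
 qed
 also have "... = 2 * G * KW * real t powr (- 2 * b) * (\<Sum>x\<in>{1..?N}. of_int (ind x)) + of_int ?N * (KW * real t powr (- b) * (G / real t))"
  using t1 by (simp add: sum.distrib sum_distrib_left mult_ac)
 also have "... <= 2 * G * KW * real t powr (- 2 * b) * (3 * real t powr b) + 2 * real t * (KW * real t powr (- b) * (G / real t))"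
  using K0 G t1 by (intro add_mono mult_left_mono mult_right_mono sum_ind_le) auto
 also have "... = 6 * G * KW * (real t powr (- 2 * b) * real t powr b) + 2 * G * KW * real t powr (- b)"
  using t1 by simp
 also have "real t powr (- 2 * b) * real t powr b = real t powr (- b)" by (simp only: powr_add[symmetric]) simp
 finally show ?thesis by (simp add: algebra_simps)
qed

end

section \<open>Sums over dyadic scales\<close>

lemma sum_dyadic_inverse:
 assumes T: "finite T" "T \<subseteq> dyadic" and z: "0 < z" "!!t. t \<in> T ==> z <= real t"
 shows "(\<Sum>t\<in>T. 1 / real t) <= 2 / z"
proof (cases "T = {}")
 case False
 have geo: "(\<Sum>k\<in>{k0..<k0 + n}. 1 / real (2 ^ k)) = 2 / 2 ^ k0 - 2 / 2 ^ (k0 + n)" for k0 n :: nat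
 proof (induction n)
  case (Suc n)
  have "2 / 2 ^ (k0 + Suc n) = 1 / (2::real) ^ (k0 + n)" by simp
  then show ?case using Suc by simp
 qed simp
 define S where "S = {k. 2 ^ k \<in> T}"
 have inj: "inj (%k::nat. (2::nat) ^ k)" by (simp add: inj_on_def)
 have TS: "T = (%k. 2 ^ k) ` S" using T by (auto simp: S_def dyadic_def)
 have finS: "finite S" unfolding S_def using finite_vimageI[OF T(1) inj] by (simp add: vimage_def)
 have neS: "S ~= {}" using False TS by auto
 define k0 where "k0 = Min S"
 have k0: "2 ^ k0 \<in> T" using Min_in[OF finS neS] by (simp add: S_def k0_def)
 have sub: "S \<subseteq> {k0..<k0 + (Suc (Max S) - k0)}"
 proof
  fix k assume "k \<in> S"
  then have "k0 <= k" "k <= Max S" using finS by (auto simp: k0_def)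
  then show "k \<in> {k0..<k0 + (Suc (Max S) - k0)}" by auto
 qed
 have "(\<Sum>t\<in>T. 1 / real t) = (\<Sum>k\<in>S. 1 / real (2 ^ k))"
  unfolding TS by (subst sum.reindex) (auto intro: inj_on_subset[OF inj])
 also have "... <= (\<Sum>k\<in>{k0..<k0 + (Suc (Max S) - k0)}. 1 / real (2 ^ k))" by (intro sum_mono2 sub) auto
 also have "... <= 2 / 2 ^ k0" unfolding geo by simp
 also have "... <= 2 / z" using z(1) z(2)[OF k0] by (intro divide_left_mono) auto
 finally show ?thesis .
qed (use z in simp)

lemma sum_dyadic:
 assumes T: "finite T" "T \<subseteq> dyadic" and z: "0 < z" "!!t. t \<in> T ==> real t <= z"
 shows "(\<Sum>t\<in>T. real t) <= 2 * z"
proof (cases "T = {}")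
 case False
 have geo: "(\<Sum>k<n. (2::real) ^ k) <= 2 ^ n" for n by (induction n) simp_all
 define S where "S = {k. 2 ^ k \<in> T}"
 have inj: "inj (%k::nat. (2::nat) ^ k)" by (simp add: inj_on_def)
 have TS: "T = (%k. 2 ^ k) ` S" using T by (auto simp: S_def dyadic_def)
 have finS: "finite S" unfolding S_def using finite_vimageI[OF T(1) inj] by (simp add: vimage_def)
 have neS: "S ~= {}" using False TS by auto
 have m: "2 ^ Max S \<in> T" using Max_in[OF finS neS] by (simp add: S_def)
 have "(\<Sum>t\<in>T. real t) = (\<Sum>k\<in>S. 2 ^ k)"
  unfolding TS by (subst sum.reindex) (auto intro: inj_on_subset[OF inj])
 also have "... <= (\<Sum>k<Suc (Max S). 2 ^ k)" using finS by (intro sum_mono2) (auto simp: less_Suc_eq_le)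
 also have "... <= 2 ^ Suc (Max S)" by (rule geo)
 also have "... <= 2 * z" using z(2)[OF m] by simp
 finally show ?thesis .
qed (use z in simp)

lemma card_dyadic:
 assumes T: "finite T" "T \<subseteq> dyadic" and M: "1 <= M" "!!t. t \<in> T ==> real t <= M"
 shows "real (card T) <= 1 + log 2 M"
proof -
 define S where "S = {k. 2 ^ k \<in> T}"
 have TS: "T = (%k. 2 ^ k) ` S" using T by (auto simp: S_def dyadic_def)
 have l0: "0 <= log 2 M" using M by simp
 have "S \<subseteq> {..nat \<lfloor>log 2 M\<rfloor>}"
 proof
  fix k assume "k \<in> S"
  then have "real (2 ^ k) <= M" by (intro M) (simp add: S_def)
  then have "2 powr real k <= M" by (simp add: powr_realpow)
  then have "real k <= log 2 M" using M by (simp add: le_log_iff)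
  then show "k \<in> {..nat \<lfloor>log 2 M\<rfloor>}" by (simp add: le_nat_floor)
 qed
 then have "card S <= card {..nat \<lfloor>log 2 M\<rfloor>}" by (intro card_mono) auto
 moreover have "finite S" using \<open>S \<subseteq> _\<close> finite_subset by blast
 then have "card T <= card S" unfolding TS by (rule card_image_le)
 ultimately have "real (card T) <= real (Suc (nat \<lfloor>log 2 M\<rfloor>))" by simp
 also have "... <= 1 + log 2 M" using l0 by simp
 finally show ?thesis .
qed

text \<open>Split at t = 1 / z: the scales below and above are dominated by geometric series with
  largest term about C.\<close>

lemma sum_dyadic_min:
 assumes T: "finite T" "T \<subseteq> dyadic" and z: "0 < z"
  and F: "!!t. t \<in> T ==> F t <= C * (real t * z)" "!!t. t \<in> T ==> z * F t <= C / real t" and C: "0 <= C"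
 shows "(\<Sum>t\<in>T. F t) <= 4 * C"
proof -
 let ?A = "{t\<in>T. real t <= 1 / z}" and ?B = "{t\<in>T. 1 / z < real t}"
 have "(\<Sum>t\<in>T. F t) = (\<Sum>t\<in>?A. F t) + (\<Sum>t\<in>?B. F t)"
  using T by (subst sum.union_disjoint[symmetric]) (auto intro!: sum.cong)
 also have "(\<Sum>t\<in>?A. F t) <= (\<Sum>t\<in>?A. (C * z) * real t)"
  using F(1) by (intro sum_mono) (auto simp: mult_ac)
 also have "... = C * z * (\<Sum>t\<in>?A. real t)" by (simp add: sum_distrib_left)
 also have "... <= C * z * (2 * (1 / z))" using T z C by (intro mult_left_mono sum_dyadic) auto
 also have "... = 2 * C" using z by simp
 also have "(\<Sum>t\<in>?B. F t) <= (\<Sum>t\<in>?B. (C / z) * (1 / real t))"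
 proof (rule sum_mono)
  fix t assume "t \<in> ?B"
  then have "z * F t <= C / real t" using F(2) by simp
  then have "F t * z <= C / real t" by (simp only: mult.commute)
  then have "F t <= C / real t / z" by (simp only: pos_le_divide_eq[OF z])
  then show "F t <= (C / z) * (1 / real t)" by (simp add: mult.commute)
 qed
 also have "... = C / z * (\<Sum>t\<in>?B. 1 / real t)" by (simp add: sum_distrib_left)
 also have "... <= C / z * (2 / (1 / z))" using T z C by (intro mult_left_mono sum_dyadic_inverse) auto
 also have "... = 2 * C" using z by simp
 finally show ?thesis by simp
qed

text \<open>The factors of the bilinear expressions: cis (\<plusminus> x / s) - 1, and the constant
  1 at the base scale. Smallness in x / s serves the scales up to s; the representation by one
  character serves larger scales, where \<open>g\<close> oscillates but modulation preserves Fourier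
  bounds. The factor 16 admits g = 1 for R = M powr \<theta> / 8 and s <= 2 * M powr \<theta>
  (\<open>multiplier_one\<close>).\<close>

definition multiplier :: "real => real => (int => complex) => bool" where
 "multiplier R s g \<longleftrightarrow>
   (\<exists>c0 c1 \<eta>. cmod c0 <= 1 & cmod c1 <= 1 & g = (%x. c0 + c1 * cis (\<eta> * of_int x)))
   & (\<forall>x. R <= \<bar>of_int x\<bar> --> cmod (g x) <= 16 * \<bar>of_int x\<bar> / s)
   & (\<forall>x a. cmod (g (x + a) - g x) <= \<bar>of_int a\<bar> / s)"

lemma multiplier_le_2: "multiplier R s g ==> cmod (g x) <= 2"
proof -
 assume "multiplier R s g"
 then obtain c0 c1 \<eta> where c: "cmod c0 <= 1" "cmod c1 <= 1" and g: "g = (%x. c0 + c1 * cis (\<eta> * of_int x))"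
  unfolding multiplier_def by auto
 have "cmod (g x) <= cmod c0 + cmod (c1 * cis (\<eta> * of_int x))" unfolding g by (rule norm_triangle_ineq)
 then show ?thesis using c by (simp add: norm_mult)
qed

lemma multiplierD:
 assumes "multiplier R s g"
 shows "R <= \<bar>of_int x\<bar> ==> cmod (g x) <= 16 * \<bar>of_int x\<bar> / s" "cmod (g (x + a) - g x) <= \<bar>of_int a\<bar> / s"
 using assms unfolding multiplier_def by auto

section \<open>Error kernels under multipliers\<close>

context rough_kernels
begin

text \<open>Modulation translates the Fourier transform, whose bound is uniform in the
  frequency.\<close>

lemma err_kernel_modulate:
 assumes "err_kernel t A f"
 shows "err_kernel t A (%x. cis (\<eta> * of_int x) * f x)"
proof -
 have s: "supp (%x. cis (\<eta> * of_int x) * f x) = supp f" by (auto simp: supp_def)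
 have "ft (%x. cis (\<eta> * of_int x) * f x) \<xi> = ft f (\<xi> + \<eta>)" for \<xi>
 proof -
  have "cis (\<eta> * of_int y) * f y * cis (\<xi> * of_int y) = f y * cis ((\<xi> + \<eta>) * of_int y)" for y
  proof -
   have "cis ((\<xi> + \<eta>) * of_int y) = cis (\<eta> * of_int y) * cis (\<xi> * of_int y)"
    unfolding cis_mult by (rule arg_cong[where f = cis]) (simp add: algebra_simps)
   then show ?thesis by simp
  qed
  then show ?thesis unfolding ft_def s by (rule sum.cong[OF refl])
 qed
 then show ?thesis using assms unfolding err_kernel_def s by (simp add: norm_mult)
qed

lemma err_kernel_combine:
 assumes f: "err_kernel t A f" and g: "err_kernel t B g" and c: "cmod c <= 1" "cmod d <= 1"
 shows "err_kernel t (A + B) (%x. c * f x + d * g x)"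
proof -
 have fin: "finite (supp f)" "finite (supp g)" using f g err_kernel_finite by auto
 have le: "cmod (c * u + d * v) <= p + q" if "cmod u <= p" "cmod v <= q" for u v p q
 proof -
  have "cmod (c * u + d * v) <= cmod c * cmod u + cmod d * cmod v"
   using norm_triangle_ineq[of "c * u" "d * v"] by (simp add: norm_mult)
  also have "... <= 1 * p + 1 * q" using that c by (intro add_mono mult_mono) auto
  finally show ?thesis by simp
 qed
 have sc: "ft (%x. c * f x) \<xi> = c * ft f \<xi>" if "finite (supp f)" for c f \<xi>
 proof -
  have "ft (%x. c * f x) \<xi> = (\<Sum>y\<in>supp f. (c * f y) * cis (\<xi> * of_int y))"
   using that by (intro ft_eq) (auto simp: supp_def)
  then show ?thesis by (simp add: ft_def sum_distrib_left mult_ac)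
 qed
 have ft: "ft (%x. c * f x + d * g x) \<xi> = c * ft f \<xi> + d * ft g \<xi>" for \<xi>
  using fin finite_supp_mult[of f "%_. c"] finite_supp_mult[of g "%_. d"] by (simp add: ft_add sc)
 have s: "supp (%x. c * f x + d * g x) \<subseteq> shell t"
 proof
  fix x assume "x \<in> supp (%x. c * f x + d * g x)"
  then have "x \<in> supp f \<or> x \<in> supp g" by (auto simp: supp_def)
  then show "x \<in> shell t" using f g unfolding err_kernel_def by blast
 qed
 show ?thesis unfolding err_kernel_def
 proof (intro conjI ballI allI s)
  show "0 <= A + B" using f g by (simp add: err_kernel_def)
  show "cmod (c * f x + d * g x) <= (A + B) * t powr - b * (real_of_int (ind \<bar>x\<bar>) + t powr (b - 1))" if "x \<in> shell t" for x
   using le[of "f x" _ "g x"] f g that unfolding err_kernel_def by (simp add: distrib_right)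
  show "cmod (ft (%x. c * f x + d * g x) \<xi>) <= (A + B) * t powr (- 1 / 60)" for \<xi>
   unfolding ft using le[of "ft f \<xi>" _ "ft g \<xi>"] f g unfolding err_kernel_def by (simp add: distrib_right)
 qed
qed

definition CI :: real where
 "CI = (SOME C. C > 0 & (\<forall>Y::nat. \<forall>\<xi>::real.
  cmod (\<Sum>x\<in>{1..int Y}. of_real (usaw b (x + 1) - usaw b x) * cis (\<xi> * of_int x)) <= C * real Y powr (49/50)))"

lemma CI:
 "0 < CI"
 "cmod (\<Sum>x\<in>{1..int Y}. of_real (usaw b (x + 1) - usaw b x) * cis (\<xi> * of_int x)) <= CI * real Y powr (49/50)"
 using someI_ex[OF indicator_exp_sum[OF b_bounds(1,2)], folded CI_def] by simp_all

text \<open>Summation by parts: an exponential sum of size t powr (49/50) against a weight of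
  variation t powr (- b).\<close>

lemma one_sided_error_sum:
 assumes t: "t \<in> dyadic" and G: "0 <= G"
  and g: "!!x. 1 <= x ==> real t / 8 <= of_int x ==> of_int x <= 2 * real t ==> cmod (g x) <= G"
  and dg: "!!x. cmod (g (x + 1) - g x) <= G / real t"
 shows "cmod (\<Sum>x\<in>{1..2 * int t}. g x * epos t x * cis (\<xi> * of_int x)) <= 16 * CI * G * KW * real t powr (- 1 / 60)"
proof -
 have t1: "1 <= real t" by (rule dyadic_ge_1[OF t])
 have fl: "\<lfloor>2 * real t\<rfloor> = int (2 * t)" by (rule floor_unique) simp_all
 let ?c = "%x. of_real (usaw b (x + 1) - usaw b x) * cis (\<xi> * of_int x)"
 have "cmod (\<Sum>x\<in>{1..int (2 * t)}. (g x * wt t x) * ?c x) <= (CI * real (2 * t) powr (49/50)) * (8 * G * KW * real t powr (- b))"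
 proof (rule sum_abel_bound)
  have "wt t (int (2 * t) + 1) = 0" using wt_supp(3)[OF t, of "int (2 * t) + 1"] by auto
  then show "g (int (2 * t) + 1) * wt t (int (2 * t) + 1) = 0" by simp
  fix y assume y: "y \<in> {1..int (2 * t)}"
  have "cmod (\<Sum>x\<in>{1..int (nat y)}. ?c x) <= CI * real (nat y) powr (49/50)" by (rule CI(2))
  also have "... <= CI * real (2 * t) powr (49/50)" using y CI(1) by (intro mult_left_mono powr_mono2) auto
  finally show "cmod (\<Sum>x\<in>{1..y}. ?c x) <= CI * real (2 * t) powr (49/50)" using y by simp
 next
  show "(\<Sum>x\<in>{1..int (2 * t)}. cmod (g (x + 1) * wt t (x + 1) - g x * wt t x)) <= 8 * G * KW * real t powr (- b)"
   unfolding fl[symmetric] by (rule wt_mult_variation[OF t G]) (use g dg in auto)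
 qed (use CI(1) in simp)
 also have "... <= (CI * (2 * real t powr (49/50))) * (8 * G * KW * real t powr (- b))"
 proof (intro mult_right_mono mult_left_mono)
  have "real (2 * t) powr (49/50) = 2 powr (49/50) * real t powr (49/50)" by (simp add: powr_mult)
  also have "... <= 2 powr 1 * real t powr (49/50)" by (intro mult_right_mono powr_mono) auto
  finally show "real (2 * t) powr (49/50) <= 2 * real t powr (49/50)" by simp
 qed (use CI(1) G KW(1) in auto)
 also have "... = 16 * CI * G * KW * (real t powr (49/50) * real t powr (- b))" by simp
 also have "real t powr (49/50) * real t powr (- b) = real t powr (49/50 + - b)" by (simp only: powr_add)
 also have "16 * CI * G * KW * real t powr (49/50 + - b) <= 16 * CI * G * KW * real t powr (- 1 / 60)"
  using t1 b_bounds CI(1) G KW(1) by (intro mult_left_mono powr_mono) auto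
 finally show ?thesis by (simp add: epos_def ind_dens mult_ac)
qed

definition CE :: real where "CE = 32 * (CI + 1) * KW"

lemma CE_pos: "0 < CE" using CI(1) KW(1) by (simp add: CE_def)

text \<open>Both half-lines fall under \<open>one_sided_error_sum\<close>, the negative one after
  reflection of \<open>g\<close>. Pointwise, at most one of \<open>epos t x\<close> and
  \<open>epos t (- x)\<close> is nonzero.\<close>

lemma err_kernel_eker_mult:
 assumes t: "t \<in> dyadic" and G: "0 <= G"
  and g: "!!x. real t / 8 <= \<bar>of_int x\<bar> ==> \<bar>of_int x\<bar> <= 2 * real t ==> cmod (g x) <= G"
  and dg: "!!x. cmod (g (x + 1) - g x) <= G / real t"
 shows "err_kernel (real t) (CE * G) (%x. g x * eker t x)"
proof -
 have t1: "1 <= real t" by (rule dyadic_ge_1[OF t])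
 have ez: "epos t x = 0" if "x \<notin> {1..2 * int t}" for x
  using that wt_supp[OF t, of x] by (cases "wt t x = 0") (auto simp: epos_def)
 have sp: "supp (%x. g x * epos t x) \<subseteq> {1..2 * int t}"
 proof
  fix x assume "x \<in> supp (%x. g x * epos t x)"
  then show "x \<in> {1..2 * int t}" using ez[of x] by (cases "x \<in> {1..2 * int t}") (simp_all add: supp_def)
 qed
 have sm: "supp (%x. g x * epos t (- x)) \<subseteq> {- (2 * int t)..- 1}"
 proof
  fix x assume "x \<in> supp (%x. g x * epos t (- x))"
  then have "- x \<in> {1..2 * int t}" using ez[of "- x"] by (cases "- x \<in> {1..2 * int t}") (simp_all add: supp_def)
  then show "x \<in> {- (2 * int t)..- 1}" by auto
 qed
 have ftb: "cmod (ft (%x. g x * eker t x) \<xi>) <= 32 * CI * G * KW * real t powr (- 1 / 60)" for \<xi>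
 proof -
  have "(%x. g x * eker t x) = (%x. g x * epos t x - g x * epos t (- x))"
   by (auto simp: eker_def antisym_part_def algebra_simps)
  then have "ft (%x. g x * eker t x) \<xi> = ft (%x. g x * epos t x) \<xi> - ft (%x. g x * epos t (- x)) \<xi>"
   using sp sm by (simp add: ft_diff finite_subset)
  also have "ft (%x. g x * epos t (- x)) \<xi> = (\<Sum>y\<in>{- (2 * int t)..- 1}. g y * epos t (- y) * cis (\<xi> * of_int y))"
   by (rule ft_eq[OF _ sm]) simp
  also have "... = (\<Sum>y\<in>{1..2 * int t}. g (- y) * epos t y * cis (- \<xi> * of_int y))"
   by (rule sum.reindex_bij_witness[where i = uminus and j = uminus]) auto
  also have "ft (%x. g x * epos t x) \<xi> = (\<Sum>y\<in>{1..2 * int t}. g y * epos t y * cis (\<xi> * of_int y))"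
   by (rule ft_eq[OF _ sp]) simp
  finally have "cmod (ft (%x. g x * eker t x) \<xi>) <=
    cmod (\<Sum>y\<in>{1..2 * int t}. g y * epos t y * cis (\<xi> * of_int y))
    + cmod (\<Sum>y\<in>{1..2 * int t}. g (- y) * epos t y * cis (- \<xi> * of_int y))"
   by (simp only: norm_triangle_ineq4)
  also have "... <= 16 * CI * G * KW * real t powr (- 1 / 60) + 16 * CI * G * KW * real t powr (- 1 / 60)"
  proof (intro add_mono one_sided_error_sum[OF t G])
   fix x :: int
   show "cmod (g (- (x + 1)) - g (- x)) <= G / real t" using dg[of "- x - 1"] by (simp add: norm_minus_commute)
  qed (use g dg in auto)
  finally show ?thesis by linarith
 qed
 have le: "32 * CI * KW <= CE" "8 * KW <= CE" using CI(1) KW(1) by (auto simp: CE_def algebra_simps)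
 have pt: "cmod (g x * eker t x) <= CE * G * real t powr - b * (real_of_int (ind \<bar>x\<bar>) + real t powr (b - 1))"
  if x: "x \<in> shell (real t)" for x
 proof -
  have x8: "real t / 8 <= \<bar>of_int x\<bar>" "\<bar>of_int x\<bar> <= 2 * real t" using x by (auto simp: shell_def)
  have ax: "1 <= \<bar>x\<bar>" by (rule shell_abs_ge_1[OF t1 x])
  have i0: "0 <= real_of_int (ind \<bar>x\<bar>)" using ind_cases[OF ax] by auto
  have d0: "0 <= dens \<bar>x\<bar>" by (rule dens_bounds(1)[OF ax])
  have "cmod (eker t x) = cmod (epos t \<bar>x\<bar>)"
  proof (cases "0 < x")
   case True
   then have "epos t (- x) = 0" by (intro ez) auto
   then show ?thesis using True by (simp add: eker_def antisym_part_def)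
  next
   case False
   then have "epos t x = 0" by (intro ez) auto
   then show ?thesis using False by (simp add: eker_def antisym_part_def)
  qed
  also have "... = cmod (wt t \<bar>x\<bar>) * \<bar>of_int (ind \<bar>x\<bar>) - dens \<bar>x\<bar>\<bar>"
   by (simp only: epos_def norm_mult norm_of_real)
  also have "... <= (KW * real t powr (- b)) * (of_int (ind \<bar>x\<bar>) + 8 * real t powr (b - 1))"
  proof (intro mult_mono)
   have "dens \<bar>x\<bar> <= 8 * real t powr (b - 1)" using x8 by (intro dens_shell t1 ax) auto
   then show "\<bar>of_int (ind \<bar>x\<bar>) - dens \<bar>x\<bar>\<bar> <= of_int (ind \<bar>x\<bar>) + 8 * real t powr (b - 1)"
    using i0 d0 by linarith
  qed (use KW(1) KW(2)[OF t] in auto)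
  also have "... <= (KW * real t powr (- b)) * (8 * (of_int (ind \<bar>x\<bar>) + real t powr (b - 1)))"
   using i0 KW(1) by (intro mult_left_mono) auto
  finally have "cmod (g x * eker t x) <= G * ((KW * real t powr (- b)) * (8 * (of_int (ind \<bar>x\<bar>) + real t powr (b - 1))))"
   unfolding norm_mult using g[OF x8] G by (intro mult_mono) auto
  also have "... = (8 * KW) * (G * real t powr - b * (of_int (ind \<bar>x\<bar>) + real t powr (b - 1)))" by simp
  also have "... <= CE * (G * real t powr - b * (of_int (ind \<bar>x\<bar>) + real t powr (b - 1)))"
   using le(2) G i0 by (intro mult_right_mono mult_nonneg_nonneg add_nonneg_nonneg) auto
  finally show ?thesis by (simp add: mult_ac)
 qed
 show ?thesis unfolding err_kernel_def
 proof (intro conjI ballI allI pt)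
  show "0 <= CE * G" using CE_pos G by simp
  show "supp (%x. g x * eker t x) \<subseteq> shell (real t)" using supp_kers(2)[OF t] by (auto simp: supp_def)
  fix \<xi>
  have "cmod (ft (%x. g x * eker t x) \<xi>) <= (32 * CI * KW) * (G * real t powr (- 1 / 60))" using ftb[of \<xi>] by (simp add: mult_ac)
  also have "... <= CE * (G * real t powr (- 1 / 60))" using le(1) G by (intro mult_right_mono) auto
  finally show "cmod (ft (%x. g x * eker t x) \<xi>) <= CE * G * real t powr (- 1 / 60)" by (simp add: mult_ac)
 qed
qed

lemma err_kernel_eker: "t \<in> dyadic ==> err_kernel (real t) CE (eker t)"
 using err_kernel_eker_mult[of t 1 "%_. 1"] by simp

text \<open>For t <= s the multiplier has size t / s on the shell and varies slowly, so it is
  absorbed into the weight. For t > s it oscillates within the shell, but then the product is a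
  combination of \<open>eker t\<close> and one modulated copy of it.\<close>

lemma err_kernel_eker_multiplier:
 assumes t: "t \<in> dyadic" and g: "multiplier R s g" and R: "R <= real t / 8" and s: "0 < s"
 shows "err_kernel (real t) (32 * CE * min 1 (real t / s)) (%x. g x * eker t x)"
proof (cases "real t <= s")
 case True
 have t1: "1 <= real t" by (rule dyadic_ge_1[OF t])
 have "err_kernel (real t) (CE * (32 * (real t / s))) (%x. g x * eker t x)"
 proof (rule err_kernel_eker_mult[OF t])
  fix x :: int assume x: "real t / 8 <= \<bar>of_int x\<bar>" "\<bar>of_int x\<bar> <= 2 * real t"
  then have "cmod (g x) <= 16 * \<bar>of_int x\<bar> / s" using R by (intro multiplierD(1)[OF g]) simp
  also have "... <= 16 * (2 * real t) / s" using x s by (intro divide_right_mono mult_left_mono) auto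
  finally show "cmod (g x) <= 32 * (real t / s)" by simp
 next
  fix x :: int
  have "cmod (g (x + 1) - g x) <= 1 / s" using multiplierD(2)[OF g, of x 1] by simp
  also have "... <= 32 * (real t / s) / real t" using t1 s by (simp add: divide_right_mono)
  finally show "cmod (g (x + 1) - g x) <= 32 * (real t / s) / real t" .
 qed (use s in simp)
 moreover have "min 1 (real t / s) = real t / s" using True s by simp
 ultimately show ?thesis by (simp add: mult_ac)
next
 case False
 then have m: "min 1 (real t / s) = 1" using s by simp
 obtain c0 c1 \<eta> where c: "cmod c0 <= 1" "cmod c1 <= 1" and ge: "g = (%x. c0 + c1 * cis (\<eta> * of_int x))"
  using g unfolding multiplier_def by auto
 have e: "(%x. g x * eker t x) = (%x. c0 * eker t x + c1 * (cis (\<eta> * of_int x) * eker t x))"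
  by (auto simp: ge algebra_simps)
 have "err_kernel (real t) (CE + CE) (%x. g x * eker t x)"
  unfolding e by (rule err_kernel_combine[OF err_kernel_eker[OF t] err_kernel_modulate[OF err_kernel_eker[OF t]] c])
 moreover have "err_kernel t B f" if "err_kernel t A f" "A <= B" "1 <= t" for A B t f
 proof -
  have "A * t powr - b * (real_of_int (ind \<bar>x\<bar>) + t powr (b - 1)) <= B * t powr - b * (real_of_int (ind \<bar>x\<bar>) + t powr (b - 1))"
   if "x \<in> shell t" for x
  proof -
   have "0 <= real_of_int (ind \<bar>x\<bar>)" using ind_cases[OF shell_abs_ge_1[OF \<open>1 <= t\<close> that]] by auto
   then show ?thesis using \<open>A <= B\<close> by (intro mult_right_mono) auto
  qed
  moreover have "A * t powr (- 1 / 60) <= B * t powr (- 1 / 60)" using that by (intro mult_right_mono) auto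
  ultimately show ?thesis using that unfolding err_kernel_def by (meson order_trans)
 qed
 ultimately have "err_kernel (real t) (32 * CE) (%x. g x * eker t x)" using CE_pos dyadic_ge_1[OF t] by simp
 then show ?thesis by (simp add: m)
qed

definition CB :: real where
 "CB = (SOME C. C > 0 & (\<forall>t1 t2 A1 A2 f1 f2 M \<theta> \<delta>.
   err_kernel t1 A1 f1 --> err_kernel t2 A2 f2 --> 1 <= M --> 0 < \<delta> --> \<theta> = \<delta> + (\<alpha> - 1) --> \<theta> < 1 -->
   M powr \<theta> <= t1 --> t1 <= t2 --> t2 <= M -->
   ell2_norm (conv f1 f2) <= C * A1 * A2 * M powr (- \<delta> / 160) * t2 powr (- 1 / 2)))"

lemma CB:
 "0 < CB"
 "err_kernel t1 A1 f1 ==> err_kernel t2 A2 f2 ==> 1 <= M ==> 0 < \<delta> ==> \<theta> = \<delta> + (\<alpha> - 1) ==> \<theta> < 1 ==>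
   M powr \<theta> <= t1 ==> t1 <= t2 ==> t2 <= M ==>
   ell2_norm (conv f1 f2) <= CB * A1 * A2 * M powr (- \<delta> / 160) * t2 powr (- 1 / 2)"
 using someI_ex[OF err_kernel_conv, folded CB_def] by simp_all

end

section \<open>The truncated transform and its density\<close>

lemma sum_inverse_squares:
 fixes m :: int
 assumes "1 <= m"
 shows "(\<Sum>x\<in>{m..N}. 1 / (real_of_int x)\<^sup>2) <= 2 / of_int m"
proof -
 have "(\<Sum>x\<in>{m..m + int n}. 1 / (real_of_int x)\<^sup>2) <= 2 / of_int m - 1 / of_int (m + int n)" for n
 proof (induction n)
  case 0
  have "1 / (real_of_int m)\<^sup>2 <= 1 / real_of_int m"
   using assms by (intro divide_left_mono) (auto simp: power2_eq_square)
  then show ?case by simp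
 next
  case (Suc n)
  define y where "y = real_of_int (m + int n)"
  have y: "1 <= y" using assms by (simp add: y_def)
  have "{m..m + int (Suc n)} = insert (m + int (Suc n)) {m..m + int n}" by auto
  then have "(\<Sum>x\<in>{m..m + int (Suc n)}. 1 / (real_of_int x)\<^sup>2)
    = 1 / (y + 1)\<^sup>2 + (\<Sum>x\<in>{m..m + int n}. 1 / (real_of_int x)\<^sup>2)" by (simp add: y_def add_ac)
  moreover have "1 / (y + 1)\<^sup>2 <= 1 / y - 1 / (y + 1)"
  proof -
   have "1 / (y + 1)\<^sup>2 <= 1 / (y * (y + 1))" using y by (intro divide_left_mono) (auto simp: power2_eq_square)
   also have "... = 1 / y - 1 / (y + 1)" using y by (simp add: field_simps)
   finally show ?thesis .
  qed
  moreover have y1: "real_of_int (m + int (Suc n)) = y + 1" by (simp add: y_def)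
  ultimately show ?case using Suc unfolding y_def[symmetric] y1 by linarith
 qed
 from this[of "nat (N - m)"] show ?thesis
 proof (cases "m <= N")
  case True
  have "0 <= 1 / real_of_int N" using True assms by simp
  moreover have "m + int (nat (N - m)) = N" using True by simp
  ultimately show ?thesis using \<open>_ <= 2 / of_int m - 1 / of_int (m + int (nat (N - m)))\<close> by (simp only:)
 qed (use assms in simp)
qed

text \<open>The value of the zeta function at 3/2; the term n = 0 vanishes because 0 powr a =
  0.\<close>

definition ZC :: real where "ZC = (\<Sum>n. real n powr (- 3 / 2))"

lemma sum_powr_le_ZC: "(\<Sum>x\<in>{1..N}. real_of_int x powr (- 3 / 2)) <= ZC"
proof -
 have s: "summable (%n. real n powr (- 3 / 2))" by (simp add: summable_real_powr_iff)
 have "(\<Sum>x\<in>{1..N}. real_of_int x powr (- 3 / 2)) = (\<Sum>n\<in>{1..nat N}. real n powr (- 3 / 2))"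
  by (rule sum.reindex_bij_witness[where i = int and j = nat]) auto
 also have "... <= ZC" unfolding ZC_def by (rule sum_le_suminf[OF s]) auto
 finally show ?thesis .
qed

lemma ZC_nonneg: "0 <= ZC" using sum_powr_le_ZC[of 0] by simp

lemma l1norm_sum:
 assumes "finite A" "!!i. i \<in> A ==> finite (supp (f i))"
 shows "l1norm (%x. \<Sum>i\<in>A. f i x) <= (\<Sum>i\<in>A. l1norm (f i))"
proof -
 let ?B = "\<Union>i\<in>A. supp (f i)"
 have fin: "finite ?B" using assms by auto
 have "l1norm (%x. \<Sum>i\<in>A. f i x) = (\<Sum>x\<in>?B. cmod (\<Sum>i\<in>A. f i x))"
  using fin by (intro l1norm_eq) (auto simp: supp_def intro: sum.neutral)
 also have "... <= (\<Sum>x\<in>?B. \<Sum>i\<in>A. cmod (f i x))" by (intro sum_mono norm_sum)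
 also have "... = (\<Sum>i\<in>A. \<Sum>x\<in>?B. cmod (f i x))" by (rule sum.swap)
 also have "... = (\<Sum>i\<in>A. l1norm (f i))" using fin by (intro sum.cong refl l1norm_eq[symmetric]) auto
 finally show ?thesis .
qed

lemma ft_sum:
 assumes "finite A" "!!i. i \<in> A ==> finite (supp (f i))"
 shows "ft (%x. \<Sum>i\<in>A. f i x) \<xi> = (\<Sum>i\<in>A. ft (f i) \<xi>)"
proof -
 let ?B = "\<Union>i\<in>A. supp (f i)"
 have fin: "finite ?B" using assms by auto
 have "ft (%x. \<Sum>i\<in>A. f i x) \<xi> = (\<Sum>x\<in>?B. (\<Sum>i\<in>A. f i x) * cis (\<xi> * of_int x))"
  using fin by (intro ft_eq) (auto simp: supp_def intro: sum.neutral)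
 also have "... = (\<Sum>i\<in>A. \<Sum>x\<in>?B. f i x * cis (\<xi> * of_int x))"
  by (subst sum.swap) (simp add: sum_distrib_right)
 also have "... = (\<Sum>i\<in>A. ft (f i) \<xi>)" using fin by (intro sum.cong refl ft_eq[symmetric]) auto
 finally show ?thesis .
qed

locale rough_scale = rough_kernels +
 fixes \<theta> \<delta> M :: real
 assumes delta: "0 < \<delta>" and theta: "\<theta> = \<delta> + (\<alpha> - 1)" "\<theta> < 1" and M1: "1 <= M"
begin

definition T :: "nat set" where "T = {t \<in> dyadic. M powr \<theta> <= real t & real t <= M}"

lemma finite_T: "finite T" by (rule finite_subset[of _ "{..nat \<lfloor>M\<rfloor>}"]) (auto simp: T_def le_nat_floor)

lemma T_dyadic: "T \<subseteq> dyadic" by (auto simp: T_def)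

lemma TD: "t \<in> T ==> t \<in> dyadic" "t \<in> T ==> M powr \<theta> <= real t" "t \<in> T ==> real t <= M"
 by (auto simp: T_def)

lemma theta_bounds: "0 < \<theta>" "\<delta> <= \<theta>" "\<delta> <= 1" using theta delta alpha by auto

lemma M_theta: "1 <= M powr \<theta>" using M1 theta_bounds by (intro ge_one_powr_ge_zero) auto

definition W :: "int => complex" where "W x = (\<Sum>t\<in>T. wt t x)"
definition h :: "int => complex" where "h x = (\<Sum>t\<in>T. hker t x)"
definition e :: "int => complex" where "e x = (\<Sum>t\<in>T. eker t x)"
definition H :: "int => complex" where "H x = (\<Sum>t\<in>T. Hker t x)"
definition ep :: "int => complex" where "ep x = W x * of_real (usaw b (x + 1) - usaw b x)"

lemma H_split: "H x = h x + e x" by (simp add: H_def h_def e_def Hker_split sum.distrib)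

lemma finite_supp_h: "finite (supp h)"
 unfolding h_def[abs_def] by (rule finite_supp_sum[OF finite_T finite_supp_kers(1)[OF TD(1)]])

lemma finite_supp_e: "finite (supp e)"
 unfolding e_def[abs_def] by (rule finite_supp_sum[OF finite_T finite_supp_kers(2)[OF TD(1)]])

lemma finite_supp_H: "finite (supp H)"
 unfolding H_def[abs_def] by (rule finite_supp_sum[OF finite_T finite_supp_kers(3)[OF TD(1)]])

lemma sum_T_inverse: "0 < x ==> (\<Sum>t\<in>{t\<in>T. x <= 2 * real t}. 1 / real t) <= 4 / x"
 using sum_dyadic_inverse[of "{t\<in>T. x <= 2 * real t}" "x / 2"] finite_T T_dyadic by fastforce

lemma W_supp:
 assumes "W x ~= 0"
 shows "1 <= x" "M powr \<theta> / 8 <= of_int x" "of_int x <= 2 * M"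
proof -
 obtain t where t: "t \<in> T" "wt t x ~= 0" using assms unfolding W_def by (meson sum.neutral)
 show "1 <= x" "M powr \<theta> / 8 <= of_int x" "of_int x <= 2 * M"
  using wt_supp[OF TD(1)[OF t(1)] t(2)] TD(2,3)[OF t(1)] by linarith+
qed

text \<open>Only scales with x / 2 <= t <= 8 * x contribute. The factor t powr (1 - b) is replaced
  by its value at x, and the remaining 1 / t is summed geometrically.\<close>

lemma W_bound:
 assumes x: "1 <= x"
 shows "cmod (W x) <= 32 * KW * of_int x powr (- b)"
proof -
 let ?x = "real_of_int x"
 let ?S = "{t\<in>T. ?x <= 2 * real t}"
 have "cmod (W x) <= (\<Sum>t\<in>?S. cmod (wt t x))"
 proof -
  have "W x = (\<Sum>t\<in>?S. wt t x)" unfolding W_def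
   using finite_T by (intro sum.mono_neutral_right) (auto simp: T_def dest: wt_supp(3))
  then show ?thesis by (simp add: norm_sum)
 qed
 also have "... <= (\<Sum>t\<in>?S. (8 * KW * ?x powr (1 - b)) * (1 / real t))"
 proof (rule sum_mono)
  fix t assume t: "t \<in> ?S"
  then have td: "t \<in> dyadic" by (simp add: T_def)
  show "cmod (wt t x) <= (8 * KW * ?x powr (1 - b)) * (1 / real t)"
  proof (cases "wt t x = 0")
   case False
   have t1: "1 <= real t" by (rule dyadic_ge_1[OF td])
   have "real t powr (1 - b) <= (8 * ?x) powr (1 - b)"
    using wt_supp(2)[OF td False] t1 b_bounds by (intro powr_mono2) auto
   also have "... = 8 powr (1 - b) * ?x powr (1 - b)" using x by (simp add: powr_mult)
   also have "... <= 8 powr 1 * ?x powr (1 - b)" using b_bounds by (intro mult_right_mono powr_mono) auto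
   finally have tb: "real t powr (1 - b) <= 8 * ?x powr (1 - b)" by simp
   have "cmod (wt t x) <= KW * real t powr (- b)" by (rule KW(2)[OF td])
   also have "real t powr (- b) = real t powr (1 - b) * real t powr (- 1)" by (simp only: powr_add[symmetric]) simp
   also have "real t powr (- 1) = 1 / real t" using t1 by (simp add: powr_minus_divide)
   also have "KW * (real t powr (1 - b) * (1 / real t)) <= KW * ((8 * ?x powr (1 - b)) * (1 / real t))"
    using tb KW(1) by (intro mult_left_mono mult_right_mono) auto
   finally show ?thesis by (simp add: mult_ac)
  qed (use KW(1) in simp)
 qed
 also have "... = (8 * KW * ?x powr (1 - b)) * (\<Sum>t\<in>?S. 1 / real t)" by (simp add: sum_distrib_left)
 also have "... <= (8 * KW * ?x powr (1 - b)) * (4 / ?x)" using x KW(1) by (intro mult_left_mono sum_T_inverse) auto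
 also have "... = 32 * KW * (?x powr (1 - b) * (1 / ?x))" by simp
 also have "1 / ?x = ?x powr (- 1)" using x by (simp add: powr_minus_divide)
 also have "?x powr (1 - b) * ?x powr (- 1) = ?x powr (- b)" by (simp only: powr_add[symmetric]) simp
 finally show ?thesis .
qed

lemma W_diff:
 assumes x: "1 <= x" and a: "0 <= a"
 shows "cmod (W (x + a) - W x) <= 8 * KW * of_int x powr (- 2 * b) * of_int (mu (x + a) - mu x)"
proof -
 let ?x = "real_of_int x"
 let ?S = "{t\<in>T. ?x <= 2 * real t}"
 let ?m = "real_of_int (mu (x + a) - mu x)"
 have m0: "0 <= ?m"
 proof -
  have "mu x <= mu (x + a)" unfolding mu_def using x a b_bounds by (intro ceiling_mono powr_mono2) auto
  then show ?thesis by simp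
 qed
 have "W (x + a) - W x = (\<Sum>t\<in>T. wt t (x + a) - wt t x)" by (simp add: W_def sum_subtractf)
 also have "... = (\<Sum>t\<in>?S. wt t (x + a) - wt t x)"
 proof (rule sum.mono_neutral_right[OF finite_T])
  show "\<forall>t\<in>T - ?S. wt t (x + a) - wt t x = 0"
  proof
   fix t assume t: "t \<in> T - ?S"
   then have td: "t \<in> dyadic" and lt: "2 * real t < ?x" by (auto simp: T_def)
   have "wt t x = 0" using wt_supp(3)[OF td, of x] lt by (cases "wt t x = 0") auto
   moreover have "wt t (x + a) = 0" using wt_supp(3)[OF td, of "x + a"] lt a by (cases "wt t (x + a) = 0") auto
   ultimately show "wt t (x + a) - wt t x = 0" by simp
  qed
 qed auto
 finally have "cmod (W (x + a) - W x) <= (\<Sum>t\<in>?S. cmod (wt t (x + a) - wt t x))" by (simp add: norm_sum)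
 also have "... <= (\<Sum>t\<in>?S. (2 * KW * ?x powr (1 - 2 * b) * ?m) * (1 / real t))"
 proof (rule sum_mono)
  fix t assume t: "t \<in> ?S"
  then have td: "t \<in> dyadic" by (simp add: T_def)
  have t1: "1 <= real t" by (rule dyadic_ge_1[OF td])
  have "real t powr (1 - 2 * b) <= (?x / 2) powr (1 - 2 * b)" using t x b_bounds by (intro powr_mono2') auto
  also have "... = 2 powr (2 * b - 1) * ?x powr (1 - 2 * b)"
   using x powr_minus_divide[of 2 "2 * b - 1"] by (simp add: powr_divide)
  also have "... <= 2 powr 1 * ?x powr (1 - 2 * b)" using b_bounds by (intro mult_right_mono powr_mono) auto
  finally have tb: "real t powr (1 - 2 * b) <= 2 * ?x powr (1 - 2 * b)" by simp
  have "cmod (wt t (x + a) - wt t x) <= KW * real t powr (- 2 * b) * ?m" by (rule KW(3)[OF td x a])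
  also have "real t powr (- 2 * b) = real t powr (1 - 2 * b) * real t powr (- 1)" by (simp only: powr_add[symmetric]) simp
  also have "real t powr (- 1) = 1 / real t" using t1 by (simp add: powr_minus_divide)
  also have "KW * (real t powr (1 - 2 * b) * (1 / real t)) * ?m <= KW * ((2 * ?x powr (1 - 2 * b)) * (1 / real t)) * ?m"
   using tb KW(1) m0 by (intro mult_left_mono mult_right_mono) auto
  finally show "cmod (wt t (x + a) - wt t x) <= (2 * KW * ?x powr (1 - 2 * b) * ?m) * (1 / real t)" by (simp add: mult_ac)
 qed
 also have "... = (2 * KW * ?x powr (1 - 2 * b) * ?m) * (\<Sum>t\<in>?S. 1 / real t)" by (simp add: sum_distrib_left)
 also have "... <= (2 * KW * ?x powr (1 - 2 * b) * ?m) * (4 / ?x)"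
  using x KW(1) m0 by (intro mult_left_mono sum_T_inverse) auto
 also have "... = 8 * KW * (?x powr (1 - 2 * b) * (1 / ?x)) * ?m" by simp
 also have "1 / ?x = ?x powr (- 1)" using x by (simp add: powr_minus_divide)
 also have "?x powr (1 - 2 * b) * ?x powr (- 1) = ?x powr (- 2 * b)" by (simp only: powr_add[symmetric]) simp
 finally show ?thesis .
qed

lemma h_pos: "1 <= x ==> h x = W x * of_real (dens x)"
proof -
 assume x: "1 <= x"
 have "hker t x = wt t x * of_real (dens x)" for t using x by (simp add: hker_def antisym_part_def hpos_def wt_def)
 then show ?thesis by (simp add: h_def W_def sum_distrib_right)
qed

lemma h_odd: "h (- x) = - h x" by (simp add: h_def hker_def antisym_part_def sum_negf[symmetric])

lemma H_odd: "H (- x) = - H x" by (simp add: H_def Hker_def antisym_part_def sum_negf[symmetric])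

lemma h_0: "h 0 = 0" using h_odd[of 0] by simp

lemma e_ep: "e x = ep x - ep (- x)"
proof -
 have "epos t x = wt t x * of_real (usaw b (x + 1) - usaw b x)" for t x by (simp add: epos_def ind_dens)
 then have "eker t x = wt t x * of_real (usaw b (x + 1) - usaw b x) - wt t (- x) * of_real (usaw b (- x + 1) - usaw b (- x))" for t
  by (simp only: eker_def antisym_part_def)
 then show ?thesis unfolding e_def ep_def W_def by (simp only: sum_subtractf sum_distrib_right)
qed

lemma h_supp:
 assumes "h x ~= 0"
 shows "1 <= \<bar>x\<bar>" "M powr \<theta> / 8 <= \<bar>of_int x\<bar>" "\<bar>of_int x\<bar> <= 2 * M"
proof -
 have x0: "x ~= 0" using assms h_0 by auto
 then show x1: "1 <= \<bar>x\<bar>" by simp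
 have "h \<bar>x\<bar> ~= 0" using assms h_odd[of x] by (cases "0 <= x") auto
 then have "W \<bar>x\<bar> ~= 0" using h_pos[OF x1] by auto
 from W_supp[OF this] show "M powr \<theta> / 8 <= \<bar>of_int x\<bar>" "\<bar>of_int x\<bar> <= 2 * M" by auto
qed

lemma h_bound: "cmod (h x) <= 32 * KW / \<bar>of_int x\<bar>"
proof (cases "x = 0")
 case False
 then have x1: "1 <= \<bar>x\<bar>" by simp
 let ?x = "real_of_int \<bar>x\<bar>"
 have "cmod (h x) = cmod (h \<bar>x\<bar>)" using h_odd[of x] by (cases "0 <= x") auto
 also have "... = cmod (W \<bar>x\<bar>) * dens \<bar>x\<bar>" using h_pos[OF x1] dens_bounds(1)[OF x1] by (simp add: norm_mult)
 also have "... <= (32 * KW * ?x powr (- b)) * ?x powr (b - 1)"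
  using W_bound[OF x1] dens_bounds(1,2)[OF x1] KW(1) by (intro mult_mono) auto
 also have "... = 32 * KW * (?x powr (- b) * ?x powr (b - 1))" by simp
 also have "?x powr (- b) * ?x powr (b - 1) = ?x powr (- 1)" by (simp only: powr_add[symmetric]) simp
 also have "?x powr (- 1) = 1 / ?x" using x1 by (simp add: powr_minus_divide)
 finally show ?thesis by simp
qed (simp add: h_0)

text \<open>The summand 1 is the rounding in \<open>mu\<close>: the weights are step functions. It
  is the source of the term x powr (- b - 1) in the increments of \<open>h\<close>, which does not
  shrink with a.\<close>

lemma mu_diff_le:
 assumes x: "1 <= x" and a: "0 <= a"
 shows "of_int (mu (x + a) - mu x) <= of_int a * of_int x powr (b - 1) + 1"
proof -
 let ?x = "real_of_int x"
 have "(?x + of_int a) powr b - ?x powr b <= of_int a * ?x powr (b - 1)"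
 proof (cases "a = 0")
  case False
  have "\<exists>z>?x. z < ?x + of_int a & (?x + of_int a) powr b - ?x powr b = (?x + of_int a - ?x) * (b * z powr (b - 1))"
  proof (rule MVT2)
   fix t assume "?x <= t" "t <= ?x + of_int a"
   then show "((%t. t powr b) has_real_derivative (b * t powr (b - 1))) (at t)"
    using x by (auto intro!: derivative_eq_intros)
  qed (use a False in simp)
  then obtain z where z: "?x < z" "(?x + of_int a) powr b - ?x powr b = of_int a * (b * z powr (b - 1))" by auto
  have "z powr (b - 1) <= ?x powr (b - 1)" using z x b_bounds by (intro powr_mono2') auto
  then have "b * z powr (b - 1) <= 1 * ?x powr (b - 1)" using b_bounds by (intro mult_mono) auto
  then show ?thesis unfolding z(2) using a by (intro mult_left_mono) auto
 qed simp
 moreover have "of_int (mu (x + a)) < (?x + of_int a) powr b + 1" "?x powr b <= of_int (mu x)"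
  unfolding mu_def by (simp_all, linarith)
 ultimately show ?thesis by simp
qed

lemma h_diff_pos:
 assumes x: "1 <= x" and a: "0 <= a"
 shows "cmod (h (x + a) - h x) <= 40 * KW * (of_int a / (of_int x)\<^sup>2 + of_int x powr (- b - 1))"
proof -
 let ?x = "real_of_int x" and ?a = "real_of_int a"
 have xa: "1 <= x + a" using x a by simp
 have x0: "0 < ?x" using x by simp
 have d: "0 <= dens (x + a)" "dens (x + a) <= ?x powr (b - 1)"
 proof -
  show "0 <= dens (x + a)" by (rule dens_bounds(1)[OF xa])
  show "dens (x + a) <= ?x powr (b - 1)" using dens_bounds(2)[OF x] dens_bounds(3)[OF x a] by linarith
 qed
 have m0: "0 <= real_of_int (mu (x + a) - mu x)"
 proof -
  have "mu x <= mu (x + a)" unfolding mu_def using x a b_bounds by (intro ceiling_mono powr_mono2) auto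
  then show ?thesis by simp
 qed
 have "h (x + a) - h x = (W (x + a) - W x) * of_real (dens (x + a)) - W x * of_real (dens x - dens (x + a))"
  unfolding h_pos[OF x] h_pos[OF xa] by (simp add: algebra_simps)
 then have "cmod (h (x + a) - h x) <= cmod (W (x + a) - W x) * \<bar>dens (x + a)\<bar> + cmod (W x) * \<bar>dens x - dens (x + a)\<bar>"
  using norm_triangle_ineq4[of "(W (x + a) - W x) * of_real (dens (x + a))" "W x * of_real (dens x - dens (x + a))"]
  by (simp only: norm_mult norm_of_real)
 also have "... <= (8 * KW * ?x powr (- 2 * b) * (?a * ?x powr (b - 1) + 1)) * ?x powr (b - 1) + (32 * KW * ?x powr (- b)) * (?a * ?x powr (b - 2))"
 proof (intro add_mono mult_mono)
  have "cmod (W (x + a) - W x) <= 8 * KW * ?x powr (- 2 * b) * of_int (mu (x + a) - mu x)" by (rule W_diff[OF x a])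
  also have "... <= 8 * KW * ?x powr (- 2 * b) * (?a * ?x powr (b - 1) + 1)"
   using mu_diff_le[OF x a] KW(1) by (intro mult_left_mono) auto
  finally show "cmod (W (x + a) - W x) <= 8 * KW * ?x powr (- 2 * b) * (?a * ?x powr (b - 1) + 1)" .
  show "\<bar>dens (x + a)\<bar> <= ?x powr (b - 1)" using d by simp
  show "cmod (W x) <= 32 * KW * ?x powr (- b)" by (rule W_bound[OF x])
  show "\<bar>dens x - dens (x + a)\<bar> <= ?a * ?x powr (b - 2)" using dens_bounds(3)[OF x a] by simp
 qed (use KW(1) a in auto)
 also have "... = 8 * KW * ?a * (?x powr (- 2 * b) * ?x powr (b - 1) * ?x powr (b - 1)) + 8 * KW * (?x powr (- 2 * b) * ?x powr (b - 1)) + 32 * KW * ?a * (?x powr (- b) * ?x powr (b - 2))"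
  by (simp add: algebra_simps)
 also have "?x powr (- 2 * b) * ?x powr (b - 1) * ?x powr (b - 1) = ?x powr (- 2)" by (simp only: powr_add[symmetric]) simp
 also have "?x powr (- 2 * b) * ?x powr (b - 1) = ?x powr (- b - 1)" by (simp only: powr_add[symmetric]) simp
 also have "?x powr (- b) * ?x powr (b - 2) = ?x powr (- 2)" by (simp only: powr_add[symmetric]) simp
 also have "?x powr (- 2) = 1 / ?x\<^sup>2" using x0 by (simp add: powr_minus_divide)
 also have "8 * KW * ?a * (1 / ?x\<^sup>2) + 8 * KW * ?x powr (- b - 1) + 32 * KW * ?a * (1 / ?x\<^sup>2)
   = 40 * KW * (?a / ?x\<^sup>2) + 8 * (KW * ?x powr (- b - 1))" by (simp add: algebra_simps)
 also have "... <= 40 * KW * (?a / ?x\<^sup>2) + 40 * (KW * ?x powr (- b - 1))"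
  using KW(1) by (intro add_left_mono mult_right_mono) auto
 finally show ?thesis by (simp add: algebra_simps)
qed

text \<open>For negative x, oddness reflects the pair x, x + a to the positive pair y + a, y with y
  = - x - a; the condition on x keeps y comparable to its modulus.\<close>

lemma h_diff:
 assumes x: "2 * a <= \<bar>x\<bar>" and a: "1 <= a"
 shows "cmod (h (x + a) - h x) <= 160 * KW * (of_int a / (of_int x)\<^sup>2 + \<bar>of_int x\<bar> powr (- b - 1))"
proof -
 define y where "y = (if 0 < x then x else - x - a)"
 have y1: "1 <= y" and yx: "\<bar>x\<bar> <= 2 * y" using x a by (auto simp: y_def)
 have e: "cmod (h (x + a) - h x) = cmod (h (y + a) - h y)"
 proof (cases "0 < x")
  case False
  have ye: "y + a = - x" "y = - (x + a)" using False by (simp_all add: y_def)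
  have "h (y + a) - h y = h (x + a) - h x" unfolding ye(1) unfolding ye(2) h_odd by simp
  then show ?thesis by simp
 qed (simp add: y_def)
 let ?x = "\<bar>real_of_int x\<bar>"
 have x0: "0 < ?x" using x a by linarith
 have yx': "?x / 2 <= of_int y" using yx by linarith
 have "cmod (h (y + a) - h y) <= 40 * KW * (of_int a / (of_int y)\<^sup>2 + of_int y powr (- b - 1))"
  using a by (intro h_diff_pos y1) simp
 also have "... <= 40 * KW * (4 * (of_int a / (of_int x)\<^sup>2) + 4 * ?x powr (- b - 1))"
 proof (intro mult_left_mono add_mono)
  have "of_int a / (of_int y)\<^sup>2 <= of_int a / (?x / 2)\<^sup>2"
   using yx' x0 a by (intro divide_left_mono power_mono mult_pos_pos) (auto intro!: mult_pos_pos)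
  then show "real_of_int a / (of_int y)\<^sup>2 <= 4 * (of_int a / (of_int x)\<^sup>2)" by (simp add: power_divide mult.commute)
  have "of_int y powr (- b - 1) <= (?x / 2) powr (- b - 1)" using yx' x0 b_bounds by (intro powr_mono2') auto
  also have "... = 2 powr (b + 1) * ?x powr (- b - 1)"
   using x0 powr_minus_divide[of 2 "b + 1"] by (simp add: powr_divide)
  also have "... <= 2 powr 2 * ?x powr (- b - 1)" using b_bounds by (intro mult_right_mono powr_mono) auto
  finally show "of_int y powr (- b - 1) <= 4 * ?x powr (- b - 1)" by simp
 qed (use KW(1) in auto)
 finally show ?thesis unfolding e by (simp add: algebra_simps)
qed

text \<open>At each frequency the transforms of all \<open>hker t\<close> add up to O(1) by
  \<open>sum_dyadic_min\<close>; where cis \<xi> = 1 they all vanish.\<close>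

lemma conv_h:
 assumes "finite (supp f)"
 shows "ell2_norm (conv h f) <= 1280 * KW * ell2_norm f"
proof (rule ell2_norm_conv_le_ft[OF finite_supp_h assms])
 fix \<xi>
 have "ft h \<xi> = (\<Sum>t\<in>T. ft (hker t) \<xi>)"
  unfolding h_def[abs_def] by (intro ft_sum finite_T finite_supp_kers TD)
 then have "cmod (ft h \<xi>) <= (\<Sum>t\<in>T. cmod (ft (hker t) \<xi>))" by (simp add: norm_sum)
 also have "... <= 1280 * KW"
 proof (cases "cmod (cis \<xi> - 1) = 0")
  case True
  then have "ft (hker t) \<xi> = 0" if "t \<in> T" for t using ft_hker_bounds(1)[OF TD(1)[OF that], of \<xi>] by simp
  then show ?thesis using KW(1) by simp
 next
  case False
  have "(\<Sum>t\<in>T. cmod (ft (hker t) \<xi>)) <= 4 * (320 * KW)"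
  proof (rule sum_dyadic_min[OF finite_T T_dyadic])
   show "0 < cmod (cis \<xi> - 1)" using False by simp
   fix t assume t: "t \<in> T"
   have "cmod (ft (hker t) \<xi>) <= 64 * (KW * (real t * cmod (cis \<xi> - 1)))"
    using ft_hker_bounds(1)[OF TD(1)[OF t], of \<xi>] by simp
   also have "... <= 320 * (KW * (real t * cmod (cis \<xi> - 1)))" using KW(1) by (intro mult_right_mono) auto
   finally show "cmod (ft (hker t) \<xi>) <= 320 * KW * (real t * cmod (cis \<xi> - 1))" by simp
   show "cmod (cis \<xi> - 1) * cmod (ft (hker t) \<xi>) <= 320 * KW / real t" by (rule ft_hker_bounds(2)[OF TD(1)[OF t]])
  qed (use KW(1) in simp)
  then show ?thesis by simp
 qed
 finally show "cmod (ft h \<xi>) <= 1280 * KW" .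
qed

text \<open>Scale t contributes O(1 / t), and the smallest scale M powr \<theta> dominates. This is
  the gain whenever a difference is moved onto \<open>h\<close>.\<close>

lemma h_variation: "l1norm (%x. h (x + 1) - h x) <= 640 * KW * M powr (- \<theta>)"
proof -
 have "(%x. h (x + 1) - h x) = (%x. \<Sum>t\<in>T. hker t (x + 1) - hker t x)" by (simp add: h_def sum_subtractf)
 then have "l1norm (%x. h (x + 1) - h x) <= (\<Sum>t\<in>T. l1norm (%x. hker t (x + 1) - hker t x))"
  using l1norm_sum[OF finite_T, of "%t x. hker t (x + 1) - hker t x"] finite_supp_kers(1) TD(1)
  by (simp add: finite_supp_diff finite_supp_shift)
 also have "... <= (\<Sum>t\<in>T. 320 * KW * (1 / real t))" using hker_variation TD(1) by (intro sum_mono) auto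
 also have "... = 320 * KW * (\<Sum>t\<in>T. 1 / real t)" by (simp add: sum_distrib_left)
 also have "... <= 320 * KW * (2 / M powr \<theta>)"
  using KW(1) M_theta TD(2) by (intro mult_left_mono sum_dyadic_inverse finite_T T_dyadic) auto
 finally show ?thesis by (simp add: powr_minus_divide)
qed

end

section \<open>The smooth kernel times a multiplier\<close>

context rough_scale
begin

text \<open>The squared size allowed at scale \<open>s\<close>: of order \<open>1 / s\<close> up to \<open>M\<close>, and better beyond.\<close>

definition Gs :: "real => real" where "Gs s = min s M / s\<^sup>2"

lemma Gs_le: "0 < s ==> Gs s <= 1 / s" by (simp add: Gs_def power2_eq_square divide_le_eq)

lemma Gs_nonneg: "0 < s ==> 0 <= Gs s" using M1 by (simp add: Gs_def)

lemma sum_min_Gs: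
 assumes s: "1 <= s"
 shows "(\<Sum>x\<in>{1..\<lfloor>2 * M\<rfloor>}. (min (1 / real_of_int x) (1 / s))\<^sup>2) <= 3 * Gs s"
proof (cases "s <= M")
 case True
 have g: "Gs s = 1 / s" using True s by (simp add: Gs_def power2_eq_square)
 let ?A = "{1..\<lfloor>s\<rfloor>}" and ?B = "{\<lfloor>s\<rfloor> + 1..\<lfloor>2 * M\<rfloor>}"
 have "(\<Sum>x\<in>{1..\<lfloor>2 * M\<rfloor>}. (min (1 / real_of_int x) (1 / s))\<^sup>2) <= (\<Sum>x\<in>?A \<union> ?B. (min (1 / real_of_int x) (1 / s))\<^sup>2)"
  by (intro sum_mono2) auto
 also have "... = (\<Sum>x\<in>?A. (min (1 / real_of_int x) (1 / s))\<^sup>2) + (\<Sum>x\<in>?B. (min (1 / real_of_int x) (1 / s))\<^sup>2)"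
  by (rule sum.union_disjoint) auto
 also have "... <= (\<Sum>x\<in>?A. (1 / s)\<^sup>2) + (\<Sum>x\<in>?B. 1 / (real_of_int x)\<^sup>2)"
 proof (intro add_mono sum_mono)
  fix x assume "x \<in> ?A"
  then show "(min (1 / real_of_int x) (1 / s))\<^sup>2 <= (1 / s)\<^sup>2" using s by (intro power_mono) auto
 next
  fix x assume "x \<in> ?B"
  moreover have "1 <= \<lfloor>s\<rfloor>" using s by simp
  ultimately have "0 <= x" by simp linarith
  then have "0 <= 1 / real_of_int x" by simp
  then have "(min (1 / real_of_int x) (1 / s))\<^sup>2 <= (1 / real_of_int x)\<^sup>2" using s by (intro power_mono) auto
  then show "(min (1 / real_of_int x) (1 / s))\<^sup>2 <= 1 / (real_of_int x)\<^sup>2" by (simp add: power_divide)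
 qed
 also have "(\<Sum>x\<in>?A. (1 / s)\<^sup>2) <= s * (1 / s)\<^sup>2"
 proof -
  have "real (card ?A) <= s" using s by simp
  then show ?thesis by (simp only: sum_constant) (intro mult_right_mono, auto)
 qed
 also have "s * (1 / s)\<^sup>2 = 1 / s" using s by (simp add: power2_eq_square)
 also have "(\<Sum>x\<in>?B. 1 / (real_of_int x)\<^sup>2) <= 2 / of_int (\<lfloor>s\<rfloor> + 1)" using s by (intro sum_inverse_squares) simp
 also have "... <= 2 / s"
 proof (rule divide_left_mono)
  show f: "s <= real_of_int (\<lfloor>s\<rfloor> + 1)" by linarith
  show "0 < real_of_int (\<lfloor>s\<rfloor> + 1) * s" using s f by (intro mult_pos_pos) linarith+
 qed simp
 finally show ?thesis unfolding g by simp
next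
 case False
 then have g: "Gs s = M / s\<^sup>2" by (simp add: Gs_def)
 have "(\<Sum>x\<in>{1..\<lfloor>2 * M\<rfloor>}. (min (1 / real_of_int x) (1 / s))\<^sup>2) <= (\<Sum>x\<in>{1..\<lfloor>2 * M\<rfloor>}. (1 / s)\<^sup>2)"
  using s by (intro sum_mono power_mono) auto
 also have "... = of_int \<lfloor>2 * M\<rfloor> * (1 / s)\<^sup>2" using M1 by simp
 also have "... <= (2 * M) * (1 / s)\<^sup>2" by (intro mult_right_mono) auto
 also have "... <= 3 * Gs s" using M1 by (simp add: g power_divide divide_right_mono)
 finally show ?thesis .
qed

lemma ell2_norm_min_bound:
 assumes s: "1 <= s" and K: "0 <= K" and supp: "!!x. f x ~= 0 ==> 1 <= \<bar>x\<bar> & \<bar>of_int x\<bar> <= 2 * M"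
  and f: "!!x. f x ~= 0 ==> cmod (f x) <= K * min (1 / \<bar>of_int x\<bar>) (1 / s)"
 shows "ell2_norm f <= 3 * K * sqrt (Gs s)"
proof -
 let ?N = "\<lfloor>2 * M\<rfloor>"
 let ?m = "%x::int. K\<^sup>2 * (min (1 / \<bar>of_int x\<bar>) (1 / s))\<^sup>2"
 have sub: "supp f \<subseteq> {1..?N} \<union> uminus ` {1..?N}"
 proof
  fix x assume "x \<in> supp f"
  then have "1 <= \<bar>x\<bar>" "\<bar>x\<bar> <= ?N" using supp[of x] by (auto simp: supp_def le_floor_iff)
  then show "x \<in> {1..?N} \<union> uminus ` {1..?N}" by (cases "0 < x") (auto intro!: image_eqI[where x = "- x"])
 qed
 have "(\<Sum>x\<in>{1..?N} \<union> uminus ` {1..?N}. (cmod (f x))\<^sup>2) <= (\<Sum>x\<in>{1..?N} \<union> uminus ` {1..?N}. ?m x)"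
 proof (rule sum_mono)
  fix x
  show "(cmod (f x))\<^sup>2 <= ?m x"
  proof (cases "f x = 0")
   case False
   then show ?thesis using power_mono[OF f[OF False] norm_ge_zero, of 2] by (simp add: power_mult_distrib)
  qed (use K in simp)
 qed
 also have "... = (\<Sum>x\<in>{1..?N}. ?m x) + (\<Sum>x\<in>uminus ` {1..?N}. ?m x)" by (rule sum.union_disjoint) auto
 also have "(\<Sum>x\<in>uminus ` {1..?N}. ?m x) = (\<Sum>x\<in>{1..?N}. ?m x)"
  by (subst sum.reindex) (auto simp: inj_on_def)
 also have "(\<Sum>x\<in>{1..?N}. ?m x) = K\<^sup>2 * (\<Sum>x\<in>{1..?N}. (min (1 / real_of_int x) (1 / s))\<^sup>2)"
  unfolding sum_distrib_left by (intro sum.cong) auto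
 also have "K\<^sup>2 * (\<Sum>x\<in>{1..?N}. (min (1 / real_of_int x) (1 / s))\<^sup>2) + K\<^sup>2 * (\<Sum>x\<in>{1..?N}. (min (1 / real_of_int x) (1 / s))\<^sup>2)
   <= K\<^sup>2 * (3 * Gs s) + K\<^sup>2 * (3 * Gs s)" using sum_min_Gs[OF s] by (intro add_mono mult_left_mono) auto
 also have "... <= (3 * K * sqrt (Gs s))\<^sup>2"
  using Gs_nonneg[of s] s by (simp add: power_mult_distrib mult_right_mono)
 finally show ?thesis
  using sub K Gs_nonneg[of s] s by (intro ell2_norm_le_of_sum[of "{1..?N} \<union> uminus ` {1..?N}"]) auto
qed

abbreviation R :: real where "R \<equiv> M powr \<theta> / 8"

lemma multiplier_min:
 assumes g: "multiplier R s g" and s: "1 <= s" and x: "R <= \<bar>of_int x\<bar>" "1 <= \<bar>x\<bar>"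
 shows "cmod (g x) / \<bar>of_int x\<bar> <= 16 * min (1 / \<bar>of_int x\<bar>) (1 / s)"
proof -
 have x0: "0 < \<bar>real_of_int x\<bar>" using x(2) by simp
 have "cmod (g x) / \<bar>of_int x\<bar> <= 2 / \<bar>of_int x\<bar>" using multiplier_le_2[OF g] by (intro divide_right_mono) auto
 then have 1: "cmod (g x) / \<bar>of_int x\<bar> <= 16 * (1 / \<bar>of_int x\<bar>)" using x0 by (simp add: divide_right_mono order_trans)
 have "cmod (g x) / \<bar>of_int x\<bar> <= (16 * \<bar>of_int x\<bar> / s) / \<bar>of_int x\<bar>"
  using multiplierD(1)[OF g x(1)] by (intro divide_right_mono) auto
 also have "... = 16 * (1 / s)" using x0 by simp
 finally show ?thesis using 1 by (simp add: min_def)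
qed

text \<open>On the support of \<open>h\<close> the multiplier is at most 2 and at most 16 *
  \<bar>x\<bar> / s, so the product has the profile min (1 / \<bar>x\<bar>) (1 / s); its squared
  norm is what \<open>Gs\<close> measures.\<close>

lemma norm_mult_h:
 assumes g: "multiplier R s g" and s: "1 <= s"
 shows "ell2_norm (%x. g x * h x) <= 1536 * KW * sqrt (Gs s)"
proof -
 have "ell2_norm (%x. g x * h x) <= 3 * (512 * KW) * sqrt (Gs s)"
 proof (rule ell2_norm_min_bound[OF s])
  fix x assume "g x * h x ~= 0"
  then have hx: "h x ~= 0" by auto
  show "1 <= \<bar>x\<bar> & \<bar>of_int x\<bar> <= 2 * M" using h_supp[OF hx] by simp
  have "cmod (g x * h x) <= cmod (g x) * (32 * KW / \<bar>of_int x\<bar>)"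
   unfolding norm_mult by (intro mult_left_mono h_bound) auto
  also have "... = 32 * KW * (cmod (g x) / \<bar>of_int x\<bar>)" by simp
  also have "... <= 32 * KW * (16 * min (1 / \<bar>of_int x\<bar>) (1 / s))"
   using h_supp[OF hx] KW(1) by (intro mult_left_mono multiplier_min[OF g s]) auto
  finally show "cmod (g x * h x) <= 512 * KW * min (1 / \<bar>of_int x\<bar>) (1 / s)" by simp
 qed (use KW(1) in simp)
 then show ?thesis by simp
qed

text \<open>For \<bar>x\<bar> < 2 * a only the size O(1 / s) is used, on fewer than 4 * a points.
  Farther out the product rule gives 1 / s times a / \<bar>x\<bar> + \<bar>x\<bar> powr (- b), whose
  squares sum to O(a). As sqrt a / s = s powr (- 1/2) * (a / s) powr (1/2), this is Hoelder
  continuity of order 1/2.\<close>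

lemma norm_diff_mult_h:
 assumes g: "multiplier R s g" and s: "1 <= s" and a: "1 <= a"
 shows "ell2_norm (%x. g (x + a) * h (x + a) - g x * h x) <= 4000 * KW * sqrt (8 + 4 * ZC) * (sqrt (of_int a) / s)"
proof -
 let ?k = "%x. g x * h x"
 let ?d = "%x. ?k (x + a) - ?k x"
 let ?N = "\<lfloor>2 * M\<rfloor> + a"
 let ?a = "real_of_int a"
 have K0: "0 <= KW" using KW(1) by simp
 have a1: "1 <= ?a" using a by simp
 have kb: "cmod (?k x) <= 512 * KW / s" for x
 proof (cases "h x = 0")
  case False
  have x1: "1 <= \<bar>x\<bar>" and R: "R <= \<bar>of_int x\<bar>" using h_supp[OF False] by auto
  have "cmod (?k x) <= (16 * \<bar>of_int x\<bar> / s) * (32 * KW / \<bar>of_int x\<bar>)"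
   unfolding norm_mult using s by (intro mult_mono multiplierD(1)[OF g R] h_bound) auto
  also have "... = 512 * KW / s" using x1 by simp
  finally show ?thesis .
 qed (use K0 s in simp)
 have near: "(cmod (?d x))\<^sup>2 <= (1024 * KW / s)\<^sup>2" for x
 proof (rule power_mono)
  have "cmod (?d x) <= cmod (?k (x + a)) + cmod (?k x)" by (rule norm_triangle_ineq4)
  then show "cmod (?d x) <= 1024 * KW / s" using kb[of x] kb[of "x + a"] by simp
 qed simp
 have far: "(cmod (?d x))\<^sup>2 <= (4000 * KW / s)\<^sup>2 * (2 * (?a\<^sup>2 * (1 / (of_int x)\<^sup>2)) + 2 * \<bar>of_int x\<bar> powr (- 3 / 2))" if x: "2 * a <= \<bar>x\<bar>" for x
 proof -
  let ?x = "\<bar>real_of_int x\<bar>"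
  have x1: "1 <= ?x" using x a by linarith
  let ?q = "?a / (of_int x)\<^sup>2 + ?x powr (- b - 1)"
  have q0: "0 <= ?q" using a by simp
  have hd: "cmod (h (x + a) - h x) <= 160 * KW * ?q" by (rule h_diff[OF x a])
  have xa: "?x / 2 <= \<bar>of_int (x + a)\<bar>" "\<bar>of_int (x + a)\<bar> <= 3 / 2 * ?x" using x a by linarith+
  have "cmod (?d x) <= (24 * ?x / s) * (160 * KW * ?q) + (?a / s) * (64 * KW / ?x)"
  proof (cases "h x = 0")
   case True
   have "cmod (?d x) <= (24 * ?x / s) * (160 * KW * ?q)"
   proof (cases "h (x + a) = 0")
    case False
    have "cmod (g (x + a)) <= 16 * \<bar>of_int (x + a)\<bar> / s"
     using h_supp(2)[OF False] by (intro multiplierD(1)[OF g]) auto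
    also have "... <= 24 * ?x / s" using xa(2) s by (intro divide_right_mono) auto
    finally have "cmod (g (x + a)) * cmod (h (x + a) - h x) <= (24 * ?x / s) * (160 * KW * ?q)"
     using hd s by (intro mult_mono) auto
    then show ?thesis using True by (simp add: norm_mult)
   next
    case F: True
    have "0 <= (24 * ?x / s) * (160 * KW * ?q)" using K0 s q0 by (intro mult_nonneg_nonneg) auto
    then show ?thesis using F True by simp
   qed
   moreover have "0 <= (?a / s) * (64 * KW / ?x)" using K0 s a1 by simp
   ultimately show ?thesis by linarith
  next
   case False
   have gx: "cmod (g x) <= 24 * ?x / s"
   proof -
    have "cmod (g x) <= 16 * ?x / s" using h_supp(2)[OF False] by (intro multiplierD(1)[OF g]) auto
    also have "... <= 24 * ?x / s" using s by (intro divide_right_mono) auto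
    finally show ?thesis .
   qed
   have hx: "cmod (h (x + a)) <= 64 * KW / ?x"
   proof -
    have "cmod (h (x + a)) <= 32 * KW / \<bar>of_int (x + a)\<bar>" by (rule h_bound)
    also have "... <= 32 * KW / (?x / 2)" using xa(1) x1 K0 by (intro divide_left_mono mult_pos_pos) auto
    finally show ?thesis by simp
   qed
   have gd: "cmod (g (x + a) - g x) <= ?a / s" using multiplierD(2)[OF g, of x a] a by simp
   have "?d x = g x * (h (x + a) - h x) + (g (x + a) - g x) * h (x + a)" by (simp add: algebra_simps)
   then have "cmod (?d x) <= cmod (g x) * cmod (h (x + a) - h x) + cmod (g (x + a) - g x) * cmod (h (x + a))"
    using norm_triangle_ineq[of "g x * (h (x + a) - h x)" "(g (x + a) - g x) * h (x + a)"] by (simp only: norm_mult)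
   also have "... <= (24 * ?x / s) * (160 * KW * ?q) + (?a / s) * (64 * KW / ?x)"
    using gx hd gd hx s a1 by (intro add_mono mult_mono) auto
   finally show ?thesis .
  qed
  also have "... = 3840 * (KW / s) * (?x * ?q) + 64 * (KW / s) * (?a / ?x)" by (simp add: field_simps)
  also have "?x * ?q = ?a / ?x + ?x powr (- b)"
  proof -
   have "y * (?a / y\<^sup>2) = ?a / y" if "1 <= y" for y :: real using that by (simp add: power2_eq_square)
   from this[of "?x"] have "?x * (?a / (of_int x)\<^sup>2) = ?a / ?x" using x1 by (simp only: power2_abs)
   moreover have "?x * ?x powr (- b - 1) = ?x powr 1 * ?x powr (- b - 1)" using x1 by simp
   moreover have "?x powr 1 * ?x powr (- b - 1) = ?x powr (- b)" by (simp only: powr_add[symmetric]) simp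
   ultimately show ?thesis by (simp only: distrib_left)
  qed
  also have "3840 * (KW / s) * (?a / ?x + ?x powr (- b)) + 64 * (KW / s) * (?a / ?x) <= 4000 * (KW / s) * (?a / ?x + ?x powr (- b))"
  proof -
   have gen: "3840 * u * (v + w) + 64 * u * v <= 4000 * u * (v + w)" if "0 <= u * v" "0 <= u * w" for u v w :: real
    using that by (simp add: algebra_simps)
   show ?thesis by (rule gen) (use K0 s a1 in auto)
  qed
  \<comment> \<open>The exponent b is weakened to 3/4 so that the square is a term of the series
    \<open>ZC\<close>.\<close>
  also have "... <= 4000 * (KW / s) * (?a / ?x + ?x powr (- 3 / 4))"
   using x1 b_bounds K0 s by (intro mult_left_mono add_left_mono powr_mono) auto
  finally have "(cmod (?d x))\<^sup>2 <= (4000 * (KW / s) * (?a / ?x + ?x powr (- 3 / 4)))\<^sup>2" by (intro power_mono) auto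
  also have "... = (4000 * KW / s)\<^sup>2 * (?a / ?x + ?x powr (- 3 / 4))\<^sup>2" by (simp add: power_mult_distrib power_divide)
  also have "... <= (4000 * KW / s)\<^sup>2 * (2 * (?a / ?x)\<^sup>2 + 2 * (?x powr (- 3 / 4))\<^sup>2)"
   using sum_squares_bound[of "?a / ?x" "?x powr (- 3 / 4)"] by (intro mult_left_mono) (auto simp: power2_sum)
  also have "(?x powr (- 3 / 4))\<^sup>2 = ?x powr (- 3 / 2)" using x1 by (simp add: power2_eq_square powr_add[symmetric])
  also have "(?a / ?x)\<^sup>2 = ?a\<^sup>2 * (1 / (of_int x)\<^sup>2)" by (simp add: power_divide)
  finally show ?thesis .
 qed
 have kN: "?k x = 0" if "\<lfloor>2 * M\<rfloor> < \<bar>x\<bar>" for x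
 proof (rule ccontr)
  assume "?k x ~= 0"
  then have "h x ~= 0" by auto
  from h_supp(3)[OF this] have "\<bar>x\<bar> <= \<lfloor>2 * M\<rfloor>" by (simp add: le_floor_iff)
  then show False using that by simp
 qed
 have sub: "supp ?d \<subseteq> {-?N..?N}"
 proof
  fix x assume "x \<in> supp ?d"
  then have "?k (x + a) ~= 0 \<or> ?k x ~= 0" by (auto simp: supp_def)
  then have "\<bar>x + a\<bar> <= \<lfloor>2 * M\<rfloor> \<or> \<bar>x\<bar> <= \<lfloor>2 * M\<rfloor>" using kN[of x] kN[of "x + a"] by linarith
  then show "x \<in> {-?N..?N}" using a by auto
 qed
 let ?A = "{- (2 * a)<..<2 * a}" and ?B = "{2 * a..?N}" and ?B' = "uminus ` {2 * a..?N}"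
 let ?f = "%x::int. (4000 * KW / s)\<^sup>2 * (2 * (?a\<^sup>2 * (1 / (of_int x)\<^sup>2)) + 2 * \<bar>of_int x\<bar> powr (- 3 / 2))"
 have cover: "{-?N..?N} \<subseteq> ?A \<union> (?B \<union> ?B')"
 proof
  fix x assume x: "x \<in> {-?N..?N}"
  show "x \<in> ?A \<union> (?B \<union> ?B')"
  proof (cases "\<bar>x\<bar> < 2 * a")
   case False
   then show ?thesis using x by (cases "0 < x") (auto intro!: image_eqI[where x = "- x"])
  qed auto
 qed
 have "(\<Sum>x\<in>?A \<union> (?B \<union> ?B'). (cmod (?d x))\<^sup>2) <= (\<Sum>x\<in>?A. (cmod (?d x))\<^sup>2) + (\<Sum>x\<in>?B \<union> ?B'. (cmod (?d x))\<^sup>2)"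
  by (subst sum.union_disjoint) auto
 also have "(\<Sum>x\<in>?B \<union> ?B'. (cmod (?d x))\<^sup>2) = (\<Sum>x\<in>?B. (cmod (?d x))\<^sup>2) + (\<Sum>x\<in>?B'. (cmod (?d x))\<^sup>2)"
  using a by (intro sum.union_disjoint) auto
 also have "(\<Sum>x\<in>?A. (cmod (?d x))\<^sup>2) <= (\<Sum>x\<in>?A. (1024 * KW / s)\<^sup>2)" by (intro sum_mono near)
 also have "... <= 4 * ?a * (1024 * KW / s)\<^sup>2" using a by (simp only: sum_constant) (intro mult_right_mono, auto)
 also have "... <= 4 * ?a * (4000 * KW / s)\<^sup>2"
  using K0 s a1 by (intro mult_left_mono power_mono divide_right_mono) auto
 also have "(\<Sum>x\<in>?B. (cmod (?d x))\<^sup>2) <= (\<Sum>x\<in>?B. ?f x)" by (intro sum_mono far) auto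
 also have "(\<Sum>x\<in>?B'. (cmod (?d x))\<^sup>2) <= (\<Sum>x\<in>?B'. ?f x)" by (intro sum_mono far) auto
 also have "(\<Sum>x\<in>?B'. ?f x) = (\<Sum>x\<in>?B. ?f x)" by (subst sum.reindex) (auto simp: inj_on_def)
 also have "(\<Sum>x\<in>?B. ?f x) <= (4000 * KW / s)\<^sup>2 * (2 * ?a + 2 * ZC * ?a)"
 proof -
  have "(\<Sum>x\<in>?B. ?f x) = (4000 * KW / s)\<^sup>2 * (2 * (?a\<^sup>2 * (\<Sum>x\<in>?B. 1 / (real_of_int x)\<^sup>2)) + 2 * (\<Sum>x\<in>?B. real_of_int x powr (- 3 / 2)))"
  proof -
   have "(\<Sum>x\<in>?B. ?f x) = (\<Sum>x\<in>?B. (4000 * KW / s)\<^sup>2 * (2 * (?a\<^sup>2 * (1 / (of_int x)\<^sup>2)) + 2 * of_int x powr (- 3 / 2)))"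
    using a by (intro sum.cong refl) auto
   also have "... = (4000 * KW / s)\<^sup>2 * (2 * (?a\<^sup>2 * (\<Sum>x\<in>?B. 1 / (real_of_int x)\<^sup>2)) + 2 * (\<Sum>x\<in>?B. real_of_int x powr (- 3 / 2)))"
    by (simp only: sum_distrib_left[symmetric] sum.distrib)
   finally show ?thesis .
  qed
  also have "... <= (4000 * KW / s)\<^sup>2 * (2 * (?a\<^sup>2 * (2 / of_int (2 * a))) + 2 * (ZC * ?a))"
  proof (intro mult_left_mono add_mono)
   show "(\<Sum>x\<in>?B. 1 / (real_of_int x)\<^sup>2) <= 2 / of_int (2 * a)" using a by (intro sum_inverse_squares) simp
   have "(\<Sum>x\<in>?B. real_of_int x powr (- 3 / 2)) <= (\<Sum>x\<in>{1..?N}. real_of_int x powr (- 3 / 2))"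
    using a by (intro sum_mono2) auto
   also have "... <= ZC" by (rule sum_powr_le_ZC)
   also have "... <= ZC * ?a" using mult_left_mono[OF a1 ZC_nonneg] by simp
   finally show "(\<Sum>x\<in>?B. real_of_int x powr (- 3 / 2)) <= ZC * ?a" .
  qed auto
  also have "?a\<^sup>2 * (2 / of_int (2 * a)) = ?a" using a1 by (simp add: power2_eq_square)
  finally show ?thesis by (simp add: mult_ac)
 qed
 finally have "(\<Sum>x\<in>?A \<union> (?B \<union> ?B'). (cmod (?d x))\<^sup>2) <= (4000 * KW / s)\<^sup>2 * ((8 + 4 * ZC) * ?a)"
  by (simp add: algebra_simps)
 also have "... = (4000 * KW * sqrt (8 + 4 * ZC) * (sqrt ?a / s))\<^sup>2"
  using ZC_nonneg a1 by (simp add: power_mult_distrib power_divide)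
 finally show ?thesis
  using sub cover K0 ZC_nonneg s a1 by (intro ell2_norm_le_of_sum[of "?A \<union> (?B \<union> ?B')"]) auto
qed

end

section \<open>Bilinear expressions in the truncated transform\<close>

context rough_scale
begin

lemma finite_supp_mult_h: "finite (supp (%x. g x * h x))" and finite_supp_mult_e: "finite (supp (%x. g x * e x))"
 and finite_supp_mult_H: "finite (supp (%x. g x * H x))"
 using finite_supp_mult finite_supp_h finite_supp_e finite_supp_H by auto

text \<open>1 / s beats the target size \<open>sqrt (Gs s)\<close> by a power of M: for s <= M
  because s >= M powr \<theta> >= M powr \<delta>, beyond M because \<delta> <= 1.\<close>

lemma inverse_le_Gs:
 assumes s: "M powr \<theta> <= s"
 shows "1 / s <= M powr (- \<delta> / 2) * sqrt (Gs s)"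
proof (rule power2_le_imp_le)
 have s1: "1 <= s" using s M_theta by linarith
 have "(M powr (- \<delta> / 2) * sqrt (Gs s))\<^sup>2 = M powr (- \<delta>) * Gs s"
 proof -
  have "(M powr (- \<delta> / 2))\<^sup>2 = M powr (- \<delta>)" using M1 by (simp add: power2_eq_square powr_add[symmetric])
  then show ?thesis using Gs_nonneg[of s] s1 by (simp add: power_mult_distrib)
 qed
 moreover have "(1 / s)\<^sup>2 <= M powr (- \<delta>) * Gs s"
 proof (cases "s <= M")
  case True
  have "M powr \<delta> <= s" using s powr_mono[OF theta_bounds(2) M1] by linarith
  then have "1 / s <= 1 / M powr \<delta>" using M1 s1 by (intro divide_left_mono mult_pos_pos) auto
  then have "1 / s * (1 / s) <= 1 / M powr \<delta> * (1 / s)" using s1 by (intro mult_right_mono) auto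
  then show ?thesis using True s1 by (simp add: Gs_def power2_eq_square powr_minus_divide)
 next
  case False
  have "M powr \<delta> <= M" using powr_mono[OF theta_bounds(3) M1] M1 by simp
  then have "1 <= M powr (- \<delta>) * M" using M1 by (simp add: powr_minus_divide field_simps)
  then have "1 * (1 / s)\<^sup>2 <= M powr (- \<delta>) * M * (1 / s)\<^sup>2" by (intro mult_right_mono) auto
  then show ?thesis using False by (simp add: Gs_def power_divide)
 qed
 ultimately show "(1 / s)\<^sup>2 <= (M powr (- \<delta> / 2) * sqrt (Gs s))\<^sup>2" by simp
 show "0 <= M powr (- \<delta> / 2) * sqrt (Gs s)" using Gs_nonneg[of s] s1 by simp
qed

definition CHE :: real where "CHE = 640 * KW * (3072 * KW) + 1280 * KW * (288 * KW * sqrt ZC)"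

text \<open>Summation by parts: the error kernel is a weight times an increment of the bounded
 sequence \<^const>\<open>usaw\<close>, and the increment can be moved to the smooth kernel.\<close>

lemma conv_h_ep:
 assumes g: "multiplier R s g" and s: "M powr \<theta> <= s"
 shows "ell2_norm (conv h (%x. g x * ep x)) <= CHE * M powr (- \<delta> / 2) * sqrt (Gs s)"
proof -
 have s1: "1 <= s" using s M_theta by linarith
 have K0: "0 <= KW" using KW(1) by simp
 \<comment> \<open>Discrete product rule: \<open>g x * ep x\<close> is the increment of
   \<open>F\<close> minus \<open>D\<close>, in which the increment falls on the slowly varying
   factor g * W.\<close>
 define F where "F = (%x. g x * W x * of_real (usaw b x))"
 define D where "D = (%x. (g (x + 1) * W (x + 1) - g x * W x) * of_real (usaw b (x + 1)))"
 let ?N = "\<lfloor>2 * M\<rfloor>"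
 have WN: "x \<in> {1..?N}" if "W x ~= 0" for x using W_supp[OF that] by (simp add: le_floor_iff)
 have sF: "supp F \<subseteq> {1..?N}" using WN by (auto simp: supp_def F_def)
 then have fF: "finite (supp F)" using finite_subset by blast
 have sD: "supp D \<subseteq> {1..?N}"
 proof
  fix x assume "x \<in> supp D"
  then have nz: "D x ~= 0" by (simp add: supp_def)
  then have "W (x + 1) ~= 0 \<or> W x ~= 0" by (auto simp: D_def)
  then have "x \<in> {0..?N}" using WN[of x] WN[of "x + 1"] by auto
  moreover have "x ~= 0"
  proof
   \<comment> \<open>At x = 0 the sawtooth is evaluated at 1, whose power is an integer, and
     vanishes.\<close>
   assume "x = 0"
   then have "usaw b (x + 1) = 0" by (simp add: usaw_def)
   then show False using nz by (simp add: D_def)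
  qed
  ultimately show "x \<in> {1..?N}" by auto
 qed
 then have fD: "finite (supp D)" using finite_subset by blast
 have split: "(%x. g x * ep x) = (%x. (F (x + 1) - F x) - D x)" by (auto simp: ep_def F_def D_def algebra_simps)
 have u1: "cmod (complex_of_real (usaw b x)) <= 1" for x using usaw_bounds[of b x] by simp
 have nF: "ell2_norm F <= 3 * (1024 * KW * M powr (1 - b)) * sqrt (Gs s)"
 proof (rule ell2_norm_min_bound[OF s1])
  fix x assume Fx: "F x ~= 0"
  then have Wx: "W x ~= 0" by (auto simp: F_def)
  note ws = W_supp[OF Wx]
  show "1 <= \<bar>x\<bar> & \<bar>of_int x\<bar> <= 2 * M" using ws by simp
  let ?x = "real_of_int x"
  have x0: "0 < ?x" using ws by simp
  have "?x powr (1 - b) <= (2 * M) powr (1 - b)" using ws b_bounds by (intro powr_mono2) auto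
  also have "... = 2 powr (1 - b) * M powr (1 - b)" using M1 by (simp add: powr_mult)
  also have "... <= 2 powr 1 * M powr (1 - b)" using b_bounds by (intro mult_right_mono powr_mono) auto
  finally have xb: "?x powr (1 - b) <= 2 * M powr (1 - b)" by simp
  have "?x powr (- b) = ?x powr (1 - b) * ?x powr (- 1)" by (simp only: powr_add[symmetric]) simp
  also have "?x powr (- 1) = 1 / ?x" using x0 by (simp add: powr_minus_divide)
  also have "?x powr (1 - b) * (1 / ?x) <= 2 * M powr (1 - b) * (1 / ?x)" using xb x0 by (intro mult_right_mono) auto
  finally have xpb: "?x powr (- b) <= 2 * M powr (1 - b) / ?x" by simp
  have "cmod (F x) <= cmod (g x) * cmod (W x) * 1" unfolding F_def norm_mult using u1 by (intro mult_left_mono) auto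
  also have "... <= cmod (g x) * (32 * KW * (2 * M powr (1 - b) / ?x)) * 1" using W_bound[OF ws(1)] xpb K0
   by (intro mult_right_mono mult_left_mono order_trans[OF W_bound[OF ws(1)] mult_left_mono]) auto
  also have "... = 64 * KW * M powr (1 - b) * (cmod (g x) / \<bar>?x\<bar>)" using x0 by simp
  also have "... <= 64 * KW * M powr (1 - b) * (16 * min (1 / \<bar>?x\<bar>) (1 / s))"
   using ws K0 by (intro mult_left_mono multiplier_min[OF g s1]) auto
  finally show "cmod (F x) <= 1024 * KW * M powr (1 - b) * min (1 / \<bar>?x\<bar>) (1 / s)" by simp
 qed (use K0 in simp)
 have nD: "ell2_norm D <= 288 * KW * sqrt ZC / s"
 proof -
  have each: "(cmod (D x))\<^sup>2 <= (288 * KW / s)\<^sup>2 * of_int x powr (- 3 / 2)" if x: "x \<in> {1..?N}" for x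
  proof -
   let ?x = "real_of_int x"
   have x1: "1 <= x" "1 <= ?x" using x by auto
   have i1: "0 <= real_of_int (ind x)" "real_of_int (ind x) <= 1" using ind_cases[OF x1(1)] by auto
   have a1: "cmod (g (x + 1)) * cmod (W (x + 1) - W x) <= 256 * (KW / s) * ?x powr (- 3 / 4)"
   proof (cases "W (x + 1) = 0 & W x = 0")
    case False
    have R: "R <= \<bar>of_int (x + 1)\<bar>" using False W_supp(2)[of x] W_supp(2)[of "x + 1"] x1 by fastforce
    have "cmod (g (x + 1)) <= 16 * \<bar>of_int (x + 1)\<bar> / s" by (rule multiplierD(1)[OF g R])
    also have "... <= 32 * ?x / s" using x1 s1 by (intro divide_right_mono) auto
    finally have gx: "cmod (g (x + 1)) <= 32 * ?x / s" .
    have "cmod (W (x + 1) - W x) <= 8 * KW * ?x powr (- 2 * b) * of_int (ind x)"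
     using W_diff[OF x1(1), of 1] by (simp add: ind_def)
    also have "... <= 8 * KW * ?x powr (- 2 * b) * 1" using i1 K0 by (intro mult_left_mono) auto
    finally have "cmod (g (x + 1)) * cmod (W (x + 1) - W x) <= (32 * ?x / s) * (8 * KW * ?x powr (- 2 * b) * 1)"
     using gx x1 s1 by (intro mult_mono) auto
    also have "... = 256 * (KW / s) * (?x powr 1 * ?x powr (- 2 * b))" using x1 by simp
    also have "?x powr 1 * ?x powr (- 2 * b) = ?x powr (1 - 2 * b)" by (simp only: powr_add[symmetric]) simp
    also have "256 * (KW / s) * ?x powr (1 - 2 * b) <= 256 * (KW / s) * ?x powr (- 3 / 4)"
     using x1 b_bounds K0 s1 by (intro mult_left_mono powr_mono) auto
    finally show ?thesis .
   qed (use K0 s1 in simp)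
   have a2: "cmod (g (x + 1) - g x) * cmod (W x) <= 32 * (KW / s) * ?x powr (- 3 / 4)"
   proof -
    have "cmod (g (x + 1) - g x) * cmod (W x) <= (1 / s) * (32 * KW * ?x powr (- b))"
     using multiplierD(2)[OF g, of x 1] W_bound[OF x1(1)] s1 by (intro mult_mono) auto
    also have "... = 32 * (KW / s) * ?x powr (- b)" by simp
    also have "... <= 32 * (KW / s) * ?x powr (- 3 / 4)"
     using x1 b_bounds K0 s1 by (intro mult_left_mono powr_mono) auto
    finally show ?thesis .
   qed
   have "cmod (D x) <= cmod (g (x + 1) * W (x + 1) - g x * W x) * 1"
    unfolding D_def norm_mult using u1 by (intro mult_left_mono) auto
   also have "g (x + 1) * W (x + 1) - g x * W x = g (x + 1) * (W (x + 1) - W x) + (g (x + 1) - g x) * W x"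
    by (simp add: algebra_simps)
   also have "cmod ... * 1 <= cmod (g (x + 1)) * cmod (W (x + 1) - W x) + cmod (g (x + 1) - g x) * cmod (W x)"
    using norm_triangle_ineq[of "g (x + 1) * (W (x + 1) - W x)" "(g (x + 1) - g x) * W x"] by (simp only: norm_mult mult_1_right)
   also have "... <= 288 * (KW / s) * ?x powr (- 3 / 4)" using a1 a2 by linarith
   finally have "(cmod (D x))\<^sup>2 <= (288 * (KW / s) * ?x powr (- 3 / 4))\<^sup>2" by (intro power_mono) auto
   also have "... = (288 * KW / s)\<^sup>2 * (?x powr (- 3 / 4))\<^sup>2" by (simp add: power_mult_distrib power_divide)
   also have "(?x powr (- 3 / 4))\<^sup>2 = ?x powr (- 3 / 2)" using x1 by (simp add: power2_eq_square powr_add[symmetric])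
   finally show ?thesis .
  qed
  have "(\<Sum>x\<in>{1..?N}. (cmod (D x))\<^sup>2) <= (\<Sum>x\<in>{1..?N}. (288 * KW / s)\<^sup>2 * of_int x powr (- 3 / 2))"
   by (intro sum_mono each)
  also have "... = (288 * KW / s)\<^sup>2 * (\<Sum>x\<in>{1..?N}. of_int x powr (- 3 / 2))" by (simp add: sum_distrib_left)
  also have "... <= (288 * KW / s)\<^sup>2 * ZC" by (intro mult_left_mono sum_powr_le_ZC) simp
  also have "... = (288 * KW * sqrt ZC / s)\<^sup>2" using ZC_nonneg by (simp add: power_mult_distrib power_divide)
  finally show ?thesis using K0 ZC_nonneg s1 by (intro ell2_norm_le_of_sum[OF _ sD]) auto
 qed
 \<comment> \<open>The difference passes from \<open>F\<close> to \<open>h\<close>: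
   \<open>h_variation\<close> gains M powr (- \<theta>) against the loss M powr (1 - b) in the norm
   of \<open>F\<close>.\<close>
 have cF: "conv h (%x. F (x + 1) - F x) = conv (%x. h (x + 1) - h x) F"
 proof -
  have "conv (%x. h (x + 1) - h x) F = conv F (%x. h (x + 1) - h x)"
   by (intro conv_commute finite_supp_diff finite_supp_shift finite_supp_h fF)
  also have "... = (%x. conv F h (x + 1) - conv F h x)" by (rule conv_difference_right)
  also have "conv F h = conv h F" by (rule conv_commute[OF fF finite_supp_h])
  finally show ?thesis by (simp add: conv_difference_right)
 qed
 have sh: "finite (supp (%x. h (x + 1) - h x))" by (intro finite_supp_diff finite_supp_shift finite_supp_h)
 have p1: "conv (%x. h (x + 1) - h x) F \<in> ell2" "conv h D \<in> ell2"
  by (intro supp_in_ell2 finite_supp_conv sh fF fD finite_supp_h)+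
 have "conv h (%x. g x * ep x) = (%x. conv (%x. h (x + 1) - h x) F x - conv h D x)"
  unfolding split conv_diff_right[of h "%x. F (x + 1) - F x"] cF ..
 then have "ell2_norm (conv h (%x. g x * ep x)) <= ell2_norm (conv (%x. h (x + 1) - h x) F) + ell2_norm (conv h D)"
  using ell2_diff[OF p1] by simp
 also have "... <= l1norm (%x. h (x + 1) - h x) * ell2_norm F + 1280 * KW * ell2_norm D"
  using conv_ell2[OF sh supp_in_ell2[OF fF]] conv_h[OF fD] by (intro add_mono) auto
 also have "... <= (640 * KW * M powr (- \<theta>)) * (3 * (1024 * KW * M powr (1 - b)) * sqrt (Gs s)) + 1280 * KW * (288 * KW * sqrt ZC / s)"
  using h_variation nF nD K0 by (intro add_mono mult_mono mult_left_mono) auto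
 also have "... = 640 * KW * (3072 * KW) * (M powr (- \<theta>) * M powr (1 - b)) * sqrt (Gs s) + 1280 * KW * (288 * KW * sqrt ZC) * (1 / s)"
  by simp
 also have "... <= 640 * KW * (3072 * KW) * M powr (- \<delta> / 2) * sqrt (Gs s) + 1280 * KW * (288 * KW * sqrt ZC) * (M powr (- \<delta> / 2) * sqrt (Gs s))"
 proof (intro add_mono mult_left_mono mult_right_mono inverse_le_Gs s)
  have "M powr (- \<theta>) * M powr (1 - b) = M powr (- \<theta> + (1 - b))" by (simp only: powr_add)
  also have "... <= M powr (- \<delta> / 2)"
  proof (rule powr_mono[OF _ M1])
   have "1 - b = b * (\<alpha> - 1)" using b_bounds by (simp add: algebra_simps)
   also have "... <= 1 * (\<alpha> - 1)" using b_bounds alpha by (intro mult_right_mono) auto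
   finally show "- \<theta> + (1 - b) <= - \<delta> / 2" using theta delta by simp
  qed
  finally show "M powr (- \<theta>) * M powr (1 - b) <= M powr (- \<delta> / 2)" .
 qed (use K0 ZC_nonneg Gs_nonneg[of s] s1 in auto)
 finally show ?thesis by (simp add: CHE_def algebra_simps)
qed

lemma multiplier_reflect:
 assumes g: "multiplier R0 s g"
 shows "multiplier R0 s (%x. g (- x))" unfolding multiplier_def
proof (intro conjI allI impI)
 obtain c0 c1 \<eta> where c: "cmod c0 <= 1" "cmod c1 <= 1" "g = (%x. c0 + c1 * cis (\<eta> * of_int x))"
  using g unfolding multiplier_def by auto
 show "\<exists>c0 c1 \<eta>. cmod c0 <= 1 & cmod c1 <= 1 & (%x. g (- x)) = (%x. c0 + c1 * cis (\<eta> * of_int x))"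
  by (rule exI[of _ c0], rule exI[of _ c1], rule exI[of _ "- \<eta>"]) (use c in auto)
 show "cmod (g (- x)) <= 16 * \<bar>of_int x\<bar> / s" if "R0 <= \<bar>of_int x\<bar>" for x
  using multiplierD(1)[OF g, of "- x"] that by simp
 show "cmod (g (- (x + a)) - g (- x)) <= \<bar>of_int a\<bar> / s" for x a
  using multiplierD(2)[OF g, of "- x" "- a"] by simp
qed

lemma finite_supp_ep: "finite (supp (%x. g x * ep x))"
proof (rule finite_subset)
 show "supp (%x. g x * ep x) \<subseteq> {1..\<lfloor>2 * M\<rfloor>}"
  using W_supp by (auto simp: supp_def ep_def le_floor_iff)
qed simp

text \<open>\<open>e\<close> is \<open>ep\<close> minus its reflection and \<open>h\<close> is odd,
  so the negative half is the estimate for \<open>ep\<close> with the reflected multiplier.\<close>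

lemma conv_h_e:
 assumes g: "multiplier R s g" and s: "M powr \<theta> <= s"
 shows "ell2_norm (conv h (%x. g x * e x)) <= 2 * CHE * M powr (- \<delta> / 2) * sqrt (Gs s)"
proof -
 let ?f = "%x. g x * ep x" and ?f' = "%x. g (- x) * ep x"
 have hr: "h = (%x. - h (- x))" by (simp add: h_odd)
 have f': "finite (supp (%x. ?f' (- x)))" by (rule finite_supp_reflect[OF finite_supp_ep])
 have "conv h (%x. ?f' (- x)) = (%x. - conv h ?f' (- x))"
 proof -
  have "conv (%x. h (- x)) (%x. ?f' (- x)) = (%x. conv h ?f' (- x))" by (rule conv_reflect)
  moreover have "conv h k = (%x. - conv (%x. h (- x)) k x)" for k
  proof
   fix x
   have "supp (%x. h (- x)) = supp h" by (auto simp: supp_def h_odd)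
   then show "conv h k x = - conv (%x. h (- x)) k x" by (simp add: conv_def h_odd sum_negf)
  qed
  ultimately show ?thesis by simp
 qed
 then have n2: "ell2_norm (conv h (%x. ?f' (- x))) = ell2_norm (conv h ?f')"
  using ell2_reflect[OF supp_in_ell2[OF finite_supp_conv[OF finite_supp_h finite_supp_ep]], of "%x. g (- x)"]
  by (simp add: ell2_norm_def)
 have "(%x. g x * e x) = (%x. ?f x - ?f' (- x))" by (auto simp: e_ep algebra_simps)
 then have "conv h (%x. g x * e x) = (%x. conv h ?f x - conv h (%x. ?f' (- x)) x)" by (simp only: conv_diff_right)
 then have "ell2_norm (conv h (%x. g x * e x)) <= ell2_norm (conv h ?f) + ell2_norm (conv h (%x. ?f' (- x)))"
  using ell2_diff[OF supp_in_ell2[OF finite_supp_conv[OF finite_supp_h finite_supp_ep, of g]]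
    supp_in_ell2[OF finite_supp_conv[OF finite_supp_h f']]] by simp
 also have "... <= CHE * M powr (- \<delta> / 2) * sqrt (Gs s) + CHE * M powr (- \<delta> / 2) * sqrt (Gs s)"
  unfolding n2 by (intro add_mono conv_h_ep[OF g s] conv_h_ep[OF multiplier_reflect[OF g] s])
 finally show ?thesis by (simp add: mult_ac)
qed

text \<open>Each scale gains M powr (- \<delta> / 60) through its Fourier bound; the scales are
  merely counted, since the count is only logarithmic in M.\<close>

lemma conv_e:
 assumes f: "finite (supp f)"
 shows "ell2_norm (conv e f) <= real (card T) * (CE * M powr (- \<delta> / 60)) * ell2_norm f"
proof -
 have "conv e f = (%x. \<Sum>t\<in>T. conv (eker t) f x)"
  unfolding e_def[abs_def] by (intro conv_sum_left finite_T finite_supp_kers TD)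
 then have "ell2_norm (conv e f) <= (\<Sum>t\<in>T. CE * M powr (- \<delta> / 60) * ell2_norm f)"
 proof (simp only:, intro ell2_sum_bound[THEN conjunct2] finite_T conjI)
  fix t assume t: "t \<in> T"
  have fe: "finite (supp (eker t))" by (rule finite_supp_kers(2)[OF TD(1)[OF t]])
  show "conv (eker t) f \<in> ell2" by (intro supp_in_ell2 finite_supp_conv fe f)
  show "ell2_norm (conv (eker t) f) <= CE * M powr (- \<delta> / 60) * ell2_norm f"
  proof (rule ell2_norm_conv_le_ft[OF fe f])
   fix \<xi>
   have "cmod (ft (eker t) \<xi>) <= CE * real t powr (- 1 / 60)"
    using err_kernel_eker[OF TD(1)[OF t]] by (simp add: err_kernel_def)
   also have "... <= CE * (M powr \<theta>) powr (- 1 / 60)"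
    using TD(2)[OF t] M_theta CE_pos by (intro mult_left_mono powr_mono2') auto
   also have "... = CE * M powr (- \<theta> / 60)" by (simp add: powr_powr)
   also have "... <= CE * M powr (- \<delta> / 60)" using CE_pos M1 theta_bounds by (intro mult_left_mono powr_mono) auto
   finally show "cmod (ft (eker t) \<xi>) <= CE * M powr (- \<delta> / 60)" .
  qed
 qed
 then show ?thesis by simp
qed

text \<open>For each pair the bound decays with the larger scale; commutativity brings it into
  second position. The size \<tau> = min 1 (t2 / s) of the multiplier times t2 powr (- 1 / 2) never
  exceeds \<open>sqrt (Gs s)\<close>.\<close>

lemma conv_e_e:
 assumes g: "multiplier R s g" and s: "M powr \<theta> <= s"
 shows "ell2_norm (conv e (%x. g x * e x)) <= (real (card T))\<^sup>2 * (32 * CB * CE\<^sup>2 * M powr (- \<delta> / 160) * sqrt (Gs s))"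
proof -
 have s1: "1 <= s" using s M_theta by linarith
 let ?G = "%t x. g x * eker t x"
 have fG: "finite (supp (?G t))" if "t \<in> T" for t using finite_supp_kers(2)[OF TD(1)[OF that]] by (rule finite_supp_mult)
 have fe: "finite (supp (eker t))" if "t \<in> T" for t by (rule finite_supp_kers(2)[OF TD(1)[OF that]])
 have pair: "ell2_norm (conv (eker t1) (?G t2)) <= 32 * CB * CE\<^sup>2 * M powr (- \<delta> / 160) * sqrt (Gs s)"
  if t: "t1 \<in> T" "t2 \<in> T" for t1 t2
 proof -
  define \<tau> where "\<tau> = min 1 (real t2 / s)"
  have t21: "1 <= real t2" by (rule dyadic_ge_1[OF TD(1)[OF t(2)]])
  have tau0: "0 <= \<tau>" using s1 by (simp add: \<tau>_def)
  have k1: "err_kernel (real t1) CE (eker t1)" by (rule err_kernel_eker[OF TD(1)[OF t(1)]])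
  have k2: "err_kernel (real t2) (32 * CE * \<tau>) (?G t2)"
   unfolding \<tau>_def using TD(2)[OF t(2)] s1 by (intro err_kernel_eker_multiplier[OF TD(1)[OF t(2)] g]) auto
  have tg: "\<tau> * real t2 powr (- 1 / 2) <= sqrt (Gs s)"
  proof (rule real_le_rsqrt)
   have sq: "(\<tau> * real t2 powr (- 1 / 2))\<^sup>2 = \<tau>\<^sup>2 / real t2"
    using t21 by (simp add: power_mult_distrib power2_eq_square powr_add[symmetric] powr_minus_divide)
   show "(\<tau> * real t2 powr (- 1 / 2))\<^sup>2 <= Gs s"
   proof (cases "real t2 <= s")
    case True
    then have "\<tau> = real t2 / s" using s1 by (simp add: \<tau>_def)
    then have "\<tau>\<^sup>2 / real t2 = real t2 / s\<^sup>2" using t21 by (simp add: power_divide power2_eq_square)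
    also have "... <= Gs s" unfolding Gs_def using True TD(3)[OF t(2)] by (intro divide_right_mono) auto
    finally show ?thesis using sq by simp
   next
    case False
    then have "\<tau> = 1" using s1 by (simp add: \<tau>_def)
    moreover have "Gs s = 1 / s" using False TD(3)[OF t(2)] s1 by (simp add: Gs_def power2_eq_square)
    moreover have "1 / real t2 <= 1 / s" using False s1 by (intro divide_left_mono) auto
    ultimately show ?thesis using sq by simp
   qed
  qed
  have "ell2_norm (conv (eker t1) (?G t2)) <= 32 * CB * CE\<^sup>2 * M powr (- \<delta> / 160) * (\<tau> * real t2 powr (- 1 / 2))"
  proof (cases "t1 <= t2")
   case True
   have "ell2_norm (conv (eker t1) (?G t2)) <= CB * CE * (32 * CE * \<tau>) * M powr (- \<delta> / 160) * real t2 powr (- 1 / 2)"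
    using True by (intro CB(2)[OF k1 k2 M1 delta theta TD(2)[OF t(1)] _ TD(3)[OF t(2)]]) simp
   then show ?thesis by (simp add: power2_eq_square mult_ac)
  next
   case False
   have "conv (eker t1) (?G t2) = conv (?G t2) (eker t1)" by (rule conv_commute[OF fe[OF t(1)] fG[OF t(2)]])
   then have "ell2_norm (conv (eker t1) (?G t2)) <= CB * (32 * CE * \<tau>) * CE * M powr (- \<delta> / 160) * real t1 powr (- 1 / 2)"
    using CB(2)[OF k2 k1 M1 delta theta TD(2)[OF t(2)] _ TD(3)[OF t(1)]] False by simp
   also have "... <= CB * (32 * CE * \<tau>) * CE * M powr (- \<delta> / 160) * real t2 powr (- 1 / 2)"
    using False t21 CB(1) CE_pos tau0 by (intro mult_left_mono powr_mono2') auto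
   finally show ?thesis by (simp add: power2_eq_square mult_ac)
  qed
  also have "... <= 32 * CB * CE\<^sup>2 * M powr (- \<delta> / 160) * sqrt (Gs s)"
   using tg CB(1) by (intro mult_left_mono) auto
  finally show ?thesis .
 qed
 have e1: "(%x. g x * e x) = (%x. \<Sum>t\<in>T. ?G t x)" by (simp add: e_def sum_distrib_left)
 have e2: "conv e k = (%x. \<Sum>t\<in>T. conv (eker t) k x)" for k
  unfolding e_def[abs_def] by (intro conv_sum_left finite_T fe)
 have "conv e (%x. g x * e x) = (%x. \<Sum>t1\<in>T. \<Sum>t2\<in>T. conv (eker t1) (?G t2) x)"
  unfolding e2 e1 conv_sum_right by (rule ext, rule sum.swap)
 moreover have "ell2_norm (%x. \<Sum>t1\<in>T. \<Sum>t2\<in>T. conv (eker t1) (?G t2) x)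
   <= (\<Sum>t1\<in>T. \<Sum>t2\<in>T. 32 * CB * CE\<^sup>2 * M powr (- \<delta> / 160) * sqrt (Gs s))"
  using pair supp_in_ell2[OF finite_supp_conv[OF fe fG]]
  by (intro ell2_sum_bound[THEN conjunct2] ell2_sum_bound finite_T conjI) auto
 ultimately show ?thesis by (simp add: power2_eq_square)
qed

definition Clog :: real where "Clog = 1 + 3200 / \<delta>"

text \<open>The exponent makes the squared count cost M powr (\<delta> / 800), which is exactly the
  difference between \<delta> / 160 and \<delta> / 200.\<close>

lemma card_T: "real (card T) <= Clog * M powr (\<delta> / 1600)" "1 <= Clog * M powr (\<delta> / 1600)"
proof -
 have m1: "1 <= M powr (\<delta> / 1600)" using M1 delta by (intro ge_one_powr_ge_zero) auto
 have c1: "1 <= Clog" using delta by (simp add: Clog_def)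
 then show "1 <= Clog * M powr (\<delta> / 1600)" using m1 mult_mono[of 1 Clog 1 "M powr (\<delta> / 1600)"] by simp
 have "real (card T) <= 1 + log 2 M" by (rule card_dyadic[OF finite_T T_dyadic M1 TD(3)])
 also have "log 2 M <= 2 * ln M"
 proof -
  have "1 / 2 <= ln (2::real)" using ln_le_minus_one[of "1 / 2 :: real"] by (simp add: ln_div)
  then have "ln M / ln 2 <= ln M / (1 / 2)" using M1 by (intro divide_left_mono) auto
  then show ?thesis by (simp add: log_def)
 qed
 also have "2 * ln M <= 2 * (M powr (\<delta> / 1600) / (\<delta> / 1600))"
  using ln_powr_bound[OF M1, of "\<delta> / 1600"] delta by (intro mult_left_mono) auto
 also have "1 + 2 * (M powr (\<delta> / 1600) / (\<delta> / 1600)) <= M powr (\<delta> / 1600) + 2 * (M powr (\<delta> / 1600) / (\<delta> / 1600))"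
  using m1 by simp
 also have "... = Clog * M powr (\<delta> / 1600)" using delta by (simp add: Clog_def field_simps)
 finally show "real (card T) <= Clog * M powr (\<delta> / 1600)" by simp
qed

definition CR :: real where
 "CR = Clog\<^sup>2 * (CE * (1536 * KW) + 32 * CB * CE\<^sup>2) + 2 * CHE"

lemma CHE_nonneg: "0 <= CHE" using KW(1) ZC_nonneg by (simp add: CHE_def)

text \<open>All parts of the product except the convolution of \<open>h\<close> with g * h. Each
  contains an error kernel and therefore gains a power of M.\<close>

definition rem :: "(int => complex) => int => complex" where
 "rem g = (%x. conv e (%x. g x * h x) x + conv h (%x. g x * e x) x + conv e (%x. g x * e x) x)"

lemma conv_H_rem: "conv H (%x. g x * H x) = (%x. conv h (%x. g x * h x) x + rem g x)"
proof -
 have 1: "(%x. g x * H x) = (%x. g x * h x + g x * e x)" by (auto simp: H_split algebra_simps)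
 have 2: "H = (%x. h x + e x)" by (auto simp: H_split)
 have "conv H (%x. g x * H x) = (%x. conv H (%x. g x * h x) x + conv H (%x. g x * e x) x)"
  unfolding 1 by (rule conv_add_right)
 also have "... = (%x. (conv h (%x. g x * h x) x + conv e (%x. g x * h x) x) + (conv h (%x. g x * e x) x + conv e (%x. g x * e x) x))"
  unfolding 2 conv_add_left[OF finite_supp_h finite_supp_e] ..
 finally show ?thesis by (simp add: rem_def add_ac)
qed

lemma finite_supp_rem: "finite (supp (rem g))" unfolding rem_def
 by (intro finite_supp_add finite_supp_conv finite_supp_e finite_supp_h finite_supp_mult_h finite_supp_mult_e)

lemma norm_rem:
 assumes g: "multiplier R s g" and s: "M powr \<theta> <= s"
 shows "ell2_norm (rem g) <= CR * M powr (- \<delta> / 200) * sqrt (Gs s)"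
proof -
 have s1: "1 <= s" using s M_theta by linarith
 have K0: "0 <= KW" using KW(1) by simp
 define Q where "Q = sqrt (Gs s)"
 have Q0: "0 <= Q" using Gs_nonneg[of s] s1 by (simp add: Q_def)
 define m where "m = M powr (- \<delta> / 200)"
 define L where "L = real (card T)"
 have L: "0 <= L" "L\<^sup>2 <= Clog\<^sup>2 * M powr (\<delta> / 800)" "L <= Clog\<^sup>2 * M powr (\<delta> / 800)"
 proof -
  show "0 <= L" by (simp add: L_def)
  have e: "(Clog * M powr (\<delta> / 1600))\<^sup>2 = Clog\<^sup>2 * M powr (\<delta> / 800)"
   using M1 by (simp add: power_mult_distrib power2_eq_square powr_add[symmetric])
  show "L\<^sup>2 <= Clog\<^sup>2 * M powr (\<delta> / 800)" unfolding e[symmetric] L_def using card_T(1) by (intro power_mono) auto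
  have "1 * L <= (Clog * M powr (\<delta> / 1600)) * (Clog * M powr (\<delta> / 1600))"
   using card_T unfolding L_def by (intro mult_mono) auto
  then show "L <= Clog\<^sup>2 * M powr (\<delta> / 800)" unfolding e[symmetric] by (simp add: power2_eq_square)
 qed
 have g1: "M powr (\<delta> / 800) * M powr (- \<delta> / 160) <= m"
 proof -
  have "M powr (\<delta> / 800) * M powr (- \<delta> / 160) = M powr (\<delta> / 800 + - \<delta> / 160)" by (simp only: powr_add)
  also have "... <= m" unfolding m_def using M1 delta by (intro powr_mono) auto
  finally show ?thesis .
 qed
 have g2: "M powr (\<delta> / 800) * M powr (- \<delta> / 60) <= m"
 proof -
  have "M powr (\<delta> / 800) * M powr (- \<delta> / 60) = M powr (\<delta> / 800 + - \<delta> / 60)" by (simp only: powr_add)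
  also have "... <= m" unfolding m_def using M1 delta by (intro powr_mono) auto
  finally show ?thesis .
 qed
 have g3: "M powr (- \<delta> / 2) <= m" unfolding m_def using M1 delta by (intro powr_mono) auto
 have i1: "ell2_norm (conv e (%x. g x * h x)) <= Clog\<^sup>2 * (CE * (1536 * KW)) * m * Q"
 proof -
  have "ell2_norm (conv e (%x. g x * h x)) <= L * (CE * M powr (- \<delta> / 60)) * (1536 * KW * Q)"
   unfolding L_def Q_def using CE_pos norm_mult_h[OF g s1]
   by (intro order_trans[OF conv_e[OF finite_supp_mult_h]] mult_left_mono) auto
  also have "... <= (Clog\<^sup>2 * M powr (\<delta> / 800)) * (CE * M powr (- \<delta> / 60)) * (1536 * KW * Q)"
   using L CE_pos K0 Q0 by (intro mult_right_mono) auto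
  also have "... = Clog\<^sup>2 * (CE * (1536 * KW)) * (M powr (\<delta> / 800) * M powr (- \<delta> / 60)) * Q" by simp
  also have "... <= Clog\<^sup>2 * (CE * (1536 * KW)) * m * Q"
   using g2 CE_pos K0 Q0 by (intro mult_right_mono mult_left_mono) auto
  finally show ?thesis .
 qed
 have i2: "ell2_norm (conv h (%x. g x * e x)) <= 2 * CHE * m * Q" using g3 CHE_nonneg Q0 unfolding Q_def
  by (intro order_trans[OF conv_h_e[OF g s]] mult_right_mono mult_left_mono) auto
 have i3: "ell2_norm (conv e (%x. g x * e x)) <= Clog\<^sup>2 * (32 * CB * CE\<^sup>2) * m * Q"
 proof -
  have "ell2_norm (conv e (%x. g x * e x)) <= L\<^sup>2 * (32 * CB * CE\<^sup>2 * M powr (- \<delta> / 160) * Q)"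
   unfolding L_def Q_def by (rule conv_e_e[OF g s])
  also have "... <= (Clog\<^sup>2 * M powr (\<delta> / 800)) * (32 * CB * CE\<^sup>2 * M powr (- \<delta> / 160) * Q)"
   using L CB(1) Q0 by (intro mult_right_mono) auto
  also have "... = Clog\<^sup>2 * (32 * CB * CE\<^sup>2) * (M powr (\<delta> / 800) * M powr (- \<delta> / 160)) * Q" by simp
  also have "... <= Clog\<^sup>2 * (32 * CB * CE\<^sup>2) * m * Q"
   using g1 CB(1) Q0 by (intro mult_right_mono mult_left_mono) auto
  finally show ?thesis .
 qed
 have m1: "conv e (%x. g x * h x) \<in> ell2" "conv h (%x. g x * e x) \<in> ell2" "conv e (%x. g x * e x) \<in> ell2"
  by (intro supp_in_ell2 finite_supp_conv finite_supp_e finite_supp_h finite_supp_mult_h finite_supp_mult_e)+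
 have "ell2_norm (rem g) <= ell2_norm (conv e (%x. g x * h x)) + ell2_norm (conv h (%x. g x * e x)) + ell2_norm (conv e (%x. g x * e x))"
  unfolding rem_def using ell2_add[OF m1(1,2)] ell2_add[OF ell2_add[OF m1(1,2), THEN conjunct1] m1(3)] by linarith
 also have "... <= CR * m * Q" using i1 i2 i3 by (simp add: CR_def algebra_simps)
 finally show ?thesis by (simp add: m_def Q_def)
qed

definition CQ :: real where
 "CQ = 1280 * KW * (1536 * KW) + 1280 * KW * (4000 * KW * sqrt (8 + 4 * ZC)) + 2 * \<bar>CR\<bar>"

text \<open>The smooth part inherits order 1/2 from \<open>norm_diff_mult_h\<close>. Increments of
  \<open>rem g\<close> are bounded by twice its norm, and the gain M powr (- \<delta> / 200) is
  spent as smoothness; for s > M the missing (M / s) powr (\<delta> / 200) is supplied by the factor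
  M / s in s * \<open>Gs s\<close>.\<close>

theorem bilinear_bounds:
 assumes g: "multiplier R s g" and s: "M powr \<theta> <= s"
 shows "ell2_norm (conv H (%x. g x * H x)) <= CQ * s powr (- 1 / 2)"
  and "1 <= a ==> of_int a <= s ==>
   ell2_norm (%x. conv H (%x. g x * H x) (x + a) - conv H (%x. g x * H x) x)
    <= CQ * s powr (- 1 / 2) * (of_int a / s) powr (\<delta> / 200)"
proof -
 have s1: "1 <= s" using s M_theta by linarith
 have K0: "0 <= KW" using KW(1) by simp
 let ?k = "%x. g x * h x"
 let ?c = "conv h ?k"
 have sq: "sqrt (Gs s) <= s powr (- 1 / 2)"
 proof -
  have "sqrt (Gs s) <= sqrt (1 / s)" using Gs_le[of s] s1 by simp
  also have "... = s powr (- 1 / 2)" using s1 by (simp add: real_sqrt_divide powr_minus_divide powr_half_sqrt)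
  finally show ?thesis .
 qed
 have me: "?c \<in> ell2" "rem g \<in> ell2"
  by (intro supp_in_ell2 finite_supp_conv finite_supp_h finite_supp_mult_h finite_supp_rem)+
 have rb: "ell2_norm (rem g) <= \<bar>CR\<bar> * (M powr (- \<delta> / 200) * sqrt (Gs s))"
 proof -
  have "CR * (M powr (- \<delta> / 200) * sqrt (Gs s)) <= \<bar>CR\<bar> * (M powr (- \<delta> / 200) * sqrt (Gs s))"
   using Gs_nonneg[of s] s1 by (intro mult_right_mono) auto
  then show ?thesis using norm_rem[OF g s] by simp
 qed
 have mle: "M powr (- \<delta> / 200) <= 1" using M1 delta powr_mono[of "- \<delta> / 200" 0 M] by simp
 have "ell2_norm (conv H (%x. g x * H x)) <= ell2_norm ?c + ell2_norm (rem g)"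
  unfolding conv_H_rem using ell2_add[OF me] by simp
 also have "... <= 1280 * KW * (1536 * KW * s powr (- 1 / 2)) + \<bar>CR\<bar> * (1 * s powr (- 1 / 2))"
 proof (rule add_mono)
  have "ell2_norm ?k <= 1536 * KW * s powr (- 1 / 2)"
   using norm_mult_h[OF g s1] sq K0 by (meson mult_left_mono mult_nonneg_nonneg order_trans zero_le_numeral)
  then show "ell2_norm ?c <= 1280 * KW * (1536 * KW * s powr (- 1 / 2))"
   using K0 by (intro order_trans[OF conv_h[OF finite_supp_mult_h]] mult_left_mono) auto
  show "ell2_norm (rem g) <= \<bar>CR\<bar> * (1 * s powr (- 1 / 2))"
   using mle sq Gs_nonneg[of s] s1 by (intro order_trans[OF rb] mult_left_mono mult_mono) auto
 qed
 also have "... <= CQ * s powr (- 1 / 2)"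
 proof -
  have "1280 * KW * (1536 * KW) + \<bar>CR\<bar> <= CQ" using K0 ZC_nonneg by (simp add: CQ_def)
  then have "(1280 * KW * (1536 * KW) + \<bar>CR\<bar>) * s powr (- 1 / 2) <= CQ * s powr (- 1 / 2)" by (intro mult_right_mono) auto
  then show ?thesis by (simp add: algebra_simps)
 qed
 finally show "ell2_norm (conv H (%x. g x * H x)) <= CQ * s powr (- 1 / 2)" .
 assume a: "1 <= a" "of_int a <= s"
 let ?a = "real_of_int a"
 let ?t = "s powr (- 1 / 2) * (?a / s) powr (\<delta> / 200)"
 have a1: "1 <= ?a" using a by simp
 have as: "0 < ?a / s" "?a / s <= 1" using a a1 s1 by auto
 have b1: "ell2_norm (%x. ?c (x + a) - ?c x) <= 1280 * KW * (4000 * KW * sqrt (8 + 4 * ZC)) * ?t"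
 proof -
  have "(%x. ?c (x + a) - ?c x) = conv h (%x. g (x + a) * h (x + a) - g x * h x)"
   using conv_difference_right[of h ?k a] by simp
  then have "ell2_norm (%x. ?c (x + a) - ?c x) <= 1280 * KW * ell2_norm (%x. ?k (x + a) - ?k x)"
   using conv_h[of "%x. ?k (x + a) - ?k x"] finite_supp_diff[OF finite_supp_shift[OF finite_supp_mult_h, of g a] finite_supp_mult_h[of g]]
   by simp
  also have "... <= 1280 * KW * (4000 * KW * sqrt (8 + 4 * ZC) * (sqrt ?a / s))"
   using K0 by (intro mult_left_mono norm_diff_mult_h[OF g s1 a(1)]) auto
  also have "sqrt ?a / s <= ?t"
  proof -
   have "sqrt ?a / s = s powr (- 1 / 2) * (?a / s) powr (1 / 2)"
   proof -
    have "s powr (- 1 / 2) = 1 / sqrt s" using s1 by (simp add: powr_minus_divide powr_half_sqrt)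
    moreover have "(?a / s) powr (1 / 2) = sqrt ?a / sqrt s" using as by (simp add: powr_half_sqrt real_sqrt_divide)
    moreover have "sqrt s * sqrt s = s" using s1 by simp
    ultimately show ?thesis by simp
   qed
   also have "... <= ?t" using as theta_bounds by (intro mult_left_mono powr_mono') auto
   finally show ?thesis .
  qed
  then have "1280 * KW * (4000 * KW * sqrt (8 + 4 * ZC) * (sqrt ?a / s)) <= 1280 * KW * (4000 * KW * sqrt (8 + 4 * ZC) * ?t)"
   using K0 ZC_nonneg by (intro mult_left_mono) auto
  finally show ?thesis by (simp add: mult_ac)
 qed
 have b2: "ell2_norm (%x. rem g (x + a) - rem g x) <= 2 * \<bar>CR\<bar> * ?t"
 proof -
  have key: "M powr (- \<delta> / 200) * sqrt (Gs s) <= ?t"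
  proof -
   have "M powr (- \<delta> / 200) * sqrt (Gs s) <= s powr (- 1 / 2) * (1 / s) powr (\<delta> / 200)"
   proof (cases "s <= M")
    case True
    have "M powr (- \<delta> / 200) <= s powr (- \<delta> / 200)" using True s1 delta by (intro powr_mono2') auto
    also have "... = (1 / s) powr (\<delta> / 200)" using s1 by (simp add: powr_divide powr_minus_divide)
    finally have "M powr (- \<delta> / 200) * sqrt (Gs s) <= (1 / s) powr (\<delta> / 200) * s powr (- 1 / 2)"
     using sq Gs_nonneg[of s] s1 by (intro mult_mono) auto
    then show ?thesis by (simp add: mult.commute)
   next
    case False
    have "sqrt (Gs s) = s powr (- 1 / 2) * (M / s) powr (1 / 2)"
    proof -
     have "s powr (- 1 / 2) = 1 / sqrt s" using s1 by (simp add: powr_minus_divide powr_half_sqrt)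
     moreover have "(M / s) powr (1 / 2) = sqrt M / sqrt s" using M1 s1 by (simp add: powr_half_sqrt real_sqrt_divide)
     moreover have "sqrt s * sqrt s = s" using s1 by simp
     moreover have "sqrt (Gs s) = sqrt M / s" using False s1 by (simp add: Gs_def real_sqrt_divide)
     ultimately show ?thesis by simp
    qed
    also have "... <= s powr (- 1 / 2) * (M / s) powr (\<delta> / 200)"
     using False M1 s1 theta_bounds by (intro mult_left_mono powr_mono') auto
    finally have "M powr (- \<delta> / 200) * sqrt (Gs s) <= M powr (- \<delta> / 200) * (s powr (- 1 / 2) * (M / s) powr (\<delta> / 200))"
     by (intro mult_left_mono) auto
    also have "... = s powr (- 1 / 2) * (1 / s) powr (\<delta> / 200)"
     using M1 s1 by (simp add: powr_divide powr_minus_divide)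
    finally show ?thesis .
   qed
   also have "... <= ?t" using a1 s1 delta by (intro mult_left_mono powr_mono2 divide_right_mono) auto
   finally show ?thesis .
  qed
  have "ell2_norm (%x. rem g (x + a) - rem g x) <= 2 * ell2_norm (rem g)" using ell2_difference[OF me(2)] by simp
  also have "... <= 2 * (\<bar>CR\<bar> * ?t)" using key by (intro mult_left_mono order_trans[OF rb]) auto
  finally show ?thesis by simp
 qed
 have "(%x. conv H (%x. g x * H x) (x + a) - conv H (%x. g x * H x) x) = (%x. (?c (x + a) - ?c x) + (rem g (x + a) - rem g x))"
  unfolding conv_H_rem by (auto simp: algebra_simps)
 then have "ell2_norm (%x. conv H (%x. g x * H x) (x + a) - conv H (%x. g x * H x) x)
   <= ell2_norm (%x. ?c (x + a) - ?c x) + ell2_norm (%x. rem g (x + a) - rem g x)"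
  using ell2_add[OF ell2_difference[OF me(1), THEN conjunct1] ell2_difference[OF me(2), THEN conjunct1], of a a] by simp
 also have "... <= (1280 * KW * (4000 * KW * sqrt (8 + 4 * ZC)) + 2 * \<bar>CR\<bar>) * ?t" using b1 b2 by (simp add: algebra_simps)
 also have "... <= CQ * ?t" using K0 by (intro mult_right_mono) (auto simp: CQ_def)
 finally show "ell2_norm (%x. conv H (%x. g x * H x) (x + a) - conv H (%x. g x * H x) x)
    <= CQ * s powr (- 1 / 2) * (of_int a / s) powr (\<delta> / 200)" by simp
qed

end

section \<open>Convolution inverses\<close>

lemma conv_shift_left:
 assumes "finite (supp k)"
 shows "conv (%x. k (x + a)) f = (%x. conv k f (x + a))"
proof
 fix x
 show "conv (%x. k (x + a)) f x = conv k f (x + a)" unfolding conv_def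
  by (rule sum.reindex_bij_witness[where i = "%y. y - a" and j = "%y. y + a"]) (auto simp: supp_def algebra_simps)
qed

lemma conv_difference_left:
 assumes "finite (supp k)"
 shows "conv (%x. k (x + a) - k x) f = (%x. conv k f (x + a) - conv k f x)"
 by (simp add: conv_diff_left finite_supp_shift assms conv_shift_left)

lemma conv_cmult_left:
 assumes "finite (supp k)"
 shows "conv (%x. c * k x) f = (%x. c * conv k f x)"
proof
 fix x
 have "conv (%x. c * k x) f x = (\<Sum>y\<in>supp k. (c * k y) * f (x - y))"
  using assms by (intro conv_eq) (auto simp: supp_def)
 then show "conv (%x. c * k x) f x = c * conv k f x" by (simp add: conv_def sum_distrib_left mult_ac)
qed

text \<open>A bounded two-sided inverse on \<open>ell2\<close>. Differences stand for linearity;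
  negation is recovered from commutation with the kernel - \<open>delta0\<close>.\<close>

locale inverse_operator =
 fixes H :: "int => complex" and lam :: complex and S :: seq_op and C :: real
 assumes finite_H: "finite (supp H)"
  and S_ell2: "f \<in> ell2 ==> S f \<in> ell2"
  and TS: "f \<in> ell2 ==> (%x. lam * S f x + conv H (S f) x) = f"
  and ST: "f \<in> ell2 ==> S (%x. lam * f x + conv H f x) = f"
  and S_add: "f \<in> ell2 ==> g \<in> ell2 ==> S (%x. f x - g x) = (%x. S f x - S g x)"
  and S_bound: "f \<in> ell2 ==> ell2_norm (S f) <= C * ell2_norm f"
  and C0: "0 <= C"
begin

definition X :: "int => complex" where "X = S delta0"

lemma delta0_ell2: "delta0 \<in> ell2" by (rule supp_in_ell2) (simp add: finite_supp_delta0)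

lemma X_ell2: "X \<in> ell2" unfolding X_def by (rule S_ell2[OF delta0_ell2])

lemma S_unique:
 assumes "f \<in> ell2" "(%x. lam * f x + conv H f x) = g"
 shows "f = S g" using ST[OF assms(1)] assms(2) by simp

text \<open>Every kernel commutes with the operator, hence with its inverse; the equality is
  uniqueness of the preimage.\<close>

lemma S_conv:
 assumes f: "f \<in> ell2" and k: "finite (supp k)"
 shows "S (conv k f) = conv k (S f)"
proof (rule S_unique[symmetric])
 show "conv k (S f) \<in> ell2" using conv_ell2[OF k S_ell2[OF f]] by simp
 have "(%x. lam * conv k (S f) x + conv H (conv k (S f)) x) = conv k (%x. lam * S f x + conv H (S f) x)"
  by (simp add: conv_add_right conv_cmult_right conv_conv_commute[of H])
 then show "(%x. lam * conv k (S f) x + conv H (conv k (S f)) x) = conv k f" by (simp add: TS[OF f])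
qed

lemma S_finite: "finite (supp k) ==> S k = conv k X" using S_conv[OF delta0_ell2, of k] by (simp add: conv_delta0 X_def)

lemma norm_conv_X: "finite (supp k) ==> ell2_norm (conv k X) <= C * ell2_norm k"
 using S_bound[OF supp_in_ell2, of k] by (simp add: S_finite)

lemma S_shift:
 assumes f: "f \<in> ell2"
 shows "S (%x. f (x + a)) = (%x. S f (x + a))"
proof (rule S_unique[symmetric])
 show "(%x. S f (x + a)) \<in> ell2" using ell2_shift[OF S_ell2[OF f]] by simp
 show "(%x. lam * S f (x + a) + conv H (%x. S f (x + a)) x) = (%x. f (x + a))"
  using TS[OF f] by (auto simp: conv_shift_right fun_eq_iff)
qed

lemma conv_H_S:
 assumes f: "f \<in> ell2"
 shows "conv H (S f) \<in> ell2 & ell2_norm (conv H (S f)) <= (1 + cmod lam * C) * ell2_norm f"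
proof -
 have e: "conv H (S f) = (%x. f x - lam * S f x)" using fun_cong[OF TS[OF f]] by (auto simp: fun_eq_iff algebra_simps)
 have m: "(%x. lam * S f x) \<in> ell2 & ell2_norm (%x. lam * S f x) <= cmod lam * ell2_norm (S f)"
  by (rule ell2_cmult[OF S_ell2[OF f]])
 have "ell2_norm (conv H (S f)) <= ell2_norm f + cmod lam * ell2_norm (S f)"
  unfolding e using ell2_diff[OF f, of "%x. lam * S f x"] m by linarith
 also have "... <= ell2_norm f + cmod lam * (C * ell2_norm f)"
  using S_bound[OF f] by (intro add_left_mono mult_left_mono) auto
 finally show ?thesis using conv_ell2[OF finite_H S_ell2[OF f]] by (simp add: algebra_simps)
qed

text \<open>On finite truncations of f the inverse is a finite convolution with \<open>X\<close>.
  The truncations converge to f in norm, so their images converge pointwise to \<open>S f\<close>,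
  while Cauchy--Schwarz makes the infinite sum converge absolutely; both limits are those of one
  net.\<close>

lemma S_convolve:
 assumes f: "f \<in> ell2"
 shows "S f = convolve X f"
proof
 fix x
 define r where "r = (%F y. if y \<in> F then f y else 0)"
 have rs: "supp (r F) \<subseteq> F" for F by (auto simp: supp_def r_def)
 have Xr: "(%y. X (x - y)) \<in> ell2" using ell2_bij[OF X_ell2 bij_int_minus] by simp
 have sm: "(%y. f y * X (x - y)) summable_on UNIV" by (rule abs_summable_summable) (rule ell2_inner(1)[OF f Xr])
 have lim1: "((%F. S (r F) x) \<longlongrightarrow> (\<Sum>\<^sub>\<infinity>y. f y * X (x - y))) (finite_subsets_at_top UNIV)"
 proof -
  have "((%F. \<Sum>y\<in>F. f y * X (x - y)) \<longlongrightarrow> (\<Sum>\<^sub>\<infinity>y. f y * X (x - y))) (finite_subsets_at_top UNIV)"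
   using has_sum_infsum[OF sm] by (simp add: has_sum_def)
  moreover have "\<forall>\<^sub>F F in finite_subsets_at_top UNIV. (\<Sum>y\<in>F. f y * X (x - y)) = S (r F) x"
  proof (rule eventually_finite_subsets_at_top_weakI)
   fix F :: "int set" assume F: "finite F"
   have fr: "finite (supp (r F))" using rs F finite_subset by blast
   have "S (r F) x = (\<Sum>y\<in>F. r F y * X (x - y))" by (simp add: S_finite[OF fr] conv_eq[OF F rs])
   then show "(\<Sum>y\<in>F. f y * X (x - y)) = S (r F) x" by (simp add: r_def)
  qed
  ultimately show ?thesis by (rule Lim_transform_eventually)
 qed
 have lim2: "((%F. S (r F) x) \<longlongrightarrow> S f x) (finite_subsets_at_top UNIV)"
 proof -
  have sf: "(%y. (cmod (f y))\<^sup>2) summable_on UNIV" using f by (simp add: ell2_def)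
  have "((%F. (ell2_norm f)\<^sup>2 - (\<Sum>y\<in>F. (cmod (f y))\<^sup>2)) \<longlongrightarrow> (ell2_norm f)\<^sup>2 - (\<Sum>\<^sub>\<infinity>y. (cmod (f y))\<^sup>2)) (finite_subsets_at_top UNIV)"
   using has_sum_infsum[OF sf] by (intro tendsto_diff tendsto_const) (simp add: has_sum_def)
  then have "((%F. C * sqrt ((ell2_norm f)\<^sup>2 - (\<Sum>y\<in>F. (cmod (f y))\<^sup>2))) \<longlongrightarrow> C * sqrt 0) (finite_subsets_at_top UNIV)"
   by (intro tendsto_mult tendsto_const tendsto_real_sqrt) (simp add: ell2_norm_sq)
  then have t0: "((%F. C * sqrt ((ell2_norm f)\<^sup>2 - (\<Sum>y\<in>F. (cmod (f y))\<^sup>2))) \<longlongrightarrow> 0) (finite_subsets_at_top UNIV)" by simp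
  have "((%F. S (r F) x - S f x) \<longlongrightarrow> 0) (finite_subsets_at_top UNIV)"
  proof (rule Lim_null_comparison[OF _ t0])
   show "\<forall>\<^sub>F F in finite_subsets_at_top UNIV. cmod (S (r F) x - S f x) <= C * sqrt ((ell2_norm f)\<^sup>2 - (\<Sum>y\<in>F. (cmod (f y))\<^sup>2))"
   proof (rule eventually_finite_subsets_at_top_weakI)
    fix F :: "int set" assume F: "finite F"
    have fr: "finite (supp (r F))" using rs F finite_subset by blast
    have rm: "r F \<in> ell2" by (rule supp_in_ell2[OF fr])
    have dm: "(%y. r F y - f y) \<in> ell2" using ell2_diff[OF rm f] by simp
    have n: "ell2_norm (%y. r F y - f y) = sqrt ((ell2_norm f)\<^sup>2 - (\<Sum>y\<in>F. (cmod (f y))\<^sup>2))"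
    proof -
     have "(ell2_norm (%y. r F y - f y))\<^sup>2 = (\<Sum>\<^sub>\<infinity>y\<in>UNIV - F. (cmod (f y))\<^sup>2)"
      unfolding ell2_norm_sq by (rule infsum_cong_neutral) (auto simp: r_def)
     also have "... = (\<Sum>\<^sub>\<infinity>y. (cmod (f y))\<^sup>2) - (\<Sum>\<^sub>\<infinity>y\<in>F. (cmod (f y))\<^sup>2)"
      using F by (intro infsum_Diff sf) auto
     finally have "(ell2_norm (%y. r F y - f y))\<^sup>2 = (ell2_norm f)\<^sup>2 - (\<Sum>y\<in>F. (cmod (f y))\<^sup>2)"
      using F by (simp add: ell2_norm_sq)
     then show ?thesis using ell2_norm_nonneg real_sqrt_unique by metis
    qed
    have "cmod (S (r F) x - S f x) = cmod (S (%y. r F y - f y) x)" by (simp add: S_add[OF rm f])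
    also have "... <= ell2_norm (S (%y. r F y - f y))" by (rule cmod_le_ell2_norm[OF S_ell2[OF dm]])
    also have "... <= C * ell2_norm (%y. r F y - f y)" by (rule S_bound[OF dm])
    finally show "cmod (S (r F) x - S f x) <= C * sqrt ((ell2_norm f)\<^sup>2 - (\<Sum>y\<in>F. (cmod (f y))\<^sup>2))" by (simp add: n)
   qed
  qed
  then show ?thesis by (simp add: LIM_zero_iff)
 qed
 have "S f x = (\<Sum>\<^sub>\<infinity>y. f y * X (x - y))" by (rule tendsto_unique[OF _ lim2 lim1]) simp
 also have "... = (\<Sum>\<^sub>\<infinity>y. f (x - y) * X (x - (x - y)))"
  using infsum_reindex_bij_betw[OF bij_int_minus[of x], of "%y. f y * X (x - y)"] by simp
 finally show "S f x = convolve X f x" by (simp add: convolve_def mult.commute)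
qed

text \<open>Long indicator functions are almost annihilated by a kernel with vanishing sum.\<close>

lemma lam_nonzero:
 assumes sum0: "(\<Sum>y\<in>supp H. H y) = 0"
 shows "lam ~= 0"
proof
 assume l0: "lam = 0"
 obtain B where B: "0 <= B" "supp H \<subseteq> {-B..B}" using supp_subset_atLeastAtMost[OF finite_H] by blast
 define q where "q = l1norm H"
 define Q where "Q = C\<^sup>2 * (real_of_int (4 * B) * q\<^sup>2)"
 \<comment> \<open>The defect lives near the two ends of the interval, with squared norm at most 4 *
   B * q^2 for every length, so an interval longer than Q contradicts the bound for the
   inverse.\<close>
 define L where "L = nat \<lceil>Q\<rceil> + 1"
 have LQ: "Q < real L" unfolding L_def by linarith
 define f :: "int => complex" where "f = (%x. if x \<in> {0..<int L} then 1 else 0)"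
 have sf: "supp f \<subseteq> {0..<int L}" by (auto simp: supp_def f_def)
 then have ff: "finite (supp f)" using finite_subset by blast
 have fm: "f \<in> ell2" by (rule supp_in_ell2[OF ff])
 have nf: "(ell2_norm f)\<^sup>2 = real L" using finite_supp_ell2(2)[OF _ sf] by (simp add: f_def)
 let ?E = "{-B..<B} \<union> {int L - B..<int L + B}"
 have z: "conv H f x = 0" if x: "x \<notin> ?E" for x
 proof -
  have c: "conv H f x = (\<Sum>y\<in>{-B..B}. H y * f (x - y))" by (rule conv_eq[OF _ B(2)]) simp
  show ?thesis
  proof (cases "B <= x & x < int L - B")
   case True
   have "(\<Sum>y\<in>{-B..B}. H y * f (x - y)) = (\<Sum>y\<in>{-B..B}. H y)"
    using True by (intro sum.cong) (auto simp: f_def)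
   also have "... = (\<Sum>y\<in>supp H. H y)" by (rule sum_supp[symmetric]) (use B in auto)
   finally show ?thesis using c sum0 by simp
  next
   case False
   have "(\<Sum>y\<in>{-B..B}. H y * f (x - y)) = 0" using False x by (intro sum.neutral) (auto simp: f_def)
   then show ?thesis using c by simp
  qed
 qed
 have sE: "supp (conv H f) \<subseteq> ?E"
 proof
  fix x assume x: "x \<in> supp (conv H f)"
  show "x \<in> ?E"
  proof (rule ccontr)
   assume "x \<notin> ?E"
   then have "conv H f x = 0" by (rule z)
   then show False using x by (simp add: supp_def)
  qed
 qed
 have "(\<Sum>x\<in>?E. (cmod (conv H f x))\<^sup>2) <= (\<Sum>x\<in>?E. q\<^sup>2)"
 proof (intro sum_mono power_mono)
  fix x
  show "cmod (conv H f x) <= q" unfolding conv_def q_def l1norm_def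
   by (rule order_trans[OF norm_sum], rule sum_mono) (auto simp: f_def norm_mult)
 qed auto
 also have "... <= real_of_int (4 * B) * q\<^sup>2"
 proof -
  have "card ?E <= card {-B..<B} + card {int L - B..<int L + B}" by (rule card_Un_le)
  also have "... = nat (4 * B)" using B by simp
  finally have "real (card ?E) <= real_of_int (4 * B)" using B by linarith
  then show ?thesis by (simp only: sum_constant) (intro mult_right_mono, auto)
 qed
 finally have nH: "(ell2_norm (conv H f))\<^sup>2 <= real_of_int (4 * B) * q\<^sup>2"
  using finite_supp_ell2(2)[OF _ sE] by simp
 have "S (conv H f) = f" using ST[OF fm] by (simp add: l0)
 then have "ell2_norm f <= C * ell2_norm (conv H f)"
  using S_bound[of "conv H f"] supp_in_ell2[OF finite_supp_conv[OF finite_H ff]] by simp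
 then have "(ell2_norm f)\<^sup>2 <= (C * ell2_norm (conv H f))\<^sup>2" by (intro power_mono) auto
 also have "... <= Q" unfolding Q_def power_mult_distrib using nH by (intro mult_left_mono) auto
 finally show False using nf LQ by simp
qed

definition Y :: "int => complex" where "Y x = X x - 1 / lam * delta0 x + 1 / lam\<^sup>2 * H x"

lemma X_eq: "lam * X x + conv H X x = delta0 x" using fun_cong[OF TS[OF delta0_ell2]] by (simp add: X_def)

lemma conv_H_X: "conv H X = (%x. delta0 x - lam * X x)" using X_eq by (auto simp: algebra_simps)

lemma Y_eq:
 assumes "lam ~= 0"
 shows "Y = (%x. 1 / lam\<^sup>2 * conv H (conv H X) x)"
proof
 fix x
 have "conv H (conv H X) x = conv H delta0 x - lam * conv H X x"
 proof -
  have "conv H (conv H X) x = conv H (%x. delta0 x - lam * X x) x" by (simp only: conv_H_X)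
  then show ?thesis by (simp only: conv_diff_right conv_cmult_right)
 qed
 also have "... = H x - lam * (delta0 x - lam * X x)"
  by (simp add: conv_delta0[OF finite_H] fun_cong[OF conv_H_X, of x])
 finally have c: "conv H (conv H X) x = H x - lam * (delta0 x - lam * X x)" .
 show "Y x = 1 / lam\<^sup>2 * conv H (conv H X) x"
  unfolding c using assms by (simp add: Y_def field_simps power2_eq_square)
qed

lemma Y_ell2: "lam ~= 0 ==> Y \<in> ell2"
 unfolding Y_eq using conv_ell2[OF finite_H conv_ell2[OF finite_H X_ell2, THEN conjunct1]] ell2_cmult by blast

section \<open>Modulated kernels and the resolvent identity\<close>

abbreviation (input) modul :: "real => (int => complex) => int => complex" where
 "modul \<eta> f \<equiv> %x. cis (\<eta> * of_int x) * f x"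

lemma modul_cancel: "modul \<eta> (modul (- \<eta>) f) = f" by (simp add: mult.assoc[symmetric] cis_mult)

text \<open>Modulation preserves norms, so demodulating \<open>k\<close> reduces the claim to
  \<open>norm_conv_X\<close>.\<close>

lemma norm_conv_modul_X:
 assumes k: "finite (supp k)"
 shows "conv k (modul \<eta> X) \<in> ell2" "ell2_norm (conv k (modul \<eta> X)) <= C * ell2_norm k"
proof -
 have fk: "finite (supp (modul (- \<eta>) k))" by (rule finite_supp_mult[OF k])
 have "conv k (modul \<eta> X) = conv (modul \<eta> (modul (- \<eta>) k)) (modul \<eta> X)"
  by (rule arg_cong[where f = "%k. conv k (modul \<eta> X)"], rule modul_cancel[symmetric])
 also have "... = modul \<eta> (conv (modul (- \<eta>) k) X)" by (rule conv_modulate)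
 finally have e: "conv k (modul \<eta> X) = modul \<eta> (conv (modul (- \<eta>) k) X)" .
 have m: "conv (modul (- \<eta>) k) X \<in> ell2" using conv_ell2[OF fk X_ell2] by simp
 have n: "modul \<eta> (conv (modul (- \<eta>) k) X) \<in> ell2 &
   ell2_norm (modul \<eta> (conv (modul (- \<eta>) k) X)) = ell2_norm (conv (modul (- \<eta>) k) X)"
  by (rule ell2_cong_norm[OF m]) (simp add: norm_mult)
 then show "conv k (modul \<eta> X) \<in> ell2" by (simp only: e)
 have "ell2_norm (conv (modul (- \<eta>) k) X) <= C * ell2_norm (modul (- \<eta>) k)" by (rule norm_conv_X[OF fk])
 also have "ell2_norm (modul (- \<eta>) k) = ell2_norm k"
  using ell2_cong_norm[OF supp_in_ell2[OF k], of "modul (- \<eta>) k"] by (simp add: norm_mult)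
 finally show "ell2_norm (conv k (modul \<eta> X)) <= C * ell2_norm k" using n by (simp only: e)
qed

text \<open>The modulated kernel inverts the modulated operator; this resolvent identity bounds the
 increment of the modulation of \<open>Y\<close> by bilinear expressions in \<open>H\<close> and its modulations.\<close>

lemma modul_X_diff:
 "(%x. modul \<eta> X x - X x) = S (%x. - conv (%x. (cis (\<eta> * of_int x) - 1) * H x) (modul \<eta> X) x)"
proof (rule S_unique)
 have mX: "modul \<eta> X \<in> ell2" using ell2_cong_norm[OF X_ell2, of "modul \<eta> X"] by (simp add: norm_mult)
 then show "(%x. modul \<eta> X x - X x) \<in> ell2" using ell2_diff[OF _ X_ell2] by blast
 have fm: "finite (supp (modul \<eta> H))" by (rule finite_supp_mult[OF finite_H])
 have "(%x. (cis (\<eta> * of_int x) - 1) * H x) = (%x. modul \<eta> H x - H x)" by (simp add: algebra_simps)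
 then have g: "conv (%x. (cis (\<eta> * of_int x) - 1) * H x) k = (%x. conv (modul \<eta> H) k x - conv H k x)" for k
  using conv_diff_left[OF fm finite_H, of k] by simp
 show "(%x. lam * (modul \<eta> X x - X x) + conv H (%x. modul \<eta> X x - X x) x) =
   (%x. - conv (%x. (cis (\<eta> * of_int x) - 1) * H x) (modul \<eta> X) x)"
 proof
  fix x
  have 1: "conv (modul \<eta> H) (modul \<eta> X) x = cis (\<eta> * of_int x) * (delta0 x - lam * X x)"
   unfolding conv_modulate conv_H_X ..
  have d: "cis (\<eta> * of_int x) * delta0 x = delta0 x" by (simp add: delta0_def)
  have 2: "conv H (%x. modul \<eta> X x - X x) x = conv H (modul \<eta> X) x - conv H X x" by (simp add: conv_diff_right)
  show "lam * (modul \<eta> X x - X x) + conv H (%x. modul \<eta> X x - X x) x =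
   - conv (%x. (cis (\<eta> * of_int x) - 1) * H x) (modul \<eta> X) x"
  proof -
   have "lam * (cis (\<eta> * of_int x) * X x - X x) + (conv H (modul \<eta> X) x - conv H X x) =
     - (cis (\<eta> * of_int x) * (delta0 x - lam * X x) - conv H (modul \<eta> X) x)"
    unfolding right_diff_distrib d fun_cong[OF conv_H_X, of x] by simp
   then show ?thesis unfolding fun_cong[OF g[of "modul \<eta> X"], of x] 1 2 .
  qed
 qed
qed

definition PH :: "real => int => complex" where
 "PH \<eta> = conv H (%x. (cis (\<eta> * of_int x) - 1) * H x)"

lemma finite_supp_PH: "finite (supp (PH \<eta>))" unfolding PH_def by (intro finite_supp_conv finite_H finite_supp_mult)

text \<open>Write Hm, Xm for the modulated kernels and gH = Hm - H. Then lam^2 times the left side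
  is Hm Hm Xm - H H X, products being convolutions, and telescopes to gH Hm Xm + H gH Xm + H H (Xm -
  X). The second term is \<open>PH \<eta>\<close> applied to Xm. In the first, gH is minus the
  modulation of its counterpart at - \<eta>, whence the modulated \<open>PH (- \<eta>)\<close>. In
  the third, \<open>modul_X_diff\<close> provides another gH, which joins a factor H because
  \<open>S\<close> commutes with convolutions.\<close>

lemma modul_Y_diff:
 assumes lam: "lam ~= 0"
 shows "(%x. modul \<eta> Y x - Y x) = (%x. 1 / lam\<^sup>2 *
  (- conv (modul \<eta> (PH (- \<eta>))) (modul \<eta> X) x + conv (PH \<eta>) (modul \<eta> X) x - conv H (S (conv (PH \<eta>) (modul \<eta> X))) x))"
proof -
 let ?gH = "%x. (cis (\<eta> * of_int x) - 1) * H x"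
 let ?Hm = "modul \<eta> H" and ?Xm = "modul \<eta> X"
 have fm: "finite (supp ?Hm)" and fg: "finite (supp ?gH)" by (rule finite_supp_mult[OF finite_H])+
 have ge: "?gH = (%x. ?Hm x - H x)" by (simp add: algebra_simps)
 have cg: "conv ?gH k x = conv ?Hm k x - conv H k x" for k x
  unfolding ge using conv_diff_left[OF fm finite_H, of k] by simp
 have e1: "modul \<eta> (conv H (conv H X)) = conv ?Hm (conv ?Hm ?Xm)" by (simp only: conv_modulate)
 have e2: "conv ?Hm (conv ?Hm ?Xm) x - conv H (conv H ?Xm) x = conv ?gH (conv ?Hm ?Xm) x + conv H (conv ?gH ?Xm) x" for x
 proof -
  have "conv H (conv ?gH ?Xm) x = conv H (%x. conv ?Hm ?Xm x - conv H ?Xm x) x"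
   by (rule arg_cong[where f = "%k. conv H k x"]) (rule ext, rule cg)
  then show ?thesis unfolding cg conv_diff_right by (simp only: diff_add_eq_diff_diff_swap add_diff_eq diff_add_cancel)
 qed
 have P2: "conv H (conv ?gH k) = conv (PH \<eta>) k" for k
  unfolding PH_def by (rule conv_assoc[OF finite_H fg, symmetric])
 have P1: "conv ?gH (conv ?Hm ?Xm) = (%x. - conv (modul \<eta> (PH (- \<eta>))) ?Xm x)"
 proof -
  have gm: "?gH = (%x. - modul \<eta> (%x. (cis (- \<eta> * of_int x) - 1) * H x) x)"
  proof
   fix x
   have c: "cis (\<eta> * of_int x) * cis (- \<eta> * of_int x) = 1" by (simp add: cis_mult)
   have "- (cis (\<eta> * of_int x) * ((cis (- \<eta> * of_int x) - 1) * H x))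
     = - ((cis (\<eta> * of_int x) * cis (- \<eta> * of_int x) - cis (\<eta> * of_int x)) * H x)"
    by (simp only: left_diff_distrib right_diff_distrib mult.assoc mult_1 mult_1_right)
   then show "(cis (\<eta> * of_int x) - 1) * H x = - (cis (\<eta> * of_int x) * ((cis (- \<eta> * of_int x) - 1) * H x))"
    unfolding c by (simp add: algebra_simps)
  qed
  have fg': "finite (supp (modul \<eta> (%x. (cis (- \<eta> * of_int x) - 1) * H x)))" by (intro finite_supp_mult finite_H)
  have n: "conv (%x. - k x) u = (%x. - conv k u x)" if "finite (supp k)" for k u
   using conv_cmult_left[OF that, of "- 1" u] by simp
  have "conv ?gH (conv ?Hm ?Xm) = conv ?Hm (conv ?gH ?Xm)" by (rule conv_conv_commute)
  also have "conv ?gH ?Xm = (%x. - conv (modul \<eta> (%x. (cis (- \<eta> * of_int x) - 1) * H x)) ?Xm x)"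
   unfolding gm by (rule n[OF fg'])
  also have "conv ?Hm ... = (%x. - conv ?Hm (conv (modul \<eta> (%x. (cis (- \<eta> * of_int x) - 1) * H x)) ?Xm) x)"
   using conv_cmult_right[of ?Hm "- 1" "conv (modul \<eta> (%x. (cis (- \<eta> * of_int x) - 1) * H x)) ?Xm"] by simp
  also have "conv ?Hm (conv (modul \<eta> (%x. (cis (- \<eta> * of_int x) - 1) * H x)) ?Xm)
    = conv (conv ?Hm (modul \<eta> (%x. (cis (- \<eta> * of_int x) - 1) * H x))) ?Xm"
   by (rule conv_assoc[OF fm fg', symmetric])
  also have "conv ?Hm (modul \<eta> (%x. (cis (- \<eta> * of_int x) - 1) * H x)) = modul \<eta> (PH (- \<eta>))"
   unfolding PH_def by (rule conv_modulate)
  finally show ?thesis .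
 qed
 have mgX: "conv ?gH ?Xm \<in> ell2" using norm_conv_modul_X(1)[OF fg] .
 have e3: "conv H (conv H (%x. ?Xm x - X x)) = (%x. - conv H (S (conv (PH \<eta>) ?Xm)) x)"
 proof -
  have fd: "finite (supp (%x. - delta0 x))" using finite_supp_delta0 by (simp add: supp_def)
  have neg: "(%x. - k x) = conv (%x. - delta0 x) k" for k
   using conv_cmult_left[of delta0 "- 1" k] by (simp add: finite_supp_delta0 delta0_conv)
  have Sneg: "S (%x. - k x) = (%x. - S k x)" if "k \<in> ell2" for k
  proof -
   have "S (%x. - k x) = S (conv (%x. - delta0 x) k)" by (rule arg_cong[OF neg])
   also have "... = conv (%x. - delta0 x) (S k)" by (rule S_conv[OF that fd])
   also have "... = (%x. - S k x)" by (rule neg[symmetric])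
   finally show ?thesis .
  qed
  have "(%x. ?Xm x - X x) = (%x. - S (conv ?gH ?Xm) x)" unfolding modul_X_diff by (rule Sneg[OF mgX])
  then have "conv H (%x. ?Xm x - X x) = (%x. - conv H (S (conv ?gH ?Xm)) x)"
   using conv_cmult_right[of H "- 1" "S (conv ?gH ?Xm)"] by simp
  also have "conv H (S (conv ?gH ?Xm)) = S (conv (PH \<eta>) ?Xm)" using S_conv[OF mgX finite_H] by (simp add: P2)
  finally show ?thesis using conv_cmult_right[of H "- 1" "S (conv (PH \<eta>) ?Xm)"] by simp
 qed
 have "modul \<eta> Y x - Y x = 1 / lam\<^sup>2 * (modul \<eta> (conv H (conv H X)) x - conv H (conv H X) x)" for x
  unfolding Y_eq[OF lam] by (simp add: algebra_simps)
 moreover have "modul \<eta> (conv H (conv H X)) x - conv H (conv H X) x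
   = conv ?gH (conv ?Hm ?Xm) x + conv H (conv ?gH ?Xm) x + conv H (conv H (%x. ?Xm x - X x)) x" for x
 proof -
  have "conv H (conv H (%x. ?Xm x - X x)) x = conv H (conv H ?Xm) x - conv H (conv H X) x"
   by (simp add: conv_diff_right)
  moreover have "m - n = c + d + y" if "y = b - n" "a - b = c + d" "m = a" for a b c d m n y :: complex
   using that(1,3) that(2)[symmetric] by simp
  ultimately show ?thesis using e2[of x] fun_cong[OF e1, of x] by blast
 qed
 ultimately show ?thesis unfolding P1 P2 e3 by (simp only: add_diff_eq diff_conv_add_uminus)
qed

lemma ell2_three:
 assumes "f \<in> ell2" "g \<in> ell2" "k \<in> ell2"
 shows "ell2_norm (%x. c * (- f x + g x - k x)) <= cmod c * (ell2_norm f + ell2_norm g + ell2_norm k)"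
proof -
 have fg: "(%x. g x - f x) \<in> ell2 & ell2_norm (%x. g x - f x) <= ell2_norm g + ell2_norm f"
  by (rule ell2_diff[OF assms(2,1)])
 have fgk: "(%x. (g x - f x) - k x) \<in> ell2 & ell2_norm (%x. (g x - f x) - k x) <= ell2_norm (%x. g x - f x) + ell2_norm k"
  using fg assms(3) by (intro ell2_diff) auto
 have "ell2_norm (%x. c * ((g x - f x) - k x)) <= cmod c * ell2_norm (%x. (g x - f x) - k x)"
  using fgk ell2_cmult by blast
 also have "... <= cmod c * (ell2_norm f + ell2_norm g + ell2_norm k)" using fg fgk by (intro mult_left_mono) auto
 finally show ?thesis by (simp add: algebra_simps)
qed

text \<open>The bracket adds up the three terms of \<open>modul_Y_diff\<close> for kernels of norm 2
  * B, B and B, namely 2 * C + C + (1 + cmod lam * C) * C. The 2 leaves room for the increment of a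
  modulated kernel.\<close>

definition CY :: "real => real" where
 "CY B = cmod (1 / lam\<^sup>2) * (C * (4 + cmod lam * C)) * B"

text \<open>Used at the base scale, where \<open>conv H H\<close> itself is small enough and no
  modulation is required.\<close>

lemma Y_bounds:
 assumes lam: "lam ~= 0" and B: "ell2_norm (conv H H) <= B"
 shows "ell2_norm Y <= CY B"
  and "ell2_norm (%x. conv H H (x + a) - conv H H x) <= B' ==> ell2_norm (%x. Y (x + a) - Y x) <= CY B'"
proof -
 have f: "finite (supp (conv H H))" by (rule finite_supp_conv[OF finite_H finite_H])
 have e: "Y = (%x. 1 / lam\<^sup>2 * conv (conv H H) X x)" unfolding Y_eq[OF lam] conv_assoc[OF finite_H finite_H] ..
 have C4: "C * b <= C * (4 + cmod lam * C) * b" if "0 <= b" for b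
  using mult_mono[of C "C * (4 + cmod lam * C)" b b] that C0 mult_left_mono[of 1 "4 + cmod lam * C" C] by simp
 have gen: "ell2_norm (%x. 1 / lam\<^sup>2 * conv k X x) <= CY b" if k: "finite (supp k)" "ell2_norm k <= b" for k b
 proof -
  have "ell2_norm (%x. 1 / lam\<^sup>2 * conv k X x) <= cmod (1 / lam\<^sup>2) * ell2_norm (conv k X)"
   using ell2_cmult[of "conv k X" "1 / lam\<^sup>2"] conv_ell2[OF k(1) X_ell2] by simp
  also have "... <= cmod (1 / lam\<^sup>2) * (C * b)"
   using norm_conv_X[OF k(1)] k(2) C0 by (intro mult_left_mono) (auto intro: order_trans mult_left_mono)
  also have "... <= cmod (1 / lam\<^sup>2) * (C * (4 + cmod lam * C) * b)"
   using order_trans[OF ell2_norm_nonneg[of k] k(2)] by (intro mult_left_mono C4) auto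
  finally show ?thesis by (simp add: CY_def mult.assoc)
 qed
 show "ell2_norm Y <= CY B" unfolding e by (rule gen[OF f B])
 assume B': "ell2_norm (%x. conv H H (x + a) - conv H H x) <= B'"
 have "(%x. Y (x + a) - Y x) = (%x. 1 / lam\<^sup>2 * conv (%x. conv H H (x + a) - conv H H x) X x)"
  unfolding conv_difference_left[OF f] e by (simp add: algebra_simps)
 then show "ell2_norm (%x. Y (x + a) - Y x) <= CY B'"
  using gen[OF finite_supp_diff[OF finite_supp_shift[OF f] f] B'] by simp
qed

text \<open>The increment of the modulated \<open>PH (- \<eta>)\<close> has an extra term from the
  character, at most \<bar>\<eta> * a\<bar> * B in norm; the last hypothesis absorbs it into B'.
  Increments pass through \<open>S\<close> because it commutes with shifts.\<close>

lemma modul_Y_bounds: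
 assumes lam: "lam ~= 0" and B: "ell2_norm (PH \<eta>) <= B" "ell2_norm (PH (- \<eta>)) <= B"
 shows "ell2_norm (%x. modul \<eta> Y x - Y x) <= CY B"
  and "ell2_norm (%x. PH \<eta> (x + a) - PH \<eta> x) <= B' ==> ell2_norm (%x. PH (- \<eta>) (x + a) - PH (- \<eta>) x) <= B' ==>
   \<bar>\<eta> * of_int a\<bar> * B <= B' ==>
   ell2_norm (%x. (modul \<eta> Y (x + a) - Y (x + a)) - (modul \<eta> Y x - Y x)) <= CY B'"
proof -
 let ?Xm = "modul \<eta> X" and ?Q = "modul \<eta> (PH (- \<eta>))"
 have fQ: "finite (supp ?Q)" by (rule finite_supp_mult[OF finite_supp_PH])
 have nQ: "ell2_norm ?Q = ell2_norm (PH (- \<eta>))"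
  using ell2_cong_norm[OF supp_in_ell2[OF finite_supp_PH, of "- \<eta>"], of ?Q] by (simp add: norm_mult)
 have gen: "ell2_norm (%x. 1 / lam\<^sup>2 * (- conv q ?Xm x + conv p ?Xm x - conv H (S (conv p ?Xm)) x)) <= CY b"
  if q: "finite (supp q)" "ell2_norm q <= 2 * b" and p: "finite (supp p)" "ell2_norm p <= b" for p q b
 proof -
  have b0: "0 <= b" using p(2) ell2_norm_nonneg[of p] by linarith
  have np: "ell2_norm (conv p ?Xm) <= C * b"
   by (rule order_trans[OF norm_conv_modul_X(2)[OF p(1)]]) (use p(2) C0 in \<open>simp add: mult_left_mono\<close>)
  have nq: "ell2_norm (conv q ?Xm) <= C * (2 * b)"
   by (rule order_trans[OF norm_conv_modul_X(2)[OF q(1)] mult_left_mono[OF q(2) C0]])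
  have nS: "conv H (S (conv p ?Xm)) \<in> ell2 & ell2_norm (conv H (S (conv p ?Xm))) <= (1 + cmod lam * C) * ell2_norm (conv p ?Xm)"
   by (rule conv_H_S[OF norm_conv_modul_X(1)[OF p(1)]])
  have nS2: "(1 + cmod lam * C) * ell2_norm (conv p ?Xm) <= (1 + cmod lam * C) * (C * b)"
   using np C0 by (intro mult_left_mono) auto
  have "ell2_norm (%x. 1 / lam\<^sup>2 * (- conv q ?Xm x + conv p ?Xm x - conv H (S (conv p ?Xm)) x))
    <= cmod (1 / lam\<^sup>2) * (ell2_norm (conv q ?Xm) + ell2_norm (conv p ?Xm) + ell2_norm (conv H (S (conv p ?Xm))))"
   using nS by (intro ell2_three norm_conv_modul_X(1) q(1) p(1)) auto
  also have "... <= cmod (1 / lam\<^sup>2) * (C * (2 * b) + C * b + (1 + cmod lam * C) * (C * b))"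
   using np nq nS nS2 by (intro mult_left_mono add_mono) auto
  also have "... = CY b" by (simp add: CY_def algebra_simps)
  finally show ?thesis .
 qed
 have B0: "0 <= B" using B(1) ell2_norm_nonneg[of "PH \<eta>"] by linarith
 show "ell2_norm (%x. modul \<eta> Y x - Y x) <= CY B"
  unfolding modul_Y_diff[OF lam] by (rule gen[OF fQ _ finite_supp_PH B(1)]) (use nQ B B0 in simp)
 assume B': "ell2_norm (%x. PH \<eta> (x + a) - PH \<eta> x) <= B'" "ell2_norm (%x. PH (- \<eta>) (x + a) - PH (- \<eta>) x) <= B'"
  and small: "\<bar>\<eta> * of_int a\<bar> * B <= B'"
 let ?dP = "%x. PH \<eta> (x + a) - PH \<eta> x" and ?dQ = "%x. ?Q (x + a) - ?Q x"
 have fdP: "finite (supp ?dP)" and fdQ: "finite (supp ?dQ)"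
  by (intro finite_supp_diff finite_supp_shift finite_supp_PH fQ)+
 have ndQ: "ell2_norm ?dQ <= 2 * B'"
 proof -
  let ?u = "%x. cis (\<eta> * of_int (x + a)) * (PH (- \<eta>) (x + a) - PH (- \<eta>) x)"
  let ?v = "%x. (cis (\<eta> * of_int (x + a)) - cis (\<eta> * of_int x)) * PH (- \<eta>) x"
  have dm: "(%x. PH (- \<eta>) (x + a) - PH (- \<eta>) x) \<in> ell2"
   by (intro supp_in_ell2 finite_supp_diff finite_supp_shift finite_supp_PH)
  have u: "?u \<in> ell2 & ell2_norm ?u = ell2_norm (%x. PH (- \<eta>) (x + a) - PH (- \<eta>) x)"
   by (rule ell2_cong_norm[OF dm]) (simp add: norm_mult)
  have v: "?v \<in> ell2 & ell2_norm ?v <= \<bar>\<eta> * of_int a\<bar> * ell2_norm (PH (- \<eta>))"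
  proof (rule ell2_mono[OF supp_in_ell2[OF finite_supp_PH]])
   fix x
   have "cis (\<eta> * of_int (x + a)) - cis (\<eta> * of_int x) = cis (\<eta> * of_int x) * (cis (\<eta> * of_int a) - 1)"
    by (simp add: right_diff_distrib cis_mult algebra_simps)
   then have "cmod (cis (\<eta> * of_int (x + a)) - cis (\<eta> * of_int x)) = cmod (cis (\<eta> * of_int a) - 1)"
    by (simp only: norm_mult norm_cis mult_1)
   also have "... <= \<bar>\<eta> * of_int a\<bar>" by (rule cmod_cis_minus_1_le)
   finally show "cmod (?v x) <= \<bar>\<eta> * of_int a\<bar> * cmod (PH (- \<eta>) x)"
    unfolding norm_mult by (rule mult_right_mono) simp
  qed simp
  have "?dQ = (%x. ?u x + ?v x)" by (auto simp: algebra_simps)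
  then have "ell2_norm ?dQ <= ell2_norm ?u + ell2_norm ?v" using ell2_add[OF u[THEN conjunct1] v[THEN conjunct1]] by simp
  also have "... <= B' + \<bar>\<eta> * of_int a\<bar> * B"
  proof (rule add_mono)
   show "ell2_norm ?u <= B'" using u B'(2) by simp
   show "ell2_norm ?v <= \<bar>\<eta> * of_int a\<bar> * B"
    using v mult_left_mono[OF B(2), of "\<bar>\<eta> * of_int a\<bar>"] by linarith
  qed
  finally show ?thesis using small by linarith
 qed
 have cp: "conv (PH \<eta>) ?Xm \<in> ell2" by (rule norm_conv_modul_X(1)[OF finite_supp_PH])
 have sd: "conv H (S (conv ?dP ?Xm)) = (%x. conv H (S (conv (PH \<eta>) ?Xm)) (x + a) - conv H (S (conv (PH \<eta>) ?Xm)) x)"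
 proof -
  have "S (conv ?dP ?Xm) = S (%x. conv (PH \<eta>) ?Xm (x + a) - conv (PH \<eta>) ?Xm x)"
   by (simp only: conv_difference_left[OF finite_supp_PH])
  also have "... = (%x. S (conv (PH \<eta>) ?Xm) (x + a) - S (conv (PH \<eta>) ?Xm) x)"
   using S_add[OF ell2_shift[OF cp, THEN conjunct1] cp] by (simp add: S_shift[OF cp])
  finally show ?thesis by (simp only: conv_difference_right)
 qed
 define Z where "Z = (%x. modul \<eta> Y x - Y x)"
 have "(%x. Z (x + a) - Z x) = (%x. 1 / lam\<^sup>2 * (- conv ?dQ ?Xm x + conv ?dP ?Xm x - conv H (S (conv ?dP ?Xm)) x))"
 proof
  fix x
  have Zx: "Z y = 1 / lam\<^sup>2 * (- conv ?Q ?Xm y + conv (PH \<eta>) ?Xm y - conv H (S (conv (PH \<eta>) ?Xm)) y)" for y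
   unfolding Z_def by (rule fun_cong[OF modul_Y_diff[OF lam]])
  have r: "conv ?dQ ?Xm x = conv ?Q ?Xm (x + a) - conv ?Q ?Xm x"
   "conv ?dP ?Xm x = conv (PH \<eta>) ?Xm (x + a) - conv (PH \<eta>) ?Xm x"
   by (simp_all only: conv_difference_left[OF fQ] conv_difference_left[OF finite_supp_PH])
  have g: "c * (- q + p - h) - c * (- q' + p' - h') = c * (- (q - q') + (p - p') - (h - h'))"
   for c q p h q' p' h' :: complex by (simp add: algebra_simps)
  show "Z (x + a) - Z x = 1 / lam\<^sup>2 * (- conv ?dQ ?Xm x + conv ?dP ?Xm x - conv H (S (conv ?dP ?Xm)) x)"
   unfolding Zx r fun_cong[OF sd] by (rule g)
 qed
 then have "ell2_norm (%x. Z (x + a) - Z x) <= CY B'" using gen[OF fdQ ndQ fdP B'(1)] by simp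
 then show "ell2_norm (%x. (modul \<eta> Y (x + a) - Y (x + a)) - (modul \<eta> Y x - Y x)) <= CY B'" by (simp add: Z_def)
qed

end

section \<open>Decomposition of a kernel into scales\<close>

definition tent :: "real => int => complex" where
 "tent s x = of_real (max 0 (1 - \<bar>of_int x\<bar> / s))"

lemma tent_zero: "0 < s ==> s <= \<bar>of_int x\<bar> ==> tent s x = 0" by (simp add: tent_def field_simps)

lemma cmod_tent_le_1: "0 < s ==> cmod (tent s x) <= 1" by (simp add: tent_def)

lemma tent_lipschitz:
 assumes "0 < s"
 shows "cmod (tent s (x + h) - tent s x) <= \<bar>of_int h\<bar> / s"
proof -
 have m: "\<bar>max 0 u - max 0 v\<bar> <= \<bar>u - v\<bar>" for u v :: real by (simp add: max_def)
 have "cmod (tent s (x + h) - tent s x) <= \<bar>(1 - \<bar>of_int (x + h)\<bar> / s) - (1 - \<bar>of_int x\<bar> / s)\<bar>"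
  unfolding tent_def of_real_diff[symmetric] norm_of_real by (rule m)
 also have "... = \<bar>\<bar>of_int x\<bar> - \<bar>of_int (x + h)\<bar>\<bar> / s"
  using assms by (simp add: diff_divide_distrib[symmetric] abs_divide)
 also have "... <= \<bar>of_int h\<bar> / s" using assms by (intro divide_right_mono) auto
 finally show ?thesis .
qed

text \<open>The tent function is the normalised autocorrelation of an interval, so pairing with it is a
 quadratic form of the convolution operator.\<close>

lemma sum_tent:
 fixes f :: "int => complex" and s :: nat
 assumes s: "1 <= s"
 shows "(\<Sum>x\<in>{-int s..int s}. f x * tent (real s) x) = (\<Sum>y\<in>{0..<int s}. \<Sum>z\<in>{0..<int s}. f (y - z)) / of_nat s"
proof -
 let ?n = "int s"
 have inner: "(\<Sum>z\<in>{0..<?n}. f (y - z)) = (\<Sum>x\<in>{-?n..?n}. if y - ?n < x & x <= y then f x else 0)"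
  if y: "y \<in> {0..<?n}" for y
 proof -
  have "(\<Sum>z\<in>{0..<?n}. f (y - z)) = (\<Sum>x\<in>{x\<in>{-?n..?n}. y - ?n < x & x <= y}. f x)"
   by (rule sum.reindex_bij_witness[where i = "%x. y - x" and j = "%z. y - z"]) (use y in auto)
  also have "... = (\<Sum>x\<in>{-?n..?n}. if y - ?n < x & x <= y then f x else 0)" by (rule sum.inter_filter) simp
  finally show ?thesis .
 qed
 have outer: "(\<Sum>y\<in>{0..<?n}. if y - ?n < x & x <= y then f x else 0) = of_nat s * (f x * tent (real s) x)"
  if x: "x \<in> {-?n..?n}" for x
 proof -
  have "(\<Sum>y\<in>{0..<?n}. if y - ?n < x & x <= y then f x else 0) = (\<Sum>y\<in>{y\<in>{0..<?n}. y - ?n < x & x <= y}. f x)"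
   by (rule sum.inter_filter[symmetric]) simp
  also have "{y\<in>{0..<?n}. y - ?n < x & x <= y} = {max 0 x..<min ?n (x + ?n)}" by auto
  also have "(\<Sum>y\<in>.... f x) = of_nat (nat (?n - \<bar>x\<bar>)) * f x"
  proof -
   have "nat (min ?n (x + ?n) - max 0 x) = nat (?n - \<bar>x\<bar>)" by (simp add: min_def max_def add.commute)
   then show ?thesis by (simp only: sum_constant card_atLeastLessThan_int)
  qed
  also have "of_nat (nat (?n - \<bar>x\<bar>)) = of_nat s * tent (real s) x"
  proof -
   have "real (nat (?n - \<bar>x\<bar>)) = real s * max 0 (1 - \<bar>of_int x\<bar> / real s)"
    using s x by (simp add: max_def field_simps of_nat_nat)
   then have "complex_of_real (real (nat (?n - \<bar>x\<bar>))) = of_nat s * tent (real s) x"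
    by (simp only: tent_def of_real_mult of_real_of_nat_eq)
   then show ?thesis by (simp only: of_real_of_nat_eq)
  qed
  finally show ?thesis by (simp only: mult_ac)
 qed
 have "(\<Sum>y\<in>{0..<?n}. \<Sum>z\<in>{0..<?n}. f (y - z))
   = (\<Sum>y\<in>{0..<?n}. \<Sum>x\<in>{-?n..?n}. if y - ?n < x & x <= y then f x else 0)"
  by (rule sum.cong[OF refl]) (rule inner)
 also have "... = (\<Sum>x\<in>{-?n..?n}. \<Sum>y\<in>{0..<?n}. if y - ?n < x & x <= y then f x else 0)" by (rule sum.swap)
 also have "... = (\<Sum>x\<in>{-?n..?n}. of_nat s * (f x * tent (real s) x))" by (rule sum.cong[OF refl]) (rule outer)
 finally show ?thesis using s by (simp add: sum_distrib_left[symmetric])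
qed

text \<open>The trapezoid equal to 1 for 2 * \<bar>x\<bar> <= s and to 0 for \<bar>x\<bar> >= s.
  Writing it with two tents makes its pairing with Y accessible through
  \<open>sum_tent\<close>.\<close>

definition chi :: "real => int => complex" where "chi s x = 2 * tent s x - tent (s / 2) x"

lemma chi_real: "chi s x = of_real (2 * max 0 (1 - \<bar>of_int x\<bar> / s) - max 0 (1 - 2 * (\<bar>of_int x\<bar> / s)))"
 by (simp add: chi_def tent_def mult.commute)

lemma chi_zero: "0 < s ==> s <= \<bar>of_int x\<bar> ==> chi s x = 0" unfolding chi_def by (simp add: tent_zero)

lemma chi_one:
 assumes "0 < s" "2 * \<bar>of_int x\<bar> <= s"
 shows "chi s x = 1"
proof -
 have "2 * (\<bar>of_int x\<bar> / s) <= 1" "0 <= \<bar>of_int x\<bar> / s" using assms by (auto simp: field_simps)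
 then show ?thesis by (simp add: chi_real max_def)
qed

lemma cmod_chi_le_1:
 assumes "0 < s"
 shows "cmod (chi s x) <= 1"
proof -
 have "0 <= \<bar>of_int x\<bar> / s" using assms by simp
 then show ?thesis unfolding chi_real norm_of_real max_def by (auto simp: abs_le_iff)
qed

lemma chi_lipschitz:
 assumes "0 < s"
 shows "cmod (chi s (x + h) - chi s x) <= 4 * \<bar>of_int h\<bar> / s"
proof -
 have "chi s (x + h) - chi s x = 2 * (tent s (x + h) - tent s x) - (tent (s / 2) (x + h) - tent (s / 2) x)"
  by (simp add: chi_def algebra_simps)
 then have "cmod (chi s (x + h) - chi s x)
   <= 2 * cmod (tent s (x + h) - tent s x) + cmod (tent (s / 2) (x + h) - tent (s / 2) x)"
  using norm_triangle_ineq4[of "2 * (tent s (x + h) - tent s x)" "tent (s / 2) (x + h) - tent (s / 2) x"]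
  by (simp only: norm_mult norm_numeral)
 then show ?thesis using tent_lipschitz[OF assms, of x h] tent_lipschitz[of "s / 2" x h] assms by simp
qed

lemma ell2_norm_le_sup:
 assumes f: "supp f \<subseteq> {- int n..int n}" and c: "!!x. cmod (f x) <= c"
 shows "f \<in> ell2" "ell2_norm f <= c * sqrt (2 * real n + 1)"
proof -
 have c0: "0 <= c" using c[of 0] norm_ge_zero[of "f 0"] by linarith
 show "f \<in> ell2" by (rule finite_supp_ell2(1)[OF _ f]) simp
 have "(\<Sum>x\<in>{- int n..int n}. (cmod (f x))\<^sup>2) <= (\<Sum>x\<in>{- int n..int n}. c\<^sup>2)"
  by (intro sum_mono power_mono c norm_ge_zero)
 also have "... = (2 * real n + 1) * c\<^sup>2" by (simp add: algebra_simps)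
 also have "... = (c * sqrt (2 * real n + 1))\<^sup>2" by (simp add: power_mult_distrib)
 finally have "(\<Sum>x\<in>{- int n..int n}. (cmod (f x))\<^sup>2) <= (c * sqrt (2 * real n + 1))\<^sup>2" .
 then show "ell2_norm f <= c * sqrt (2 * real n + 1)" by (intro ell2_norm_le_of_sum[OF _ f]) (use c0 in auto)
qed

lemma ell2_mono_add:
 assumes u: "u \<in> ell2" and v: "v \<in> ell2" and c: "0 <= c" "0 <= d"
  and le: "!!x. cmod (f x) <= c * cmod (u x) + d * cmod (v x)"
 shows "f \<in> ell2 & ell2_norm f <= c * ell2_norm u + d * ell2_norm v"
proof -
 let ?u = "%x. complex_of_real (c * cmod (u x))" and ?v = "%x. complex_of_real (d * cmod (v x))"
 have u': "?u \<in> ell2 & ell2_norm ?u <= c * ell2_norm u" using c by (intro ell2_mono[OF u]) (auto simp: norm_mult)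
 have v': "?v \<in> ell2 & ell2_norm ?v <= d * ell2_norm v" using c by (intro ell2_mono[OF v]) (auto simp: norm_mult)
 have uv: "(%x. ?u x + ?v x) \<in> ell2 & ell2_norm (%x. ?u x + ?v x) <= ell2_norm ?u + ell2_norm ?v"
  using u' v' by (intro ell2_add) auto
 have "f \<in> ell2 & ell2_norm f <= 1 * ell2_norm (%x. ?u x + ?v x)"
 proof (rule ell2_mono)
  fix x
  have "cmod (?u x + ?v x) = c * cmod (u x) + d * cmod (v x)"
   unfolding of_real_add[symmetric] norm_of_real using c by simp
  then show "cmod (f x) <= 1 * cmod (?u x + ?v x)" using le[of x] by simp
 qed (use uv in auto)
 then show ?thesis using u' v' uv by linarith
qed

definition bump :: "nat => int => complex" where "bump s x = tent (real s) x / of_nat s"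

lemma bump_supp: "1 <= s ==> supp (bump s) \<subseteq> {- int s..int s}"
proof
 fix x assume s: "1 <= s" and x: "x \<in> supp (bump s)"
 then have "\<not> real s <= \<bar>of_int x\<bar>" using tent_zero[of "real s" x] by (auto simp: supp_def bump_def)
 then show "x \<in> {- int s..int s}" by auto
qed

lemma cmod_bump: "1 <= s ==> cmod (bump s x) <= 1 / real s"
 using cmod_tent_le_1[of "real s" x] by (simp add: bump_def norm_divide divide_right_mono)

lemma sqrt_div_le:
 assumes "1 <= s" "x <= c\<^sup>2 * real s" "0 <= c"
 shows "1 / real s * sqrt x <= c * real s powr (- 1 / 2)"
proof -
 have "sqrt x <= c * sqrt (real s)" using real_sqrt_le_mono[OF assms(2)] assms(3) by (simp add: real_sqrt_mult)
 then have "1 / real s * sqrt x <= 1 / real s * (c * sqrt (real s))" by (intro mult_left_mono) auto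
 also have "... = c * (real s powr (-1) * real s powr (1 / 2))"
  using assms(1) by (simp add: powr_minus powr_half_sqrt field_simps)
 also have "... = c * real s powr (- 1 / 2)" by (simp only: powr_add[symmetric]) simp
 finally show ?thesis .
qed

lemma bump_bounds:
 assumes s: "1 <= s"
 shows "bump s \<in> ell2" "ell2_norm (bump s) <= 2 * real s powr (- 1 / 2)"
  and "\<bar>h\<bar> <= int s ==>
   ell2_norm (%x. bump s (x + h) - bump s x) <= 3 * real s powr (- 1 / 2) * (\<bar>of_int h\<bar> / real s)"
proof -
 show "bump s \<in> ell2" by (rule ell2_norm_le_sup(1)[OF bump_supp[OF s] cmod_bump[OF s]])
 have "ell2_norm (bump s) <= 1 / real s * sqrt (2 * real s + 1)"
  by (rule ell2_norm_le_sup(2)[OF bump_supp[OF s] cmod_bump[OF s]])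
 also have "... <= 2 * real s powr (- 1 / 2)" by (rule sqrt_div_le[OF s]) (use s in auto)
 finally show "ell2_norm (bump s) <= 2 * real s powr (- 1 / 2)" .
 assume h: "\<bar>h\<bar> <= int s"
 have sp: "supp (%x. bump s (x + h) - bump s x) \<subseteq> {- int (2 * s)..int (2 * s)}"
 proof
  fix x assume "x \<in> supp (%x. bump s (x + h) - bump s x)"
  then have "x + h \<in> supp (bump s) \<or> x \<in> supp (bump s)" by (auto simp: supp_def)
  then have "x + h \<in> {- int s..int s} \<or> x \<in> {- int s..int s}" using bump_supp[OF s] by blast
  then show "x \<in> {- int (2 * s)..int (2 * s)}" using h by auto
 qed
 have c: "cmod (bump s (x + h) - bump s x) <= \<bar>of_int h\<bar> / real s * (1 / real s)" for x
 proof -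
  have "bump s (x + h) - bump s x = (tent (real s) (x + h) - tent (real s) x) / of_nat s"
   by (simp add: bump_def diff_divide_distrib)
  then have "cmod (bump s (x + h) - bump s x) = cmod (tent (real s) (x + h) - tent (real s) x) / real s"
   by (simp add: norm_divide)
  also have "... <= (\<bar>of_int h\<bar> / real s) / real s" using s by (intro divide_right_mono tent_lipschitz) auto
  finally show ?thesis by simp
 qed
 have "ell2_norm (%x. bump s (x + h) - bump s x) <= \<bar>of_int h\<bar> / real s * (1 / real s) * sqrt (2 * real (2 * s) + 1)"
  by (rule ell2_norm_le_sup(2)[OF sp c])
 also have "... = \<bar>of_int h\<bar> / real s * (1 / real s * sqrt (2 * real (2 * s) + 1))" by (simp only: mult.assoc)
 also have "... <= \<bar>of_int h\<bar> / real s * (3 * real s powr (- 1 / 2))"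
  by (intro mult_left_mono sqrt_div_le[OF s]) (use s in auto)
 finally show "ell2_norm (%x. bump s (x + h) - bump s x) <= 3 * real s powr (- 1 / 2) * (\<bar>of_int h\<bar> / real s)"
  by (simp only: mult_ac)
qed

lemma sum_bump: "1 <= s ==> (\<Sum>x\<in>{-int s..int s}. bump s x) = 1"
 using sum_tent[of s "%x. 1"] by (simp add: bump_def sum_divide_distrib[symmetric] power2_eq_square)

text \<open>The squared norms in \<open>admissible_const\<close> double the exponent. Shifts with 8
  * \<bar>h\<bar> > s follow from the size alone, since then (\<bar>h\<bar> / s) powr \<gamma> >=
  1/8; together with the two terms of the difference this gives 16.\<close>

lemma admissible_constI:
 assumes k: "k \<in> ell2" and s: "1 <= s" and D: "0 <= D" and g: "0 < \<gamma>" "\<gamma> <= 1"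
  and n: "ell2_norm k <= D * real s powr (- 1 / 2)"
  and d: "!!h. 8 * \<bar>h\<bar> <= int s ==> ell2_norm (%x. k (x + h) - k x) <= D * real s powr (- 1 / 2) * (\<bar>of_int h\<bar> / real s) powr \<gamma>"
 shows "admissible_const (2 * \<gamma>) s k (16 * D)" unfolding admissible_const_def
proof (intro conjI allI)
 show "0 <= 16 * D" using D by simp
 have sq: "(real s powr (- 1 / 2))\<^sup>2 = 1 / real s"
 proof -
  have "(real s powr (- 1 / 2))\<^sup>2 = real s powr (- 1 / 2 + - 1 / 2)" by (simp only: power2_eq_square powr_add)
  also have "... = 1 / real s" using s by (simp add: powr_minus_divide)
  finally show ?thesis .
 qed
 have p0: "0 <= D * real s powr (- 1 / 2)" using D by simp
 have "(ell2_norm k)\<^sup>2 <= (16 * D * real s powr (- 1 / 2))\<^sup>2" using n p0 by (intro power_mono) auto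
 then show "(\<Sum>\<^sub>\<infinity>x. (cmod (k x))\<^sup>2) <= (16 * D)\<^sup>2 / real s"
  unfolding ell2_norm_sq power_mult_distrib[of _ "real s powr (- 1 / 2)"] sq by simp
 fix h :: int
 have "ell2_norm (%x. k (x + h) - k x) <= 16 * D * real s powr (- 1 / 2) * (\<bar>of_int h\<bar> / real s) powr \<gamma>"
 proof (cases "8 * \<bar>h\<bar> <= int s")
  case True
  have "0 <= D * real s powr (- 1 / 2) * (\<bar>of_int h\<bar> / real s) powr \<gamma>" using D by simp
  then show ?thesis using d[OF True] by linarith
 next
  case False
  then have "int s < 8 * \<bar>h\<bar>" by simp
  then have "real_of_int (int s) < real_of_int (8 * \<bar>h\<bar>)" by (simp only: of_int_less_iff)
  then have "1 / 8 <= \<bar>of_int h\<bar> / real s" using s by (simp add: field_simps)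
  then have "(1 / 8) powr \<gamma> <= (\<bar>of_int h\<bar> / real s) powr \<gamma>" using g by (intro powr_mono2) auto
  moreover have "(1 / 8 :: real) powr 1 <= (1 / 8) powr \<gamma>" using g by (intro powr_mono') auto
  ultimately have q: "1 / 8 <= (\<bar>of_int h\<bar> / real s) powr \<gamma>" by simp
  have "ell2_norm (%x. k (x + h) - k x) <= 2 * ell2_norm k" using ell2_difference[OF k] by simp
  also have "... <= 16 * (D * real s powr (- 1 / 2)) * (1 / 8)" using n by simp
  also have "... <= 16 * (D * real s powr (- 1 / 2)) * (\<bar>of_int h\<bar> / real s) powr \<gamma>"
   using p0 by (intro mult_left_mono q) auto
  finally show ?thesis by (simp only: mult.assoc)
 qed
 then have "(ell2_norm (%x. k (x + h) - k x))\<^sup>2 <= (16 * D * real s powr (- 1 / 2) * (\<bar>of_int h\<bar> / real s) powr \<gamma>)\<^sup>2"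
  by (intro power_mono) auto
 moreover have "((\<bar>of_int h\<bar> / real s) powr \<gamma>)\<^sup>2 = (real_of_int \<bar>h\<bar> / real s) powr (2 * \<gamma>)"
  by (simp add: power2_eq_square powr_add[symmetric])
 ultimately show "(\<Sum>\<^sub>\<infinity>x. (cmod (k (x + h) - k x))\<^sup>2)
    <= (16 * D)\<^sup>2 / real s * (real_of_int \<bar>h\<bar> / real s) powr (2 * \<gamma>)"
  unfolding ell2_norm_sq power_mult_distrib[of _ "real s powr (- 1 / 2)"]
   power_mult_distrib[of _ "(\<bar>of_int h\<bar> / real s) powr \<gamma>"] sq by simp
qed

lemma infsum_finite_supp:
 assumes "finite A" "supp f \<subseteq> A"
 shows "(\<Sum>\<^sub>\<infinity>x. f x) = (\<Sum>x\<in>A. f x)"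
proof -
 have "(\<Sum>\<^sub>\<infinity>x. f x) = (\<Sum>\<^sub>\<infinity>x\<in>A. f x)" using assms(2) by (intro infsum_cong_neutral) (auto simp: supp_def)
 then show ?thesis using assms(1) by simp
qed

lemma dyadic_from:
 assumes "s0 \<in> dyadic"
 shows "{s \<in> dyadic. s0 <= s} = range (%n. s0 * 2 ^ n)"
proof -
 obtain k where k: "s0 = 2 ^ k" using assms by (auto simp: dyadic_def)
 show ?thesis
 proof (intro equalityI subsetI)
  fix s assume "s \<in> {s \<in> dyadic. s0 <= s}"
  then obtain j where j: "s = 2 ^ j" "s0 <= s" by (auto simp: dyadic_def)
  then have "k <= j" using k by simp
  then have "s = s0 * 2 ^ (j - k)" using j k by (simp add: power_add[symmetric])
  then show "s \<in> range (%n. s0 * 2 ^ n)" by blast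
 next
  fix s assume "s \<in> range (%n. s0 * 2 ^ n)"
  then obtain n where "s = s0 * 2 ^ n" by blast
  then show "s \<in> {s \<in> dyadic. s0 <= s}" unfolding k by (auto simp: dyadic_def power_add[symmetric])
 qed
qed

lemma difference_bound_abs:
 assumes f: "f \<in> ell2" and c: "0 <= c"
  and b: "!!a::int. 1 <= a ==> of_int a <= s ==> ell2_norm (%x. f (x + a) - f x) <= c * (of_int a / s) powr \<gamma>"
  and h: "of_int \<bar>h\<bar> <= s"
 shows "ell2_norm (%x. f (x + h) - f x) <= c * (\<bar>of_int h\<bar> / s) powr \<gamma>"
proof -
 consider "h = 0" | "1 <= h" | "1 <= - h" by linarith
 then show ?thesis
 proof cases
  case 1
  then show ?thesis using c by (simp add: ell2_zero(2))
 next
  case 2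
  then show ?thesis using b[of h] h by simp
 next
  case 3
  then show ?thesis using b[of "- h"] h ell2_difference_minus[OF f, of "- h"] by simp
 qed
qed

text \<open>s0 is the smallest scale, where Y itself is controlled (\<open>nY\<close>,
  \<open>dY\<close>). At the scale s only the difference between Y and its modulation at frequency 1
  / s is controlled (\<open>nW\<close>, \<open>dW\<close>), and \<open>tY\<close> bounds the masses
  to be moved.\<close>

locale scale_decomposition =
 fixes Y :: "int => complex" and s0 :: nat and E \<gamma> :: real
 assumes Y: "Y \<in> ell2" and s0: "s0 \<in> dyadic" "4 <= s0" and E: "0 <= E" and gamma: "0 < \<gamma>" "\<gamma> <= 1"
  and nY: "ell2_norm Y <= E * real s0 powr (- 1 / 2)"
  and dY: "!!a. 1 <= a ==> of_int a <= real s0 ==>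
   ell2_norm (%x. Y (x + a) - Y x) <= E * real s0 powr (- 1 / 2) * (of_int a / real s0) powr \<gamma>"
  and nW: "!!s. s \<in> dyadic ==> s0 <= s ==>
   ell2_norm (%x. cis (1 / real s * of_int x) * Y x - Y x) <= E * real s powr (- 1 / 2)"
  and dW: "!!s a. s \<in> dyadic ==> s0 <= s ==> 1 <= a ==> of_int a <= real s ==>
   ell2_norm (%x. (cis (1 / real s * of_int (x + a)) * Y (x + a) - Y (x + a)) - (cis (1 / real s * of_int x) * Y x - Y x))
    <= E * real s powr (- 1 / 2) * (of_int a / real s) powr \<gamma>"
  and tY: "!!s. 1 <= s ==> cmod (\<Sum>x\<in>{-int s..int s}. Y x * tent (real s) x) <= E"
begin

definition mass :: "nat => complex" where "mass s = (\<Sum>x\<in>{-int s..int s}. Y x * chi (real s) x)"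

definition lowpass :: "nat => int => complex" where "lowpass s x = Y x * chi (real s) x - mass s * bump s x"

text \<open>Telescoping differences of truncations of Y whose mass has been removed by a bump;
  \<open>s div 2\<close> is the preceding scale. Each difference has sum zero and, apart from the
  two bumps, involves Y only on s / 4 <= \<bar>x\<bar> <= s.\<close>

definition K :: "nat => int => complex" where
 "K s x = (if s = s0 then lowpass s x else lowpass s x - lowpass (s div 2) x)"

lemma cmod_mass:
 assumes s: "s = 2 * r" "1 <= r"
 shows "cmod (mass s) <= 3 * E"
proof -
 have "mass s = 2 * (\<Sum>x\<in>{-int s..int s}. Y x * tent (real s) x) - (\<Sum>x\<in>{-int s..int s}. Y x * tent (real r) x)"
  by (simp add: mass_def chi_def s right_diff_distrib sum_subtractf sum_distrib_left mult.left_commute)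
 also have "(\<Sum>x\<in>{-int s..int s}. Y x * tent (real r) x) = (\<Sum>x\<in>{-int r..int r}. Y x * tent (real r) x)"
 proof (rule sum.mono_neutral_right)
  show "\<forall>x\<in>{- int s..int s} - {- int r..int r}. Y x * tent (real r) x = 0"
  proof
   fix x assume "x \<in> {- int s..int s} - {- int r..int r}"
   then have "int r <= \<bar>x\<bar>" by auto
   then have "real r <= \<bar>of_int x\<bar>" by linarith
   then show "Y x * tent (real r) x = 0" using tent_zero[of "real r" x] s by simp
  qed
 qed (use s in auto)
 finally have e: "mass s = 2 * (\<Sum>x\<in>{-int s..int s}. Y x * tent (real s) x) - (\<Sum>x\<in>{-int r..int r}. Y x * tent (real r) x)" .
 have "cmod (mass s) <= 2 * cmod (\<Sum>x\<in>{-int s..int s}. Y x * tent (real s) x) + cmod (\<Sum>x\<in>{-int r..int r}. Y x * tent (real r) x)"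
  unfolding e by (rule order_trans[OF norm_triangle_ineq4]) (simp add: norm_mult)
 then show ?thesis using tY[of s] tY[of r] s by linarith
qed

lemma dyadic_half:
 assumes "s \<in> dyadic" "s0 <= s"
 obtains r where "s = 2 * r" "2 <= r" "r \<in> dyadic" "s ~= s0 ==> s0 <= r"
proof -
 obtain j where j: "s = 2 ^ j" using assms by (auto simp: dyadic_def)
 obtain k where k: "s0 = 2 ^ k" using s0 by (auto simp: dyadic_def)
 have j0: "j ~= 0" using j assms(2) s0(2) by (cases "j = 0") auto
 then obtain i where i: "j = Suc i" by (cases j) auto
 show ?thesis
 proof (rule that[of "2 ^ i"])
  show "s = 2 * 2 ^ i" using j i by simp
  then show "(2::nat) <= 2 ^ i" using assms(2) s0(2) by linarith
  show "2 ^ i \<in> dyadic" by (simp add: dyadic_def)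
  assume "s ~= s0"
  have "k <= j" using assms(2) j k by simp
  then have "k <= i" using \<open>s ~= s0\<close> j k i by (cases "k = Suc i") auto
  then show "s0 <= 2 ^ i" using k by simp
 qed
qed

lemma lowpass_supp: "1 <= s ==> supp (lowpass s) \<subseteq> {-int s..int s}"
proof
 fix x assume s: "1 <= s" and x: "x \<in> supp (lowpass s)"
 show "x \<in> {-int s..int s}"
 proof (rule ccontr)
  assume n: "x \<notin> {-int s..int s}"
  then have "int s <= \<bar>x\<bar>" by auto
  then have "real s <= \<bar>of_int x\<bar>" by linarith
  then have "chi (real s) x = 0" "bump s x = 0" using s by (auto simp: chi_zero bump_def tent_zero)
  then show False using x by (simp add: supp_def lowpass_def)
 qed
qed

lemma sum_lowpass: "1 <= s ==> (\<Sum>x\<in>{-int s..int s}. lowpass s x) = 0"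
 using sum_bump[of s] by (simp add: lowpass_def sum_subtractf sum_distrib_left[symmetric] mass_def)

lemma K_cancel:
 assumes s: "s \<in> dyadic" "s0 <= s"
 shows "supp (K s) \<subseteq> {-int s..int s}" "(\<Sum>\<^sub>\<infinity>x. K s x) = 0"
proof -
 obtain r where r: "s = 2 * r" "2 <= r" using dyadic_half[OF s] by blast
 have s1: "1 <= s" and r1: "1 <= r" using r by auto
 have rs: "supp (lowpass r) \<subseteq> {-int s..int s}" using lowpass_supp[OF r1] r by auto
 have d: "s div 2 = r" using r by simp
 show sup: "supp (K s) \<subseteq> {-int s..int s}"
 proof
  fix x assume "x \<in> supp (K s)"
  then have "x \<in> supp (lowpass s) \<or> x \<in> supp (lowpass r)" by (auto simp: supp_def K_def d split: if_splits)
  then show "x \<in> {-int s..int s}" using lowpass_supp[OF s1] rs by blast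
 qed
 have "(\<Sum>x\<in>{-int s..int s}. lowpass r x) = (\<Sum>x\<in>{-int r..int r}. lowpass r x)"
  using lowpass_supp[OF r1] r by (intro sum.mono_neutral_right) (auto simp: supp_def)
 then have "(\<Sum>x\<in>{-int s..int s}. K s x) = 0"
  by (cases "s = s0") (use sum_lowpass[OF s1] sum_lowpass[OF r1] in \<open>simp_all add: K_def d sum_subtractf\<close>)
 then show "(\<Sum>\<^sub>\<infinity>x. K s x) = 0" using infsum_finite_supp[OF _ sup] by simp
qed

text \<open>The cutoff is already 1 at x; what is left is a bounded mass times a bump of height 1 /
  s.\<close>

lemma lowpass_limit:
 assumes "4 * \<bar>of_int x\<bar> <= (2::real) ^ n"
 shows "cmod (lowpass (s0 * 2 ^ n) x - Y x) <= 3 * E * (1 / 2) ^ n"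
proof -
 let ?s = "s0 * 2 ^ n"
 have s: "real ?s = real s0 * 2 ^ n" by simp
 have le: "(2::real) ^ n <= real ?s" unfolding s using s0(2) by simp
 have pos: "0 < (2::real) ^ n" by simp
 have sp: "1 <= ?s" using s0(2) by simp
 have "chi (real ?s) x = 1" by (rule chi_one) (use le pos assms in linarith)+
 then have e: "lowpass ?s x - Y x = - (mass ?s * bump ?s x)" by (simp add: lowpass_def)
 obtain r where r: "?s = 2 * r" "2 <= r" using dyadic_half[of ?s] dyadic_from[OF s0(1)] s0(2) by blast
 have "cmod (lowpass ?s x - Y x) <= 3 * E * (1 / real ?s)" unfolding e norm_minus_cancel norm_mult
  by (intro mult_mono cmod_mass[OF r(1)] cmod_bump[OF sp]) (use r E in auto)
 also have "... <= 3 * E * (1 / 2 ^ n)" using le pos E by (intro mult_left_mono divide_left_mono) auto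
 finally show ?thesis by (simp add: power_one_over)
qed

text \<open>The partial sums telescope to \<open>lowpass\<close>. Its geometric rate of convergence
  provides the absolute summability that the unordered sum requires.\<close>

lemma K_sum: "(\<Sum>\<^sub>\<infinity>s\<in>{s \<in> dyadic. s0 <= s}. K s x) = Y x"
proof -
 let ?g = "%n::nat. s0 * 2 ^ n"
 have K0: "K (?g 0) x = lowpass (?g 0) x" by (simp add: K_def)
 have KS: "K (?g (Suc n)) x = lowpass (?g (Suc n)) x - lowpass (?g n) x" for n
 proof -
  have "?g (Suc n) ~= s0" using s0(2) power_gt1[of "2::nat" n] by simp
  moreover have "?g (Suc n) div 2 = ?g n" by simp
  ultimately show ?thesis by (simp only: K_def if_False)
 qed
 have partial: "(\<Sum>i\<le>n. K (?g i) x) = lowpass (?g n) x" for n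
 proof (induction n)
  case 0
  then show ?case by (simp only: atMost_0 sum.insert finite.emptyI empty_iff not_False_eq_True sum.empty K0 add_0_right)
 next
  case (Suc n)
  then show ?case unfolding sum.atMost_Suc KS by simp
 qed
 obtain N where N: "4 * \<bar>real_of_int x\<bar> <= 2 ^ N"
  using real_arch_pow[of 2 "4 * \<bar>real_of_int x\<bar>"] by (auto intro: less_imp_le)
 have ev: "4 * \<bar>real_of_int x\<bar> <= 2 ^ n" if "N <= n" for n
  using N power_increasing[OF that, of "2::real"] by linarith
 have lim: "(%n. lowpass (?g n) x) \<longlonglongrightarrow> Y x"
 proof (rule LIM_zero_cancel, rule Lim_null_comparison)
  show "\<forall>\<^sub>F n in sequentially. norm (lowpass (?g n) x - Y x) <= 3 * E * (1 / 2) ^ n"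
   using lowpass_limit[OF ev] by (auto simp: eventually_sequentially)
  show "(%n. 3 * E * (1 / 2) ^ n) \<longlonglongrightarrow> 0" by (intro tendsto_mult_right_zero LIMSEQ_power_zero) simp
 qed
 then have sums: "(%n. K (?g n) x) sums Y x" unfolding sums_def_le partial .
 have "summable (%n. norm (K (?g (Suc n)) x))"
 proof (rule summable_comparison_test_ev)
  show "\<forall>\<^sub>F n in sequentially. norm (norm (K (?g (Suc n)) x)) <= 6 * E * (1 / 2) ^ n"
   unfolding eventually_sequentially
  proof (intro exI allI impI)
   fix n assume n: "N <= n"
   have "norm (K (?g (Suc n)) x) <= norm (lowpass (?g (Suc n)) x - Y x) + norm (lowpass (?g n) x - Y x)"
    unfolding KS using norm_triangle_ineq4[of "lowpass (?g (Suc n)) x - Y x" "lowpass (?g n) x - Y x"] by simp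
   also have "... <= 3 * E * (1 / 2) ^ Suc n + 3 * E * (1 / 2) ^ n" using n by (intro add_mono lowpass_limit ev) auto
   also have "... <= 6 * E * (1 / 2) ^ n" using E by simp
   finally show "norm (norm (K (?g (Suc n)) x)) <= 6 * E * (1 / 2) ^ n" by simp
  qed
  show "summable (%n. 6 * E * (1 / 2) ^ n)" by (intro summable_mult summable_geometric) simp
 qed
 then have "summable (%n. norm (K (?g n) x))" by (subst (asm) summable_Suc_iff)
 then have "((%n. K (?g n) x) has_sum Y x) UNIV" by (rule norm_summable_imp_has_sum[OF _ sums])
 then have "(\<Sum>\<^sub>\<infinity>n. K (?g n) x) = Y x" by (rule infsumI)
 moreover have "inj ?g" using s0(2) by (intro injI) simp
 ultimately show ?thesis unfolding dyadic_from[OF s0(1)] by (simp add: infsum_reindex o_def)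
qed

lemma powr_ge_self: "0 <= u ==> u <= 1 ==> u <= u powr \<gamma>" using powr_mono'[of \<gamma> 1 u] gamma by simp

text \<open>The bumps are Lipschitz at scale s, hence Hoelder. 45 * E = 3 * E * (3 + 12): the
  increment constant is 3 for the bump at s and four times that at r = s / 2, once 2 from the height
  and once 2 from the slope.\<close>

lemma admissible_combine:
 assumes P: "P \<in> ell2" and A: "0 <= A" and s: "s = 2 * r" "1 <= r"
  and nP: "ell2_norm P <= A * real s powr (- 1 / 2)"
  and dP: "!!h. 8 * \<bar>h\<bar> <= int s ==>
   ell2_norm (%x. P (x + h) - P x) <= A * real s powr (- 1 / 2) * (\<bar>of_int h\<bar> / real s) powr \<gamma>"
  and c: "cmod c <= 3 * E" "cmod d <= 3 * E"
 shows "admissible_const (2 * \<gamma>) s (%x. P x - (c * bump s x - d * bump r x)) (16 * (A + 45 * E))"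
proof -
 let ?Q = "%x. c * bump s x - d * bump r x" and ?p = "real s powr (- 1 / 2)"
 have s1: "1 <= s" using s by simp
 have rp: "real r powr (- 1 / 2) <= 2 * ?p"
 proof -
  have "real r = real s / 2" using s by simp
  then have "real r powr (- 1 / 2) = ?p / 2 powr (- 1 / 2)" by (simp only: powr_divide)
  also have "... = ?p * 2 powr (1 / 2)" by (simp add: powr_minus_divide)
  also have "... <= ?p * 2" using powr_mono[of "1/2" 1 "2::real"] by (intro mult_left_mono) auto
  finally show ?thesis by simp
 qed
 note bs = bump_bounds[OF s1] and br = bump_bounds[OF s(2)]
 have Q: "?Q \<in> ell2 & ell2_norm ?Q <= 3 * E * ell2_norm (bump s) + 3 * E * ell2_norm (bump r)"
  by (rule ell2_mono_add[OF bs(1) br(1)])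
   (use E c in \<open>auto simp: norm_mult intro!: order_trans[OF norm_triangle_ineq4] add_mono mult_right_mono\<close>)
 have "3 * E * ell2_norm (bump s) <= 3 * E * (2 * ?p)" "3 * E * ell2_norm (bump r) <= 3 * E * (4 * ?p)"
  using E bs(2) order_trans[OF br(2) mult_left_mono[OF rp, of 2]] by (intro mult_left_mono; simp)+
 then have nQ: "ell2_norm ?Q <= 18 * (E * ?p)" using Q by linarith
 have Ep: "0 <= E * ?p" using E by simp
 show ?thesis
 proof (rule admissible_constI)
  have PQ: "(%x. P x - ?Q x) \<in> ell2 & ell2_norm (%x. P x - ?Q x) <= ell2_norm P + ell2_norm ?Q"
   using P Q by (intro ell2_diff) auto
  then show "(%x. P x - ?Q x) \<in> ell2" by simp
  have "ell2_norm (%x. P x - ?Q x) <= A * ?p + 45 * (E * ?p)" using PQ nP nQ Ep by linarith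
  then show "ell2_norm (%x. P x - ?Q x) <= (A + 45 * E) * ?p" by (simp add: algebra_simps)
  fix h :: int assume h: "8 * \<bar>h\<bar> <= int s"
  let ?\<rho> = "\<bar>of_int h\<bar> / real s"
  have hs: "\<bar>h\<bar> <= int s" "\<bar>h\<bar> <= int r" using h s by auto
  have "\<bar>real_of_int h\<bar> <= real s" using hs(1) by linarith
  then have \<rho>: "0 <= ?\<rho>" "?\<rho> <= 1" using s1 by (auto simp: field_simps)
  let ?dQ = "%x. ?Q (x + h) - ?Q x"
  let ?ds = "%x. bump s (x + h) - bump s x" and ?dr = "%x. bump r (x + h) - bump r x"
  have dQ: "?dQ \<in> ell2 & ell2_norm ?dQ <= 3 * E * ell2_norm ?ds + 3 * E * ell2_norm ?dr"
  proof (rule ell2_mono_add)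
   show "?ds \<in> ell2" "?dr \<in> ell2" using ell2_difference[OF bs(1)] ell2_difference[OF br(1)] by auto
   fix x
   have "?dQ x = c * ?ds x - d * ?dr x" by (simp add: algebra_simps)
   then have "cmod (?dQ x) <= cmod c * cmod (?ds x) + cmod d * cmod (?dr x)"
    using norm_triangle_ineq4[of "c * ?ds x" "d * ?dr x"] by (simp only: norm_mult)
   also have "... <= 3 * E * cmod (?ds x) + 3 * E * cmod (?dr x)" using c by (intro add_mono mult_right_mono) auto
   finally show "cmod (?dQ x) <= 3 * E * cmod (?ds x) + 3 * E * cmod (?dr x)" .
  qed (use E in auto)
  have b1: "ell2_norm ?ds <= 3 * (?p * ?\<rho>)" using bs(3)[OF hs(1)] by (simp only: mult.assoc)
  have b2: "ell2_norm ?dr <= 12 * (?p * ?\<rho>)"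
  proof -
   have "ell2_norm ?dr <= 3 * real r powr (- 1 / 2) * (\<bar>of_int h\<bar> / real r)" by (rule br(3)[OF hs(2)])
   also have "\<bar>of_int h\<bar> / real r = 2 * ?\<rho>" using s by simp
   also have "3 * real r powr (- 1 / 2) * (2 * ?\<rho>) <= 3 * (2 * ?p) * (2 * ?\<rho>)"
    using rp \<rho>(1) by (intro mult_right_mono mult_left_mono) auto
   finally show ?thesis by simp
  qed
  have "ell2_norm ?dQ <= 3 * E * (3 * (?p * ?\<rho>)) + 3 * E * (12 * (?p * ?\<rho>))"
   using dQ mult_left_mono[OF b1, of "3 * E"] mult_left_mono[OF b2, of "3 * E"] E by linarith
  also have "... = 45 * (E * ?p) * ?\<rho>" by (simp add: algebra_simps)
  also have "... <= 45 * (E * ?p) * ?\<rho> powr \<gamma>" using Ep by (intro mult_left_mono powr_ge_self \<rho>) auto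
  finally have ndQ: "ell2_norm ?dQ <= 45 * (E * ?p) * ?\<rho> powr \<gamma>" .
  have "(%x. (P (x + h) - P x) - ?dQ x) \<in> ell2 &
    ell2_norm (%x. (P (x + h) - P x) - ?dQ x) <= ell2_norm (%x. P (x + h) - P x) + ell2_norm ?dQ"
   using ell2_difference[OF P] dQ by (intro ell2_diff) auto
  then have "ell2_norm (%x. (P (x + h) - P x) - ?dQ x) <= A * ?p * ?\<rho> powr \<gamma> + 45 * (E * ?p) * ?\<rho> powr \<gamma>"
   using dP[OF h] ndQ by linarith
  moreover have "(%x. (P (x + h) - P x) - ?dQ x) = (%x. (P (x + h) - ?Q (x + h)) - (P x - ?Q x))"
   by (simp add: algebra_simps)
  moreover have "A * ?p * ?\<rho> powr \<gamma> + 45 * (E * ?p) * ?\<rho> powr \<gamma> = (A + 45 * E) * ?p * ?\<rho> powr \<gamma>"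
   by (simp add: algebra_simps)
  ultimately show "ell2_norm (%x. (P (x + h) - ?Q (x + h)) - (P x - ?Q x)) <= (A + 45 * E) * ?p * ?\<rho> powr \<gamma>"
   by simp
 qed (use s1 A E gamma in auto)
qed

text \<open>The radius 9/8 * s leaves room for shifts with 8 * \<bar>h\<bar> <= s and keeps the
  phase below pi.\<close>

lemma cis_shell:
 assumes s: "0 < s" and x: "\<epsilon> * s <= \<bar>of_int x\<bar>" "\<bar>of_int x\<bar> <= 9 / 8 * s"
 shows "\<epsilon> / 2 <= cmod (cis (1 / s * of_int x) - 1)"
proof -
 have a: "\<bar>1 / s * of_int x\<bar> = \<bar>of_int x\<bar> / s" using s by (simp add: abs_mult)
 have "\<bar>of_int x\<bar> / s <= 9 / 8" "\<epsilon> <= \<bar>of_int x\<bar> / s" using x s by (auto simp: field_simps)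
 moreover from this(1) have "\<bar>of_int x\<bar> / s <= pi" using pi_gt3 by linarith
 ultimately have "\<epsilon> / 2 <= \<bar>of_int x\<bar> / s / 2" "\<bar>of_int x\<bar> / s / 2 <= cmod (cis (1 / s * of_int x) - 1)"
  using cmod_cis_minus_1_ge[of "1 / s * of_int x"] unfolding a by auto
 then show ?thesis by (rule order_trans)
qed

text \<open>On the shell of radius \<open>s\<close> the factor \<open>cis (x / s) - 1\<close> is bounded below, so there \<open>Y\<close> inherits
 the bounds for the increment of its modulation at the frequency \<open>1 / s\<close>.\<close>

lemma shell_bounds:
 assumes s: "s \<in> dyadic" "s0 <= s" and r: "s = 2 * r" "2 <= r"
 defines "P \<equiv> %x. Y x * (chi (real s) x - chi (real r) x)"
 shows "P \<in> ell2" "ell2_norm P <= 500 * E * real s powr (- 1 / 2)"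
  and "8 * \<bar>h\<bar> <= int s ==>
   ell2_norm (%x. P (x + h) - P x) <= 500 * E * real s powr (- 1 / 2) * (\<bar>of_int h\<bar> / real s) powr \<gamma>"
proof -
 define W where "W x = cis (1 / real s * of_int x) * Y x - Y x" for x
 define k where "k x = chi (real s) x - chi (real r) x" for x
 define g where "g x = cis (1 / real s * of_int x)" for x :: int
 have sp: "0 < real s" and rp: "0 < real r" and rs: "real s = 2 * real r" using r by auto
 have Wg: "W x = (g x - 1) * Y x" for x by (simp add: W_def g_def algebra_simps)
 have mY: "(%x. cis (1 / real s * of_int x) * Y x) \<in> ell2"
  using ell2_cong_norm[OF Y, of "%x. cis (1 / real s * of_int x) * Y x"] by (simp add: norm_mult)
 have W: "W \<in> ell2" using ell2_diff[OF mY Y] unfolding W_def[abs_def] by simp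
 have nW': "ell2_norm W <= E * real s powr (- 1 / 2)" using nW[OF s] unfolding W_def[abs_def] .
 have k2: "cmod (k x) <= 2" for x
  using norm_triangle_ineq4[of "chi (real s) x" "chi (real r) x"] cmod_chi_le_1[OF sp, of x] cmod_chi_le_1[OF rp, of x]
  unfolding k_def by linarith
 \<comment> \<open>For \<bar>x\<bar> below s / 4 both cutoffs equal 1, beyond s both vanish.\<close>
 have k0: "1 / 4 * real s <= \<bar>of_int x\<bar> & \<bar>of_int x\<bar> <= real s" if "k x ~= 0" for x
 proof (rule ccontr)
  assume "\<not> ?thesis"
  then consider "\<bar>of_int x\<bar> < 1 / 4 * real s" | "real s < \<bar>of_int x\<bar>" by linarith
  then have "k x = 0"
  proof cases
   case 1
   then have "2 * \<bar>of_int x\<bar> <= real s" "2 * \<bar>of_int x\<bar> <= real r" using rs by linarith+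
   then show ?thesis unfolding k_def by (simp only: chi_one[OF sp] chi_one[OF rp] diff_self)
  next
   case 2
   then have "real s <= \<bar>of_int x\<bar>" "real r <= \<bar>of_int x\<bar>" using rs rp by linarith+
   then show ?thesis unfolding k_def by (simp only: chi_zero[OF sp] chi_zero[OF rp] diff_self)
  qed
  then show False using that by simp
 qed
 have g1: "1 / 8 <= cmod (g x - 1)" if "k x ~= 0" for x
  using cis_shell[OF sp, of "1/4" x] k0[OF that] sp unfolding g_def by simp
 have g2: "1 / 16 <= cmod (g x - 1)" if "1 / 8 * real s <= \<bar>of_int x\<bar>" "\<bar>of_int x\<bar> <= 9 / 8 * real s" for x
  using cis_shell[OF sp that] unfolding g_def by simp
 have Yle: "cmod (Y x) <= 16 * cmod (W x)" if "1 / 16 <= cmod (g x - 1)" for x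
  using mult_right_mono[OF that, of "cmod (Y x)"] unfolding Wg norm_mult by simp
 have Pk: "P x = Y x * k x" for x by (simp add: P_def k_def)
 have "cmod (P x) <= 32 * cmod (W x)" for x
 proof (cases "k x = 0")
  case False
  have "cmod (P x) <= 16 * cmod (W x) * 2" unfolding Pk norm_mult using g1[OF False] by (intro mult_mono k2 Yle) auto
  then show ?thesis by simp
 qed (simp add: Pk)
 then have P: "P \<in> ell2 & ell2_norm P <= 32 * ell2_norm W" by (intro ell2_mono[OF W]) auto
 then show "P \<in> ell2" by simp
 have Ep: "0 <= E * real s powr (- 1 / 2)" using E by simp
 have "ell2_norm P <= 500 * (E * real s powr (- 1 / 2))" using P nW' Ep by linarith
 then show "ell2_norm P <= 500 * E * real s powr (- 1 / 2)" by (simp only: mult.assoc)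
 assume h: "8 * \<bar>h\<bar> <= int s"
 let ?\<rho> = "\<bar>of_int h\<bar> / real s"
 have "real_of_int (8 * \<bar>h\<bar>) <= real_of_int (int s)" using h by (simp only: of_int_le_iff)
 then have h8: "8 * \<bar>real_of_int h\<bar> <= real s" by simp
 then have \<rho>: "0 <= ?\<rho>" "?\<rho> <= 1" using sp by (auto simp: field_simps)
 have near: "1 / 16 <= cmod (g (x + h) - 1)" if "k x ~= 0 \<or> k (x + h) ~= 0" for x
 proof (rule g2)
  have "\<bar>of_int x\<bar> <= \<bar>of_int (x + h)\<bar> + \<bar>real_of_int h\<bar>" "\<bar>of_int (x + h)\<bar> <= \<bar>of_int x\<bar> + \<bar>real_of_int h\<bar>"
   by auto
  then show "1 / 8 * real s <= \<bar>of_int (x + h)\<bar>" "\<bar>of_int (x + h)\<bar> <= 9 / 8 * real s"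
   using that k0[of x] k0[of "x + h"] h8 by linarith+
 qed
 have gd: "cmod (g (x + h) - g x) <= ?\<rho>" for x
 proof -
  have "g (x + h) - g x = g x * (cis (1 / real s * of_int h) - 1)"
   by (simp add: g_def right_diff_distrib cis_mult add_divide_distrib)
  then have "cmod (g (x + h) - g x) = cmod (cis (1 / real s * of_int h) - 1)" by (simp add: norm_mult g_def)
  also have "... <= \<bar>1 / real s * of_int h\<bar>" by (rule cmod_cis_minus_1_le)
  finally show ?thesis by (simp add: abs_mult)
 qed
 have kd: "cmod (k (x + h) - k x) <= 12 * ?\<rho>" for x
 proof -
  have "k (x + h) - k x = (chi (real s) (x + h) - chi (real s) x) - (chi (real r) (x + h) - chi (real r) x)"
   by (simp add: k_def)
  then have "cmod (k (x + h) - k x) <= 4 * \<bar>of_int h\<bar> / real s + 4 * \<bar>of_int h\<bar> / real r"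
   using norm_triangle_ineq4[of "chi (real s) (x + h) - chi (real s) x" "chi (real r) (x + h) - chi (real r) x"]
    chi_lipschitz[OF sp, of x h] chi_lipschitz[OF rp, of x h] by simp
  then show ?thesis by (simp add: rs field_simps)
 qed
 let ?dW = "%x. W (x + h) - W x"
 \<comment> \<open>Product rules for P = Y * k and for W, which is Y times g - 1. Division by g - 1
   costs 8 where k is nonzero and 16 one shift away; 448 = 16 * 16 + 16 * 12.\<close>
 have pt: "cmod (P (x + h) - P x) <= 16 * cmod (?dW x) + (448 * ?\<rho>) * cmod (W (x + h))" for x
 proof (cases "k x ~= 0 \<or> k (x + h) ~= 0")
  case True
  have Yh: "cmod (Y (x + h)) <= 16 * cmod (W (x + h))" by (rule Yle[OF near[OF True]])
  have t1: "cmod (k x * (Y (x + h) - Y x)) <= 16 * (cmod (?dW x) + ?\<rho> * (16 * cmod (W (x + h))))"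
  proof (cases "k x = 0")
   case False
   have "(g x - 1) * (Y (x + h) - Y x) = ?dW x - (g (x + h) - g x) * Y (x + h)" by (simp add: Wg algebra_simps)
   then have "cmod (g x - 1) * cmod (Y (x + h) - Y x) <= cmod (?dW x) + cmod (g (x + h) - g x) * cmod (Y (x + h))"
    using norm_triangle_ineq4[of "?dW x" "(g (x + h) - g x) * Y (x + h)"] by (simp only: norm_mult[symmetric])
   also have "... <= cmod (?dW x) + ?\<rho> * (16 * cmod (W (x + h)))"
    using \<rho>(1) by (intro add_left_mono mult_mono gd Yh) auto
   finally have "1 / 8 * cmod (Y (x + h) - Y x) <= cmod (?dW x) + ?\<rho> * (16 * cmod (W (x + h)))"
    using mult_right_mono[OF g1[OF False], of "cmod (Y (x + h) - Y x)"] by simp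
   moreover have "cmod (k x) * cmod (Y (x + h) - Y x) <= 2 * cmod (Y (x + h) - Y x)" by (intro mult_right_mono k2) simp
   moreover have "u <= 16 * w" if "1 / 8 * v <= w" "u <= 2 * v" for u v w :: real using that by linarith
   ultimately show ?thesis unfolding norm_mult by blast
  qed (use \<rho>(1) in simp)
  have t2: "cmod (Y (x + h) * (k (x + h) - k x)) <= (16 * cmod (W (x + h))) * (12 * ?\<rho>)"
   unfolding norm_mult by (intro mult_mono Yh kd) auto
  have "P (x + h) - P x = k x * (Y (x + h) - Y x) + Y (x + h) * (k (x + h) - k x)" by (simp add: Pk algebra_simps)
  then have "cmod (P (x + h) - P x) <= cmod (k x * (Y (x + h) - Y x)) + cmod (Y (x + h) * (k (x + h) - k x))"
   using norm_triangle_ineq by simp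
  also have "... <= 16 * (cmod (?dW x) + ?\<rho> * (16 * cmod (W (x + h)))) + (16 * cmod (W (x + h))) * (12 * ?\<rho>)"
   using t1 t2 by (rule add_mono)
  also have "... = 16 * cmod (?dW x) + (448 * ?\<rho>) * cmod (W (x + h))" by (simp add: algebra_simps)
  finally show ?thesis .
 qed (use \<rho>(1) in \<open>simp add: Pk\<close>)
 show "ell2_norm (%x. P (x + h) - P x) <= 500 * E * real s powr (- 1 / 2) * ?\<rho> powr \<gamma>"
 proof -
  have dW': "ell2_norm ?dW <= E * real s powr (- 1 / 2) * ?\<rho> powr \<gamma>"
  proof (rule difference_bound_abs[OF W Ep])
   fix a :: int assume "1 <= a" "of_int a <= real s"
   then show "ell2_norm (%x. W (x + a) - W x) <= E * real s powr (- 1 / 2) * (of_int a / real s) powr \<gamma>"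
    unfolding W_def by (intro dW s)
  qed (use h8 in linarith)
  have Wh: "(%x. W (x + h)) \<in> ell2" "ell2_norm (%x. W (x + h)) = ell2_norm W" using ell2_shift[OF W] by auto
  have "ell2_norm (%x. P (x + h) - P x) <= 16 * ell2_norm ?dW + (448 * ?\<rho>) * ell2_norm W"
   using ell2_mono_add[OF _ Wh(1) _ _ pt] ell2_difference[OF W] \<rho>(1) unfolding Wh(2) by simp
  also have "... <= 16 * (E * real s powr (- 1 / 2) * ?\<rho> powr \<gamma>) + (448 * ?\<rho> powr \<gamma>) * (E * real s powr (- 1 / 2))"
   using dW' nW' \<rho> powr_ge_self[OF \<rho>] by (intro add_mono mult_mono) auto
  also have "... = 464 * (E * real s powr (- 1 / 2) * ?\<rho> powr \<gamma>)" by (simp only: mult_ac)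
  also have "... <= 500 * (E * real s powr (- 1 / 2) * ?\<rho> powr \<gamma>)" using Ep by (intro mult_right_mono) auto
  finally show ?thesis by (simp only: mult.assoc)
 qed
qed

lemma base_bounds:
 defines "P \<equiv> %x. Y x * chi (real s0) x"
 shows "P \<in> ell2" "ell2_norm P <= 500 * E * real s0 powr (- 1 / 2)"
  and "8 * \<bar>h\<bar> <= int s0 ==>
   ell2_norm (%x. P (x + h) - P x) <= 500 * E * real s0 powr (- 1 / 2) * (\<bar>of_int h\<bar> / real s0) powr \<gamma>"
proof -
 have sp: "0 < real s0" using s0(2) by simp
 have Ep: "0 <= E * real s0 powr (- 1 / 2)" using E by simp
 have P: "P \<in> ell2 & ell2_norm P <= 1 * ell2_norm Y"
 proof (rule ell2_mono[OF Y])
  fix x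
  show "cmod (P x) <= 1 * cmod (Y x)"
   using mult_left_mono[OF cmod_chi_le_1[OF sp, of x], of "cmod (Y x)"] by (simp add: P_def norm_mult)
 qed simp
 then show "P \<in> ell2" by simp
 have "ell2_norm P <= 500 * (E * real s0 powr (- 1 / 2))" using P nY Ep by linarith
 then show "ell2_norm P <= 500 * E * real s0 powr (- 1 / 2)" by (simp only: mult.assoc)
 assume h: "8 * \<bar>h\<bar> <= int s0"
 let ?\<rho> = "\<bar>of_int h\<bar> / real s0" and ?dY = "%x. Y (x + h) - Y x"
 have "real_of_int (8 * \<bar>h\<bar>) <= real_of_int (int s0)" using h by (simp only: of_int_le_iff)
 then have h8: "8 * \<bar>real_of_int h\<bar> <= real s0" by simp
 then have \<rho>: "0 <= ?\<rho>" "?\<rho> <= 1" using sp by (auto simp: field_simps)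
 have pt: "cmod (P (x + h) - P x) <= 1 * cmod (?dY x) + (4 * ?\<rho>) * cmod (Y (x + h))" for x
 proof -
  have "P (x + h) - P x = ?dY x * chi (real s0) x + (chi (real s0) (x + h) - chi (real s0) x) * Y (x + h)"
   by (simp add: P_def algebra_simps)
  then have "cmod (P (x + h) - P x)
    <= cmod (?dY x) * cmod (chi (real s0) x) + cmod (chi (real s0) (x + h) - chi (real s0) x) * cmod (Y (x + h))"
   unfolding norm_mult[symmetric] by (simp only: norm_triangle_ineq)
  also have "... <= cmod (?dY x) * 1 + (4 * ?\<rho>) * cmod (Y (x + h))"
   using cmod_chi_le_1[OF sp, of x] chi_lipschitz[OF sp, of x h] by (intro add_mono mult_mono) auto
  finally show ?thesis by simp
 qed
 have dY': "ell2_norm ?dY <= E * real s0 powr (- 1 / 2) * ?\<rho> powr \<gamma>"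
  by (rule difference_bound_abs[OF Y Ep]) (use dY h8 in auto)
 have Yh: "(%x. Y (x + h)) \<in> ell2" "ell2_norm (%x. Y (x + h)) = ell2_norm Y" using ell2_shift[OF Y] by auto
 have "ell2_norm (%x. P (x + h) - P x) <= 1 * ell2_norm ?dY + (4 * ?\<rho>) * ell2_norm Y"
  using ell2_mono_add[OF _ Yh(1) _ _ pt] ell2_difference[OF Y] \<rho>(1) unfolding Yh(2) by simp
 also have "... <= 1 * (E * real s0 powr (- 1 / 2) * ?\<rho> powr \<gamma>) + (4 * ?\<rho> powr \<gamma>) * (E * real s0 powr (- 1 / 2))"
  using dY' nY \<rho> powr_ge_self[OF \<rho>] by (intro add_mono mult_mono) auto
 also have "... = 5 * (E * real s0 powr (- 1 / 2) * ?\<rho> powr \<gamma>)" by (simp only: mult_ac)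
 also have "... <= 500 * (E * real s0 powr (- 1 / 2) * ?\<rho> powr \<gamma>)" using Ep by (intro mult_right_mono) auto
 finally show "ell2_norm (%x. P (x + h) - P x) <= 500 * E * real s0 powr (- 1 / 2) * ?\<rho> powr \<gamma>"
  by (simp only: mult.assoc)
qed

lemma K_admissible:
 assumes s: "s \<in> dyadic" "s0 <= s"
 shows "admissible_const (2 * \<gamma>) s (K s) (8720 * E)"
proof -
 obtain r where r: "s = 2 * r" "2 <= r" "r \<in> dyadic" "s ~= s0 ==> s0 <= r" using dyadic_half[OF s] by blast
 have d: "s div 2 = r" and r1: "1 <= r" using r by auto
 have E0: "0 <= 500 * E" "cmod 0 <= 3 * E" using E by auto
 have m: "cmod (mass s) <= 3 * E" by (rule cmod_mass[OF r(1) r1])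
 have n: "16 * (500 * E + 45 * E) = 8720 * E" by simp
 show ?thesis
 proof (cases "s = s0")
  case True
  have "K s = (%x. Y x * chi (real s0) x - (mass s * bump s x - 0 * bump r x))"
   unfolding True by (simp add: K_def[abs_def] lowpass_def)
  then show ?thesis
   using admissible_combine[OF base_bounds(1) E0(1) r(1)[unfolded True] r1 base_bounds(2,3) m E0(2)] True
   unfolding n by simp
 next
  case False
  obtain r' where "r = 2 * r'" "2 <= r'" using dyadic_half[OF r(3) r(4)[OF False]] by blast
  then have m': "cmod (mass r) <= 3 * E" by (intro cmod_mass) auto
  have "K s = (%x. Y x * (chi (real s) x - chi (real r) x) - (mass s * bump s x - mass r * bump r x))"
   using False by (simp add: K_def[abs_def] lowpass_def d algebra_simps)
  then show ?thesis
   using admissible_combine[OF shell_bounds(1)[OF s r(1,2)] E0(1) r(1) r1 shell_bounds(2,3)[OF s r(1,2)] m m']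
   unfolding n by simp
 qed
qed

end

section \<open>The inverse in the space of kernels\<close>

lemma conv_antisym_part:
 assumes A: "supp A \<subseteq> {1..int N}"
 shows "conv (antisym_part A) f x = (\<Sum>y\<in>{1..int N}. A y * (f (x - y) - f (x + y)))"
proof -
 have fA: "finite (supp A)" using A finite_subset by blast
 have fr: "finite (supp (%x. A (- x)))" by (rule finite_supp_reflect[OF fA])
 have sr: "supp (%x. A (- x)) \<subseteq> {- int N..-1}" using A by (force simp: supp_def)
 have "conv (antisym_part A) f x = conv A f x - conv (%x. A (- x)) f x"
  unfolding antisym_part_def[abs_def] conv_diff_left[OF fA fr] ..
 also have "conv A f x = (\<Sum>y\<in>{1..int N}. A y * f (x - y))" by (rule conv_eq[OF _ A]) simp
 also have "conv (%x. A (- x)) f x = (\<Sum>y\<in>{- int N..-1}. A (- y) * f (x - y))" by (rule conv_eq[OF _ sr]) simp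
 also have "... = (\<Sum>y\<in>{1..int N}. A y * f (x + y))"
  by (rule sum.reindex_bij_witness[where i = uminus and j = uminus]) auto
 finally show ?thesis by (simp add: right_diff_distrib sum_subtractf)
qed

text \<open>The index m and the member y determine each other, with \<open>mu\<close> as the inverse
  of the integer part. Both sums are first cut down to the finite sets \<open>J\<close> and
  \<open>I\<close>, outside of which \<phi> vanishes.\<close>

lemma (in rough_kernels) conv_Hker:
 assumes t: "t \<in> dyadic"
 shows "(\<Sum>\<^sub>\<infinity>m\<in>{m::nat. m > 0}. \<phi> t (real m powr \<alpha> / real t) *
   ((f (x - \<lfloor>real m powr \<alpha>\<rfloor>) - f (x + \<lfloor>real m powr \<alpha>\<rfloor>)) / of_nat m)) = conv (Hker t) f x"
proof -
 define A where "A y = wt t y * of_int (ind y)" for y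
 define F where "F y = f (x - y) - f (x + y)" for y
 define G where "G m = \<phi> t (real m powr \<alpha> / real t) * (F \<lfloor>real m powr \<alpha>\<rfloor> / of_nat m)" for m :: nat
 define J where "J = {m\<in>{1..2 * t}. real m powr \<alpha> < 2 * real t}"
 define I where "I = {y\<in>{1..int (2 * t)}. ind y = 1 & of_int (mu y) powr \<alpha> < 2 * real t}"
 have t1: "1 <= real t" using t by (rule dyadic_ge_1)
 have small: "real m powr \<alpha> < 2 * real t" if "\<phi> t (real m powr \<alpha> / real t) ~= 0" for m :: nat
  using phi_support[OF t that] t1 by (simp add: field_simps)
 have le: "real m <= real m powr \<alpha>" if "1 <= m" for m :: nat
  using powr_mono[of 1 \<alpha> "real m"] alpha that by simp
 have "(\<Sum>\<^sub>\<infinity>m\<in>{m::nat. m > 0}. G m) = (\<Sum>\<^sub>\<infinity>m\<in>J. G m)"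
 proof (rule infsum_cong_neutral)
  fix m assume m: "m \<in> {m. m > 0} - J"
  have "\<not> real m powr \<alpha> < 2 * real t"
  proof
   assume l: "real m powr \<alpha> < 2 * real t"
   have "m <= 2 * t" using le[of m] l m by simp
   moreover have "1 <= m" using m by simp
   ultimately have "m \<in> J" using l unfolding J_def by simp
   then show False using m by blast
  qed
  then have "\<phi> t (real m powr \<alpha> / real t) = 0" using small[of m] by blast
  then show "G m = 0" by (simp add: G_def)
 qed (auto simp: J_def)
 also have "... = (\<Sum>m\<in>J. G m)" by (rule infsum_finite) (simp add: J_def)
 also have "... = (\<Sum>y\<in>I. A y * F y)"
 proof (rule sum.reindex_bij_witness[where i = "%y. nat (mu y)" and j = "%m. \<lfloor>real m powr \<alpha>\<rfloor>"])
  fix m assume m: "m \<in> J"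
  then have m1: "1 <= int m" by (simp add: J_def)
  note f = mu_floor[OF m1, simplified]
  show "nat (mu \<lfloor>real m powr \<alpha>\<rfloor>) = m" by (simp add: f)
  have "\<lfloor>real m powr \<alpha>\<rfloor> <= int (2 * t)" using m by (simp add: J_def floor_le_iff)
  then show "\<lfloor>real m powr \<alpha>\<rfloor> \<in> I" using m f by (simp add: I_def J_def)
  show "A \<lfloor>real m powr \<alpha>\<rfloor> * F \<lfloor>real m powr \<alpha>\<rfloor> = G m"
   using f by (simp add: A_def G_def wt_def weight_def)
 next
  fix y assume y: "y \<in> I"
  then have y1: "1 <= y" "ind y = 1" by (auto simp: I_def)
  have m: "1 <= mu y" by (rule mu_pos[OF y1(1)])
  then have r: "real (nat (mu y)) = of_int (mu y)" by simp
  show "\<lfloor>real (nat (mu y)) powr \<alpha>\<rfloor> = y" unfolding r by (rule ind_1_floor[OF y1, symmetric])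
  have l: "real (nat (mu y)) powr \<alpha> < 2 * real t" unfolding r using y by (simp add: I_def)
  have "nat (mu y) <= 2 * t" using le[of "nat (mu y)"] l m by linarith
  then show "nat (mu y) \<in> J" using m l by (simp add: J_def)
 qed
 also have "... = (\<Sum>y\<in>{1..int (2 * t)}. A y * F y)"
 proof (rule sum.mono_neutral_left)
  show "\<forall>y\<in>{1..int (2 * t)} - I. A y * F y = 0"
  proof
   fix y assume y: "y \<in> {1..int (2 * t)} - I"
   then have y1: "1 <= y" by auto
   have m: "1 <= mu y" by (rule mu_pos[OF y1])
   have "A y = 0"
   proof (cases "ind y = 1")
    case True
    then have "\<not> of_int (mu y) powr \<alpha> < 2 * real t" using y by (auto simp: I_def)
    then have "\<phi> t (of_int (mu y) powr \<alpha> / real t) = 0" using small[of "nat (mu y)"] m by auto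
    then show ?thesis by (simp add: A_def wt_def weight_def)
   qed (use ind_cases[OF y1] in \<open>simp add: A_def\<close>)
   then show "A y * F y = 0" by simp
  qed
 qed (auto simp: I_def)
 also have "... = conv (antisym_part A) f x"
 proof -
  have "supp A \<subseteq> {1..int (2 * t)}"
  proof
   fix y assume "y \<in> supp A"
   then have "wt t y ~= 0" by (auto simp: supp_def A_def)
   from wt_supp[OF t this] show "y \<in> {1..int (2 * t)}" by simp
  qed
  from conv_antisym_part[OF this] show ?thesis by (simp add: F_def)
 qed
 finally show ?thesis by (simp add: G_def F_def Hker_def A_def[abs_def])
qed

lemma odd_sum_eq_0:
 fixes f :: "int => complex"
 assumes "!!x. f (- x) = - f x"
 shows "(\<Sum>x\<in>{- n..n}. f x) = 0"
proof -
 have "(\<Sum>x\<in>{- n..n}. f x) = (\<Sum>x\<in>{- n..n}. f (- x))"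
  by (rule sum.reindex_bij_witness[where i = uminus and j = uminus]) auto
 then show ?thesis by (simp add: assms sum_negf)
qed

text \<open>By injectivity the choice in \<open>inv_into\<close> agrees with the given inverse on
  \<open>ell2\<close>. Boundedness of that inverse makes the supremum in \<open>ell2_opnorm\<close>
  meaningful, and scaling carries the bound from the unit ball to all of
  \<open>ell2\<close>.\<close>

lemma inverse_operator_ell2_inverse:
 assumes inv: "ell2_invertible L" and op: "ell2_opnorm (ell2_inverse L) <= C"
  and L: "!!f. L f = (%x. lam * f x + conv H f x)" and H: "finite (supp H)"
 shows "inverse_operator H lam (ell2_inverse L) C"
proof -
 obtain S where S: "ell2_bounded S" and SL: "!!f. f \<in> ell2 ==> S (L f) = f" and LS: "!!f. f \<in> ell2 ==> L (S f) = f"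
  using inv unfolding ell2_invertible_def by blast
 have L2: "f \<in> ell2 ==> L f \<in> ell2" for f using inv by (simp add: ell2_invertible_def ell2_bounded_def)
 have S2: "f \<in> ell2 ==> S f \<in> ell2" for f using S by (simp add: ell2_bounded_def)
 have lin: "f \<in> ell2 ==> g \<in> ell2 ==> S (%x. c * f x + d * g x) = (%x. c * S f x + d * S g x)" for f g c d
  using S by (simp add: ell2_bounded_def)
 obtain B where B: "!!f. f \<in> ell2 ==> ell2_norm (S f) <= B * ell2_norm f" using S unfolding ell2_bounded_def by blast
 have inj: "inj_on L ell2" by (rule inj_on_inverseI[of _ S]) (rule SL)
 have eq: "ell2_inverse L f = S f" if "f \<in> ell2" for f
  unfolding ell2_inverse_def using inv_into_f_eq[of L ell2 "S f" f] inj S2[OF that] LS[OF that] by blast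
 have unit: "ell2_norm (S f) <= C" if f: "f \<in> ell2" "ell2_norm f <= 1" for f
 proof -
  have "bdd_above ((%f. ell2_norm (ell2_inverse L f)) ` {f \<in> ell2. ell2_norm f <= 1})"
  proof (rule bdd_aboveI2)
   fix g assume g: "g \<in> {f \<in> ell2. ell2_norm f <= 1}"
   have "ell2_norm (S g) <= B * ell2_norm g" using B g by simp
   also have "... <= \<bar>B\<bar> * 1" using g by (intro mult_mono) auto
   finally show "ell2_norm (ell2_inverse L g) <= \<bar>B\<bar>" using g by (simp add: eq)
  qed
  then have "ell2_norm (ell2_inverse L f) <= ell2_opnorm (ell2_inverse L)"
   unfolding ell2_opnorm_def using f by (intro cSUP_upper) auto
  then show ?thesis using op eq[OF f(1)] by simp
 qed
 have C0: "0 <= C" using order_trans[OF ell2_norm_nonneg unit[OF ell2_zero(1)]] ell2_zero(2) by simp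
 have bound: "ell2_norm (S f) <= C * ell2_norm f" if f: "f \<in> ell2" for f
 proof (cases "ell2_norm f = 0")
  case True
  then show ?thesis using B[OF f] by simp
 next
  case False
  define n where "n = ell2_norm f"
  have n: "0 < n" using False ell2_norm_nonneg[of f] unfolding n_def by linarith
  define g where "g x = of_real (1 / n) * f x" for x
  have g: "g \<in> ell2 & ell2_norm g <= 1"
   using ell2_cmult[OF f, of "of_real (1 / n)"] n unfolding g_def[abs_def] by (simp add: norm_divide n_def[symmetric])
  have "f = (%x. of_real n * g x + 0 * g x)" using n by (simp add: g_def)
  then have "S f = (%x. of_real n * S g x + 0 * S g x)" using lin[of g g "of_real n" 0] g by simp
  then have "ell2_norm (S f) <= n * ell2_norm (S g)" using ell2_cmult[OF S2, of g "of_real n"] g n by simp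
  also have "... <= n * C" using unit g n by (intro mult_left_mono) auto
  finally show ?thesis by (simp add: n_def mult.commute)
 qed
 show ?thesis
 proof
  show "finite (supp H)" by (rule H)
  show "0 <= C" by (rule C0)
  fix f assume f: "f \<in> ell2"
  show "ell2_inverse L f \<in> ell2" using S2[OF f] by (simp add: eq[OF f])
  show "(%x. lam * ell2_inverse L f x + conv H (ell2_inverse L f) x) = f" using LS[OF f] unfolding L eq[OF f] .
  show "ell2_inverse L (%x. lam * f x + conv H f x) = f" using SL[OF f] eq[OF L2[OF f]] unfolding L by simp
  show "ell2_norm (ell2_inverse L f) <= C * ell2_norm f" using bound[OF f] by (simp add: eq[OF f])
  fix g assume g: "g \<in> ell2"
  have "(%x. f x - g x) \<in> ell2" using ell2_diff[OF f g] by simp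
  then show "ell2_inverse L (%x. f x - g x) = (%x. ell2_inverse L f x - ell2_inverse L g x)"
   using lin[OF f g, of 1 "-1"] by (simp add: eq f g)
 qed
qed

lemma least_const_le: "admissible_const \<gamma> s k D ==> least_const \<gamma> s k <= D"
 unfolding least_const_def by (intro cInf_lower bdd_belowI[of _ 0]) (auto simp: admissible_const_def)

lemma least_const_nonneg: "\<exists>D. admissible_const \<gamma> s k D ==> 0 <= least_const \<gamma> s k"
 unfolding least_const_def by (intro cInf_greatest) (auto simp: admissible_const_def)

text \<open>The factor 2 is what admits the constant multiplier 1 at the base scale.\<close>

lemma least_scale:
 assumes "1 < m"
 obtains s0 where "s0 \<in> dyadic" "m <= real s0" "real s0 <= 2 * m" "{s \<in> dyadic. m <= real s} = {s \<in> dyadic. s0 <= s}"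
proof -
 define k where "k = (LEAST k. m <= 2 ^ k)"
 obtain j where "m <= 2 ^ j" using real_arch_pow[of 2 m] by (auto intro: less_imp_le)
 then have k: "m <= 2 ^ k" unfolding k_def by (rule LeastI)
 then have "k ~= 0" using assms by (cases "k = 0") auto
 then obtain i where i: "k = Suc i" by (cases k) auto
 have "\<not> m <= 2 ^ i" using not_less_Least[of i "%k. m <= 2 ^ k"] i unfolding k_def by simp
 then have "real (2 ^ k) <= 2 * m" using i by simp
 moreover have "{s \<in> dyadic. m <= real s} = {s \<in> dyadic. 2 ^ k <= s}"
 proof (intro equalityI subsetI)
  fix s assume "s \<in> {s \<in> dyadic. m <= real s}"
  then obtain l where l: "s = 2 ^ l" "m <= 2 ^ l" by (auto simp: dyadic_def)
  then have "k <= l" unfolding k_def by (intro Least_le)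
  then show "s \<in> {s \<in> dyadic. 2 ^ k <= s}" using l by (simp add: dyadic_def)
 next
  fix s assume s: "s \<in> {s \<in> dyadic. 2 ^ k <= s}"
  then have "real (2 ^ k) <= real s" by (simp only: of_nat_le_iff mem_Collect_eq)
  then have "2 ^ k <= real s" by (simp only: of_nat_power of_nat_numeral)
  then have "m <= real s" using k by linarith
  then show "s \<in> {s \<in> dyadic. m <= real s}" using s by blast
 qed
 ultimately show ?thesis using that[of "2 ^ k"] k by (simp add: dyadic_def)
qed

text \<open>The infimum is below each of its members because the set is bounded below by 0: least
  constants are nonnegative and the set of scales is not empty.\<close>

lemma A_norm_le:
 assumes rep: "A_represents \<gamma> \<alpha> \<theta> \<phi> M L lam beta K" and M: "1 < M powr \<theta>"
  and D: "!!s. s \<in> A_scales \<theta> M ==> least_const \<gamma> s (K s) <= D"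
 shows "A_norm \<gamma> \<alpha> \<theta> \<phi> M L <= cmod lam + cmod beta + D"
proof -
 obtain s0 where s0: "s0 \<in> dyadic" "M powr \<theta> <= real s0" using least_scale[OF M] by blast
 then have s0A: "s0 \<in> A_scales \<theta> M" by (simp add: A_scales_def)
 have "A_norm \<gamma> \<alpha> \<theta> \<phi> M L <= cmod lam + cmod beta + A_family_norm \<gamma> \<theta> M K"
  unfolding A_norm_def
 proof (rule cInf_lower)
  show "bdd_below {cmod lam + cmod beta + A_family_norm \<gamma> \<theta> M K | lam beta K. A_represents \<gamma> \<alpha> \<theta> \<phi> M L lam beta K}"
  proof (rule bdd_belowI)
   fix u assume "u \<in> {cmod lam + cmod beta + A_family_norm \<gamma> \<theta> M K | lam beta K. A_represents \<gamma> \<alpha> \<theta> \<phi> M L lam beta K}"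
   then obtain l b K' where u: "u = cmod l + cmod b + A_family_norm \<gamma> \<theta> M K'" and r: "A_represents \<gamma> \<alpha> \<theta> \<phi> M L l b K'"
    by blast
   have f: "A_family \<gamma> \<theta> M K'" using r by (simp add: A_represents_def)
   have "0 <= least_const \<gamma> s0 (K' s0)" using f s0A by (intro least_const_nonneg) (simp add: A_family_def)
   also have "... <= A_family_norm \<gamma> \<theta> M K'"
    unfolding A_family_norm_def using f s0A by (intro cSUP_upper) (auto simp: A_family_def)
   finally show "0 <= u" unfolding u by simp
  qed
 qed (use rep in blast)
 moreover have "A_family_norm \<gamma> \<theta> M K <= D" unfolding A_family_norm_def using s0A D by (intro cSUP_least) auto
 ultimately show ?thesis by linarith
qed

text \<open>The pairing is the quadratic form of the inverse on the indicator of an interval of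
  length s, divided by s. Cauchy--Schwarz bounds it by C * sqrt s * sqrt s / s.\<close>

lemma (in inverse_operator) sum_X_tent:
 assumes s: "1 <= s"
 shows "cmod (\<Sum>x\<in>{-int s..int s}. X x * tent (real s) x) <= C"
proof -
 let ?Z = "{0..<int s}"
 define k where "k x = (if x \<in> ?Z then 1 else 0 :: complex)" for x
 have sk: "supp k \<subseteq> ?Z" by (auto simp: supp_def k_def)
 then have fk: "finite (supp k)" using finite_subset by blast
 have nk: "ell2_norm k = sqrt (real s)"
 proof -
  have "(ell2_norm k)\<^sup>2 = real s" using finite_supp_ell2(2)[OF _ sk] by (simp add: k_def)
  then show ?thesis by (metis ell2_norm_nonneg real_sqrt_abs abs_of_nonneg)
 qed
 have c: "conv k X y = (\<Sum>z\<in>?Z. X (y - z))" for y using conv_eq[OF _ sk, of X y] by (simp add: k_def)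
 have "cmod (\<Sum>y\<in>?Z. conv k X y) <= (\<Sum>y\<in>?Z. \<bar>cmod (conv k X y)\<bar> * \<bar>1\<bar>)"
  by (rule order_trans[OF norm_sum]) simp
 also have "... <= L2_set (%y. cmod (conv k X y)) ?Z * L2_set (%y. 1) ?Z" by (rule L2_set_mult_ineq)
 also have "... <= (C * sqrt (real s)) * sqrt (real s)"
 proof (rule mult_mono)
  have "L2_set (%y. cmod (conv k X y)) ?Z <= ell2_norm (conv k X)"
   using conv_ell2[OF fk X_ell2] by (intro L2_set_le_ell2_norm) simp
  then show "L2_set (%y. cmod (conv k X y)) ?Z <= C * sqrt (real s)" using norm_conv_X[OF fk] nk by simp
 qed (use C0 in \<open>auto simp: L2_set_def sum_nonneg\<close>)
 also have "... = C * real s" by simp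
 finally have "cmod (\<Sum>y\<in>?Z. conv k X y) / real s <= C" using s by (simp add: field_simps)
 then show ?thesis unfolding sum_tent[OF s] c[symmetric] norm_divide by simp
qed

section \<open>Representation and norm of the inverse\<close>

context rough_scale
begin

lemma hilbert_trunc_eq: "hilbert_trunc \<alpha> \<theta> \<phi> M f = conv H f"
proof
 fix x
 have "hilbert_trunc \<alpha> \<theta> \<phi> M f x = (\<Sum>t\<in>T. conv (Hker t) f x)"
  unfolding hilbert_trunc_def T_def[symmetric] by (rule sum.cong[OF refl]) (rule conv_Hker[OF TD(1)])
 also have "... = conv H f x"
  unfolding H_def[abs_def] by (rule fun_cong[OF conv_sum_left[OF finite_T finite_supp_kers(3)[OF TD(1)]], symmetric])
 finally show "hilbert_trunc \<alpha> \<theta> \<phi> M f x = conv H f x" .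
qed

lemma multiplier_cis:
 assumes s: "0 < s" and \<eta>: "\<bar>\<eta>\<bar> = 1 / s"
 shows "multiplier r s (%x. cis (\<eta> * of_int x) - 1)"
proof -
 have e: "\<bar>\<eta> * of_int x\<bar> = \<bar>of_int x\<bar> / s" for x :: int by (simp add: abs_mult \<eta>)
 have le: "cmod (cis (\<eta> * of_int x) - 1) <= \<bar>of_int x\<bar> / s" for x :: int
  using cmod_cis_minus_1_le[of "\<eta> * of_int x"] unfolding e .
 show ?thesis unfolding multiplier_def
 proof (intro conjI allI impI)
  show "\<exists>c0 c1 \<eta>'. cmod c0 <= 1 & cmod c1 <= 1 & (%x. cis (\<eta> * real_of_int x) - 1) = (%x. c0 + c1 * cis (\<eta>' * real_of_int x))"
   by (rule exI[of _ "- 1"], rule exI[of _ 1], rule exI[of _ \<eta>]) simp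
  fix x :: int
  have "0 <= \<bar>of_int x\<bar> / s" using s by simp
  then show "cmod (cis (\<eta> * of_int x) - 1) <= 16 * \<bar>of_int x\<bar> / s" using le[of x] by simp
  fix a :: int
  have "(cis (\<eta> * of_int (x + a)) - 1) - (cis (\<eta> * of_int x) - 1) = cis (\<eta> * of_int x) * (cis (\<eta> * of_int a) - 1)"
   by (simp add: right_diff_distrib cis_mult distrib_left)
  then show "cmod ((cis (\<eta> * of_int (x + a)) - 1) - (cis (\<eta> * of_int x) - 1)) <= \<bar>of_int a\<bar> / s"
   using le[of a] by (simp add: norm_mult)
 qed
qed

lemma multiplier_one:
 assumes "0 < s" "s <= 2 * M powr \<theta>"
 shows "multiplier (M powr \<theta> / 8) s (%x. 1)" unfolding multiplier_def
proof (intro conjI allI impI)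
 show "\<exists>c0 c1 \<eta>. cmod c0 <= 1 & cmod c1 <= 1 & (%x. 1) = (%x. c0 + c1 * cis (\<eta> * real_of_int x))"
  by (rule exI[of _ 1], rule exI[of _ 0], rule exI[of _ 0]) simp
 fix x :: int
 show "cmod 1 <= 16 * \<bar>of_int x\<bar> / s" if "M powr \<theta> / 8 <= \<bar>of_int x\<bar>" using assms that by (simp add: field_simps)
 show "cmod (1 - 1) <= \<bar>of_int a\<bar> / s" for a using assms by simp
qed

text \<open>The first two summands bound the tent pairings of \<open>X\<close> and of
  \<open>delta0\<close> / lam, while the odd kernel pairs to 0; the last one bounds the norms of Y
  and of its modulated differences. M does not occur.\<close>

definition CA :: "complex => real => real" where
 "CA lam C = C + cmod (1 / lam) + cmod (1 / lam\<^sup>2) * (C * (4 + cmod lam * C)) * \<bar>CQ\<bar>"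

theorem inverse_bound:
 assumes M4: "4 <= M powr \<theta>" and inv: "ell2_invertible (shifted_hilbert \<alpha> \<theta> \<phi> lam M)"
  and op: "ell2_opnorm (ell2_inverse (shifted_hilbert \<alpha> \<theta> \<phi> lam M)) <= C"
 defines "L \<equiv> ell2_inverse (shifted_hilbert \<alpha> \<theta> \<phi> lam M)"
 shows "L \<in> A_space (\<delta> / 100) \<alpha> \<theta> \<phi> M"
  and "A_norm (\<delta> / 100) \<alpha> \<theta> \<phi> M L <= cmod (1 / lam) + cmod (- 1 / lam\<^sup>2) + 8720 * CA lam C"
proof -
 interpret io: inverse_operator H lam L C unfolding L_def
  by (rule inverse_operator_ell2_inverse[OF inv op _ finite_supp_H]) (simp add: shifted_hilbert_def[abs_def] hilbert_trunc_eq)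
 have lam: "lam ~= 0"
 proof (rule io.lam_nonzero)
  obtain B where B: "0 <= B" "supp H \<subseteq> {-B..B}" using supp_subset_atLeastAtMost[OF finite_supp_H] by blast
  have "(\<Sum>y\<in>supp H. H y) = (\<Sum>y\<in>{-B..B}. H y)" by (rule sum_supp[OF _ B(2)]) auto
  then show "(\<Sum>y\<in>supp H. H y) = 0" using odd_sum_eq_0[of H B] H_odd by simp
 qed
 obtain s0 where s0: "s0 \<in> dyadic" "M powr \<theta> <= real s0" "real s0 <= 2 * M powr \<theta>"
  and scales: "{s \<in> dyadic. M powr \<theta> <= real s} = {s \<in> dyadic. s0 <= s}"
  using least_scale[of "M powr \<theta>"] M4 by auto
 have s04: "4 <= s0" using s0(2) M4 by linarith
 define E where "E = CA lam C"
 have C0: "0 <= C" by (rule io.C0)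
 define c1 where "c1 = cmod (1 / lam\<^sup>2) * (C * (4 + cmod lam * C))"
 have c1: "0 <= c1" using C0 by (simp add: c1_def)
 have CY: "io.CY B = c1 * B" for B by (simp add: io.CY_def c1_def)
 have E: "E = C + cmod (1 / lam) + c1 * \<bar>CQ\<bar>" by (simp add: E_def CA_def c1_def)
 have "0 <= c1 * \<bar>CQ\<bar>" using c1 by simp
 then have E0: "0 <= E" and EC: "C + cmod (1 / lam) <= E" and Eq: "c1 * \<bar>CQ\<bar> <= E"
  unfolding E using C0 norm_ge_zero[of "1 / lam"] by linarith+
 have le: "io.CY (CQ * p) <= E * p" if "0 <= p" for p
 proof -
  have "io.CY (CQ * p) = c1 * CQ * p" by (simp add: CY)
  also have "... <= c1 * \<bar>CQ\<bar> * p" using that c1 by (intro mult_right_mono mult_left_mono) auto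
  also have "... <= E * p" using Eq that by (rule mult_right_mono)
  finally show ?thesis .
 qed
 have th: "0 < \<delta> / 200" "\<delta> / 200 <= 1" using delta theta_bounds by auto
 have pw: "u <= u powr (\<delta> / 200)" if "0 <= u" "u <= 1" for u
  using powr_mono'[of "\<delta> / 200" 1 u] th that by simp
 have m1': "multiplier (M powr \<theta> / 8) (real s0) (%x. 1)" using s04 by (intro multiplier_one s0(3)) simp
 have PHe: "io.PH \<eta> = conv H (%x. (cis (\<eta> * of_int x) - 1) * H x)" for \<eta> by (rule io.PH_def)
 have big: "0 < real s & M powr \<theta> <= real s" if "s0 <= s" for s using that s0(2) s04 by linarith
 have mc: "multiplier (M powr \<theta> / 8) (real s) (%x. cis (\<eta> * of_int x) - 1)"
  if "s0 <= s" "\<eta> = 1 / real s \<or> \<eta> = - (1 / real s)" for s \<eta>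
  using that big[OF that(1)] by (intro multiplier_cis) auto
 have PH1: "ell2_norm (io.PH \<eta>) <= CQ * real s powr (- 1 / 2)"
  if "s0 <= s" "\<eta> = 1 / real s \<or> \<eta> = - (1 / real s)" for s \<eta>
  unfolding PHe using big[OF that(1)] by (intro bilinear_bounds(1)[OF mc[OF that]]) simp
 have PH2: "ell2_norm (%x. io.PH \<eta> (x + a) - io.PH \<eta> x) <= CQ * real s powr (- 1 / 2) * (of_int a / real s) powr (\<delta> / 200)"
  if "s0 <= s" "\<eta> = 1 / real s \<or> \<eta> = - (1 / real s)" "1 <= a" "of_int a <= real s" for s \<eta> a
  unfolding PHe using big[OF that(1)] that(3,4) by (intro bilinear_bounds(2)[OF mc[OF that(1,2)]]) auto
 interpret sd: scale_decomposition io.Y s0 E "\<delta> / 200"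
 proof
  show "io.Y \<in> ell2" by (rule io.Y_ell2[OF lam])
  have HH: "ell2_norm (conv H H) <= CQ * real s0 powr (- 1 / 2)" using bilinear_bounds(1)[OF m1' s0(2)] by simp
  show "ell2_norm io.Y <= E * real s0 powr (- 1 / 2)" by (rule order_trans[OF io.Y_bounds(1)[OF lam HH] le]) simp
  show "ell2_norm (%x. io.Y (x + a) - io.Y x) <= E * real s0 powr (- 1 / 2) * (of_int a / real s0) powr (\<delta> / 200)"
   if a: "1 <= a" "of_int a <= real s0" for a
  proof -
   have "ell2_norm (%x. conv H H (x + a) - conv H H x) <= CQ * (real s0 powr (- 1 / 2) * (of_int a / real s0) powr (\<delta> / 200))"
    using bilinear_bounds(2)[OF m1' s0(2) a] by (simp add: mult.assoc)
   from order_trans[OF io.Y_bounds(2)[OF lam HH this] le] show ?thesis by (simp add: mult.assoc)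
  qed
  fix s assume s: "s \<in> dyadic" "s0 <= s"
  have P1: "ell2_norm (io.PH (1 / real s)) <= CQ * real s powr (- 1 / 2)"
   "ell2_norm (io.PH (- (1 / real s))) <= CQ * real s powr (- 1 / 2)" using PH1[OF s(2)] by blast+
  show "ell2_norm (%x. cis (1 / real s * of_int x) * io.Y x - io.Y x) <= E * real s powr (- 1 / 2)"
   by (rule order_trans[OF io.modul_Y_bounds(1)[OF lam P1] le]) simp
  fix a :: int assume a: "1 <= a" "of_int a <= real s"
  let ?B' = "CQ * (real s powr (- 1 / 2) * (of_int a / real s) powr (\<delta> / 200))"
  have q: "ell2_norm (%x. io.PH \<eta> (x + a) - io.PH \<eta> x) <= ?B'" if "\<eta> = 1 / real s \<or> \<eta> = - (1 / real s)" for \<eta>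
   using PH2[OF s(2) that a] by (simp add: mult.assoc)
  have sp: "0 < real s" using big[OF s(2)] by simp
  have u: "0 <= of_int a / real s" "of_int a / real s <= 1" using a sp by (auto simp: field_simps)
  have Cp: "0 <= CQ * real s powr (- 1 / 2)" using P1(1) ell2_norm_nonneg[of "io.PH (1 / real s)"] by linarith
  have "\<bar>1 / real s * of_int a\<bar> = of_int a / real s" using a sp by (simp add: abs_mult)
  then have "\<bar>1 / real s * of_int a\<bar> * (CQ * real s powr (- 1 / 2))
    <= (of_int a / real s) powr (\<delta> / 200) * (CQ * real s powr (- 1 / 2))"
   using pw[OF u] Cp by (simp only: mult_right_mono)
  also have "... = ?B'" by (simp only: mult_ac)
  finally have small: "\<bar>1 / real s * of_int a\<bar> * (CQ * real s powr (- 1 / 2)) <= ?B'" .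
  have "ell2_norm (%x. (cis (1 / real s * of_int (x + a)) * io.Y (x + a) - io.Y (x + a)) - (cis (1 / real s * of_int x) * io.Y x - io.Y x))
    <= io.CY ?B'" by (rule io.modul_Y_bounds(2)[OF lam P1 q q small]) auto
  also have "... <= E * (real s powr (- 1 / 2) * (of_int a / real s) powr (\<delta> / 200))" by (rule le) simp
  finally show "ell2_norm (%x. (cis (1 / real s * of_int (x + a)) * io.Y (x + a) - io.Y (x + a)) - (cis (1 / real s * of_int x) * io.Y x - io.Y x))
    <= E * real s powr (- 1 / 2) * (of_int a / real s) powr (\<delta> / 200)" by (simp only: mult.assoc)
 next
  fix s :: nat assume s: "1 <= s"
  let ?I = "{-int s..int s}" and ?t = "tent (real s)"
  have h: "(\<Sum>x\<in>?I. H x * ?t x) = 0" by (rule odd_sum_eq_0) (simp add: H_odd tent_def)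
  have d: "(\<Sum>x\<in>?I. delta0 x * ?t x) = 1"
  proof -
   have "(\<Sum>x\<in>?I. delta0 x * ?t x) = (\<Sum>x\<in>{0}. delta0 x * ?t x)"
    by (rule sum.mono_neutral_right) (auto simp: delta0_def)
   then show ?thesis by (simp add: delta0_def tent_def)
  qed
  have "(\<Sum>x\<in>?I. io.Y x * ?t x) = (\<Sum>x\<in>?I. io.X x * ?t x - 1 / lam * (delta0 x * ?t x) + 1 / lam\<^sup>2 * (H x * ?t x))"
   by (rule sum.cong[OF refl]) (simp add: io.Y_def algebra_simps)
  also have "... = (\<Sum>x\<in>?I. io.X x * ?t x) - 1 / lam * (\<Sum>x\<in>?I. delta0 x * ?t x) + 1 / lam\<^sup>2 * (\<Sum>x\<in>?I. H x * ?t x)"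
   by (simp only: sum.distrib sum_subtractf sum_distrib_left)
  finally have "cmod (\<Sum>x\<in>?I. io.Y x * ?t x) <= cmod (\<Sum>x\<in>?I. io.X x * ?t x) + cmod (1 / lam)"
   unfolding h d using norm_triangle_ineq4[of "\<Sum>x\<in>?I. io.X x * ?t x" "1 / lam"] by simp
  then show "cmod (\<Sum>x\<in>?I. io.Y x * ?t x) <= E" using io.sum_X_tent[OF s] EC by linarith
 qed (use s0(1) s04 E0 th in auto)
 have As: "A_scales \<theta> M = {s \<in> dyadic. s0 <= s}" unfolding A_scales_def by (rule scales)
 have adm: "admissible_const (\<delta> / 100) s (sd.K s) (8720 * E)" if "s \<in> A_scales \<theta> M" for s
  using sd.K_admissible[of s] that unfolding As by simp
 have bd: "least_const (\<delta> / 100) s (sd.K s) <= 8720 * E" if "s \<in> A_scales \<theta> M" for s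
  by (rule least_const_le[OF adm[OF that]])
 have "A_family (\<delta> / 100) \<theta> M sd.K" unfolding A_family_def
 proof (intro conjI ballI)
  fix s assume s: "s \<in> A_scales \<theta> M"
  then have s': "s \<in> dyadic" "s0 <= s" unfolding As by auto
  show "(\<Sum>\<^sub>\<infinity>x. sd.K s x) = 0" by (rule sd.K_cancel(2)[OF s'])
  show "{x. sd.K s x ~= 0} \<subseteq> {- int s..int s}" using sd.K_cancel(1)[OF s'] unfolding supp_def .
  show "\<exists>D. admissible_const (\<delta> / 100) s (sd.K s) D" using adm[OF s] by blast
 qed (rule bdd_aboveI2[OF bd])
 moreover have "A_kernel \<alpha> \<theta> \<phi> M (1 / lam) (- 1 / lam\<^sup>2) sd.K = io.X"
 proof
  fix x
  show "A_kernel \<alpha> \<theta> \<phi> M (1 / lam) (- 1 / lam\<^sup>2) sd.K x = io.X x"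
   unfolding A_kernel_def hilbert_trunc_eq conv_delta0[OF finite_supp_H] As sd.K_sum by (simp add: io.Y_def)
 qed
 ultimately have rep: "A_represents (\<delta> / 100) \<alpha> \<theta> \<phi> M L (1 / lam) (- 1 / lam\<^sup>2) sd.K"
  unfolding A_represents_def using io.S_convolve by simp
 then show "L \<in> A_space (\<delta> / 100) \<alpha> \<theta> \<phi> M" unfolding A_space_def by blast
 show "A_norm (\<delta> / 100) \<alpha> \<theta> \<phi> M L <= cmod (1 / lam) + cmod (- 1 / lam\<^sup>2) + 8720 * CA lam C"
  using A_norm_le[OF rep _ bd] M4 unfolding E_def by simp
qed

end

theorem theorem3:
  fixes \<delta> :: real
  shows "\<exists>\<gamma>0>0. \<forall>\<alpha> \<theta> \<phi>.
    1 < \<alpha> \<and> \<alpha> \<le> 1 + 1/1000 \<and> \<alpha> - 1 < \<theta> \<and> \<theta> < 1 \<and> \<delta> = \<theta> - (\<alpha> - 1) \<and>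
    uniformly_Cc_smooth \<phi> \<longrightarrow>
    (\<forall>(lam::complex) (C_I::real). \<exists>C::real. \<forall>M0::real.
      (\<forall>M\<ge>M0. ell2_invertible (shifted_hilbert \<alpha> \<theta> \<phi> lam M) \<and>
               ell2_opnorm (ell2_inverse (shifted_hilbert \<alpha> \<theta> \<phi> lam M)) \<le> C_I) \<longrightarrow>
      (\<exists>M1\<ge>M0. \<forall>M\<ge>M1.
         ell2_inverse (shifted_hilbert \<alpha> \<theta> \<phi> lam M) \<in> A_space \<gamma>0 \<alpha> \<theta> \<phi> M \<and>
         A_norm \<gamma>0 \<alpha> \<theta> \<phi> M (ell2_inverse (shifted_hilbert \<alpha> \<theta> \<phi> lam M)) \<le> C))"
proof (rule exI[of _ "if \<delta> > 0 then \<delta> / 100 else 1"], intro conjI allI impI)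
 \<comment> \<open>For \<delta> <= 0 the hypotheses cannot hold and any positive value will do;
   otherwise \<delta> / 100 is twice the Hoelder exponent \<delta> / 200.\<close>
 show "(if \<delta> > 0 then \<delta> / 100 else 1) > 0" by simp
 fix \<alpha> \<theta> :: real and \<phi> :: "nat => real => complex" and lam :: complex and C_I :: real
 assume "1 < \<alpha> & \<alpha> <= 1 + 1/1000 & \<alpha> - 1 < \<theta> & \<theta> < 1 & \<delta> = \<theta> - (\<alpha> - 1) & uniformly_Cc_smooth \<phi>"
 then have h: "1 < \<alpha>" "\<alpha> <= 1 + 1/1000" "\<theta> < 1" "\<theta> = \<delta> + (\<alpha> - 1)" "0 < \<delta>" "uniformly_Cc_smooth \<phi>" "0 < \<theta>"
  by auto
 have g: "(if \<delta> > 0 then \<delta> / 100 else 1) = \<delta> / 100" using h(5) by simp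
 \<comment> \<open>Available before M0 and M are fixed, since \<open>CA\<close> depends on
   neither.\<close>
 let ?C = "cmod (1 / lam) + cmod (- 1 / lam\<^sup>2) + 8720 * rough_scale.CA \<alpha> \<phi> \<delta> lam C_I"
 show "\<exists>C. \<forall>M0. (\<forall>M\<ge>M0. ell2_invertible (shifted_hilbert \<alpha> \<theta> \<phi> lam M) &
        ell2_opnorm (ell2_inverse (shifted_hilbert \<alpha> \<theta> \<phi> lam M)) <= C_I) -->
   (\<exists>M1\<ge>M0. \<forall>M\<ge>M1.
     ell2_inverse (shifted_hilbert \<alpha> \<theta> \<phi> lam M) \<in> A_space (if \<delta> > 0 then \<delta> / 100 else 1) \<alpha> \<theta> \<phi> M &
     A_norm (if \<delta> > 0 then \<delta> / 100 else 1) \<alpha> \<theta> \<phi> M (ell2_inverse (shifted_hilbert \<alpha> \<theta> \<phi> lam M)) <= C)"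
  unfolding g
 proof (rule exI[of _ ?C], intro allI impI)
  fix M0 :: real
  assume a: "\<forall>M\<ge>M0. ell2_invertible (shifted_hilbert \<alpha> \<theta> \<phi> lam M) &
        ell2_opnorm (ell2_inverse (shifted_hilbert \<alpha> \<theta> \<phi> lam M)) <= C_I"
  show "\<exists>M1\<ge>M0. \<forall>M\<ge>M1.
     ell2_inverse (shifted_hilbert \<alpha> \<theta> \<phi> lam M) \<in> A_space (\<delta> / 100) \<alpha> \<theta> \<phi> M &
     A_norm (\<delta> / 100) \<alpha> \<theta> \<phi> M (ell2_inverse (shifted_hilbert \<alpha> \<theta> \<phi> lam M)) <= ?C"
  \<comment> \<open>The value 4 powr (1 / \<theta>) ensures M powr \<theta> >= 4, so the base scale
    is at least 4 and its half at least 2.\<close>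
  proof (intro exI[of _ "max M0 (max 1 (4 powr (1 / \<theta>)))"] conjI allI impI)
   show "M0 <= max M0 (max 1 (4 powr (1 / \<theta>)))" by simp
   fix M :: real assume M: "max M0 (max 1 (4 powr (1 / \<theta>))) <= M"
   then have M': "M0 <= M" "1 <= M" "4 powr (1 / \<theta>) <= M" by (simp_all only: max.bounded_iff)
   interpret rough_scale \<alpha> \<phi> \<theta> \<delta> M by unfold_locales (fact h M')+
   have "(4 powr (1 / \<theta>)) powr \<theta> <= M powr \<theta>" using M'(3) h by (intro powr_mono2) auto
   then have M4: "4 <= M powr \<theta>" using h(7) by (simp add: powr_powr)
   have inv: "ell2_invertible (shifted_hilbert \<alpha> \<theta> \<phi> lam M)"
    and op: "ell2_opnorm (ell2_inverse (shifted_hilbert \<alpha> \<theta> \<phi> lam M)) <= C_I" using a M'(1) by auto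
   show "ell2_inverse (shifted_hilbert \<alpha> \<theta> \<phi> lam M) \<in> A_space (\<delta> / 100) \<alpha> \<theta> \<phi> M"
    by (rule inverse_bound(1)[OF M4 inv op])
   show "A_norm (\<delta> / 100) \<alpha> \<theta> \<phi> M (ell2_inverse (shifted_hilbert \<alpha> \<theta> \<phi> lam M)) <= ?C"
    by (rule inverse_bound(2)[OF M4 inv op])
  qed
 qed
qed

end
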